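(* Let $\Bbbk$ be a field, $0\neq v\in\Bbbk$, $n\ge 1$, and suppose $[n]!\neq 0$ in $\Bbbk$. Let $\delta=\pm(v+v^{-1})$ and write $\mathrm{TL}_n=\mathrm{TL}_n(\delta)$. With the notation of the context: (a) For $\lambda\in\Lambda(n)$, the set $\{\mu(p): p\in\mathcal P(\lambda)\}$ is a basis for the subspace of maximal vectors of weight $\lambda_1-\lambda_2$ in $V^{\otimes n}$ (together with $0$). (b) $V^{\otimes n}=\bigoplus_{p\in\mathcal P(n)}S(n)\mu(p)\cong\bigoplus_{\lambda\in\Lambda(n)}c_\lambda V(\lambda)$ is a semisimple $S(n)$-module decomposition ($c_\lambda V(\lambda)$ denoting the direct sum of $c_\lambda$ copies of $V(\lambda)$). (c) If $p\in\mathcal P(n)$ and $\mu(p)$ has weight $k$, then $\{F^a\mu(p):0\le a\le k\}$ is an orthogonal basis of $S(n)\mu(p)$. Furthermore, $\bigcup_{p\in\mathcal P(n)}\{F^a\mu(p):0\le a\le \mathrm{weight}(\mu(p))\}$ is a basis of $V^{\otimes n}$, the elements of which are pairwise orthogonal. (d) $C(\lambda)$ is a simple $\mathrm{TL}_n$-module of dimension $c_\lambda$, and $\{C(\lambda):\lambda\in\Lambda(n)\}$ is a set of pairwise non-isomorphic simple $\mathrm{TL}_n$-modules. (e) The image of the representation $\mathrm{TL}_n\to\mathrm{End}_\Bbbk(V^{\otimes n})$ is equal to the centralizer algebra $\mathrm{End}_{S(n)}(V^{\otimes n})$. (f) $\mathrm{TL}_n\cong\mathrm{End}_{S(n)}(V^{\otimes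 n})$ is (split) semisimple, acts faithfully on $V^{\otimes n}$, and $\{C(\lambda):\lambda\in\Lambda(n)\}$ is a complete set of simple $\mathrm{TL}_n$-modules up to isomorphism. (g) $V^{\otimes n}$ satisfies Schur--Weyl duality as an $(S(n),\mathrm{TL}_n)$-bimodule; i.e., the image of each action in $\mathrm{End}_\Bbbk(V^{\otimes n})$ equals the full centralizer of the other. (h) $V^{\otimes n}\cong\bigoplus_{\lambda\in\Lambda(n)}V(\lambda)\otimes C(\lambda)$ as $(S(n),\mathrm{TL}_n)$-bimodules.
   Context: Quantum integers: for $k\ge0$, $[k]=\sum_{t=0}^{k-1}v^{k-1-2t}\in\Bbbk$, $[-k]=-[k]$, $[k]!=[1][2]\cdots[k]$, $[0]!=1$. Schur algebra: $X(n)=\{i\in\mathbb Z:-n\le i\le n,\ i\equiv n\ (\mathrm{mod}\ 2)\}$. $S(n)$ is the unital associative $\Bbbk$-algebra generated by $E,F,1_i$ ($i\in X(n)$) with relations $1_i1_j=\delta_{ij}1_i$, $\sum_{i\in X(n)}1_i=1$, $EF-FE=\sum_{i\in X(n)}[i]1_i$, $E1_i=1_{i+2}E$, $F1_i=1_{i-2}F$, $1_iE=E1_{i-2}$, $1_iF=F1_{i+2}$ for $i\in X(n)$, where $1_j$ is read as $0$ if $j\notin X(n)$. For $0\le m\in X(n)$, $V(m)$ is the left ideal $S(m)1_m$ of $S(m)$, regarded as an $S(n)$-module via the algebra surjection $S(n)\to S(m)$ with $E\mapsto E$, $F\mapsto F$, $1_i\mapsto1_i$ if $|i|\le m$ and $1_i\mapsto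 0$ otherwise. Tensor space: $V=V(1)$ has basis $y_1,y_{-1}$ with $Ey_1=0$, $Ey_{-1}=y_1$, $Fy_1=y_{-1}$, $Fy_{-1}=0$, $1_iy_j=\delta_{ij}y_j$; put $Ky_{\pm1}=v^{\pm1}y_{\pm1}$. Write $y_{i_1,\dots,i_n}=y_{i_1}\otimes\cdots\otimes y_{i_n}$ for $i_j\in\{1,-1\}$. $V^{\otimes n}$ is an $S(n)$-module: $E$ acts as $\sum_{j=1}^nK^{\otimes(j-1)}\otimes E\otimes1^{\otimes(n-j)}$, $F$ acts as $\sum_{j=1}^n1^{\otimes(j-1)}\otimes F\otimes(K^{-1})^{\otimes(n-j)}$, and $1_i$ acts as the projection onto the span of the $y_{i_1,\dots,i_n}$ with $\sum_j i_j=i$ along the other $y$'s. ($V^{\otimes0}=\Bbbk$, of weight $0$, with $E=F=0$.) A nonzero vector $m$ is a weight vector of weight $i$ if $1_im=m$, and is maximal if $Em=0$. The bilinear form $\langle-,-\rangle$ on $V^{\otimes n}$ is the symmetric bilinear form for which the $y_{i_1,\dots,i_n}$ are orthonormal; "orthogonal" refers to this form. Walks and the vectors $\mu(p)$: $\Lambda(n)=\{(\lambda_1,\lambda_2)\in\mathbb Z^2:\lambda_1\ge\lambda_2\ge0,\ \lambda_1+\lambda_2=n\}$ and $V(\lambda):=V(\lambda_1-\lambda_2)$. A walk of length $n$ on the Bratteli diagram to $\lambda\in\Lambda(n)$ is a sequence of partitions with at most two parts, starting from the empty partition and ending at $\lambda$, each obtained from the previous one by adding one box, either to the first row (a vertical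 edge) or to the second row (a diagonal edge). $\mathcal P(\lambda)$ is the set of walks to $\lambda$, $\mathcal P(n)=\bigsqcup_{\lambda\in\Lambda(n)}\mathcal P(\lambda)$, $c_\lambda=|\mathcal P(\lambda)|$. For $b\in V^{\otimes(m-1)}$ of weight $i_b$, put $\Phi_1(b)=b\otimes y_1$ and $\Phi_2(b)=[i_b]\,b\otimes y_{-1}-v^{i_b}Fb\otimes y_1$, in $V^{\otimes m}$. For $p\in\mathcal P(n)$, $\mu(p)=\Upsilon_n\cdots\Upsilon_1(1)$, where $\Upsilon_i=\Phi_1$ (resp. $\Phi_2$) if the $i$th edge of $p$ is vertical (resp. diagonal). $C(\lambda)$ is the $\Bbbk$-span of $\{\mu(p):p\in\mathcal P(\lambda)\}$. Temperley--Lieb algebra: $\mathrm{TL}_n(\delta)$ is the unital $\Bbbk$-algebra generated by $e_1,\dots,e_{n-1}$ with relations $e_i^2=\delta e_i$, $e_ie_je_i=e_i$ if $|i-j|=1$, $e_ie_j=e_je_i$ if $|i-j|>1$. Let $\dot e_i$ be the operator on $V^{\otimes n}$ acting in tensor positions $i,i+1$ by $y_{1,1}\mapsto0$, $y_{-1,-1}\mapsto0$, $y_{1,-1}\mapsto -v^{-1}y_{1,-1}+y_{-1,1}$, $y_{-1,1}\mapsto y_{1,-1}-vy_{-1,1}$, and as the identity in the other positions. $\mathrm{TL}_n(-(v+v^{-1}))$ acts on $V^{\otimes n}$ by $e_i\mapsto\dot e_i$, and $\mathrm{TL}_n(v+v^{-1})$ acts by $e_i\mapsto-\dot e_i$; these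 actions commute with that of $S(n)$. $C(\lambda)$ is a $\mathrm{TL}_n$-module by restriction of this action. *)

theory Defs
  imports
    Complex_Main
    "HOL-Algebra.QuotRing"
    "HOL-Algebra.Module"
    "HOL-Library.Poly_Mapping"
    "HOL-Library.Function_Algebras"
begin

section \<open>Left modules over a not necessarily commutative ring\<close>

text \<open>
  The locale \<^locale>\<open>module\<close> of HOL-Algebra requires a commutative ring of scalars, so left
  modules are introduced here, on the same record type. In a module record the fields
  \<^const>\<open>mult\<close> and \<^const>\<open>one\<close> are irrelevant.
\<close>

locale left_module = R?: ring R + M?: abelian_group M for R and M (structure) +
  assumes smult_closed:
      "\<lbrakk>a \<in> carrier R; x \<in> carrier M\<rbrakk> \<Longrightarrow> a \<odot>\<^bsub>M\<^esub> x \<in> carrier M"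
    and smult_l_distr:
      "\<lbrakk>a \<in> carrier R; b \<in> carrier R; x \<in> carrier M\<rbrakk>
        \<Longrightarrow> (a \<oplus>\<^bsub>R\<^esub> b) \<odot>\<^bsub>M\<^esub> x = a \<odot>\<^bsub>M\<^esub> x \<oplus>\<^bsub>M\<^esub> b \<odot>\<^bsub>M\<^esub> x"
    and smult_r_distr:
      "\<lbrakk>a \<in> carrier R; x \<in> carrier M; y \<in> carrier M\<rbrakk>
        \<Longrightarrow> a \<odot>\<^bsub>M\<^esub> (x \<oplus>\<^bsub>M\<^esub> y) = a \<odot>\<^bsub>M\<^esub> x \<oplus>\<^bsub>M\<^esub> a \<odot>\<^bsub>M\<^esub> y"
    and smult_assoc:
      "\<lbrakk>a \<in> carrier R; b \<in> carrier R; x \<in> carrier M\<rbrakk>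
        \<Longrightarrow> (a \<otimes>\<^bsub>R\<^esub> b) \<odot>\<^bsub>M\<^esub> x = a \<odot>\<^bsub>M\<^esub> (b \<odot>\<^bsub>M\<^esub> x)"
    and smult_one:
      "x \<in> carrier M \<Longrightarrow> \<one>\<^bsub>R\<^esub> \<odot>\<^bsub>M\<^esub> x = x"

text \<open>Homomorphisms are taken extensional, so that they form a set of functions on the carrier.\<close>

definition mod_hom ::
    "('a, 'c) ring_scheme \<Rightarrow> ('a, 'm) module \<Rightarrow> ('a, 'n) module \<Rightarrow> ('m \<Rightarrow> 'n) set" where
  "mod_hom R M N = {f \<in> carrier M \<rightarrow>\<^sub>E carrier N.
     (\<forall>x\<in>carrier M. \<forall>y\<in>carrier M. f (x \<oplus>\<^bsub>M\<^esub> y) = f x \<oplus>\<^bsub>N\<^esub> f y) \<and>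
     (\<forall>a\<in>carrier R. \<forall>x\<in>carrier M. f (a \<odot>\<^bsub>M\<^esub> x) = a \<odot>\<^bsub>N\<^esub> f x)}"

definition mod_iso ::
    "('a, 'c) ring_scheme \<Rightarrow> ('a, 'm) module \<Rightarrow> ('a, 'n) module \<Rightarrow> ('m \<Rightarrow> 'n) set" where
  "mod_iso R M N = {f \<in> mod_hom R M N. bij_betw f (carrier M) (carrier N)}"

definition mod_isomorphic ::
    "('a, 'c) ring_scheme \<Rightarrow> ('a, 'm) module \<Rightarrow> ('a, 'n) module \<Rightarrow> bool" where
  "mod_isomorphic R M N \<longleftrightarrow> mod_iso R M N \<noteq> {}"

definition simple_module :: "('a, 'c) ring_scheme \<Rightarrow> ('a, 'm) module \<Rightarrow> bool" where
  "simple_module R M \<longleftrightarrow> left_module R M \<and> carrier M \<noteq> {\<zero>\<^bsub>M\<^esub>} \<and>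
     (\<forall>N. submodule N R M \<longrightarrow> N = {\<zero>\<^bsub>M\<^esub>} \<or> N = carrier M)"

definition cyclic_submodule ::
    "('a, 'c) ring_scheme \<Rightarrow> ('a, 'm) module \<Rightarrow> 'm \<Rightarrow> 'm set" where
  "cyclic_submodule R M x = (\<lambda>a. a \<odot>\<^bsub>M\<^esub> x) ` carrier R"

definition internal_direct_sum ::
    "('a, 'c) ring_scheme \<Rightarrow> ('a, 'm) module \<Rightarrow> 'i set \<Rightarrow> ('i \<Rightarrow> 'm set) \<Rightarrow> bool" where
  "internal_direct_sum R M I N \<longleftrightarrow> (\<forall>i\<in>I. submodule (N i) R M) \<and>
     (\<forall>x\<in>carrier M. \<exists>!f. f \<in> (\<Pi>\<^sub>E i\<in>I. N i) \<and> finite {i \<in> I. f i \<noteq> \<zero>\<^bsub>M\<^esub>} \<and>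
        x = finsum M f {i \<in> I. f i \<noteq> \<zero>\<^bsub>M\<^esub>})"

definition direct_sum :: "'i set \<Rightarrow> ('i \<Rightarrow> ('a, 'm) module) \<Rightarrow> ('a, 'i \<Rightarrow> 'm) module" where
  "direct_sum I M =
     \<lparr>carrier = {f \<in> (\<Pi>\<^sub>E i\<in>I. carrier (M i)). finite {i \<in> I. f i \<noteq> \<zero>\<^bsub>M i\<^esub>}},
      mult = undefined, one = undefined,
      zero = (\<lambda>i\<in>I. \<zero>\<^bsub>M i\<^esub>),
      add = (\<lambda>f g. \<lambda>i\<in>I. f i \<oplus>\<^bsub>M i\<^esub> g i),
      smult = (\<lambda>a f. \<lambda>i\<in>I. a \<odot>\<^bsub>M i\<^esub> f i)\<rparr>"

definition semisimple_module :: "('a, 'c) ring_scheme \<Rightarrow> ('a, 'm) module \<Rightarrow> bool" where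
  "semisimple_module R M \<longleftrightarrow> left_module R M \<and>
     (\<exists>\<N>. (\<forall>N\<in>\<N>. simple_module R (M\<lparr>carrier := N\<rparr>)) \<and> internal_direct_sum R M \<N> (\<lambda>N. N))"

definition faithful_module :: "('a, 'c) ring_scheme \<Rightarrow> ('a, 'm) module \<Rightarrow> bool" where
  "faithful_module R M \<longleftrightarrow> left_module R M \<and>
     (\<forall>a\<in>carrier R. (\<forall>x\<in>carrier M. a \<odot>\<^bsub>M\<^esub> x = \<zero>\<^bsub>M\<^esub>) \<longrightarrow> a = \<zero>\<^bsub>R\<^esub>)"


section \<open>Algebras over a field and their modules\<close>

text \<open>
  An associative unital algebra over the field \<^typ>\<open>'k\<close> is a record of type
  \<^typ>\<open>('k, 'a) module\<close> in which all fields are meaningful; \<^const>\<open>smult\<close> is the action of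
  \<^typ>\<open>'k\<close>. A vector space over \<^typ>\<open>'k\<close> is a module over \<open>base_field\<close>.
\<close>

definition base_field :: "('k::field, 'k) module" where
  "base_field = \<lparr>carrier = UNIV, mult = (*), one = 1, zero = 0, add = (+), smult = (*)\<rparr>"

definition regular_module :: "('k, 'a) module \<Rightarrow> ('a, 'a) module" where
  "regular_module A =
     \<lparr>carrier = carrier A, mult = mult A, one = one A, zero = zero A, add = add A,
      smult = mult A\<rparr>"

definition restrict_scalars :: "('k, 'a) module \<Rightarrow> ('a, 'm) module \<Rightarrow> ('k, 'm) module" where
  "restrict_scalars A M =
     \<lparr>carrier = carrier M, mult = mult M, one = one M, zero = zero M, add = add M,
      smult = (\<lambda>c x. (c \<odot>\<^bsub>A\<^esub> \<one>\<^bsub>A\<^esub>) \<odot>\<^bsub>M\<^esub> x)\<rparr>"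

definition alg_hom :: "('k, 'a) module \<Rightarrow> ('k, 'b) module \<Rightarrow> ('a \<Rightarrow> 'b) set" where
  "alg_hom A B =
     {h \<in> ring_hom A B. \<forall>c. \<forall>a\<in>carrier A. h (c \<odot>\<^bsub>A\<^esub> a) = c \<odot>\<^bsub>B\<^esub> h a}"

definition alg_iso :: "('k, 'a) module \<Rightarrow> ('k, 'b) module \<Rightarrow> ('a \<Rightarrow> 'b) set" where
  "alg_iso A B = {h \<in> alg_hom A B. bij_betw h (carrier A) (carrier B)}"

text \<open>\<open>End\<^sub>A(M)\<close>; with \<open>A = base_field\<close> this is the algebra of all linear endomorphisms.\<close>

definition end_algebra :: "('k, 'a) module \<Rightarrow> ('a, 'm) module \<Rightarrow> ('k, 'm \<Rightarrow> 'm) module" where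
  "end_algebra A M =
     \<lparr>carrier = mod_hom A M M,
      mult = (\<lambda>f g. compose (carrier M) f g),
      one = (\<lambda>x\<in>carrier M. x),
      zero = (\<lambda>x\<in>carrier M. \<zero>\<^bsub>M\<^esub>),
      add = (\<lambda>f g. \<lambda>x\<in>carrier M. f x \<oplus>\<^bsub>M\<^esub> g x),
      smult = (\<lambda>c f. \<lambda>x\<in>carrier M. (c \<odot>\<^bsub>A\<^esub> \<one>\<^bsub>A\<^esub>) \<odot>\<^bsub>M\<^esub> f x)\<rparr>"

definition centralizer :: "('a, 'c) ring_scheme \<Rightarrow> 'a set \<Rightarrow> 'a set" where
  "centralizer R X = {a \<in> carrier R. \<forall>x\<in>X. a \<otimes>\<^bsub>R\<^esub> x = x \<otimes>\<^bsub>R\<^esub> a}"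

text \<open>The module structure on a vector space \<open>W\<close> given by a representation \<open>\<rho>\<close>.\<close>

definition rep_module :: "('a \<Rightarrow> 'm \<Rightarrow> 'm) \<Rightarrow> ('k, 'm) module \<Rightarrow> ('a, 'm) module" where
  "rep_module \<rho> W =
     \<lparr>carrier = carrier W, mult = mult W, one = one W, zero = zero W, add = add W, smult = \<rho>\<rparr>"

text \<open>
  Split semisimple: the regular module is semisimple, and every simple module has only scalar
  endomorphisms. The type argument is the type in which simple modules are taken; statements
  using it are universally quantified over that type.
\<close>

definition split_semisimple :: "'w itself \<Rightarrow> ('k, 'a) module \<Rightarrow> bool" where
  "split_semisimple TYPE('w) A \<longleftrightarrow> semisimple_module A (regular_module A) \<and>
     (\<forall>N :: ('a, 'w) module. simple_module A N \<longrightarrow>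
        (\<forall>f \<in> mod_hom A N N. \<exists>c. \<forall>x\<in>carrier N. f x = (c \<odot>\<^bsub>A\<^esub> \<one>\<^bsub>A\<^esub>) \<odot>\<^bsub>N\<^esub> x))"

text \<open>
  A bimodule is given by two commuting left actions on one vector space, encoded as two module
  records with the same underlying abelian group. (The algebras acting on the second side below
  have an anti-involution fixing the generators, so left and right actions correspond.)
\<close>

definition bimodule ::
    "('k, 'a) module \<Rightarrow> ('k, 'b) module \<Rightarrow> ('a, 'm) module \<Rightarrow> ('b, 'm) module \<Rightarrow> bool" where
  "bimodule A B M M' \<longleftrightarrow> left_module A M \<and> left_module B M' \<and>
     carrier M = carrier M' \<and> add M = add M' \<and> zero M = zero M' \<and>
     (\<forall>c. \<forall>x\<in>carrier M. (c \<odot>\<^bsub>A\<^esub> \<one>\<^bsub>A\<^esub>) \<odot>\<^bsub>M\<^esub> x = (c \<odot>\<^bsub>B\<^esub> \<one>\<^bsub>B\<^esub>) \<odot>\<^bsub>M'\<^esub> x) \<and>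
     (\<forall>a\<in>carrier A. \<forall>b\<in>carrier B. \<forall>x\<in>carrier M.
        a \<odot>\<^bsub>M\<^esub> (b \<odot>\<^bsub>M'\<^esub> x) = b \<odot>\<^bsub>M'\<^esub> (a \<odot>\<^bsub>M\<^esub> x))"

definition bimod_isomorphic ::
    "('k, 'a) module \<Rightarrow> ('k, 'b) module \<Rightarrow> ('a, 'm) module \<Rightarrow> ('b, 'm) module \<Rightarrow>
     ('a, 'n) module \<Rightarrow> ('b, 'n) module \<Rightarrow> bool" where
  "bimod_isomorphic A B M M' N N' \<longleftrightarrow> mod_iso A M N \<inter> mod_iso B M' N' \<noteq> {}"


section \<open>Free vector spaces and tensor products\<close>

definition pscale :: "'k::field \<Rightarrow> ('x \<Rightarrow>\<^sub>0 'k) \<Rightarrow> ('x \<Rightarrow>\<^sub>0 'k)" where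
  "pscale c = Poly_Mapping.map ((*) c)"

lemma lookup_pscale: "Poly_Mapping.lookup (pscale c p) x = c * Poly_Mapping.lookup p x"
  by (simp add: pscale_def Poly_Mapping.map.rep_eq when_def)

interpretation pvec: vector_space "pscale :: 'k::field \<Rightarrow> ('x \<Rightarrow>\<^sub>0 'k) \<Rightarrow> _"
  by standard (auto intro!: poly_mapping_eqI simp: lookup_pscale lookup_add algebra_simps)

definition free_vector_space :: "'x set \<Rightarrow> ('k::field, 'x \<Rightarrow>\<^sub>0 'k) module" where
  "free_vector_space X =
     \<lparr>carrier = {p. Poly_Mapping.keys p \<subseteq> X}, mult = undefined, one = undefined,
      zero = 0, add = (+), smult = pscale\<rparr>"

definition quotient_module :: "('k, 'm) module \<Rightarrow> 'm set \<Rightarrow> ('k, 'm set) module" where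
  "quotient_module M H =
     \<lparr>carrier = a_rcosets\<^bsub>M\<^esub> H, mult = undefined, one = undefined,
      zero = H, add = set_add M,
      smult = (\<lambda>c X. \<Union>x\<in>X. H +>\<^bsub>M\<^esub> (c \<odot>\<^bsub>M\<^esub> x))\<rparr>"

definition tensor_relations ::
    "('k::field, 'm) module \<Rightarrow> ('k, 'n) module \<Rightarrow> (('m \<times> 'n) \<Rightarrow>\<^sub>0 'k) set" where
  "tensor_relations M N = (let s = (\<lambda>x y. Poly_Mapping.single (x, y) (1::'k)) in
     {s (x \<oplus>\<^bsub>M\<^esub> x') y - s x y - s x' y | x x' y.
        x \<in> carrier M \<and> x' \<in> carrier M \<and> y \<in> carrier N} \<union>
     {s x (y \<oplus>\<^bsub>N\<^esub> y') - s x y - s x y' | x y y'.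
        x \<in> carrier M \<and> y \<in> carrier N \<and> y' \<in> carrier N} \<union>
     {s (c \<odot>\<^bsub>M\<^esub> x) y - pscale c (s x y) | c x y. x \<in> carrier M \<and> y \<in> carrier N} \<union>
     {s x (c \<odot>\<^bsub>N\<^esub> y) - pscale c (s x y) | c x y. x \<in> carrier M \<and> y \<in> carrier N})"

definition tensor_product ::
    "('k::field, 'm) module \<Rightarrow> ('k, 'n) module \<Rightarrow> ('k, (('m \<times> 'n) \<Rightarrow>\<^sub>0 'k) set) module" where
  "tensor_product M N =
     quotient_module (free_vector_space (carrier M \<times> carrier N))
       (pvec.span (tensor_relations M N))"

text \<open>
  The map induced on classes by the linear extension of the map \<open>g\<close> on pairs; \<open>H\<close> is the
  subspace of relations.
\<close>

definition tensor_map ::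
    "('x \<Rightarrow>\<^sub>0 'k::field) set \<Rightarrow> ('x \<Rightarrow> 'x) \<Rightarrow> ('x \<Rightarrow>\<^sub>0 'k) set \<Rightarrow> ('x \<Rightarrow>\<^sub>0 'k) set" where
  "tensor_map H g X =
     (\<Union>p\<in>X. H +>\<^bsub>free_vector_space UNIV\<^esub>
        (\<Sum>z\<in>Poly_Mapping.keys p. Poly_Mapping.single (g z) (Poly_Mapping.lookup p z)))"

text \<open>
  For an \<open>A\<close>-module \<open>M\<close> and a \<open>B\<close>-module \<open>N\<close>, the \<open>A\<close>-module and the \<open>B\<close>-module structure
  of \<open>M \<otimes> N\<close> (tensor product over \<^typ>\<open>'k\<close>).
\<close>

definition tensor_left ::
    "('k::field, 'a) module \<Rightarrow> ('k, 'b) module \<Rightarrow> ('a, 'm) module \<Rightarrow> ('b, 'n) module \<Rightarrow>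
     ('a, (('m \<times> 'n) \<Rightarrow>\<^sub>0 'k) set) module" where
  "tensor_left A B M N = (let T = tensor_product (restrict_scalars A M) (restrict_scalars B N) in
     rep_module (\<lambda>a. tensor_map (zero T) (\<lambda>(x, y). (a \<odot>\<^bsub>M\<^esub> x, y))) T)"

definition tensor_right ::
    "('k::field, 'a) module \<Rightarrow> ('k, 'b) module \<Rightarrow> ('a, 'm) module \<Rightarrow> ('b, 'n) module \<Rightarrow>
     ('b, (('m \<times> 'n) \<Rightarrow>\<^sub>0 'k) set) module" where
  "tensor_right A B M N = (let T = tensor_product (restrict_scalars A M) (restrict_scalars B N) in
     rep_module (\<lambda>b. tensor_map (zero T) (\<lambda>(x, y). (x, b \<odot>\<^bsub>N\<^esub> y))) T)"


section \<open>Algebras given by generators and relations\<close>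

text \<open>
  Words, i.e. the free monoid, written additively so that \<open>'g word \<Rightarrow>\<^sub>0 'k\<close> with its library
  multiplication is the free algebra.
\<close>

datatype 'g word = Word (letters: "'g list")

instantiation word :: (type) monoid_add
begin
definition zero_word :: "'a word" where "0 = Word []"
definition plus_word :: "'a word \<Rightarrow> 'a word \<Rightarrow> 'a word" where
  "u + w = Word (letters u @ letters w)"
instance by standard (auto simp: zero_word_def plus_word_def)
end

definition free_algebra :: "'g set \<Rightarrow> ('k::field, 'g word \<Rightarrow>\<^sub>0 'k) module" where
  "free_algebra G =
     \<lparr>carrier = {p. \<forall>w\<in>Poly_Mapping.keys p. set (letters w) \<subseteq> G},
      mult = (*), one = 1, zero = 0, add = (+), smult = pscale\<rparr>"

definition gen :: "'g \<Rightarrow> ('g word \<Rightarrow>\<^sub>0 'k::field)" where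
  "gen g = Poly_Mapping.single (Word [g]) 1"

definition presented_algebra ::
    "'g set \<Rightarrow> ('g word \<Rightarrow>\<^sub>0 'k::field) set \<Rightarrow> ('k, ('g word \<Rightarrow>\<^sub>0 'k) set) module" where
  "presented_algebra G Rel = (let A = free_algebra G; I = Idl\<^bsub>A\<^esub> Rel; Q = A Quot I in
     \<lparr>carrier = carrier Q, mult = mult Q, one = one Q, zero = zero Q, add = add Q,
      smult = (\<lambda>c X. \<Union>p\<in>X. I +>\<^bsub>A\<^esub> (c \<odot>\<^bsub>A\<^esub> p))\<rparr>)"

definition eval_free :: "('k::field, 'b) module \<Rightarrow> ('g \<Rightarrow> 'b) \<Rightarrow> ('g word \<Rightarrow>\<^sub>0 'k) \<Rightarrow> 'b" where
  "eval_free B g p =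
     (\<Oplus>\<^bsub>B\<^esub>w\<in>Poly_Mapping.keys p. Poly_Mapping.lookup p w
       \<odot>\<^bsub>B\<^esub> foldr (\<lambda>x b. g x \<otimes>\<^bsub>B\<^esub> b) (letters w) \<one>\<^bsub>B\<^esub>)"

text \<open>
  The homomorphism from a presented algebra to \<open>B\<close> sending each generator \<open>x\<close> to \<open>g x\<close>. It is
  meaningful when the elements \<open>g x\<close> satisfy the relations, so that evaluation is constant on
  each coset.
\<close>

definition presented_hom ::
    "('k::field, 'b) module \<Rightarrow> ('g \<Rightarrow> 'b) \<Rightarrow> ('g word \<Rightarrow>\<^sub>0 'k) set \<Rightarrow> 'b" where
  "presented_hom B g X = the_elem (eval_free B g ` X)"


section \<open>Quantum integers\<close>

definition qint :: "'k::field \<Rightarrow> int \<Rightarrow> 'k" where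
  "qint v k = (if 0 \<le> k then \<Sum>t<nat k. v powi (k - 1 - 2 * int t)
               else - (\<Sum>t<nat (- k). v powi (- k - 1 - 2 * int t)))"

definition qfact :: "'k::field \<Rightarrow> nat \<Rightarrow> 'k" where
  "qfact v n = (\<Prod>k=1..n. qint v (int k))"


section \<open>The Schur algebra\<close>

datatype schur_gen = GE | GF | GI int

definition weights :: "nat \<Rightarrow> int set" where
  "weights n = {i. - int n \<le> i \<and> i \<le> int n \<and> i mod 2 = int n mod 2}"

definition gen_idem :: "nat \<Rightarrow> int \<Rightarrow> (schur_gen word \<Rightarrow>\<^sub>0 'k::field)" where
  "gen_idem n j = (if j \<in> weights n then gen (GI j) else 0)"

definition schur_relations :: "'k::field \<Rightarrow> nat \<Rightarrow> (schur_gen word \<Rightarrow>\<^sub>0 'k) set" where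
  "schur_relations v n = (let E = gen GE; F = gen GF; one = gen_idem n in
     {one i * one j - (if i = j then one i else 0) | i j. i \<in> weights n \<and> j \<in> weights n} \<union>
     {(\<Sum>i\<in>weights n. one i) - 1} \<union>
     {E * F - F * E - (\<Sum>i\<in>weights n. pscale (qint v i) (one i))} \<union>
     {E * one i - one (i + 2) * E | i. i \<in> weights n} \<union>
     {F * one i - one (i - 2) * F | i. i \<in> weights n} \<union>
     {one i * E - E * one (i - 2) | i. i \<in> weights n} \<union>
     {one i * F - F * one (i + 2) | i. i \<in> weights n})"

type_synonym 'k schur_elt = "(schur_gen word \<Rightarrow>\<^sub>0 'k) set"

definition schur :: "'k::field \<Rightarrow> nat \<Rightarrow> ('k, 'k schur_elt) module" where
  "schur v n = presented_algebra ({GE, GF} \<union> GI ` weights n) (schur_relations v n)"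

text \<open>The class of the generator \<open>x\<close> in \<open>S(m)\<close>.\<close>

definition schur_class :: "'k::field \<Rightarrow> nat \<Rightarrow> schur_gen \<Rightarrow> 'k schur_elt" where
  "schur_class v m x =
     Idl\<^bsub>free_algebra ({GE, GF} \<union> GI ` weights m)\<^esub> (schur_relations v m)
       +>\<^bsub>free_algebra ({GE, GF} \<union> GI ` weights m)\<^esub> gen x"

text \<open>The surjection \<open>S(n) \<rightarrow> S(m)\<close>, for \<open>m \<in> X(n)\<close>; it does not depend on \<open>n\<close> at the level
  of representatives.\<close>

definition schur_surj :: "'k::field \<Rightarrow> nat \<Rightarrow> 'k schur_elt \<Rightarrow> 'k schur_elt" where
  "schur_surj v m = presented_hom (schur v m)
     (\<lambda>x. case x of GI i \<Rightarrow> if \<bar>i\<bar> \<le> int m then schur_class v m (GI i) else \<zero>\<^bsub>schur v m\<^esub>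
                  | _ \<Rightarrow> schur_class v m x)"

text \<open>\<open>V(m)\<close> as a module over \<open>S(n)\<close>, for \<open>m \<in> X(n)\<close>.\<close>

definition weyl_module :: "'k::field \<Rightarrow> nat \<Rightarrow> ('k schur_elt, 'k schur_elt) module" where
  "weyl_module v m = (let S = schur v m in
     \<lparr>carrier = (\<lambda>x. x \<otimes>\<^bsub>S\<^esub> schur_class v m (GI (int m))) ` carrier S,
      mult = undefined, one = undefined, zero = zero S, add = add S,
      smult = (\<lambda>a x. schur_surj v m a \<otimes>\<^bsub>S\<^esub> x)\<rparr>)"


section \<open>Tensor space\<close>

text \<open>
  Basis vectors of \<open>V\<^sup>\<otimes>\<^sup>n\<close> are indexed by the words of length \<open>n\<close> in \<open>1\<close> and \<open>-1\<close>; an element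
  of \<open>V\<^sup>\<otimes>\<^sup>n\<close> is its coordinate function, extended by \<open>0\<close> to all integer lists.
\<close>

type_synonym 'k tvec = "int list \<Rightarrow> 'k"

definition tscale :: "'k::field \<Rightarrow> 'k tvec \<Rightarrow> 'k tvec" where
  "tscale c f = (\<lambda>w. c * f w)"

interpretation tvec: vector_space "tscale :: 'k::field \<Rightarrow> 'k tvec \<Rightarrow> 'k tvec"
  by standard (auto simp: tscale_def fun_eq_iff algebra_simps)

definition sign_words :: "nat \<Rightarrow> int list set" where
  "sign_words n = {w. length w = n \<and> set w \<subseteq> {1, -1}}"

definition ybasis :: "int list \<Rightarrow> 'k::field tvec" where
  "ybasis u = (\<lambda>w. if w = u then 1 else 0)"

definition tensor_power :: "nat \<Rightarrow> ('k::field, 'k tvec) module" where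
  "tensor_power n =
     \<lparr>carrier = {f. \<forall>w. w \<notin> sign_words n \<longrightarrow> f w = 0}, mult = undefined, one = undefined,
      zero = 0, add = (+), smult = tscale\<rparr>"

definition lin_ext :: "nat \<Rightarrow> (int list \<Rightarrow> 'k::field tvec) \<Rightarrow> 'k tvec \<Rightarrow> 'k tvec" where
  "lin_ext n g f = (\<Sum>u\<in>sign_words n. tscale (f u) (g u))"

text \<open>
  An operator \<open>A\<close> on \<open>V\<close> is given by its matrix: \<open>A s t\<close> is the coefficient of \<open>y\<^sub>t\<close> in
  \<open>A y\<^sub>s\<close>. The operator \<open>A\<^sub>1 \<otimes> \<dots> \<otimes> A\<^sub>n\<close> is obtained from the list of factors.
\<close>

type_synonym 'k site_op = "int \<Rightarrow> int \<Rightarrow> 'k"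

definition site_E :: "'k::field site_op" where
  "site_E s t = (if s = -1 \<and> t = 1 then 1 else 0)"

definition site_F :: "'k::field site_op" where
  "site_F s t = (if s = 1 \<and> t = -1 then 1 else 0)"

definition site_K :: "'k::field \<Rightarrow> 'k site_op" where
  "site_K v s t = (if s = t then v powi s else 0)"

definition site_K_inv :: "'k::field \<Rightarrow> 'k site_op" where
  "site_K_inv v s t = (if s = t then v powi (- s) else 0)"

definition site_id :: "'k::field site_op" where
  "site_id s t = (if s = t then 1 else 0)"

definition tensor_op :: "'k::field site_op list \<Rightarrow> 'k tvec \<Rightarrow> 'k tvec" where
  "tensor_op As = lin_ext (length As)
     (\<lambda>u w. if length w = length As then \<Prod>j<length As. (As ! j) (u ! j) (w ! j) else 0)"

definition op_E :: "'k::field \<Rightarrow> nat \<Rightarrow> 'k tvec \<Rightarrow> 'k tvec" where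
  "op_E v n f = (\<Sum>j=1..n.
     tensor_op (replicate (j - 1) (site_K v) @ [site_E] @ replicate (n - j) site_id) f)"

definition op_F :: "'k::field \<Rightarrow> nat \<Rightarrow> 'k tvec \<Rightarrow> 'k tvec" where
  "op_F v n f = (\<Sum>j=1..n.
     tensor_op (replicate (j - 1) site_id @ [site_F] @ replicate (n - j) (site_K_inv v)) f)"

definition op_idem :: "int \<Rightarrow> 'k::field tvec \<Rightarrow> 'k tvec" where
  "op_idem i f = (\<lambda>w. if sum_list w = i then f w else 0)"

definition schur_rep ::
    "'k::field \<Rightarrow> nat \<Rightarrow> 'k schur_elt \<Rightarrow> 'k tvec \<Rightarrow> 'k tvec" where
  "schur_rep v n = presented_hom (end_algebra base_field (tensor_power n))
     (\<lambda>x. restrict (case x of GE \<Rightarrow> op_E v n | GF \<Rightarrow> op_F v n | GI i \<Rightarrow> op_idem i)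
            (carrier (tensor_power n)))"

definition schur_tensor :: "'k::field \<Rightarrow> nat \<Rightarrow> ('k schur_elt, 'k tvec) module" where
  "schur_tensor v n = rep_module (schur_rep v n) (tensor_power n)"

definition weight_vector :: "nat \<Rightarrow> int \<Rightarrow> 'k::field tvec \<Rightarrow> bool" where
  "weight_vector n i b \<longleftrightarrow> b \<in> carrier (tensor_power n) \<and> b \<noteq> 0 \<and> op_idem i b = b"

definition weight :: "nat \<Rightarrow> 'k::field tvec \<Rightarrow> int" where
  "weight n b = (THE i. weight_vector n i b)"

definition maximal_vectors :: "'k::field \<Rightarrow> nat \<Rightarrow> int \<Rightarrow> 'k tvec set" where
  "maximal_vectors v n i = {b. weight_vector n i b \<and> op_E v n b = 0}"

definition tform :: "nat \<Rightarrow> 'k::field tvec \<Rightarrow> 'k tvec \<Rightarrow> 'k" where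
  "tform n f g = (\<Sum>w\<in>sign_words n. f w * g w)"

text \<open>An indexed basis of a subspace; in particular the indexed vectors are distinct.\<close>

definition is_basis :: "'i set \<Rightarrow> ('i \<Rightarrow> 'k::field tvec) \<Rightarrow> 'k tvec set \<Rightarrow> bool" where
  "is_basis I b W \<longleftrightarrow> inj_on b I \<and> tvec.independent (b ` I) \<and> tvec.span (b ` I) = W"

definition pairwise_orthogonal :: "nat \<Rightarrow> 'i set \<Rightarrow> ('i \<Rightarrow> 'k::field tvec) \<Rightarrow> bool" where
  "pairwise_orthogonal n I b \<longleftrightarrow> (\<forall>i\<in>I. \<forall>j\<in>I. i \<noteq> j \<longrightarrow> tform n (b i) (b j) = 0)"


section \<open>Walks on the Bratteli diagram\<close>

definition two_row_partitions :: "nat \<Rightarrow> (nat \<times> nat) set" where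
  "two_row_partitions n = {(a, b). b \<le> a \<and> a + b = n}"

definition walks_to :: "(nat \<times> nat) \<Rightarrow> (nat \<times> nat) list set" where
  "walks_to l = {p. p \<noteq> [] \<and> hd p = (0, 0) \<and> last p = l \<and>
     (\<forall>(a, b)\<in>set p. b \<le> a) \<and>
     (\<forall>i. Suc i < length p \<longrightarrow>
        p ! Suc i = (Suc (fst (p ! i)), snd (p ! i)) \<or>
        p ! Suc i = (fst (p ! i), Suc (snd (p ! i))))}"

definition walks :: "nat \<Rightarrow> (nat \<times> nat) list set" where
  "walks n = (\<Union>l\<in>two_row_partitions n. walks_to l)"

definition num_walks :: "(nat \<times> nat) \<Rightarrow> nat" where
  "num_walks l = card (walks_to l)"

text \<open>\<open>tensor_y b s\<close> is \<open>b \<otimes> y\<^sub>s\<close>.\<close>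

definition tensor_y :: "'k::field tvec \<Rightarrow> int \<Rightarrow> 'k tvec" where
  "tensor_y b s = (\<lambda>w. if w \<noteq> [] \<and> last w = s then b (butlast w) else 0)"

definition Phi1 :: "'k::field tvec \<Rightarrow> 'k tvec" where
  "Phi1 b = tensor_y b 1"

text \<open>In \<open>Phi2 v m b\<close> the argument \<open>b\<close> is a weight vector of \<open>V\<^sup>\<otimes>\<^sup>m\<close>.\<close>

definition Phi2 :: "'k::field \<Rightarrow> nat \<Rightarrow> 'k tvec \<Rightarrow> 'k tvec" where
  "Phi2 v m b = tscale (qint v (weight m b)) (tensor_y b (-1))
     - tscale (v powi weight m b) (tensor_y (op_F v m b) 1)"

fun mu_upto :: "'k::field \<Rightarrow> (nat \<times> nat) list \<Rightarrow> nat \<Rightarrow> 'k tvec" where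
  "mu_upto v p 0 = ybasis []"
| "mu_upto v p (Suc i) =
     (if fst (p ! Suc i) = Suc (fst (p ! i)) then Phi1 (mu_upto v p i)
      else Phi2 v i (mu_upto v p i))"

definition mu :: "'k::field \<Rightarrow> (nat \<times> nat) list \<Rightarrow> 'k tvec" where
  "mu v p = mu_upto v p (length p - 1)"

definition Cspace :: "'k::field \<Rightarrow> (nat \<times> nat) \<Rightarrow> 'k tvec set" where
  "Cspace v l = tvec.span (mu v ` walks_to l)"

text \<open>\<open>V(\<lambda>) = V(\<lambda>\<^sub>1 - \<lambda>\<^sub>2)\<close>.\<close>

definition weyl_of :: "'k::field \<Rightarrow> (nat \<times> nat) \<Rightarrow> ('k schur_elt, 'k schur_elt) module" where
  "weyl_of v l = weyl_module v (fst l - snd l)"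


section \<open>The Temperley--Lieb algebra\<close>

definition tl_relations :: "nat \<Rightarrow> 'k::field \<Rightarrow> (nat word \<Rightarrow>\<^sub>0 'k) set" where
  "tl_relations n \<delta> = (let e = gen; G = {1..<n} in
     {e i * e i - pscale \<delta> (e i) | i. i \<in> G} \<union>
     {e i * e j * e i - e i | i j. i \<in> G \<and> j \<in> G \<and> \<bar>int i - int j\<bar> = 1} \<union>
     {e i * e j - e j * e i | i j. i \<in> G \<and> j \<in> G \<and> \<bar>int i - int j\<bar> > 1})"

type_synonym 'k tl_elt = "(nat word \<Rightarrow>\<^sub>0 'k) set"

definition TL :: "nat \<Rightarrow> 'k::field \<Rightarrow> ('k, 'k tl_elt) module" where
  "TL n \<delta> = presented_algebra {1..<n} (tl_relations n \<delta>)"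

text \<open>Tensor positions \<open>i\<close>, \<open>i + 1\<close> (counted from 1) are the list positions \<open>i - 1\<close>, \<open>i\<close>.\<close>

definition op_e :: "'k::field \<Rightarrow> nat \<Rightarrow> nat \<Rightarrow> 'k tvec \<Rightarrow> 'k tvec" where
  "op_e v n i = lin_ext n (\<lambda>u. let u' = u[i - 1 := u ! i, i := u ! (i - 1)] in
     if u ! (i - 1) = 1 \<and> u ! i = -1 then tscale (- inverse v) (ybasis u) + ybasis u'
     else if u ! (i - 1) = -1 \<and> u ! i = 1 then ybasis u' - tscale v (ybasis u)
     else 0)"

text \<open>
  The representation of \<open>TL\<^sub>n(\<delta>)\<close> for \<open>\<delta> = \<epsilon> (v + v\<^sup>-\<^sup>1)\<close>, where \<open>\<epsilon>\<close> is \<open>1\<close> or \<open>-1\<close>: the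
  generator \<open>e\<^sub>i\<close> acts as \<open>-\<epsilon>\<close> times \<open>op_e v n i\<close>.
\<close>

definition tl_rep :: "'k::field \<Rightarrow> 'k \<Rightarrow> nat \<Rightarrow> 'k tl_elt \<Rightarrow> 'k tvec \<Rightarrow> 'k tvec" where
  "tl_rep v \<epsilon> n = presented_hom (end_algebra base_field (tensor_power n))
     (\<lambda>i. \<lambda>f\<in>carrier (tensor_power n). tscale (- \<epsilon>) (op_e v n i f))"

definition tl_tensor :: "'k::field \<Rightarrow> 'k \<Rightarrow> nat \<Rightarrow> ('k tl_elt, 'k tvec) module" where
  "tl_tensor v \<epsilon> n = rep_module (tl_rep v \<epsilon> n) (tensor_power n)"

definition tl_cell ::
    "'k::field \<Rightarrow> 'k \<Rightarrow> nat \<Rightarrow> (nat \<times> nat) \<Rightarrow> ('k tl_elt, 'k tvec) module" where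
  "tl_cell v \<epsilon> n l = (tl_tensor v \<epsilon> n)\<lparr>carrier := Cspace v l\<rparr>"

end

theory Submission
  imports Defs
begin

text \<open>
  Everything rests on one explicit basis of tensor space. The maps \<Phi>_1 and \<Phi>_2 send
  highest weight vectors to highest weight vectors, and up to powers of v the operator E is adjoint to
  F for the bilinear form. Hence the vectors F^a \<mu>(p) are pairwise orthogonal, and their norms are products of
  powers of v and of quantum integers [1], \<dots>, [n], so they do not vanish when [n]! \<noteq> 0
  (bas_orth, bas_norm). A combination of F^{a+1} \<Phi>_1(b) and F^a \<Phi>_2(b)
  is a nonzero multiple of F^a b \<otimes> y_{-1}, so by induction on n these vectors also span
  (TS_SB). Coordinates in this basis are given by the form; they show that the strings
  {F^a \<mu>(p) : a} span simple modules for the Schur algebra, and that a commuting operator is determined by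
  its values on the \<mu>(p). The commutant therefore has the basis of matrix units munit, indexed by pairs of
  walks with the same end.

  The Temperley--Lieb algebra reaches all matrix units (tu_exists). If the walks end at (a, b) with
  b \<noteq> 0, choose a walk R to (a - 1, b - 1): up to a nonzero factor, the unit is t e_{n-1} t',
  where t and t' are matrix units of level n - 1 passing through extensions of R
  (sandwich_act). The only walk to (n, 0) is handled by subtracting all other diagonal units from the
  identity. This gives the image.

  For faithfulness (tl_faithful) the algebra must be bounded from above. Every element is a
  multiple of 1 plus a combination of products a e_{n-1} b with a, b of level n - 1
  (one_last_generator). By induction a and b may be taken to be matrix units; since units of level
  n - 2 commute with e_{n-1}, the products collapse to zero or to the same elements t e_{n-1} t', one for each
  pair of walks (YL_span). Together with 1 these act linearly independently. So the algebra is
  a direct sum of matrix algebras, and its columns are copies of the cell modules C(\<lambda>); a nonzero vector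
  fixed by a diagonal unit identifies any simple module with a cell module.

  The Schur algebra has enough elements as well: a triangular induction on the second row of \<lambda>
  isolates the operators F^b E^a 1_i on the strings of one type (schur_units), which is the remaining half of the double
  centralizer property. The Weyl module V(m) is spanned by the classes of F^a 1_m for a \<le> m by the
  commutation relations, and they are independent because they act independently on V^{\<otimes>m}; so coordinates along a
  string give an isomorphism with V(m) (wproj_smult, tensor_weyl_iso). Finally x is sent to
  the sum over walks p to \<lambda> of (coordinates of x along p) \<otimes> \<mu>(p), and this is the bimodule
  isomorphism (tensor_bimodule_iso).

  All abstract algebras are handled through representatives: an element of a presented algebra is a coset
  coset I p of an element p of the free algebra, and p acts on a vector space through act.
\<close>

section \<open>Cosets and presented algebras\<close>

abbreviation keys :: "('x \<Rightarrow>\<^sub>0 'k::zero) => 'x set" where "keys \<equiv> Poly_Mapping.keys"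
abbreviation lookup :: "('x \<Rightarrow>\<^sub>0 'k::zero) => 'x => 'k" where "lookup \<equiv> Poly_Mapping.lookup"
abbreviation single :: "'x => 'k => ('x \<Rightarrow>\<^sub>0 'k::zero)" where "single \<equiv> Poly_Mapping.single"

text \<open>Cosets of a subspace of finitely supported functions; they are the elements of presented algebras
 and of tensor products, which are quotients of such spaces.\<close>

definition coset :: "('x \<Rightarrow>\<^sub>0 'k::field) set => ('x \<Rightarrow>\<^sub>0 'k) => ('x \<Rightarrow>\<^sub>0 'k) set" where
 "coset H p = (\<lambda>h. h + p) ` H"

lemma a_r_coset_eq_coset:
 assumes "add M = (+)"
 shows "H +>\<^bsub>M\<^esub> p = coset H p"
 using assms by (auto simp: a_r_coset_def r_coset_def coset_def)

lemma mem_coset: "q \<in> coset H p \<longleftrightarrow> q - p \<in> H"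
 by (force simp: coset_def image_iff)

lemma coset_self: "pvec.subspace H ==> p \<in> coset H p"
 by (simp add: mem_coset pvec.subspace_0)

lemma coset_eq_iff:
 assumes "pvec.subspace H"
 shows "coset H p = coset H q \<longleftrightarrow> p - q \<in> H"
proof
 assume "coset H p = coset H q"
 then show "p - q \<in> H" using coset_self[OF assms, of p] by (simp add: mem_coset)
next
 assume d: "p - q \<in> H"
 show "coset H p = coset H q"
 proof (rule Set.set_eqI)
  fix x
  have "x - q \<in> H" if "x - p \<in> H"
   using pvec.subspace_add[OF assms that d] by (simp only: diff_add_eq diff_add_cancel add_diff_cancel add_diff_eq)
  moreover have "x - p \<in> H" if "x - q \<in> H"
   using pvec.subspace_diff[OF assms that d] by (simp only: diff_diff_eq2 diff_add_cancel)
  ultimately show "x \<in> coset H p \<longleftrightarrow> x \<in> coset H q" unfolding mem_coset by blast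
 qed
qed

lemma coset_zero: "coset H 0 = H"
 by (auto simp: coset_def)

lemma coset_UN_eq:
 assumes H: "pvec.subspace H" and f: "\<And>q. q - p \<in> H ==> f q - f p \<in> H"
 shows "(\<Union>q\<in>coset H p. coset H (f q)) = coset H (f p)"
proof -
 have "coset H (f q) = coset H (f p)" if "q \<in> coset H p" for q
  using that f by (simp add: coset_eq_iff[OF H] mem_coset)
 with coset_self[OF H, of p] show ?thesis by blast
qed

lemma coset_set_add:
 assumes H: "pvec.subspace H" and M: "add M = (+)"
 shows "set_add M (coset H p) (coset H q) = coset H (p + q)"
proof -
 have "set_add M (coset H p) (coset H q) = {x. \<exists>a\<in>coset H p. \<exists>b\<in>coset H q. x = a + b}"
  using M by (auto simp: set_add_def set_mult_def)
 also have "\<dots> = coset H (p + q)"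
 proof (intro Set.set_eqI iffI CollectI)
  fix x assume "x \<in> {x. \<exists>a\<in>coset H p. \<exists>b\<in>coset H q. x = a + b}"
  then obtain a b where x: "x = a + b" "a - p \<in> H" "b - q \<in> H"
   by (auto simp: mem_coset)
  have "x - (p + q) = (a - p) + (b - q)" using x by simp
  also have "\<dots> \<in> H" using x H by (intro pvec.subspace_add)
  finally show "x \<in> coset H (p + q)" by (simp add: mem_coset)
 next
  fix x assume "x \<in> coset H (p + q)"
  then have "x - q \<in> coset H p" by (simp add: mem_coset algebra_simps)
  moreover have "x = (x - q) + q" by simp
  ultimately show "\<exists>a\<in>coset H p. \<exists>b\<in>coset H q. x = a + b"
   using coset_self[OF H, of q] by blast
 qed
 finally show ?thesis .
qed

abbreviation FA :: "'g set => ('g word \<Rightarrow>\<^sub>0 'k::field) set" where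
 "FA G \<equiv> carrier (free_algebra G)"

lemma FA_def: "FA G = {p. \<forall>w\<in>keys p. set (letters w) \<subseteq> G}"
 by (simp add: free_algebra_def)

lemma free_algebra_simps [simp]:
 "mult (free_algebra G) = (*)" "one (free_algebra G) = 1" "zero (free_algebra G) = 0"
 "add (free_algebra G) = (+)" "smult (free_algebra G) = pscale"
 by (simp_all add: free_algebra_def)

lemma keys_pscale: "keys (pscale c p) \<subseteq> keys p"
 by (auto simp: in_keys_iff lookup_pscale)

lemma pscale_single: "pscale c (single w d) = single w (c * d)"
 by (rule poly_mapping_eqI) (simp add: lookup_pscale lookup_single when_def)

lemma FA_0 [simp, intro]: "0 \<in> FA G" by (simp add: FA_def)
lemma FA_1 [simp, intro]: "1 \<in> FA G"
 by (auto simp: FA_def zero_word_def simp flip: single_one)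
lemma FA_gen [intro]: "g \<in> G ==> gen g \<in> FA G"
 by (auto simp: FA_def gen_def)
lemma FA_add [intro]: "p \<in> FA G ==> q \<in> FA G ==> p + q \<in> FA G"
 using keys_add[of p q] unfolding FA_def by blast
lemma FA_pscale [intro]: "p \<in> FA G ==> pscale c p \<in> FA G"
 using keys_pscale[of c p] unfolding FA_def by blast
lemma FA_mult [intro]: "p \<in> FA G ==> q \<in> FA G ==> p * q \<in> FA G"
 using keys_mult[of p q] unfolding FA_def by (fastforce simp: plus_word_def)
lemma FA_uminus [intro]: "p \<in> FA G ==> - p \<in> FA G"
 by (simp add: FA_def)
lemma FA_diff [intro]: "p \<in> FA G ==> q \<in> FA G ==> p - q \<in> FA G"
 using FA_add[of p G "- q"] by auto
lemma FA_power [intro]: "p \<in> FA G ==> p ^ k \<in> FA G"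
 by (induction k) auto
lemma subspace_FA: "pvec.subspace (FA G)"
 unfolding pvec.subspace_def by auto
lemma FA_sum [intro]: "(\<And>i. i \<in> S ==> f i \<in> FA G) ==> sum f S \<in> FA G"
 by (rule pvec.subspace_sum[OF subspace_FA])
lemma FA_mono: "G \<subseteq> G' ==> FA G \<subseteq> FA G'"
 unfolding FA_def by blast

lemma pm_expand: "(p :: 'a \<Rightarrow>\<^sub>0 'b::comm_monoid_add) = (\<Sum>w\<in>keys p. single w (lookup p w))"
proof (rule poly_mapping_eqI)
 fix x
 have "lookup (\<Sum>w\<in>keys p. single w (lookup p w)) x
   = (\<Sum>w\<in>keys p. if w = x then lookup p w else 0)"
  by (simp add: lookup_sum lookup_single when_def)
 then show "lookup p x = lookup (\<Sum>w\<in>keys p. single w (lookup p w)) x"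
  by (simp add: in_keys_iff)
qed

lemma pm_induct [case_names zero single add]:
 fixes p :: "'a \<Rightarrow>\<^sub>0 'b::comm_monoid_add"
 assumes "P 0" "\<And>w c. w \<in> keys p ==> P (single w c)"
  "\<And>a b. P a ==> P b ==> P (a + b)"
 shows "P p"
proof -
 have "P (\<Sum>w\<in>S. single w (lookup p w))"
  if "finite S" "S \<subseteq> keys p" for S
  using that by (induction S) (auto intro: assms)
 then show ?thesis using pm_expand[of p] by (metis finite_keys order_refl)
qed

lemma pscale_mult_left: "pscale c p * q = pscale c (p * q :: 'g word \<Rightarrow>\<^sub>0 'k::field)"
proof (induction p rule: pm_induct)
 case (single w d)
 show ?case
  by (induction q rule: pm_induct)
    (auto simp: pscale_single mult_single algebra_simps pvec.scale_right_distrib)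
qed (auto simp: algebra_simps pvec.scale_right_distrib)

lemma pscale_mult_right: "p * pscale c q = pscale c (p * q :: 'g word \<Rightarrow>\<^sub>0 'k::field)"
proof (induction p rule: pm_induct)
 case (single w d)
 show ?case
  by (induction q rule: pm_induct)
    (auto simp: pscale_single mult_single algebra_simps pvec.scale_right_distrib)
qed (auto simp: algebra_simps pvec.scale_right_distrib)

lemma ring_free_algebra: "ring (free_algebra G :: ('k::field, 'g word \<Rightarrow>\<^sub>0 'k) module)"
proof (rule ringI)
 show "abelian_group (free_algebra G :: ('k::field, 'g word \<Rightarrow>\<^sub>0 'k) module)"
 proof (rule abelian_groupI)
  fix x :: "'g word \<Rightarrow>\<^sub>0 'k" assume "x \<in> FA G"
  then show "\<exists>y\<in>FA G. y \<oplus>\<^bsub>free_algebra G\<^esub> x = \<zero>\<^bsub>free_algebra G\<^esub>"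
   by (intro bexI[of _ "- x"]) auto
 qed (auto simp: ac_simps)
 show "Group.monoid (free_algebra G :: ('k::field, 'g word \<Rightarrow>\<^sub>0 'k) module)"
  by (rule monoidI) (auto simp: mult.assoc)
qed (auto simp: algebra_simps)

definition idl :: "'g set => ('g word \<Rightarrow>\<^sub>0 'k::field) set => ('g word \<Rightarrow>\<^sub>0 'k) set" where
 "idl G Rel = Idl\<^bsub>free_algebra G\<^esub> Rel"

lemma ideal_free_algebraI:
 assumes "J \<subseteq> FA G" "pvec.subspace J"
  and "\<And>a x. a \<in> FA G ==> x \<in> J ==> a * x \<in> J" "\<And>a x. a \<in> FA G ==> x \<in> J ==> x * a \<in> J"
 shows "ideal J (free_algebra G)"
proof (rule idealI[OF ring_free_algebra])
 interpret A: ring "free_algebra G" by (rule ring_free_algebra)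
 show "subgroup J (add_monoid (free_algebra G))"
 proof (rule A.add.subgroupI)
  show "J \<noteq> {}" using assms(2) pvec.subspace_0 by blast
  fix a assume a: "a \<in> J"
  then have "a \<in> FA G" using assms(1) by blast
  then have "\<ominus>\<^bsub>free_algebra G\<^esub> a = - a"
   by (intro A.minus_equality) auto
  then show "\<ominus>\<^bsub>free_algebra G\<^esub> a \<in> J" using a assms(2) by (simp add: pvec.subspace_neg)
 qed (use assms in \<open>auto simp: pvec.subspace_add\<close>)
qed (use assms in auto)

locale presentation =
 fixes G :: "'g set" and Rel :: "('g word \<Rightarrow>\<^sub>0 'k::field) set"
 assumes Rel: "Rel \<subseteq> FA G"
begin

abbreviation "I \<equiv> idl G Rel"
abbreviation "PA \<equiv> presented_algebra G Rel"

lemma ideal_I: "ideal I (free_algebra G)"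
 unfolding idl_def by (rule ring.genideal_ideal[OF ring_free_algebra Rel])

lemma I_subset: "I \<subseteq> FA G"
 using ideal.Icarr[OF ideal_I] by blast

lemma Rel_I: "r \<in> Rel ==> r \<in> I"
 unfolding idl_def using ring.genideal_self[OF ring_free_algebra Rel] by blast

lemma I_mult_left: "a \<in> FA G ==> x \<in> I ==> a * x \<in> I"
 using ideal.I_l_closed[OF ideal_I] by simp

lemma I_mult_right: "a \<in> FA G ==> x \<in> I ==> x * a \<in> I"
 using ideal.I_r_closed[OF ideal_I] by simp

lemma subspace_I: "pvec.subspace I"
proof (rule pvec.subspaceI)
 interpret ideal I "free_algebra G" by (rule ideal_I)
 show "0 \<in> I" using additive_subgroup.zero_closed[OF ideal.axioms(1)[OF ideal_I]] by simp
 show "x + y \<in> I" if "x \<in> I" "y \<in> I" for x y using additive_subgroup.a_closed[OF ideal.axioms(1)[OF ideal_I] that] by simp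
 show "pscale c x \<in> I" if "x \<in> I" for c x
  using I_mult_left[OF FA_pscale[OF FA_1, of c] that] by (simp add: pscale_mult_left)
qed

text \<open>Calculations in the quotient are done with representatives, as congruences x - y \<in> I.\<close>

lemma I_0 [simp]: "0 \<in> I"
 by (rule pvec.subspace_0[OF subspace_I])
lemma I_trans: "x - y \<in> I ==> y - z \<in> I ==> x - z \<in> I"
 using pvec.subspace_add[OF subspace_I, of "x - y" "y - z"] by simp
lemma I_sym: "x - y \<in> I ==> y - x \<in> I"
 using pvec.subspace_neg[OF subspace_I, of "x - y"] by simp
lemma I_cong: "y \<in> I ==> x - y \<in> I ==> x \<in> I"
 using pvec.subspace_add[OF subspace_I, of y "x - y"] by simp
lemma I_mult_left_cong: "a \<in> FA G ==> x - y \<in> I ==> a * x - a * y \<in> I"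
 using I_mult_left[of a "x - y"] by (simp add: right_diff_distrib)
lemma I_mult_right_cong: "a \<in> FA G ==> x - y \<in> I ==> x * a - y * a \<in> I"
 using I_mult_right[of a "x - y"] by (simp add: left_diff_distrib)
lemma I_add_cong: "x - y \<in> I ==> x' - y' \<in> I ==> (x + x') - (y + y') \<in> I"
 using pvec.subspace_add[OF subspace_I, of "x - y" "x' - y'"] by (simp add: algebra_simps)
lemma I_scale_cong: "x - y \<in> I ==> pscale c x - pscale c y \<in> I"
 using pvec.subspace_scale[OF subspace_I, of "x - y" c] by (simp add: pvec.scale_right_diff_distrib)

lemma I_minimal:
 assumes "J \<subseteq> FA G" "pvec.subspace J" "Rel \<subseteq> J"
  and "\<And>a x. a \<in> FA G ==> x \<in> J ==> a * x \<in> J" "\<And>a x. a \<in> FA G ==> x \<in> J ==> x * a \<in> J"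
 shows "I \<subseteq> J"
 unfolding idl_def
 by (rule ring.genideal_minimal[OF ring_free_algebra ideal_free_algebraI]) (use assms in auto)

lemma rcos: "I +>\<^bsub>free_algebra G\<^esub> p = coset I p"
 by (rule a_r_coset_eq_coset) simp

lemma PA_carrier: "carrier PA = coset I ` FA G"
 by (auto simp: presented_algebra_def Let_def FactRing_def A_RCOSETS_def' rcos simp flip: idl_def)

lemma PA_I: "p \<in> FA G ==> coset I p \<in> carrier PA"
 by (simp add: PA_carrier)

lemma PA_E: assumes "X \<in> carrier PA" obtains p where "p \<in> FA G" "X = coset I p"
 using assms by (auto simp: PA_carrier)

lemma PA_eq: "coset I p = coset I q \<longleftrightarrow> p - q \<in> I"
 by (rule coset_eq_iff[OF subspace_I])

lemma PA_add: "coset I p \<oplus>\<^bsub>PA\<^esub> coset I q = coset I (p + q)"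
 by (simp add: presented_algebra_def Let_def FactRing_def coset_set_add[OF subspace_I] flip: idl_def)

lemma PA_zero: "\<zero>\<^bsub>PA\<^esub> = coset I 0"
 by (simp add: presented_algebra_def Let_def FactRing_def coset_zero flip: idl_def)

lemma PA_one: "\<one>\<^bsub>PA\<^esub> = coset I 1"
 by (simp add: presented_algebra_def Let_def FactRing_def rcos flip: idl_def)

lemma PA_mult: "p \<in> FA G ==> q \<in> FA G ==> coset I p \<otimes>\<^bsub>PA\<^esub> coset I q = coset I (p * q)"
 using ideal.rcoset_mult_add[OF ideal_I, of p q]
 by (simp add: presented_algebra_def Let_def FactRing_def rcos flip: idl_def)

lemma PA_smult: "c \<odot>\<^bsub>PA\<^esub> coset I p = coset I (pscale c p)"
proof -
 have "c \<odot>\<^bsub>PA\<^esub> coset I p = (\<Union>q\<in>coset I p. coset I (pscale c q))"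
  by (simp add: presented_algebra_def Let_def rcos flip: idl_def)
 also have "\<dots> = coset I (pscale c p)"
 proof (rule coset_UN_eq[OF subspace_I])
  fix q assume "q - p \<in> I"
  then have "pscale c (q - p) \<in> I" by (rule pvec.subspace_scale[OF subspace_I])
  then show "pscale c q - pscale c p \<in> I" by (simp add: pvec.scale_right_diff_distrib)
 qed
 finally show ?thesis .
qed

lemmas PA_simps = PA_add PA_zero PA_one PA_mult PA_smult

lemma ring_PA: "ring PA"
proof (rule ringI)
 show "abelian_group PA"
 proof (rule abelian_groupI)
  fix x assume "x \<in> carrier PA"
  then obtain p where p: "p \<in> FA G" "x = coset I p" by (rule PA_E)
  then show "\<exists>y\<in>carrier PA. y \<oplus>\<^bsub>PA\<^esub> x = \<zero>\<^bsub>PA\<^esub>"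
   by (intro bexI[of _ "coset I (- p)"]) (auto simp: PA_simps intro: PA_I)
 qed (auto elim!: PA_E simp: PA_simps ac_simps intro!: PA_I)
 show "Group.monoid PA"
  by (rule monoidI) (auto elim!: PA_E simp: PA_simps FA_mult mult.assoc intro!: PA_I)
qed (auto elim!: PA_E simp: PA_simps FA_mult FA_add algebra_simps)

lemma PA_scalar: "c \<odot>\<^bsub>PA\<^esub> \<one>\<^bsub>PA\<^esub> = coset I (pscale c 1)"
 by (simp add: PA_simps)

end

section \<open>Evaluation of free algebra elements on operators\<close>

text \<open>The action of the free algebra on a vector space on which the generators act by the operators g i.\<close>

definition act :: "('k => 'v => 'v) => ('g => 'v => 'v) => ('g word \<Rightarrow>\<^sub>0 'k::field) => 'v => 'v::ab_group_add" where
 "act scale g p x = (\<Sum>w\<in>keys p. scale (lookup p w) (foldr g (letters w) x))"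

locale free_rep = vector_space scale
 for scale :: "'k::field => 'v::ab_group_add => 'v" +
 fixes g :: "'g => 'v => 'v"
 assumes g_add: "g i (x + y) = g i x + g i y" and g_scale: "g i (scale c x) = scale c (g i x)"
begin

abbreviation "ev \<equiv> act scale g"

lemma foldr_add: "foldr g w (x + y) = foldr g w x + foldr g w y"
 by (induction w) (auto simp: g_add)
lemma foldr_scale: "foldr g w (scale c x) = scale c (foldr g w x)"
 by (induction w) (auto simp: g_scale)

lemma ev_superset:
 assumes "finite S" "keys p \<subseteq> S"
 shows "ev p x = (\<Sum>w\<in>S. scale (lookup p w) (foldr g (letters w) x))"
 unfolding act_def by (rule sum.mono_neutral_left) (use assms in \<open>auto simp: in_keys_iff\<close>)

lemma ev_zero [simp]: "ev 0 x = 0" by (simp add: act_def)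

lemma ev_add: "ev (p + q) x = ev p x + ev q x"
proof -
 let ?S = "keys p \<union> keys q"
 have f: "finite ?S" by simp
 show ?thesis
  using ev_superset[OF f, of p x] ev_superset[OF f, of q x]
   ev_superset[OF f keys_add, of x]
  by (simp add: lookup_add scale_left_distrib sum.distrib)
qed

lemma ev_single: "ev (single w c) x = scale c (foldr g (letters w) x)"
 by (subst ev_superset[of "{w}"]) auto

lemma ev_gen [simp]: "ev (gen i) x = g i x"
 by (simp add: gen_def ev_single)

lemma ev_one [simp]: "ev 1 x = x"
 using ev_single[of 0 1 x] by (simp only: single_one) (simp add: zero_word_def)

lemma ev_pscale: "ev (pscale c p) x = scale c (ev p x)"
 by (induction p rule: pm_induct)
   (auto simp: pscale_single ev_single ev_add scale_right_distrib pvec.scale_right_distrib)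

lemma ev_uminus: "ev (- p) x = - ev p x"
 using ev_add[of p "- p" x] by (simp add: eq_neg_iff_add_eq_0 add.commute)

lemma ev_diff: "ev (p - q) x = ev p x - ev q x"
 using ev_add[of p "- q" x] by (simp add: ev_uminus)

lemma ev_sum: "ev (sum f S) x = (\<Sum>i\<in>S. ev (f i) x)"
 by (induction S rule: infinite_finite_induct) (auto simp: ev_add)

lemma ev_add_right: "ev p (x + y) = ev p x + ev p y"
 by (simp add: act_def foldr_add scale_right_distrib sum.distrib)

lemma ev_scale_right: "ev p (scale c x) = scale c (ev p x)"
 by (simp add: act_def foldr_scale scale_sum_right mult.commute)

lemma ev_zero_right [simp]: "ev p 0 = 0"
 using ev_scale_right[of p 0 0] by simp

lemma ev_uminus_right: "ev p (- x) = - ev p x"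
 using ev_add_right[of p x "- x"] by (simp add: eq_neg_iff_add_eq_0 add.commute)

lemma ev_diff_right: "ev p (x - y) = ev p x - ev p y"
 using ev_add_right[of p x "- y"] by (simp add: ev_uminus_right)

lemma ev_sum_right: "ev p (sum f S) = (\<Sum>i\<in>S. ev p (f i))"
 by (induction S rule: infinite_finite_induct) (auto simp: ev_add_right)

lemma ev_mult: "ev (p * q) x = ev p (ev q x)"
proof (induction p rule: pm_induct)
 case (single w c)
 show ?case
  by (induction q rule: pm_induct)
   (auto simp: mult_single ev_single ev_add ring_distribs plus_word_def foldr_scale foldr_add
    scale_right_distrib mult.commute)
qed (auto simp: ring_distribs ev_add)

lemma ev_induct:
 assumes p: "p \<in> FA G" and U: "subspace U" "x \<in> U" and g: "\<And>i y. i \<in> G ==> y \<in> U ==> g i y \<in> U"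
 shows "ev p x \<in> U"
proof -
 have "foldr g w x \<in> U" if "set w \<subseteq> G" for w
  using that by (induction w) (auto intro: g U)
 then show ?thesis unfolding act_def
  using p by (intro subspace_sum subspace_scale U) (auto simp: FA_def)
qed

text \<open>Transports a relation between two vector spaces along the action: a relation that is linear and
 respected by every generator is respected by the whole free algebra.\<close>

lemma ev_word_induct:
 assumes p: "p \<in> FA G" and 0: "P 0 0" and 1: "P x y"
  and add: "\<And>a b c d. P a b ==> P c d ==> P (a + c) (b + d)"
  and sc: "\<And>a b c. P a b ==> P (scale c a) (scale' c b)"
  and g: "\<And>i a b. i \<in> G ==> P a b ==> P (g i a) (g' i b)"
 shows "P (ev p x) (act scale' g' p y)"
proof -
 have w: "P (foldr g w x) (foldr g' w y)" if "set w \<subseteq> G" for w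
  using that by (induction w) (auto intro: g 1)
 have "P (\<Sum>w\<in>S. scale (lookup p w) (foldr g (letters w) x))
     (\<Sum>w\<in>S. scale' (lookup p w) (foldr g' (letters w) y))"
  if "finite S" "S \<subseteq> keys p" for S
  using that
 proof (induction S)
  case (insert a S)
  then have "set (letters a) \<subseteq> G" using p by (auto simp: FA_def)
  with insert show ?case by (simp add: add sc w)
 qed (simp add: 0)
 then show ?thesis unfolding act_def by simp
qed

end

text \<open>The elements killing a stable subspace form a two-sided ideal, so killing the relators suffices.\<close>

lemma (in presentation) ev_I_zero:
 assumes "free_rep scale g" and U: "module.subspace scale U"
  and g: "\<And>i y. i \<in> G ==> y \<in> U ==> g i y \<in> U"
  and R: "\<And>r y. r \<in> Rel ==> y \<in> U ==> act scale g r y = 0"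
  and p: "p \<in> I" and x: "x \<in> U"
 shows "act scale g p x = 0"
proof -
 interpret free_rep scale g by fact
 have "I \<subseteq> {p \<in> FA G. \<forall>y\<in>U. ev p y = 0}"
 proof (rule I_minimal)
  show "pvec.subspace {p \<in> FA G. \<forall>y\<in>U. ev p y = 0}"
   by (rule pvec.subspaceI) (auto simp: ev_add ev_pscale)
  show "x * a \<in> {p \<in> FA G. \<forall>y\<in>U. ev p y = 0}" if "a \<in> FA G" "x \<in> {p \<in> FA G. \<forall>y\<in>U. ev p y = 0}" for a x
   using that ev_induct[OF that(1) U _ g] by (auto simp: ev_mult)
 qed (use Rel R in \<open>auto simp: ev_mult\<close>)
 then show ?thesis using p x by blast
qed

section \<open>Quantum integers\<close>

locale quantum =
 fixes v :: "'k::field"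
 assumes v_nonzero: "v \<noteq> 0"
begin

lemma powi_add: "v powi (a + b) = v powi a * v powi b"
 by (simp add: power_int_add v_nonzero)

lemma v_powi_1: "v * v powi a = v powi (a + 1)"
 using powi_add[of a 1] by (simp add: mult.commute)

lemma v_powi_m1: "inverse v * v powi a = v powi (a - 1)"
 using powi_add[of a "-1"] by (simp add: power_int_minus mult.commute)

lemma powi_cancel: "v powi (- a) * v powi a = 1"
 using powi_add[of "-a" a] by simp

lemma qint_0 [simp]: "qint v 0 = 0" by (simp add: qint_def)

lemma qint_uminus: "qint v (- k) = - qint v k"
 by (auto simp: qint_def)

lemma qint_Suc_nat: "qint v (int n + 1) = v * qint v (int n) + v powi (- int n)"
proof -
 have "nat (int n + 1) = Suc n" by simp
 then show ?thesis by (simp add: qint_def sum_distrib_left v_powi_1 algebra_simps)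
qed

lemma qint_Suc_nat': "qint v (int n + 1) = inverse v * qint v (int n) + v powi (int n)"
proof -
 have "(\<Sum>t<Suc n. v powi (int n - 2 * int t)) = v powi int n + (\<Sum>t<n. v powi (int n - 2 * int (Suc t)))"
  by (subst sum.lessThan_Suc_shift) simp
 also have "(\<Sum>t<n. v powi (int n - 2 * int (Suc t))) = inverse v * (\<Sum>t<n. v powi (int n - 1 - 2 * int t))"
  unfolding sum_distrib_left v_powi_m1 by (rule sum.cong) (simp_all add: algebra_simps)
 finally show ?thesis
  by (simp add: qint_def nat_add_distrib del: sum.lessThan_Suc)
qed

lemma qint_1 [simp]: "qint v 1 = 1" using qint_Suc_nat[of 0] by simp

lemma qint_Suc: "qint v (k + 1) = v * qint v k + v powi (- k)"
proof (cases "k \<ge> 0")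
 case True
 then show ?thesis using qint_Suc_nat[of "nat k"] by simp
next
 case False
 define n where "n = nat (- k - 1)"
 have k: "k = - (int n + 1)" using False by (simp add: n_def)
 have 1: "qint v (k + 1) = - qint v (int n)" using qint_uminus[of "int n"] by (simp add: k)
 have 2: "qint v k = - (inverse v * qint v (int n) + v powi int n)"
  by (simp only: k qint_uminus qint_Suc_nat')
 have 3: "v powi (- k) = v * v powi int n" by (simp only: k v_powi_1 minus_minus)
 show ?thesis unfolding 1 2 3 using v_nonzero by (simp add: algebra_simps)
qed

lemma qint_add: "qint v (a + b) = v powi b * qint v a + v powi (- a) * qint v b"
proof (induction b rule: int_induct[where k = 0])
 case base then show ?case by simp
next
 case (step1 b)
 have "qint v (a + (b + 1)) = v * qint v (a + b) + v powi (- a + (- b))"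
  using qint_Suc[of "a + b"] by (simp add: add.assoc)
 then show ?case
  unfolding step1.IH powi_add qint_Suc[of b] by (simp add: algebra_simps)
next
 case (step2 b)
 have 1: "qint v (a + b) = v * qint v (a + (b - 1)) + v powi (- a - (b - 1))"
  using qint_Suc[of "a + (b - 1)"] by (simp add: algebra_simps)
 have 2: "qint v b = v * qint v (b - 1) + v powi (- (b - 1))"
  using qint_Suc[of "b - 1"] by simp
 have 3: "v powi b = v * v powi (b - 1)" by (simp add: v_powi_1)
 have 4: "v powi (- a - (b - 1)) = v powi (- a) * v powi (- (b - 1))"
  using powi_add[of "-a" "-(b-1)"] by (simp add: algebra_simps)
 have "v * qint v (a + (b - 1)) = v * (v powi (b - 1) * qint v a + v powi - a * qint v (b - 1))"
  using step2.IH 1 unfolding 2 3 4 by (simp add: algebra_simps)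
 then show ?case using v_nonzero by simp
qed

lemma qint_Suc': "qint v (k + 1) = inverse v * qint v k + v powi k"
 using qint_add[of 1 k] by (simp add: power_int_minus add.commute[of 1])

text \<open>This identity is what makes the products [a][k - a + 1] in the action of E on F^a b add up.\<close>

lemma qint_ladder: "qint v (a + 1) * qint v (b + a) = qint v a * qint v (b + a + 1) + qint v b"
proof -
 have 1: "qint v (b + a) = v powi a * qint v b + v powi (- b) * qint v a" by (rule qint_add)
 have "qint v (b + (a + 1)) = v powi (a + 1) * qint v b + v powi (- b) * qint v (a + 1)" by (rule qint_add)
 then have 2: "qint v (b + a + 1) = v powi (a + 1) * qint v b + v powi (- b) * qint v (a + 1)"
  by (simp add: add.assoc)
 have 3: "v powi a * qint v (a + 1) = v powi (a + 1) * qint v a + 1"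
  unfolding qint_Suc[of a] powi_add using powi_cancel[of a] by (simp add: algebra_simps)
 have "qint v (a + 1) * qint v (b + a) - qint v a * qint v (b + a + 1)
   = qint v b * (v powi a * qint v (a + 1) - v powi (a + 1) * qint v a)"
  unfolding 1 2 by (simp add: algebra_simps)
 then show ?thesis using 3 by (simp add: algebra_simps)
qed

end

section \<open>Tensor space one factor at a time\<close>

abbreviation ty :: "'k::field tvec => int => 'k tvec" where "ty \<equiv> tensor_y"
abbreviation TS :: "nat => 'k::field tvec set" where "TS n \<equiv> carrier (tensor_power n)"

lemma TS_def: "TS n = {f. \<forall>w. w \<notin> sign_words n --> f w = 0}"
 by (simp add: tensor_power_def)

lemma tensor_power_simps [simp]:
 "zero (tensor_power n) = 0" "add (tensor_power n) = (+)" "smult (tensor_power n) = tscale"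
 by (simp_all add: tensor_power_def)

declare plus_fun_apply [simp del] zero_fun_apply [simp del] minus_apply [simp del] uminus_apply [simp del]

lemma tscale_apply: "tscale c f w = c * f w" by (simp add: tscale_def)

lemma fun_sum_apply: "(sum f S) x = (\<Sum>i\<in>S. f i x)" for f :: "'i => 'a => 'b::comm_monoid_add"
 by (induction S rule: infinite_finite_induct) (auto simp: plus_fun_apply zero_fun_apply)

lemmas fun_app = plus_fun_apply zero_fun_apply minus_apply uminus_apply tscale_apply

lemma subspace_TS: "tvec.subspace (TS n)"
 by (rule tvec.subspaceI) (auto simp: TS_def fun_app)

lemmas TS_add [intro] = tvec.subspace_add[OF subspace_TS]
 and TS_diff [intro] = tvec.subspace_diff[OF subspace_TS]
 and TS_scale [intro] = tvec.subspace_scale[OF subspace_TS]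
 and TS_0 [simp, intro] = tvec.subspace_0[OF subspace_TS]
 and TS_sum [intro] = tvec.subspace_sum[OF subspace_TS]

lemma sign_words_0: "sign_words 0 = {[]}" by (auto simp: sign_words_def)

lemma sign_words_Suc: "sign_words (Suc n) = (\<lambda>(u, s). u @ [s]) ` (sign_words n \<times> {1, -1})"
proof (intro Set.set_eqI iffI)
 fix w assume w: "w \<in> sign_words (Suc n)"
 then have "w \<noteq> []" by (auto simp: sign_words_def)
 then have "w = butlast w @ [last w]" by simp
 moreover have "last w \<in> set w" using \<open>w \<noteq> []\<close> by simp
 moreover have "set (butlast w) \<subseteq> set w" by (auto dest: in_set_butlastD)
 ultimately show "w \<in> (\<lambda>(u, s). u @ [s]) ` (sign_words n \<times> {1, -1})"
  using w by (intro image_eqI[of _ _ "(butlast w, last w)"]) (auto simp: sign_words_def)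
qed (auto simp: sign_words_def)

lemma snoc_sign_words [simp]: "u @ [s] \<in> sign_words (Suc n) \<longleftrightarrow> u \<in> sign_words n \<and> s \<in> {1, -1}"
 by (auto simp: sign_words_def)

lemma Nil_sign_words [simp]: "[] \<notin> sign_words (Suc n)" by (auto simp: sign_words_def)

lemma finite_sign_words [simp]: "finite (sign_words n)"
 by (induction n) (auto simp: sign_words_0 sign_words_Suc)

lemma sum_sign_words_Suc:
 "(\<Sum>w\<in>sign_words (Suc n). h w) = (\<Sum>u\<in>sign_words n. h (u @ [1]) + h (u @ [-1]))"
proof -
 have "inj_on (\<lambda>(u, s). u @ [s]) (sign_words n \<times> {1, -1 :: int})" by (auto simp: inj_on_def)
 then have "(\<Sum>w\<in>sign_words (Suc n). h w) = (\<Sum>(u, s)\<in>sign_words n \<times> {1, -1}. h (u @ [s]))"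
  unfolding sign_words_Suc by (subst sum.reindex) (auto simp: case_prod_unfold)
 then show ?thesis by (simp flip: sum.cartesian_product)
qed

lemma tensor_y_snoc [simp]: "ty b s (u @ [t]) = (if t = s then b u else 0)"
 by (simp add: tensor_y_def)
lemma tensor_y_Nil [simp]: "ty b s [] = 0"
 by (simp add: tensor_y_def)

text \<open>A tensor is compared at the empty word and at the words with a last letter, because all operators
 are computed by splitting off the last tensor factor.\<close>

lemma tvec_eqI:
 assumes "f [] = g []" "\<And>u t. f (u @ [t]) = g (u @ [t])"
 shows "f = (g :: int list => 'a)"
proof
 fix w show "f w = g w" using assms by (cases w rule: rev_cases) auto
qed

lemma tensor_y_add: "ty (a + b) s = ty a s + ty b s"
 by (rule tvec_eqI) (auto simp: fun_app)
lemma tensor_y_diff: "ty (a - b) s = ty a s - ty b s"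
 by (rule tvec_eqI) (auto simp: fun_app)
lemma tensor_y_scale: "ty (tscale c b) s = tscale c (ty b s)"
 by (rule tvec_eqI) (auto simp: fun_app)
lemma tensor_y_zero [simp]: "ty 0 s = 0"
 by (rule tvec_eqI) (auto simp: fun_app)
lemma tensor_y_uminus: "ty (- b) s = - ty b s"
 by (rule tvec_eqI) (auto simp: fun_app)
lemma tensor_y_sum: "ty (sum f S) s = (\<Sum>i\<in>S. ty (f i) s)"
 by (induction S rule: infinite_finite_induct) (auto simp: tensor_y_add)
lemmas tensor_y_linear = tensor_y_add tensor_y_diff tensor_y_scale tensor_y_uminus

lemma tensor_y_TS [intro]: "b \<in> TS n ==> s \<in> {1, -1} ==> ty b s \<in> TS (Suc n)"
proof -
 assume b: "b \<in> TS n" and s: "s \<in> {1, -1}"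
 have "ty b s w = 0" if "w \<notin> sign_words (Suc n)" for w
  using that b s by (cases w rule: rev_cases) (auto simp: TS_def)
 then show ?thesis by (simp add: TS_def)
qed

lemma TS_Suc_cases:
 assumes "f \<in> TS (Suc n)"
 obtains a b where "a \<in> TS n" "b \<in> TS n" "f = ty a 1 + ty b (-1)"
proof
 show "(\<lambda>u. f (u @ [1])) \<in> TS n" "(\<lambda>u. f (u @ [-1])) \<in> TS n"
  using assms by (auto simp: TS_def)
 show "f = ty (\<lambda>u. f (u @ [1])) 1 + ty (\<lambda>u. f (u @ [-1])) (-1)"
 proof (rule tvec_eqI)
  show "f [] = (ty (\<lambda>u. f (u @ [1])) 1 + ty (\<lambda>u. f (u @ [-1])) (-1)) []"
   using assms by (simp add: TS_def fun_app)
  fix u t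
  show "f (u @ [t]) = (ty (\<lambda>u. f (u @ [1])) 1 + ty (\<lambda>u. f (u @ [-1])) (-1)) (u @ [t])"
   using assms by (cases "t = 1 \<or> t = -1") (auto simp: TS_def fun_app)
 qed
qed

lemma lin_ext_apply: "lin_ext n g f w = (\<Sum>u\<in>sign_words n. f u * g u w)"
 by (simp add: lin_ext_def fun_sum_apply tscale_apply)

lemma lin_ext_add: "lin_ext n g (a + b) = lin_ext n g a + lin_ext n g b"
 by (simp add: fun_app fun_eq_iff lin_ext_apply sum.distrib ring_distribs)
lemma lin_ext_scale: "lin_ext n g (tscale c b) = tscale c (lin_ext n g b)"
 by (simp add: fun_app fun_eq_iff lin_ext_apply sum_distrib_left mult.assoc)

lemma tensor_op_add: "tensor_op As (a + b) = tensor_op As a + tensor_op As b"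
 by (simp add: tensor_op_def lin_ext_add)
lemma tensor_op_scale: "tensor_op As (tscale c b) = tscale c (tensor_op As b)"
 by (simp add: tensor_op_def lin_ext_scale)

lemma tensor_op_snoc:
 assumes "s \<in> {1, -1}"
 shows "tensor_op (As @ [A]) (ty b s) (u @ [t]) = A s t * tensor_op As b u"
proof (cases "length u = length As")
 case True
 let ?n = "length As"
 have l: "length w = ?n" if "w \<in> sign_words ?n" for w using that by (simp add: sign_words_def)
 have *: "(\<Prod>j<Suc ?n. ((As @ [A]) ! j) ((w @ [r]) ! j) ((u @ [t]) ! j))
   = A r t * (\<Prod>j<?n. (As ! j) (w ! j) (u ! j))" if "w \<in> sign_words ?n" for w r
  using l[OF that] True by (simp add: nth_append mult.commute)
 have "tensor_op (As @ [A]) (ty b s) (u @ [t])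
  = (\<Sum>w\<in>sign_words ?n. b w * (A s t * (\<Prod>j<?n. (As ! j) (w ! j) (u ! j))))"
  using True assms by (auto simp: tensor_op_def lin_ext_apply sum_sign_words_Suc * simp del: prod.lessThan_Suc intro!: sum.cong)
 then show ?thesis using True by (simp add: tensor_op_def lin_ext_apply sum_distrib_left ac_simps)
next
 case False
 then show ?thesis by (simp add: tensor_op_def lin_ext_apply)
qed

lemma tensor_op_snoc_Nil [simp]: "tensor_op (As @ [A]) f [] = 0"
 by (simp add: tensor_op_def lin_ext_apply)

lemma tensor_op_snoc_diag:
 assumes "s \<in> {1, -1}" "\<And>t. A s t = (if s = t then c else 0)"
 shows "tensor_op (As @ [A]) (ty b s) = tscale c (ty (tensor_op As b) s)"
 by (rule tvec_eqI) (auto simp: fun_app tensor_op_snoc[OF assms(1)] assms(2))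

lemma tensor_op_snoc_E:
 "s \<in> {1, -1} ==> tensor_op (As @ [site_E]) (ty b s) = (if s = -1 then ty (tensor_op As b) 1 else 0)"
 by (rule tvec_eqI) (auto simp: fun_app tensor_op_snoc site_E_def)

lemma tensor_op_snoc_F:
 "s \<in> {1, -1} ==> tensor_op (As @ [site_F]) (ty b s) = (if s = 1 then ty (tensor_op As b) (-1) else 0)"
 by (rule tvec_eqI) (auto simp: fun_app tensor_op_snoc site_F_def)

text \<open>The grouplike element acting on tensor space, diagonally by v to the weight.\<close>

definition Kop :: "'k::field => 'k tvec => 'k tvec" where
 "Kop v b = (\<lambda>w. v powi sum_list w * b w)"

text \<open>The operator (K - K^{-1})/(v - v^{-1}), which is \<Sum>_i [i] 1_i; it is defined directly by quantum
 integers, so that v^2 = 1 is allowed.\<close>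

definition Hop :: "'k::field => 'k tvec => 'k tvec" where
 "Hop v b = (\<lambda>w. qint v (sum_list w) * b w)"

lemma Kop_add: "Kop v (a + b) = Kop v a + Kop v b" by (simp add: fun_app Kop_def fun_eq_iff algebra_simps)
lemma Kop_scale: "Kop v (tscale c a) = tscale c (Kop v a)" by (simp add: fun_app Kop_def fun_eq_iff algebra_simps)
lemma Kop_zero [simp]: "Kop v 0 = 0" by (simp add: Kop_def fun_eq_iff zero_fun_apply)
lemma Kop_TS [intro]: "b \<in> TS n ==> Kop v b \<in> TS n" by (auto simp: TS_def Kop_def)

lemma op_E_add: "op_E v n (a + b) = op_E v n a + op_E v n b"
 by (simp add: op_E_def tensor_op_add sum.distrib)
lemma op_E_scale: "op_E v n (tscale c b) = tscale c (op_E v n b)"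
 by (simp add: op_E_def tensor_op_scale tvec.scale_sum_right)
lemma op_F_add: "op_F v n (a + b) = op_F v n a + op_F v n b"
 by (simp add: op_F_def tensor_op_add sum.distrib)
lemma op_F_scale: "op_F v n (tscale c b) = tscale c (op_F v n b)"
 by (simp add: op_F_def tensor_op_scale tvec.scale_sum_right)
lemma op_idem_add: "op_idem i (a + b) = op_idem i a + op_idem i b"
 by (simp add: fun_app op_idem_def fun_eq_iff)
lemma idem_tensor_y: "op_idem i (ty b s) = ty (op_idem (i - s) b) s"
 by (rule tvec_eqI) (auto simp: fun_app op_idem_def)

lemma op_idem_scale: "op_idem i (tscale c b) = tscale c (op_idem i b)"
 by (simp add: fun_app op_idem_def fun_eq_iff)

lemma replicate_snoc: "replicate (Suc n) x = replicate n x @ [x]"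
 by (simp add: replicate_append_same)

lemma tensor_op_replicate_id: "b \<in> TS n ==> tensor_op (replicate n site_id) b = b"
proof (induction n arbitrary: b)
 case 0
 show ?case
 proof
  fix w show "tensor_op (replicate 0 site_id) b w = b w"
   using 0 by (cases w) (auto simp: tensor_op_def lin_ext_apply sign_words_0 TS_def)
 qed
next
 case (Suc n)
 obtain a c where "a \<in> TS n" "c \<in> TS n" "b = ty a 1 + ty c (-1)"
  using TS_Suc_cases[OF Suc.prems] .
 then show ?case
  using Suc.IH[of a] Suc.IH[of c] unfolding replicate_snoc
  by (simp add: tensor_op_add tensor_op_snoc_diag[where c = 1 and A = site_id, OF _ site_id_def])
qed

context quantum begin

lemma Kop_tensor_y: "Kop v (ty b s) = tscale (v powi s) (ty (Kop v b) s)"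
 by (rule tvec_eqI) (auto simp: fun_app Kop_def power_int_add v_nonzero)

lemma tensor_op_replicate_K: "b \<in> TS n ==> tensor_op (replicate n (site_K v)) b = Kop v b"
proof (induction n arbitrary: b)
 case 0
 show ?case
 proof
  fix w show "tensor_op (replicate 0 (site_K v)) b w = Kop v b w"
   using 0 by (cases w) (auto simp: tensor_op_def lin_ext_apply sign_words_0 TS_def Kop_def)
 qed
next
 case (Suc n)
 obtain a c where "a \<in> TS n" "c \<in> TS n" "b = ty a 1 + ty c (-1)"
  using TS_Suc_cases[OF Suc.prems] .
 moreover have "tensor_op (replicate n (site_K v) @ [site_K v]) (ty f s)
   = tscale (v powi s) (ty (tensor_op (replicate n (site_K v)) f) s)" if "s \<in> {1, -1}" for f s
  by (rule tensor_op_snoc_diag[OF that]) (simp add: site_K_def)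
 ultimately show ?case
  using Suc.IH[of a] Suc.IH[of c] unfolding replicate_snoc
  by (simp add: tensor_op_add Kop_add Kop_tensor_y)
qed

abbreviation "E \<equiv> op_E v"
abbreviation "F \<equiv> op_F v"
abbreviation "K \<equiv> Kop v"
abbreviation "H \<equiv> Hop v"

lemma E_0 [simp]: "E 0 b = 0" by (simp add: op_E_def)
lemma F_0 [simp]: "F 0 b = 0" by (simp add: op_F_def)

text \<open>The coproduct of E: the last factor is hit after K has passed over all others. This and the
 analogous rule for F replace the sums over tensor positions from here on.\<close>

lemma E_tensor_y:
 assumes b: "b \<in> TS n" and s: "s \<in> {1, -1}"
 shows "E (Suc n) (ty b s) = ty (E n b) s + (if s = -1 then ty (K b) 1 else 0)"
proof -
 have 1: "tensor_op (replicate (j - 1) (site_K v) @ [site_E] @ replicate (Suc n - j) site_id) (ty b s)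
   = ty (tensor_op (replicate (j - 1) (site_K v) @ [site_E] @ replicate (n - j) site_id) b) s"
  if "j \<in> {1..n}" for j
 proof -
  have "replicate (j - 1) (site_K v) @ [site_E] @ replicate (Suc n - j) site_id
    = (replicate (j - 1) (site_K v) @ [site_E] @ replicate (n - j) site_id) @ [site_id]"
   using that by (simp add: Suc_diff_le replicate_append_same)
  then show ?thesis by (simp only: tensor_op_snoc_diag[OF s, where c = 1] site_id_def) simp
 qed
 have 2: "tensor_op (replicate n (site_K v) @ [site_E]) (ty b s) = (if s = -1 then ty (K b) 1 else 0)"
  by (simp add: tensor_op_snoc_E[OF s] tensor_op_replicate_K[OF b])
 have "E (Suc n) (ty b s) = (\<Sum>j=1..n. tensor_op (replicate (j - 1) (site_K v) @ [site_E] @ replicate (Suc n - j) site_id) (ty b s))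
   + tensor_op (replicate n (site_K v) @ [site_E]) (ty b s)"
  by (simp add: op_E_def)
 also have "\<dots> = ty (E n b) s + (if s = -1 then ty (K b) 1 else 0)"
  by (simp only: 1 2 op_E_def tensor_y_sum cong: sum.cong)
 finally show ?thesis .
qed

lemma F_tensor_y:
 assumes b: "b \<in> TS n" and s: "s \<in> {1, -1}"
 shows "F (Suc n) (ty b s) = tscale (v powi (- s)) (ty (F n b) s) + (if s = 1 then ty b (-1) else 0)"
proof -
 have 1: "tensor_op (replicate (j - 1) site_id @ [site_F] @ replicate (Suc n - j) (site_K_inv v)) (ty b s)
   = tscale (v powi (- s)) (ty (tensor_op (replicate (j - 1) site_id @ [site_F] @ replicate (n - j) (site_K_inv v)) b) s)"
  if "j \<in> {1..n}" for j
 proof -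
  have "replicate (j - 1) site_id @ [site_F] @ replicate (Suc n - j) (site_K_inv v)
    = (replicate (j - 1) site_id @ [site_F] @ replicate (n - j) (site_K_inv v)) @ [site_K_inv v]"
   using that by (simp add: Suc_diff_le replicate_append_same)
  then show ?thesis by (simp only: tensor_op_snoc_diag[OF s, where c = "v powi (- s)"] site_K_inv_def)
 qed
 have 2: "tensor_op (replicate n site_id @ [site_F]) (ty b s) = (if s = 1 then ty b (-1) else 0)"
  by (simp add: tensor_op_snoc_F[OF s] tensor_op_replicate_id[OF b])
 have "F (Suc n) (ty b s) = (\<Sum>j=1..n. tensor_op (replicate (j - 1) site_id @ [site_F] @ replicate (Suc n - j) (site_K_inv v)) (ty b s))
   + tensor_op (replicate n site_id @ [site_F]) (ty b s)"
  by (simp add: op_F_def)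
 also have "\<dots> = tscale (v powi (- s)) (ty (F n b) s) + (if s = 1 then ty b (-1) else 0)"
  by (simp only: 1 2 op_F_def tensor_y_sum tvec.scale_sum_right cong: sum.cong)
 finally show ?thesis .
qed

lemma E_plus: "b \<in> TS n ==> E (Suc n) (ty b 1) = ty (E n b) 1"
 and E_minus: "b \<in> TS n ==> E (Suc n) (ty b (-1)) = ty (E n b) (-1) + ty (K b) 1"
 and F_plus: "b \<in> TS n ==> F (Suc n) (ty b 1) = tscale (inverse v) (ty (F n b) 1) + ty b (-1)"
 and F_minus: "b \<in> TS n ==> F (Suc n) (ty b (-1)) = tscale v (ty (F n b) (-1))"
 by (simp_all add: E_tensor_y F_tensor_y power_int_minus)

lemmas EF_rec = E_plus E_minus F_plus F_minus

lemma E_TS [intro]: "b \<in> TS n ==> E n b \<in> TS n"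
proof (induction n arbitrary: b)
 case (Suc n)
 obtain a c where b: "a \<in> TS n" "c \<in> TS n" "b = ty a 1 + ty c (-1)"
  using TS_Suc_cases[OF Suc.prems] .
 show ?case unfolding b(3)
  by (simp add: op_E_add EF_rec b, intro TS_add TS_scale tensor_y_TS Kop_TS Suc.IH b) auto
qed auto

lemma F_TS [intro]: "b \<in> TS n ==> F n b \<in> TS n"
proof (induction n arbitrary: b)
 case (Suc n)
 obtain a c where b: "a \<in> TS n" "c \<in> TS n" "b = ty a 1 + ty c (-1)"
  using TS_Suc_cases[OF Suc.prems] .
 show ?case unfolding b(3)
  by (simp add: op_F_add EF_rec b, intro TS_add TS_scale tensor_y_TS Kop_TS Suc.IH b) auto
qed auto

lemma idem_TS [intro]: "b \<in> TS n ==> op_idem i b \<in> TS n"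
 by (auto simp: TS_def op_idem_def)

lemma E_zero [simp]: "E n 0 = 0" using op_E_scale[of v n 0 0] by simp
lemma F_zero [simp]: "F n 0 = 0" using op_F_scale[of v n 0 0] by simp
lemma E_uminus: "E n (- x) = - E n x" using op_E_scale[of v n "-1" x] by simp
lemma F_uminus: "F n (- x) = - F n x" using op_F_scale[of v n "-1" x] by simp
lemma E_diff: "E n (x - y) = E n x - E n y" using op_E_add[of v n x "- y"] by (simp add: E_uminus)
lemma F_diff: "F n (x - y) = F n x - F n y" using op_F_add[of v n x "- y"] by (simp add: F_uminus)
lemmas EF_linear = op_E_add op_E_scale op_F_add op_F_scale E_diff F_diff E_uminus F_uminus

lemma KF: "b \<in> TS n ==> K (F n b) = tscale (v powi -2) (F n (K b))"
proof (induction n arbitrary: b)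
 case (Suc n)
 obtain a c where b: "a \<in> TS n" "c \<in> TS n" "b = ty a 1 + ty c (-1)"
  using TS_Suc_cases[OF Suc.prems] .
 show ?case unfolding b(3)
  by (simp add: EF_linear EF_rec Kop_add Kop_scale Kop_tensor_y tensor_y_linear Kop_TS F_TS b Suc.IH,
   (intro ext)?, simp add: fun_app v_nonzero power_int_minus field_simps power2_eq_square)
qed auto

lemma H_add: "H (a + b) = H a + H b" by (simp add: fun_app Hop_def fun_eq_iff algebra_simps)

lemma H_plus: "H (ty b 1) = tscale (inverse v) (ty (H b) 1) + ty (K b) 1"
proof (rule tvec_eqI)
 fix u t show "H (ty b 1) (u @ [t]) = (tscale (inverse v) (ty (H b) 1) + ty (K b) 1) (u @ [t])"
  using qint_Suc'[of "sum_list u"] by (simp add: Hop_def Kop_def fun_app algebra_simps)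
qed (simp add: Hop_def Kop_def fun_app)

lemma H_minus: "H (ty b (-1)) = tscale v (ty (H b) (-1)) - ty (K b) (-1)"
proof (rule tvec_eqI)
 fix u t
 have "qint v (sum_list u) = inverse v * qint v (sum_list u - 1) + v powi (sum_list u - 1)"
  using qint_Suc'[of "sum_list u - 1"] by simp
 then have "v * qint v (sum_list u) = qint v (sum_list u - 1) + v powi (sum_list u)"
  using v_nonzero v_powi_1[of "sum_list u - 1"] by (simp add: algebra_simps)
 then have *: "qint v (sum_list u - 1) = v * qint v (sum_list u) - v powi (sum_list u)" by simp
 then show "H (ty b (-1)) (u @ [t]) = (tscale v (ty (H b) (-1)) - ty (K b) (-1)) (u @ [t])"
  by (simp add: Hop_def Kop_def fun_app algebra_simps *)
qed (simp add: Hop_def Kop_def fun_app)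

text \<open>Both sides satisfy the same recursion in the last tensor factor; the cross terms combine to K on the
 remaining factors.\<close>

lemma EF_commutator: "b \<in> TS n ==> E n (F n b) - F n (E n b) = H b"
proof (induction n arbitrary: b)
 case 0
 have "H b w = 0" for w using 0 by (cases w) (auto simp: TS_def Hop_def sign_words_0)
 then have "H b = 0" by (intro ext) (simp add: zero_fun_apply)
 then show ?case by simp
next
 case (Suc n)
 obtain a c where b: "a \<in> TS n" "c \<in> TS n" "b = ty a 1 + ty c (-1)"
  using TS_Suc_cases[OF Suc.prems] .
 have ih: "E n (F n a) = H a + F n (E n a)" "E n (F n c) = H c + F n (E n c)"
  using Suc.IH[of a] Suc.IH[of c] b by (simp_all add: algebra_simps)
 show ?case unfolding b(3)
  by (simp add: EF_linear EF_rec tensor_y_linear Kop_TS F_TS E_TS b ih H_add H_plus H_minus KF,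
   (intro ext)?, simp add: fun_app v_nonzero power_int_minus field_simps power2_eq_square)
qed

end

section \<open>Weights, the bilinear form and the Temperley--Lieb operators\<close>

text \<open>Tensor space is spanned by vectors ending in y_1 or y_{-1}.\<close>

lemma TS_Suc_induct [consumes 1, case_names add tensor]:
 fixes f :: "'k::field tvec"
 assumes "f \<in> TS (Suc n)" "\<And>a b. P a ==> P b ==> P (a + b)"
  "\<And>a s. a \<in> TS n ==> s \<in> {1, -1} ==> P (ty a s)"
 shows "P f"
proof -
 obtain a b where "a \<in> TS n" "b \<in> TS n" and f: "f = ty a 1 + ty b (-1)"
  using TS_Suc_cases[OF assms(1)] .
 then show ?thesis unfolding f by (intro assms) auto
qed

lemma top_index: "1 \<le> i ==> \<not> i < n ==> i < Suc n ==> \<exists>m. n = Suc m \<and> i = Suc m"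
 by (cases n) auto

lemma TS_Suc2_induct [consumes 1, case_names add tensor]:
 fixes f :: "'k::field tvec"
 assumes "f \<in> TS (Suc (Suc n))" "\<And>a b. P a ==> P b ==> P (a + b)"
  "\<And>a s t. a \<in> TS n ==> s \<in> {1, -1} ==> t \<in> {1, -1} ==> P (ty (ty a s) t)"
 shows "P f"
proof (rule TS_Suc_induct[OF assms(1)])
 fix a :: "'k tvec" and s assume "a \<in> TS (Suc n)" and s: "s \<in> {1, -1 :: int}"
 from this(1) show "P (ty a s)"
  by (induction rule: TS_Suc_induct) (use s in \<open>auto simp only: tensor_y_add intro: assms\<close>)
qed (rule assms)

lemma TS_Suc3_induct [consumes 1, case_names add tensor]:
 fixes f :: "'k::field tvec"
 assumes "f \<in> TS (Suc (Suc (Suc n)))" "\<And>a b. P a ==> P b ==> P (a + b)"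
  "\<And>a r s t. a \<in> TS n ==> r \<in> {1, -1} ==> s \<in> {1, -1} ==> t \<in> {1, -1} ==>
    P (ty (ty (ty a r) s) t)"
 shows "P f"
proof (rule TS_Suc2_induct[OF assms(1)])
 fix a :: "'k tvec" and s t assume "a \<in> TS (Suc n)" and s: "s \<in> {1, -1 :: int}" "t \<in> {1, -1 :: int}"
 from this(1) show "P (ty (ty a s) t)"
  by (induction rule: TS_Suc_induct) (use s in \<open>auto simp only: tensor_y_add intro: assms\<close>)
qed (rule assms)

lemma idem_E: "v \<noteq> 0 ==> b \<in> TS n ==> op_idem i (op_E v n b) = op_E v n (op_idem (i - 2) b)"
proof (induction n arbitrary: b i)
 case 0
 then interpret quantum v by unfold_locales
 show ?case by (simp add: op_idem_def fun_eq_iff zero_fun_apply)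
next
 case (Suc n)
 interpret quantum v by unfold_locales (fact \<open>v \<noteq> 0\<close>)
 have K: "op_idem i (Kop v a) = Kop v (op_idem i a)" for a i
  by (simp add: op_idem_def Kop_def fun_eq_iff)
 obtain a c where b: "a \<in> TS n" "c \<in> TS n" "b = ty a 1 + ty c (-1)"
  using TS_Suc_cases[OF Suc.prems(2)] .
 show ?case unfolding b(3)
  by (simp add: EF_linear op_idem_add idem_tensor_y EF_rec b Suc.IH[OF v_nonzero] idem_TS K algebra_simps)
qed

lemma idem_F: "v \<noteq> 0 ==> b \<in> TS n ==> op_idem i (op_F v n b) = op_F v n (op_idem (i + 2) b)"
proof (induction n arbitrary: b i)
 case 0
 then interpret quantum v by unfold_locales
 show ?case by (simp add: op_idem_def fun_eq_iff zero_fun_apply)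
next
 case (Suc n)
 interpret quantum v by unfold_locales (fact \<open>v \<noteq> 0\<close>)
 obtain a c where b: "a \<in> TS n" "c \<in> TS n" "b = ty a 1 + ty c (-1)"
  using TS_Suc_cases[OF Suc.prems(2)] .
 show ?case unfolding b(3)
  by (simp add: EF_linear op_idem_add op_idem_scale idem_tensor_y EF_rec b Suc.IH[OF v_nonzero] idem_TS algebra_simps)
qed

lemma op_idem_idem: "op_idem i (op_idem j b) = (if i = j then op_idem i b else 0)"
 by (auto simp: op_idem_def fun_eq_iff zero_fun_apply)

lemma op_idem_zero [simp]: "op_idem i 0 = 0"
 by (simp add: op_idem_def fun_eq_iff zero_fun_apply)

text \<open>Unlike for weight vectors, zero is allowed, so that this is a linear condition.\<close>

definition has_wt :: "nat => int => 'k::field tvec => bool" where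
 "has_wt n k b \<longleftrightarrow> b \<in> TS n \<and> op_idem k b = b"

lemma has_wt_TS: "has_wt n k b ==> b \<in> TS n" by (simp add: has_wt_def)

lemma weight_vector_iff: "weight_vector n k b \<longleftrightarrow> has_wt n k b \<and> b \<noteq> 0"
 by (auto simp: weight_vector_def has_wt_def)

lemma has_wt_unique: "has_wt n k b ==> has_wt n l b ==> b \<noteq> 0 ==> k = l"
 using op_idem_idem[of k l b] by (auto simp: has_wt_def split: if_splits)

lemma weight_eq: "has_wt n k b ==> b \<noteq> 0 ==> weight n b = k"
 unfolding weight_def weight_vector_iff by (rule the_equality) (auto dest: has_wt_unique)

lemma has_wt_nonzero: "has_wt n k b ==> b w \<noteq> 0 ==> sum_list w = k"
 unfolding has_wt_def op_idem_def by (metis (mono_tags, lifting))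

lemma has_wt_tensor_y:
 "has_wt n k b ==> s \<in> {1, -1} ==> l = k + s ==> has_wt (Suc n) l (ty b s)"
 by (auto simp: has_wt_def idem_tensor_y)

lemma has_wt_linear:
 "has_wt n k 0" "has_wt n k a ==> has_wt n k b ==> has_wt n k (a + b)"
 "has_wt n k a ==> has_wt n k (tscale c a)"
 by (auto simp: has_wt_def op_idem_add op_idem_scale)

lemma has_wt_diff: "has_wt n k a ==> has_wt n k b ==> has_wt n k (a - b)"
 using has_wt_linear(2)[of n k a "tscale (-1) b"] has_wt_linear(3)[of n k b "-1"] by simp

lemma TS_uminus: "b \<in> TS n ==> - b \<in> TS n"
 by (rule tvec.subspace_neg[OF subspace_TS])

lemma op_idem_uminus: "op_idem i (- b) = - op_idem i b"
 by (simp add: op_idem_def fun_eq_iff uminus_apply)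
lemma op_idem_diff: "op_idem i (a - b) = op_idem i a - op_idem i b"
 by (simp add: op_idem_def fun_eq_iff minus_apply)
lemmas op_idem_linear = op_idem_add op_idem_scale op_idem_uminus op_idem_diff

lemma Kop_uminus: "Kop v (- b) = - Kop v b"
 by (simp add: Kop_def fun_eq_iff uminus_apply)
lemma Kop_diff: "Kop v (a - b) = Kop v a - Kop v b"
 by (simp add: Kop_def fun_eq_iff minus_apply algebra_simps)
lemmas Kop_linear = Kop_add Kop_scale Kop_uminus Kop_diff

context quantum begin

lemma K_wt: "has_wt n k b ==> K b = tscale (v powi k) b"
 by (rule ext) (metis Kop_def has_wt_nonzero mult_zero_right tscale_apply)

lemma H_wt: "has_wt n k b ==> H b = tscale (qint v k) b"
 by (rule ext) (metis Hop_def has_wt_nonzero mult_zero_right tscale_apply)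

lemma F_wt: "has_wt n k b ==> l = k - 2 ==> has_wt n l (F n b)"
 by (auto simp: has_wt_def idem_F[OF v_nonzero])

lemma Fpow_wt: "has_wt n k b ==> has_wt n (k - 2 * int a) ((F n ^^ a) b)"
 by (induction a) (auto intro: F_wt)

lemma Fpow_TS: "b \<in> TS n ==> (F n ^^ a) b \<in> TS n"
 by (induction a) auto

lemma Fpow_scale: "(F n ^^ a) (tscale c b) = tscale c ((F n ^^ a) b)"
 by (induction a) (auto simp: op_F_scale)

lemma Fpow_add: "(F n ^^ a) (b + c) = (F n ^^ a) b + (F n ^^ a) c"
 by (induction a) (auto simp: op_F_add)

end

lemma tform_add: "tform n (a + b) c = tform n a c + tform n b c"
 by (simp add: tform_def plus_fun_apply ring_distribs sum.distrib)
lemma tform_scale: "tform n (tscale x a) c = x * tform n a c"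
 by (simp add: tform_def tscale_apply sum_distrib_left mult.assoc)
lemma tform_commute: "tform n a b = tform n b a"
 by (simp add: tform_def mult.commute)
lemma tform_add_right: "tform n c (a + b) = tform n c a + tform n c b"
 by (simp add: tform_commute[of n c] tform_add)
lemma tform_scale_right: "tform n c (tscale x a) = x * tform n c a"
 by (simp add: tform_commute[of n c] tform_scale)
lemma tform_zero [simp]: "tform n 0 c = 0" "tform n c 0 = 0"
 by (simp_all add: tform_def zero_fun_apply)
lemma tform_diff: "tform n (a - b) c = tform n a c - tform n b c"
 by (simp add: tform_def minus_apply ring_distribs sum_subtractf)
lemma tform_diff_right: "tform n c (a - b) = tform n c a - tform n c b"
 by (simp add: tform_commute[of n c] tform_diff)
lemma tform_sum: "tform n (sum f S) c = (\<Sum>i\<in>S. tform n (f i) c)"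
 by (induction S rule: infinite_finite_induct) (auto simp: tform_add)

lemmas tform_linear = tform_add tform_scale tform_add_right tform_scale_right tform_diff tform_diff_right

lemma tform_tensor_y:
 assumes "s \<in> {1, -1}" "t \<in> {1, -1}"
 shows "tform (Suc n) (ty a s) (ty b t) = (if s = t then tform n a b else 0)"
 using assms by (auto simp: tform_def sum_sign_words_Suc)

lemma tform_K: "tform n (Kop v a) b = tform n a (Kop v b)"
 by (simp add: tform_def Kop_def ac_simps)

lemma tform_wt: "has_wt n k a ==> has_wt n l b ==> k \<noteq> l ==> tform n a b = 0"
 unfolding tform_def by (rule sum.neutral) (metis has_wt_nonzero mult_eq_0_iff)

context quantum begin

text \<open>The adjunction between E and F. In the form F K it carries no weights, so it can be proved by
 induction on the number of tensor factors for arbitrary vectors.\<close>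

lemma form_FK: "x \<in> TS n ==> y \<in> TS n ==> tform n (F n (K x)) y = v * tform n x (E n y)"
proof (induction n arbitrary: x y)
 case (Suc n)
 obtain a c where b: "a \<in> TS n" "c \<in> TS n" "x = ty a 1 + ty c (-1)"
  using TS_Suc_cases[OF Suc.prems(1)] .
 obtain a' c' where b': "a' \<in> TS n" "c' \<in> TS n" "y = ty a' 1 + ty c' (-1)"
  using TS_Suc_cases[OF Suc.prems(2)] .
 show ?case unfolding b(3) b'(3) using v_nonzero
  by (simp add: Kop_add Kop_tensor_y EF_linear EF_rec Kop_TS b b' tform_linear tform_tensor_y Suc.IH
    tform_K power_int_minus field_simps)
qed simp

lemma form_F:
 assumes "has_wt n k x" "y \<in> TS n"
 shows "tform n (F n x) y = v powi (1 - k) * tform n x (E n y)"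
proof -
 have "v powi k * tform n (F n x) y = v * tform n x (E n y)"
  using form_FK[OF has_wt_TS[OF assms(1)] assms(2)] by (simp add: K_wt[OF assms(1)] op_F_scale tform_scale)
 then have h: "v powi k * tform n (F n x) y = v * tform n x (E n y)" .
 have "tform n (F n x) y = (v powi (- k) * v powi k) * tform n (F n x) y"
  by (simp only: powi_cancel mult_1_left)
 also have "\<dots> = v powi (- k) * v * tform n x (E n y)" by (simp only: mult.assoc h)
 also have "v powi (- k) * v = v powi (1 - k)" using v_powi_1[of "- k"] by (simp add: mult.commute)
 finally show ?thesis .
qed

end

section \<open>The operators of the Temperley--Lieb algebra\<close>

text \<open>An operator given on basis words is split along the last letter of the word.\<close>

lemma lin_ext_tensor_y:
 "s \<in> {1, -1} ==> lin_ext (Suc n) g (ty b s) = lin_ext n (\<lambda>u. g (u @ [s])) b"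
 by (intro ext) (auto simp: lin_ext_apply sum_sign_words_Suc)

lemma lin_ext_cong: "(\<And>u. u \<in> sign_words n ==> g u = h u) ==> lin_ext n g b = lin_ext n h b"
 by (simp add: lin_ext_def)

lemma lin_ext_of_tensor_y: "lin_ext n (\<lambda>u. ty (h u) s) b = ty (lin_ext n h b) s"
 by (simp add: lin_ext_def tensor_y_sum tensor_y_scale)

lemma lin_ext_of_scale: "lin_ext n (\<lambda>u. tscale c (h u)) b = tscale c (lin_ext n h b)"
 by (intro ext) (simp add: lin_ext_apply tscale_apply sum_distrib_left ac_simps)

lemma lin_ext_of_diff: "lin_ext n (\<lambda>u. h u - g u) b = lin_ext n h b - lin_ext n g b"
 by (intro ext) (simp add: lin_ext_apply minus_apply sum_subtractf ring_distribs)

lemma lin_ext_ybasis: "b \<in> TS n ==> lin_ext n ybasis b = b"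
 by (intro ext) (auto simp: lin_ext_apply ybasis_def TS_def if_distrib cong: if_cong)

lemma ybasis_snoc: "ybasis (u @ [s]) = ty (ybasis u) s"
 by (rule tvec_eqI) (auto simp: ybasis_def)

lemma ybasis_TS: "u \<in> sign_words n ==> ybasis u \<in> TS n"
 by (auto simp: ybasis_def TS_def)

lemma op_e_add: "op_e v n i (a + b) = op_e v n i a + op_e v n i b"
 by (simp add: op_e_def lin_ext_add)
lemma op_e_scale: "op_e v n i (tscale c b) = tscale c (op_e v n i b)"
 by (simp add: op_e_def lin_ext_scale)
lemma op_e_zero [simp]: "op_e v n i 0 = 0" using op_e_scale[of v n i 0 0] by simp
lemma op_e_uminus: "op_e v n i (- x) = - op_e v n i x" using op_e_scale[of v n i "-1" x] by simp
lemma op_e_diff: "op_e v n i (x - y) = op_e v n i x - op_e v n i y"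
 using op_e_add[of v n i x "- y"] by (simp add: op_e_uminus)
lemmas op_e_linear = op_e_add op_e_scale op_e_diff op_e_uminus

text \<open>The operators below the last one do not see the last tensor factor, which allows all relations to be
 proved by induction on n, with only the cases at the last factors computed.\<close>

lemma op_e_tensor_y:
 assumes "s \<in> {1, -1}" "1 \<le> i" "i < n"
 shows "op_e v (Suc n) i (ty b s) = ty (op_e v n i b) s"
 unfolding op_e_def lin_ext_tensor_y[OF assms(1)] lin_ext_of_tensor_y[symmetric]
proof (rule lin_ext_cong)
 fix u assume "u \<in> sign_words n"
 then have l: "length u = n" by (simp add: sign_words_def)
 then have *: "(u @ [s]) ! (i - 1) = u ! (i - 1)" "(u @ [s]) ! i = u ! i"
  using assms by (auto simp: nth_append)
 have **: "(u @ [s])[i - 1 := x, i := y] = u[i - 1 := x, i := y] @ [s]" for x y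
  using l assms by (auto simp: list_update_append)
 show "(let u' = (u @ [s])[i - 1 := (u @ [s]) ! i, i := (u @ [s]) ! (i - 1)]
     in if (u @ [s]) ! (i - 1) = 1 \<and> (u @ [s]) ! i = - 1 then tscale (- inverse v) (ybasis (u @ [s])) + ybasis u'
       else if (u @ [s]) ! (i - 1) = - 1 \<and> (u @ [s]) ! i = 1 then ybasis u' - tscale v (ybasis (u @ [s])) else 0) =
    ty (let u' = u[i - 1 := u ! i, i := u ! (i - 1)]
     in if u ! (i - 1) = 1 \<and> u ! i = - 1 then tscale (- inverse v) (ybasis u) + ybasis u'
       else if u ! (i - 1) = - 1 \<and> u ! i = 1 then ybasis u' - tscale v (ybasis u) else 0) s"
  unfolding * ** Let_def ybasis_snoc by (simp add: tensor_y_linear)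
qed

text \<open>The generator e_{n+1} maps b \<otimes> V \<otimes> V onto the line through this vector.\<close>

definition singlet :: "'k::field => 'k tvec => 'k tvec" where
 "singlet v b = ty (ty b 1) (-1) - tscale v (ty (ty b (-1)) 1)"

lemma op_e_last:
 assumes "v \<noteq> 0" "b \<in> TS n" "s \<in> {1, -1}" "t \<in> {1, -1}"
 shows "op_e v (Suc (Suc n)) (Suc n) (ty (ty b s) t) =
  (if s = 1 \<and> t = -1 then tscale (- inverse v) (singlet v b)
   else if s = -1 \<and> t = 1 then singlet v b else 0)"
proof -
 let ?g = "\<lambda>u. tscale (if s = 1 \<and> t = -1 then - inverse v else if s = -1 \<and> t = 1 then 1 else 0)
   (ty (ty (ybasis u) 1) (-1) - tscale v (ty (ty (ybasis u) (-1)) 1))"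
 have "op_e v (Suc (Suc n)) (Suc n) (ty (ty b s) t) = lin_ext n ?g b"
  unfolding op_e_def lin_ext_tensor_y[OF assms(3)] lin_ext_tensor_y[OF assms(4)]
 proof (rule lin_ext_cong)
  fix u assume "u \<in> sign_words n"
  then have l: "length u = n" by (simp add: sign_words_def)
  have *: "(u @ [s] @ [t]) ! (Suc n - 1) = s" "(u @ [s] @ [t]) ! Suc n = t"
   "(u @ [s] @ [t])[Suc n - 1 := x, Suc n := y] = u @ [x] @ [y]" for x y
   using l by (auto simp: nth_append list_update_append)
  show "(let u' = ((u @ [s]) @ [t])[Suc n - 1 := ((u @ [s]) @ [t]) ! Suc n, Suc n := ((u @ [s]) @ [t]) ! (Suc n - 1)]
     in if ((u @ [s]) @ [t]) ! (Suc n - 1) = 1 \<and> ((u @ [s]) @ [t]) ! Suc n = - 1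
       then tscale (- inverse v) (ybasis ((u @ [s]) @ [t])) + ybasis u'
       else if ((u @ [s]) @ [t]) ! (Suc n - 1) = - 1 \<and> ((u @ [s]) @ [t]) ! Suc n = 1
         then ybasis u' - tscale v (ybasis ((u @ [s]) @ [t])) else 0) = ?g u"
   unfolding append_assoc * Let_def
   unfolding append_assoc[symmetric] ybasis_snoc using assms(1)
   by (simp add: tvec.scale_right_diff_distrib)
 qed
 also have "\<dots> = tscale (if s = 1 \<and> t = -1 then - inverse v else if s = -1 \<and> t = 1 then 1 else 0) (singlet v b)"
  by (simp only: lin_ext_of_scale lin_ext_of_diff lin_ext_of_tensor_y lin_ext_ybasis[OF assms(2)] singlet_def)
 finally show ?thesis by simp
qed

context quantum begin

abbreviation "e \<equiv> op_e v"

lemma e_last_simps: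
 assumes "b \<in> TS n"
 shows "e (Suc (Suc n)) (Suc n) (ty (ty b 1) 1) = 0"
  "e (Suc (Suc n)) (Suc n) (ty (ty b (-1)) (-1)) = 0"
  "e (Suc (Suc n)) (Suc n) (ty (ty b 1) (-1)) = tscale (- inverse v) (singlet v b)"
  "e (Suc (Suc n)) (Suc n) (ty (ty b (-1)) 1) = singlet v b"
 using assms by (simp_all add: op_e_last[OF v_nonzero assms])

lemma singlet_TS: "b \<in> TS n ==> singlet v b \<in> TS (Suc (Suc n))"
 unfolding singlet_def by (intro TS_diff TS_scale tensor_y_TS) auto

lemma e_TS: "b \<in> TS n ==> 1 \<le> i ==> i < n ==> e n i b \<in> TS n"
proof (induction n arbitrary: b)
 case (Suc n)
 show ?case
 proof (cases "i < n")
  case True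
  from Suc.prems(1) show ?thesis
   by (induction rule: TS_Suc_induct)
    (use True Suc.IH Suc.prems in \<open>auto simp: op_e_add op_e_tensor_y intro!: TS_add tensor_y_TS\<close>)
 next
  case False
  then obtain m where m: "n = Suc m" "i = Suc m" using top_index[of i n] Suc.prems by auto
  from Suc.prems(1)[unfolded m] show ?thesis unfolding m
   by (induction rule: TS_Suc2_induct)
    (auto simp: op_e_add e_last_simps intro!: TS_add TS_uminus TS_scale singlet_TS)
 qed
qed auto

lemma e_singlet: "b \<in> TS n ==> e (Suc (Suc n)) (Suc n) (singlet v b) = tscale (- (v + inverse v)) (singlet v b)"
proof -
 assume b: "b \<in> TS n"
 have "e (Suc (Suc n)) (Suc n) (singlet v b) = e (Suc (Suc n)) (Suc n) (ty (ty b 1) (-1))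
   - tscale v (e (Suc (Suc n)) (Suc n) (ty (ty b (-1)) 1))"
  by (simp only: singlet_def op_e_linear)
 also have "\<dots> = tscale (- inverse v) (singlet v b) - tscale v (singlet v b)"
  by (simp only: e_last_simps[OF b])
 also have "\<dots> = tscale (- (v + inverse v)) (singlet v b)"
  by (simp add: fun_eq_iff fun_app algebra_simps)
 finally show ?thesis .
qed

lemma e_square: "b \<in> TS n ==> 1 \<le> i ==> i < n ==> e n i (e n i b) = tscale (- (v + inverse v)) (e n i b)"
proof (induction n arbitrary: b)
 case (Suc n)
 show ?case
 proof (cases "i < n")
  case True
  from Suc.prems(1) show ?thesis
   by (induction rule: TS_Suc_induct)
    (use True Suc.IH Suc.prems in \<open>auto simp: op_e_add op_e_tensor_y tensor_y_linear tvec.scale_right_distrib\<close>)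
 next
  case False
  then obtain m where m: "n = Suc m" "i = Suc m" using top_index[of i n] Suc.prems by auto
  from Suc.prems(1)[unfolded m] show ?thesis unfolding m
   by (induction rule: TS_Suc2_induct)
    (auto simp: op_e_linear e_last_simps e_singlet tvec.scale_right_distrib mult.commute)
 qed
qed auto

lemma e_commute:
 "b \<in> TS n ==> 1 \<le> i ==> Suc i < j ==> j < n ==> e n i (e n j b) = e n j (e n i b)"
proof (induction n arbitrary: b)
 case (Suc n)
 show ?case
 proof (cases "j < n")
  case True
  from Suc.prems(1) show ?thesis
   by (induction rule: TS_Suc_induct)
    (use True Suc.IH Suc.prems in \<open>auto simp: op_e_add op_e_tensor_y\<close>)
 next
  case False
  then obtain m where m: "n = Suc m" "j = Suc m" using top_index[of j n] Suc.prems by auto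
  then have i: "1 \<le> i" "i < m" "i < Suc m" using Suc.prems by auto
  from Suc.prems(1)[unfolded m] show ?thesis unfolding m
   by (induction rule: TS_Suc2_induct)
    (use i in \<open>auto simp: op_e_linear e_last_simps op_e_tensor_y singlet_def e_TS\<close>)
 qed
qed auto

lemma e_braid:
 "b \<in> TS n ==> 1 \<le> i ==> Suc i < n ==> e n i (e n (Suc i) (e n i b)) = e n i b \<and>
   e n (Suc i) (e n i (e n (Suc i) b)) = e n (Suc i) b"
proof (induction n arbitrary: b)
 case (Suc n)
 show ?case
 proof (cases "Suc i < n")
  case True
  from Suc.prems(1) show ?thesis
   by (induction rule: TS_Suc_induct)
    (use True Suc.IH Suc.prems in \<open>auto simp: op_e_add op_e_tensor_y\<close>)
 next
  case False
  then obtain m where m: "n = Suc (Suc m)" "i = Suc m" using top_index[of i "n - 1"] Suc.prems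
   by (cases n) auto
  have l: "e (Suc (Suc (Suc m))) (Suc m) (ty (ty (ty a r) s) t) =
    ty (e (Suc (Suc m)) (Suc m) (ty (ty a r) s)) t"
   if "t \<in> {1, -1}" for a r s t using that by (simp add: op_e_tensor_y)
  from Suc.prems(1)[unfolded m] show ?thesis unfolding m
  proof (induction rule: TS_Suc3_induct)
   case (tensor a r s t)
   then show ?case using v_nonzero
    by (elim insertE; simp add: l e_last_simps tensor_y_TS op_e_linear tensor_y_linear singlet_def;
      simp add: fun_eq_iff fun_app field_simps)
  qed (simp add: op_e_add)
 qed
qed auto

text \<open>Both commutations are proved together because E on the last factor involves K.\<close>

lemma e_E: "b \<in> TS n ==> 1 \<le> i ==> i < n ==> e n i (E n b) = E n (e n i b) \<and> e n i (K b) = K (e n i b)"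
proof (induction n arbitrary: b)
 case (Suc n)
 show ?case
 proof (cases "i < n")
  case True
  from Suc.prems(1) show ?thesis
  proof (induction rule: TS_Suc_induct)
   case (tensor a s)
   then have "e n i (E n a) = E n (e n i a)" "e n i (K a) = K (e n i a)"
    using Suc.IH[of a] Suc.prems True by auto
   with tensor True Suc.prems show ?case
    by (auto simp: op_e_linear op_e_tensor_y E_plus E_minus Kop_tensor_y tensor_y_linear e_TS)
  qed (simp add: op_e_add op_E_add Kop_add)
 next
  case False
  then obtain m where m: "n = Suc m" "i = Suc m" using top_index[of i n] Suc.prems by auto
  from Suc.prems(1)[unfolded m] show ?thesis unfolding m
  proof (induction rule: TS_Suc2_induct)
   case (tensor a s t)
   then show ?case using v_nonzero
    by (elim insertE; simp add: op_e_linear EF_linear tensor_y_linear EF_rec Kop_tensor_y E_TS Kop_TS tensor_y_TS e_last_simps singlet_def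
      Kop_linear;
      simp add: fun_eq_iff fun_app field_simps power_int_minus)
  qed (simp add: op_e_add op_E_add Kop_add)
 qed
qed auto

lemma e_F: "b \<in> TS n ==> 1 \<le> i ==> i < n ==> e n i (F n b) = F n (e n i b)"
proof (induction n arbitrary: b)
 case (Suc n)
 show ?case
 proof (cases "i < n")
  case True
  from Suc.prems(1) show ?thesis
   by (induction rule: TS_Suc_induct)
    (use True Suc.IH Suc.prems in \<open>auto simp: op_e_linear EF_linear op_e_tensor_y F_plus F_minus tensor_y_linear e_TS\<close>)
 next
  case False
  then obtain m where m: "n = Suc m" "i = Suc m" using top_index[of i n] Suc.prems by auto
  from Suc.prems(1)[unfolded m] show ?thesis unfolding m
  proof (induction rule: TS_Suc2_induct)
   case (tensor a s t)
   then show ?case using v_nonzero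
    by (elim insertE; simp add: op_e_linear EF_linear tensor_y_linear EF_rec F_TS tensor_y_TS e_last_simps singlet_def;
      simp add: fun_eq_iff fun_app field_simps power_int_minus)
  qed (simp add: op_e_add op_F_add)
 qed
qed auto

lemma e_idem: "b \<in> TS n ==> 1 \<le> i ==> i < n ==> e n i (op_idem k b) = op_idem k (e n i b)"
proof (induction n arbitrary: b k)
 case (Suc n)
 show ?case
 proof (cases "i < n")
  case True
  from Suc.prems(1) show ?thesis
   by (induction rule: TS_Suc_induct)
    (use True Suc.IH Suc.prems in \<open>auto simp: op_e_linear op_idem_add idem_tensor_y op_e_tensor_y\<close>)
 next
  case False
  then obtain m where m: "n = Suc m" "i = Suc m" using top_index[of i n] Suc.prems by auto
  from Suc.prems(1)[unfolded m] show ?thesis unfolding m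
  proof (induction rule: TS_Suc2_induct)
   case (tensor a s t)
   then show ?case
    by (elim insertE; simp add: op_e_linear op_idem_linear idem_tensor_y idem_TS tensor_y_linear e_last_simps singlet_def)
  qed (simp add: op_e_add op_idem_add)
 qed
qed auto

end

section \<open>Highest weight vectors\<close>

context quantum begin

text \<open>The map \<Phi>_2 with the weight as a parameter, which makes it linear.\<close>

definition Phi2k :: "nat => int => 'k tvec => 'k tvec" where
 "Phi2k n k b = tscale (qint v k) (ty b (-1)) - tscale (v powi k) (ty (F n b) 1)"

lemma Phi2_eq: "Phi2 v n b = Phi2k n (weight n b) b"
 by (simp add: Phi2_def Phi2k_def)

lemma Phi2k_zero [simp]: "Phi2k n k 0 = 0"
 by (simp add: Phi2k_def)

lemma Fpow_tensor_minus:
 "b \<in> TS n ==> (F (Suc n) ^^ a) (ty b (-1)) = tscale (v ^ a) (ty ((F n ^^ a) b) (-1))"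
 by (induction a) (simp_all add: op_F_scale F_minus Fpow_TS mult.commute)

lemma Fpow_tensor_F:
 "b \<in> TS n ==> (F (Suc n) ^^ a) (ty (F n b) 1) =
  tscale (v powi (- int a)) (ty ((F n ^^ Suc a) b) 1) + tscale (qint v (int a)) (ty ((F n ^^ a) b) (-1))"
proof (induction a)
 case (Suc a)
 have q: "qint v (int (Suc a)) = v * qint v (int a) + v powi (- int a)"
  using qint_Suc[of "int a"] by (simp add: add.commute)
 have p: "v powi (- int (Suc a)) = v powi (- int a) * inverse v"
  using powi_add[of "- int a" "-1"] by (simp add: power_int_minus diff_minus_eq_add minus_diff_commute)
 have t: "(F n ^^ Suc a) b \<in> TS n" "(F n ^^ a) b \<in> TS n" using Suc.prems by (simp_all only: Fpow_TS)
 have s: "F n ((F n ^^ a) b) = (F n ^^ Suc a) b" "F n ((F n ^^ Suc a) b) = (F n ^^ Suc (Suc a)) b" by simp_all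
 have "(F (Suc n) ^^ Suc a) (ty (F n b) 1) = F (Suc n) ((F (Suc n) ^^ a) (ty (F n b) 1))" by simp
 also have "\<dots> = tscale (v powi (- int a)) (tscale (inverse v) (ty ((F n ^^ Suc (Suc a)) b) 1) + ty ((F n ^^ Suc a) b) (-1))
   + tscale (qint v (int a)) (tscale v (ty ((F n ^^ Suc a) b) (-1)))"
  unfolding Suc.IH[OF Suc.prems] by (simp only: op_F_add op_F_scale F_plus[OF t(1)] F_minus[OF t(2)] s)
 also have "\<dots> = tscale (v powi (- int (Suc a))) (ty ((F n ^^ Suc (Suc a)) b) 1) + tscale (qint v (int (Suc a))) (ty ((F n ^^ Suc a) b) (-1))"
  unfolding q p by (intro ext) (simp only: fun_app, simp add: algebra_simps)
 finally show ?case .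
qed simp

lemma Fpow_tensor_plus:
 assumes "b \<in> TS n"
 shows "(F (Suc n) ^^ Suc a) (ty b 1) =
  tscale (v powi (- int (Suc a))) (ty ((F n ^^ Suc a) b) 1) + tscale (qint v (int (Suc a))) (ty ((F n ^^ a) b) (-1))"
proof -
 have q: "qint v (int (Suc a)) = inverse v * qint v (int a) + v ^ a"
  using qint_Suc'[of "int a"] by (simp add: add.commute)
 have p: "v powi (- int (Suc a)) = v powi (- int a) * inverse v"
  using powi_add[of "- int a" "-1"] by (simp add: power_int_minus diff_minus_eq_add minus_diff_commute)
 have add: "(F (Suc n) ^^ a) (x + y) = (F (Suc n) ^^ a) x + (F (Suc n) ^^ a) y" for x y by (rule Fpow_add)
 have "(F (Suc n) ^^ Suc a) (ty b 1) = (F (Suc n) ^^ a) (F (Suc n) (ty b 1))"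
  by (simp only: funpow_Suc_right o_apply)
 also have "\<dots> = tscale (inverse v) ((F (Suc n) ^^ a) (ty (F n b) 1)) + (F (Suc n) ^^ a) (ty b (-1))"
  by (simp only: F_plus[OF assms] Fpow_add Fpow_scale)
 also have "\<dots> = tscale (v powi (- int (Suc a))) (ty ((F n ^^ Suc a) b) 1) + tscale (qint v (int (Suc a))) (ty ((F n ^^ a) b) (-1))"
  unfolding q p Fpow_tensor_F[OF assms] Fpow_tensor_minus[OF assms]
  by (intro ext) (simp only: fun_app, simp add: algebra_simps)
 finally show ?thesis .
qed

text \<open>Only the two terms F^a b \<otimes> y_{-1} and F^{a+1} b \<otimes> y_1 ever occur; together with the
 formula for \<Phi>_1 this is an invertible change of basis.\<close>

lemma Fpow_Phi2k:
 assumes "b \<in> TS n"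
 shows "(F (Suc n) ^^ a) (Phi2k n k b) =
  tscale (qint v (k - int a)) (ty ((F n ^^ a) b) (-1)) - tscale (v powi (k - int a)) (ty ((F n ^^ Suc a) b) 1)"
proof -
 have q: "qint v (k - int a) = v ^ a * qint v k - v powi k * qint v (int a)"
  using qint_add[of "- int a" k] by (simp add: qint_uminus algebra_simps)
 have p: "v powi (k - int a) = v powi k * v powi (- int a)"
  using powi_add[of k "- int a"] by simp
 have "Phi2k n k b = tscale (qint v k) (ty b (-1)) + tscale (- (v powi k)) (ty (F n b) 1)"
  by (simp add: Phi2k_def)
 then have "(F (Suc n) ^^ a) (Phi2k n k b) =
   tscale (qint v k) ((F (Suc n) ^^ a) (ty b (-1))) + tscale (- (v powi k)) ((F (Suc n) ^^ a) (ty (F n b) 1))"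
  by (simp only: Fpow_add Fpow_scale)
 also have "\<dots> = tscale (qint v (k - int a)) (ty ((F n ^^ a) b) (-1)) - tscale (v powi (k - int a)) (ty ((F n ^^ Suc a) b) 1)"
  unfolding q p Fpow_tensor_F[OF assms] Fpow_tensor_minus[OF assms]
  by (intro ext) (simp only: fun_app, simp add: algebra_simps)
 finally show ?thesis .
qed

text \<open>A maximal vector of weight k whose string stops after k + 1 steps. The last condition is recorded
 because it is inherited along \<Phi>_1 and \<Phi>_2 without any assumption on quantum integers.\<close>

definition hw :: "nat => nat => 'k tvec => bool" where
 "hw n k b \<longleftrightarrow> has_wt n (int k) b \<and> E n b = 0 \<and> (F n ^^ Suc k) b = 0"

lemma hw_TS: "hw n k b ==> b \<in> TS n" by (auto simp: hw_def dest: has_wt_TS)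
lemma hw_wt: "hw n k b ==> has_wt n (int k) b" by (simp add: hw_def)

lemma Fpow_hw_zero: "hw n k b ==> k < a ==> (F n ^^ a) b = 0"
proof -
 assume h: "hw n k b" "k < a"
 then obtain c where a: "a = c + Suc k" by (metis add.commute less_iff_Suc_add add_Suc_right)
 have "(F n ^^ c) 0 = 0" by (induction c) auto
 then show ?thesis using h unfolding a funpow_add o_apply hw_def by simp
qed

lemma hw_Phi1:
 assumes "hw n k b" shows "hw (Suc n) (Suc k) (ty b 1)"
proof -
 have "(F (Suc n) ^^ Suc (Suc k)) (ty b 1) = 0"
  unfolding Fpow_tensor_plus[OF hw_TS[OF assms]]
  using Fpow_hw_zero[OF assms, of "Suc k"] Fpow_hw_zero[OF assms, of "Suc (Suc k)"] by (simp del: funpow.simps)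
 moreover have "has_wt (Suc n) (int (Suc k)) (ty b 1)"
  by (rule has_wt_tensor_y[OF hw_wt[OF assms]]) auto
 moreover have "E (Suc n) (ty b 1) = 0"
  using assms by (simp add: E_plus[OF hw_TS[OF assms]] hw_def)
 ultimately show ?thesis by (simp add: hw_def del: funpow.simps)
qed

text \<open>Moving E past F one step at a time adds up the quantum integers of the weights in the string.\<close>

lemma EF_hw:
 assumes b: "has_wt n k b" and E: "E n b = 0"
 shows "E n ((F n ^^ Suc a) b) = tscale (qint v (int (Suc a)) * qint v (k - int a)) ((F n ^^ a) b)"
proof (induction a)
 case 0
 have "E n (F n b) = H b" using EF_commutator[OF has_wt_TS[OF b]] E by simp
 then show ?case by (simp add: H_wt[OF b])
next
 case (Suc a)
 let ?x = "(F n ^^ Suc a) b"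
 have x: "has_wt n (k - 2 * int (Suc a)) ?x" by (rule Fpow_wt[OF b])
 have "E n (F n ?x) = F n (E n ?x) + H ?x" using EF_commutator[OF has_wt_TS[OF x]] by (simp add: algebra_simps)
 also have "\<dots> = tscale (qint v (int (Suc a)) * qint v (k - int a)) (F n ((F n ^^ a) b)) + tscale (qint v (k - 2 * int (Suc a))) ?x"
  by (simp only: Suc.IH op_F_scale H_wt[OF x])
 also have "\<dots> = tscale (qint v (int (Suc a)) * qint v (k - int a) + qint v (k - 2 * int (Suc a))) ?x"
  by (simp add: tvec.scale_left_distrib)
 also have "qint v (int (Suc a)) * qint v (k - int a) + qint v (k - 2 * int (Suc a))
   = qint v (int (Suc (Suc a))) * qint v (k - int (Suc a))"
  using qint_ladder[of "int (Suc a)" "k - 2 * int (Suc a)"] by (simp add: algebra_simps)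
 finally show ?case by simp
qed

lemma hw_Phi2:
 assumes "hw n (Suc k) b" shows "hw (Suc n) k (Phi2k n (int (Suc k)) b)"
proof -
 note t = hw_TS[OF assms] and w = hw_wt[OF assms]
 have "(F (Suc n) ^^ Suc k) (Phi2k n (int (Suc k)) b) = 0"
  unfolding Fpow_Phi2k[OF t] using Fpow_hw_zero[OF assms, of "Suc (Suc k)"] by (simp del: funpow.simps)
 moreover have "has_wt (Suc n) (int k) (Phi2k n (int (Suc k)) b)"
  unfolding Phi2k_def
  by (intro has_wt_diff has_wt_linear has_wt_tensor_y[OF w] has_wt_tensor_y[OF F_wt[OF w refl]]) auto
 moreover have "E (Suc n) (Phi2k n (int (Suc k)) b) = 0"
 proof -
  have e: "E n b = 0" using assms by (simp add: hw_def)
  have ef: "E n (F n b) = tscale (qint v (int (Suc k))) b" using EF_hw[OF w e, of 0] by simp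
  show ?thesis unfolding Phi2k_def
   by (simp only: EF_linear E_plus[OF F_TS[OF t]] E_minus[OF t] e ef K_wt[OF w] tensor_y_linear)
    (simp add: mult.commute)
 qed
 ultimately show ?thesis by (simp add: hw_def del: funpow.simps)
qed

text \<open>One step down both strings changes the form by an explicit factor, by adjunction and the action of E
 on the string. Orthogonality and norms of all F^a b are thereby reduced to those of the highest
 weight vectors.\<close>

lemma form_Fpow_Suc:
 assumes x: "hw n k x" and y: "hw n l y"
 shows "tform n ((F n ^^ Suc a) x) ((F n ^^ Suc b) y) =
   v powi (1 - (int k - 2 * int a)) * (qint v (int (Suc b)) * qint v (int l - int b)) * tform n ((F n ^^ a) x) ((F n ^^ b) y)"
proof -
 have "tform n (F n ((F n ^^ a) x)) ((F n ^^ Suc b) y) =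
   v powi (1 - (int k - 2 * int a)) * tform n ((F n ^^ a) x) (E n ((F n ^^ Suc b) y))"
  by (rule form_F[OF Fpow_wt[OF hw_wt[OF x]] Fpow_TS[OF hw_TS[OF y]]])
 moreover have "E n y = 0" using y by (simp add: hw_def)
 ultimately show ?thesis
  unfolding EF_hw[OF hw_wt[OF y] \<open>E n y = 0\<close>] tform_scale_right by simp
qed

lemma form_Fpow_less:
 assumes x: "hw n k x" and y: "hw n l y" and "b < a"
 shows "tform n ((F n ^^ a) x) ((F n ^^ b) y) = 0"
 using \<open>b < a\<close>
proof (induction b arbitrary: a)
 case 0
 then obtain c where a: "a = Suc c" by (cases a) auto
 have "E n y = 0" using y by (simp add: hw_def)
 then show ?case
  using form_F[OF Fpow_wt[OF hw_wt[OF x]] hw_TS[OF y], of c] by (simp add: a)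
next
 case (Suc b)
 then obtain c where a: "a = Suc c" by (cases a) auto
 then show ?case using Suc form_Fpow_Suc[OF x y, of c b] by (simp del: funpow.simps)
qed

lemma form_Fpow_zero:
 assumes "hw n k x" "hw n l y" "tform n x y = 0"
 shows "tform n ((F n ^^ a) x) ((F n ^^ b) y) = 0"
proof (cases a b rule: linorder_cases)
 case less
 then show ?thesis using form_Fpow_less[OF assms(2,1)] tform_commute by metis
next
 case equal
 have "tform n ((F n ^^ a) x) ((F n ^^ a) y) = 0"
 proof (induction a)
  case (Suc a)
  then show ?case using form_Fpow_Suc[OF assms(1,2), of a a] by (simp del: funpow.simps)
 qed (simp add: assms)
 then show ?thesis using equal by simp
next
 case greater
 then show ?thesis using form_Fpow_less[OF assms(1,2)] by simp
qed

end

text \<open>The standing hypothesis. The bound N is fixed, while inductions run over the number n \<le> N of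
 tensor factors.\<close>

locale quantum_N = quantum v for v :: "'k::field" +
 fixes N :: nat
 assumes qfact_nonzero: "qfact v N \<noteq> 0"
begin

lemma qint_nonzero: "1 \<le> j ==> j \<le> N ==> qint v (int j) \<noteq> 0"
 using qfact_nonzero by (auto simp: qfact_def prod_zero_iff)

lemma qint_nonzero': "1 \<le> j ==> j \<le> int N ==> qint v j \<noteq> 0"
 using qint_nonzero[of "nat j"] by simp

lemma form_Fpow_nonzero:
 assumes x: "hw n k x" "tform n x x \<noteq> 0" and "a \<le> k" "k \<le> N"
 shows "tform n ((F n ^^ a) x) ((F n ^^ a) x) \<noteq> 0"
 using \<open>a \<le> k\<close>
proof (induction a)
 case (Suc a)
 have "qint v (int (Suc a)) \<noteq> 0" by (rule qint_nonzero') (use Suc.prems \<open>k \<le> N\<close> in auto)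
 moreover have "qint v (int k - int a) \<noteq> 0" by (rule qint_nonzero') (use Suc.prems \<open>k \<le> N\<close> in auto)
 ultimately show ?case
  using Suc form_Fpow_Suc[OF x(1) x(1), of a a] v_nonzero by (simp del: funpow.simps of_nat_Suc)
qed (simp add: x)

lemma form_Phi1: "tform (Suc n) (ty a 1) (ty b 1) = tform n a b"
 by (simp add: tform_tensor_y)

text \<open>The recursion for the norms of the \<mu>(p): a diagonal step from weight k multiplies the norm by v
 [k][k + 1].\<close>

lemma form_Phi2k:
 assumes x: "hw n k x" and y: "hw n k y"
 shows "tform (Suc n) (Phi2k n (int k) x) (Phi2k n (int k) y)
  = v * qint v (int k) * qint v (int k + 1) * tform n x y"
proof -
 have F: "tform n (F n x) (F n y) = v powi (1 - int k) * qint v (int k) * tform n x y"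
  using form_Fpow_Suc[OF x y, of 0 0] by simp
 have p: "v powi int k * v powi (1 - int k) = v" using powi_add[of "int k" "1 - int k"] by simp
 have r: "v * qint v (int k + 1) = qint v (int k) + v * v powi int k"
  unfolding qint_Suc' using v_nonzero by (simp add: algebra_simps)
 have "v * qint v (int k) * qint v (int k + 1) = qint v (int k) * (v * qint v (int k + 1))"
  by (simp only: ac_simps)
 then have q: "v * qint v (int k) * qint v (int k + 1) = qint v (int k) * qint v (int k) + v powi int k * v * qint v (int k)"
  unfolding r by (simp only: ring_distribs ac_simps)
 have "tform (Suc n) (Phi2k n (int k) x) (Phi2k n (int k) y) =
  qint v (int k) * qint v (int k) * tform n x y + v powi int k * v powi int k * tform n (F n x) (F n y)"
  unfolding Phi2k_def by (simp add: tform_linear tform_tensor_y mult.assoc)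
 also have "\<dots> = (qint v (int k) * qint v (int k) + v powi int k * (v powi int k * v powi (1 - int k)) * qint v (int k)) * tform n x y"
  unfolding F by (simp add: algebra_simps)
 finally show ?thesis unfolding p q .
qed

text \<open>Orthogonality of vectors arriving at the same partition by different last steps.\<close>

lemma form_Phi12:
 assumes "E n a = 0" "a \<in> TS n" "has_wt n k b"
 shows "tform (Suc n) (Phi2k n l b) (ty a 1) = 0"
proof -
 have "tform n (F n b) a = 0" using form_F[OF assms(3,2)] assms(1) by simp
 then show ?thesis unfolding Phi2k_def by (simp add: tform_linear tform_tensor_y)
qed

end

section \<open>Walks\<close>

text \<open>An inductive description of the walks, suited to induction on the last step.\<close>

inductive walk :: "nat \<times> nat => (nat \<times> nat) list => bool" where
 Nil: "walk (0, 0) [(0, 0)]"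
| Up: "walk (a, b) p ==> walk (Suc a, b) (p @ [(Suc a, b)])"
| Diag: "walk (a, b) p ==> Suc b \<le> a ==> walk (a, Suc b) (p @ [(a, Suc b)])"

lemma walk_props: "walk l p ==> p \<noteq> [] \<and> hd p = (0, 0) \<and> last p = l \<and> length p = Suc (fst l + snd l) \<and>
  snd l \<le> fst l \<and> (\<forall>(a, b)\<in>set p. b \<le> a) \<and> set p \<subseteq> {..fst l} \<times> {..snd l}"
 by (induction rule: walk.induct) (auto simp: hd_append)

lemma walk_step: "walk l p ==> Suc i < length p ==>
    p ! Suc i = (Suc (fst (p ! i)), snd (p ! i)) \<or> p ! Suc i = (fst (p ! i), Suc (snd (p ! i)))"
proof (induction arbitrary: i rule: walk.induct)
 case (Up a b p)
 have "last p = (a, b)" "p \<noteq> []" using walk_props[OF Up.hyps] by auto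
 then have "p ! i = (a, b)" if "Suc i = length p"
  using that by (metis diff_Suc_1 last_conv_nth)
 then show ?case using Up.IH[of i] Up.prems by (cases "Suc i = length p") (auto simp: nth_append)
next
 case (Diag a b p)
 have "last p = (a, b)" "p \<noteq> []" using walk_props[OF Diag.hyps(1)] by auto
 then have "p ! i = (a, b)" if "Suc i = length p"
  using that by (metis diff_Suc_1 last_conv_nth)
 then show ?case using Diag.IH[of i] Diag.prems by (cases "Suc i = length p") (auto simp: nth_append)
qed simp

lemma walks_to_snoc:
 assumes p: "p \<in> walks_to l" and "length p = Suc (Suc n)"
 shows "butlast p \<in> walks_to (last (butlast p))" "p = butlast p @ [l]" "snd l \<le> fst l"
  "l = (Suc (fst (last (butlast p))), snd (last (butlast p))) \<or> l = (fst (last (butlast p)), Suc (snd (last (butlast p))))"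
proof -
 obtain q where q: "p = q @ [l]" "length q = Suc n"
  using assms by (cases p rule: rev_cases) (auto simp: walks_to_def)
 then have "q \<noteq> []" by auto
 then have lq: "last q = q ! n" using q(2) by (simp add: last_conv_nth)
 have step: "\<And>i. Suc i < length p ==> p ! Suc i = (Suc (fst (p ! i)), snd (p ! i)) \<or> p ! Suc i = (fst (p ! i), Suc (snd (p ! i)))"
  using p by (auto simp: walks_to_def)
 have "q ! Suc i = (Suc (fst (q ! i)), snd (q ! i)) \<or> q ! Suc i = (fst (q ! i), Suc (snd (q ! i)))" if "Suc i < length q" for i
  using step[of i] that by (simp add: q nth_append)
 then have "q \<in> walks_to (last q)" using p \<open>q \<noteq> []\<close> by (auto simp: walks_to_def q hd_append)
 then show "butlast p \<in> walks_to (last (butlast p))" by (simp add: q)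
 show "p = butlast p @ [l]" by (simp add: q)
 show "snd l \<le> fst l" using p by (auto simp: walks_to_def q)
 show "l = (Suc (fst (last (butlast p))), snd (last (butlast p))) \<or> l = (fst (last (butlast p)), Suc (snd (last (butlast p))))"
  using step[of n] by (simp add: q nth_append lq)
qed

lemma walks_to_iff: "p \<in> walks_to l \<longleftrightarrow> walk l p"
proof
 assume "walk l p"
 then show "p \<in> walks_to l"
  using walk_props walk_step by (auto simp: walks_to_def)
next
 assume "p \<in> walks_to l"
 then show "walk l p"
 proof (induction "length p" arbitrary: p l rule: less_induct)
  case less
  show ?case
  proof (cases "length p = 1")
   case True
   then obtain x where "p = [x]" by (auto simp: length_Suc_conv)
   then show ?thesis using less.prems walk.Nil by (auto simp: walks_to_def)
  next
   case False
   moreover have "p \<noteq> []" using less.prems by (simp add: walks_to_def)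
   then have "length p \<noteq> 0" by simp
   ultimately obtain n where n: "length p = Suc (Suc n)" by (cases "length p"; cases "length p - 1") auto
   note s = walks_to_snoc[OF less.prems n]
   have "walk (last (butlast p)) (butlast p)" using less.hyps[OF _ s(1)] n by simp
   then show ?thesis using s(3,4) walk.Up walk.Diag s(2)
    by (metis fst_conv prod.collapse snd_conv)
  qed
 qed
qed

lemma finite_walks_to [simp]: "finite (walks_to l)"
proof -
 have "walks_to l \<subseteq> {p. set p \<subseteq> {..fst l} \<times> {..snd l} \<and> length p = Suc (fst l + snd l)}"
  by (auto simp: walks_to_iff dest!: walk_props)
 then show ?thesis by (rule finite_subset) (intro finite_lists_length_eq finite_SigmaI; simp)
qed

lemma finite_two_row_partitions [simp]: "finite (two_row_partitions n)"
proof -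
 have "two_row_partitions n \<subseteq> {..n} \<times> {..n}" by (auto simp: two_row_partitions_def)
 then show ?thesis by (rule finite_subset) auto
qed

lemma finite_walks [simp]: "finite (walks n)" by (simp add: walks_def)

lemma walks_iff: "p \<in> walks n \<longleftrightarrow> (\<exists>l. walk l p \<and> fst l + snd l = n)"
 using walk_props by (fastforce simp: walks_def walks_to_iff two_row_partitions_def)

lemma walk_exists: "b \<le> a ==> \<exists>p. walk (a, b) p"
proof (induction a arbitrary: b)
 case 0 then show ?case using walk.Nil by auto
next
 case (Suc a)
 have *: "\<exists>p. walk (Suc a, b) p" if "b \<le> a" for b using Suc.IH[OF that] walk.Up by blast
 show ?case
 proof (cases "b \<le> a")
  case False
  then have "b = Suc a" using Suc.prems by simp
  then show ?thesis using *[of a] walk.Diag[of "Suc a" a] by auto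
 qed (rule *)
qed

lemma mu_upto_append: "i < length p ==> mu_upto v (p @ q) i = mu_upto v p i"
 by (induction i) (auto simp: nth_append)

lemma mu_Nil: "mu v [(0, 0)] = ybasis []" by (simp add: mu_def)

lemma mu_snoc:
 assumes "walk l p"
 shows "mu v (p @ [l']) = (if fst l' = Suc (fst l) then Phi1 (mu v p) else Phi2 v (fst l + snd l) (mu v p))"
proof -
 have p: "length p = Suc (fst l + snd l)" "p ! (fst l + snd l) = l"
  using walk_props[OF assms] last_conv_nth[of p] by auto
 have l: "length (p @ [l']) - 1 = Suc (fst l + snd l)" using p by simp
 show ?thesis unfolding mu_def l using p by (simp add: mu_upto_append nth_append)
qed

context quantum_N begin

abbreviation "\<mu> \<equiv> mu v"

lemma mu_Up: "walk (a, b) p ==> \<mu> (p @ [(Suc a, b)]) = ty (\<mu> p) 1"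
 by (simp add: mu_snoc Phi1_def)

text \<open>Both properties propagate along the walk together: a diagonal step starts from positive weight k,
 and then [k] and [k + 1] are among the invertible quantum integers.\<close>

lemma mu_hw_norm:
 "walk l p ==> fst l + snd l \<le> N ==>
  hw (fst l + snd l) (fst l - snd l) (\<mu> p) \<and> tform (fst l + snd l) (\<mu> p) (\<mu> p) \<noteq> 0"
proof (induction rule: walk.induct)
 case Nil
 have "ybasis [] \<in> TS 0" by (rule ybasis_TS) (simp add: sign_words_0)
 moreover have "op_idem 0 (ybasis []) = (ybasis [] :: 'k tvec)" by (auto simp: op_idem_def ybasis_def fun_eq_iff)
 ultimately show ?case
  by (simp add: mu_Nil hw_def has_wt_def tform_def sign_words_0) (simp add: ybasis_def)
next
 case (Up a b p)
 then have "snd (a, b) \<le> fst (a, b)" using walk_props by blast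
 then have k: "Suc a - b = Suc (a - b)" by simp
 then show ?case using Up hw_Phi1[of "a + b" "a - b" "\<mu> p"] by (simp add: mu_Up form_Phi1)
next
 case (Diag a b p)
 let ?n = "a + b"
 have h: "hw ?n (a - b) (\<mu> p)" "tform ?n (\<mu> p) (\<mu> p) \<noteq> 0" using Diag by auto
 then have w: "weight ?n (\<mu> p) = int (a - b)"
  using hw_wt weight_eq by (metis tform_zero(1))
 have k: "a - b = Suc (a - Suc b)" using Diag by simp
 have m: "\<mu> (p @ [(a, Suc b)]) = Phi2k ?n (int (a - b)) (\<mu> p)"
  using mu_snoc[OF Diag.hyps(1), of v "(a, Suc b)"] w by (simp add: Phi2_eq)
 have "hw (Suc ?n) (a - Suc b) (\<mu> (p @ [(a, Suc b)]))"
  using h(1) unfolding m k by (rule hw_Phi2)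
 moreover have "qint v (int (a - b)) \<noteq> 0" by (rule qint_nonzero') (use Diag in auto)
 moreover have "qint v (int (a - b) + 1) \<noteq> 0" by (rule qint_nonzero') (use Diag in auto)
 ultimately have "tform (Suc ?n) (\<mu> (p @ [(a, Suc b)])) (\<mu> (p @ [(a, Suc b)])) \<noteq> 0"
  unfolding m form_Phi2k[OF h(1) h(1)] using h(2) v_nonzero by simp
 with \<open>hw _ _ (\<mu> (p @ _))\<close> show ?case by simp
qed

lemma mu_hw: "walk l p ==> fst l + snd l = n ==> n \<le> N ==> hw n (fst l - snd l) (\<mu> p)"
 and mu_norm: "walk l p ==> fst l + snd l = n ==> n \<le> N ==> tform n (\<mu> p) (\<mu> p) \<noteq> 0"
 using mu_hw_norm by blast+

lemma mu_weight: "walk l p ==> fst l + snd l = n ==> n \<le> N ==> weight n (\<mu> p) = int (fst l - snd l)"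
 using hw_wt[OF mu_hw] weight_eq mu_norm by (metis tform_zero(1))

lemma mu_Diag:
 assumes "walk (a, b) p" "a + b \<le> N"
 shows "\<mu> (p @ [(a, Suc b)]) = Phi2k (a + b) (int (a - b)) (\<mu> p)"
 using mu_snoc[OF assms(1), of v "(a, Suc b)"] mu_weight[OF assms(1) _ assms(2)] by (simp add: Phi2_eq)

text \<open>Walks with different last steps are separated by \<Phi>_1 and \<Phi>_2 having orthogonal images on
 maximal vectors; otherwise the form on the shorter walks decides.\<close>

lemma mu_orth:
 "walk l p ==> walk l q ==> p \<noteq> q ==> fst l + snd l \<le> N ==> tform (fst l + snd l) (\<mu> p) (\<mu> q) = 0"
proof (induction arbitrary: q rule: walk.induct)
 case Nil
 then show ?case by (auto elim: walk.cases)
next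
 case (Up a b p)
 note IH = Up.IH and prems = Up.prems and hyps = Up.hyps
 from Up.prems(1) show ?case
 proof (cases rule: walk.cases)
  case (Up q')
  then show ?thesis using IH[of q'] prems hyps by (auto simp: mu_Up form_Phi1)
 next
  case (Diag b' q')
  have h: "hw (a + b) (a - b) (\<mu> p)" "hw (a + b) (Suc a - b') (\<mu> q')"
   using mu_hw[OF hyps, of "a + b"] mu_hw[OF Diag(3), of "a + b"] prems Diag by auto
  have "\<mu> q = Phi2k (a + b) (int (Suc a - b')) (\<mu> q')"
   using mu_Diag[OF Diag(3)] prems Diag by simp
  moreover have "tform (Suc (a + b)) (Phi2k (a + b) (int (Suc a - b')) (\<mu> q')) (ty (\<mu> p) 1) = 0"
   by (rule form_Phi12[OF _ hw_TS[OF h(1)] hw_wt[OF h(2)]]) (use h in \<open>simp add: hw_def\<close>)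
  ultimately show ?thesis
   by (simp add: mu_Up[OF hyps] tform_commute[of _ "ty _ 1"])
 qed
next
 case (Diag a b p)
 note IH = Diag.IH and prems = Diag.prems and hyps = Diag.hyps
 have h: "hw (a + b) (a - b) (\<mu> p)"
  using mu_hw[OF hyps(1), of "a + b"] prems by auto
 have m: "\<mu> (p @ [(a, Suc b)]) = Phi2k (a + b) (int (a - b)) (\<mu> p)"
  using mu_Diag[OF hyps(1)] prems by simp
 from Diag.prems(1) show ?case
 proof (cases rule: walk.cases)
  case (Up a' q')
  have h': "hw (a + b) (a' - Suc b) (\<mu> q')"
   using mu_hw[OF Up(3), of "a + b"] prems Up by auto
  have "\<mu> q = ty (\<mu> q') 1" using mu_Up[OF Up(3)] Up by simp
  moreover have "tform (Suc (a + b)) (Phi2k (a + b) (int (a - b)) (\<mu> p)) (ty (\<mu> q') 1) = 0"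
   by (rule form_Phi12[OF _ hw_TS[OF h'] hw_wt[OF h]]) (use h' in \<open>simp add: hw_def\<close>)
  ultimately show ?thesis by (simp add: m)
 next
  case (Diag q')
  have h': "hw (a + b) (a - b) (\<mu> q')"
   using mu_hw[OF Diag(2), of "a + b"] prems by auto
  have "\<mu> q = Phi2k (a + b) (int (a - b)) (\<mu> q')" using mu_Diag[OF Diag(2)] prems Diag by simp
  moreover have "tform (a + b) (\<mu> p) (\<mu> q') = 0" using IH[of q'] prems Diag by auto
  ultimately show ?thesis by (simp add: m form_Phi2k[OF h h'])
 qed
qed

end

section \<open>The orthogonal basis of tensor space\<close>

text \<open>Vectors that are pairwise orthogonal and not isotropic are independent, over any field.\<close>

lemma orth_basis:
 assumes orth: "\<And>i j. i \<in> I ==> j \<in> I ==> i \<noteq> j ==> tform n (b i) (b j) = 0"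
  and norm: "\<And>i. i \<in> I ==> tform n (b i) (b i) \<noteq> 0"
 shows "is_basis I b (tvec.span (b ` I))"
proof -
 have inj: "inj_on b I"
  by (rule inj_onI) (metis norm orth)
 have "tvec.independent (b ` I)"
 proof
  assume "tvec.dependent (b ` I)"
  then obtain t u w where t: "finite t" "t \<subseteq> b ` I" "(\<Sum>x\<in>t. tscale (u x) x) = 0" "w \<in> t" "u w \<noteq> 0"
   unfolding tvec.dependent_explicit by blast
  have z: "tform n x w = 0" if "x \<in> t" "x \<noteq> w" for x
  proof -
   have "x \<in> b ` I" "w \<in> b ` I" using t(2,4) that(1) by auto
   then obtain i j where ij: "i \<in> I" "x = b i" "j \<in> I" "w = b j" by auto
   then have "i \<noteq> j" using that by auto
   then show ?thesis using orth ij by simp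
  qed
  have "0 = tform n (\<Sum>x\<in>t. tscale (u x) x) w" by (simp add: t)
  also have "\<dots> = (\<Sum>x\<in>t. if x = w then u w * tform n w w else 0)"
   unfolding tform_sum by (rule sum.cong) (auto simp: tform_scale z)
  also have "\<dots> = u w * tform n w w" using t by simp
  finally show False using t norm by (auto simp: image_iff subset_iff)
 qed
 then show ?thesis by (simp add: is_basis_def inj)
qed

lemma orth_expand:
 assumes fin: "finite I"
  and orth: "\<And>i j. i \<in> I ==> j \<in> I ==> i \<noteq> j ==> tform n (b i) (b j) = 0"
  and norm: "\<And>i. i \<in> I ==> tform n (b i) (b i) \<noteq> 0"
  and x: "x \<in> tvec.span (b ` I)"
 shows "x = (\<Sum>i\<in>I. tscale (tform n x (b i) / tform n (b i) (b i)) (b i))"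
proof -
 let ?e = "\<lambda>x. \<Sum>i\<in>I. tscale (tform n x (b i) / tform n (b i) (b i)) (b i)"
 have "tvec.span (b ` I) \<subseteq> {x. x = ?e x}"
 proof (rule tvec.span_minimal)
  show "b ` I \<subseteq> {x. x = ?e x}"
  proof safe
   fix j assume j: "j \<in> I"
   have "?e (b j) = (\<Sum>i\<in>I. if i = j then b j else 0)"
    by (rule sum.cong) (use orth norm j in auto)
   then show "b j = ?e (b j)" using fin j by simp
  qed
  show "tvec.subspace {x. x = ?e x}"
  proof (rule tvec.subspaceI)
   fix x y c assume "x \<in> {x. x = ?e x}" "y \<in> {x. x = ?e x}"
   then have x: "x = ?e x" and y: "y = ?e y" by simp_all
   have "?e (x + y) = ?e x + ?e y"
    by (simp add: tform_add add_divide_distrib tvec.scale_left_distrib sum.distrib)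
   then show "x + y \<in> {x. x = ?e x}" using x y by simp
   have "?e (tscale c x) = tscale c (?e x)"
    by (simp add: tform_scale tvec.scale_sum_right)
   then show "tscale c x \<in> {x. x = ?e x}" using x by simp
  qed simp
 qed
 then show ?thesis using x by blast
qed

lemma span_scale_cancel: "tscale c x \<in> tvec.span S ==> c \<noteq> 0 ==> x \<in> tvec.span S"
 using tvec.span_scale[of "tscale c x" S "inverse c"] by simp

text \<open>The weight of \<mu>(p).\<close>

definition wtp :: "(nat \<times> nat) list => nat" where
 "wtp p = fst (last p) - snd (last p)"

lemma wtp_walk: "walk l p ==> wtp p = fst l - snd l"
 using walk_props by (auto simp: wtp_def)

lemma walks_walk: "p \<in> walks n ==> walk (last p) p \<and> fst (last p) + snd (last p) = n"
 using walk_props by (auto simp: walks_iff)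

lemma walks_wtp_eq: "p \<in> walks n ==> q \<in> walks n ==> wtp p = wtp q \<longleftrightarrow> last p = last q"
proof -
 assume p: "p \<in> walks n" and q: "q \<in> walks n"
 have "snd (last p) \<le> fst (last p)" "snd (last q) \<le> fst (last q)"
  using walks_walk[OF p] walks_walk[OF q] walk_props by blast+
 then show ?thesis
  using walks_walk[OF p] walks_walk[OF q] by (simp add: wtp_def prod_eq_iff) arith
qed

lemma wtp_le: "p \<in> walks n ==> wtp p \<le> n"
 using walks_walk[of p n] by (auto simp: wtp_def)

lemma walks_to_walks: "l \<in> two_row_partitions n ==> p \<in> walks_to l \<longleftrightarrow> p \<in> walks n \<and> last p = l"
proof -
 assume l: "l \<in> two_row_partitions n"
 show ?thesis
 proof
  assume "p \<in> walks_to l"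
  then have w: "walk l p" by (simp add: walks_to_iff)
  have "fst l + snd l = n" using l by (auto simp: two_row_partitions_def)
  moreover have "last p = l" using walk_props[OF w] by blast
  ultimately show "p \<in> walks n \<and> last p = l" using w walks_iff by blast
 next
  assume "p \<in> walks n \<and> last p = l"
  then show "p \<in> walks_to l" using walks_walk[of p n] walks_to_iff by blast
 qed
qed

lemma last_two_row: "p \<in> walks n ==> last p \<in> two_row_partitions n"
proof -
 assume p: "p \<in> walks n"
 have "snd (last p) \<le> fst (last p)" using walks_walk[OF p] walk_props by blast
 then show ?thesis using walks_walk[OF p] by (simp add: two_row_partitions_def case_prod_beta)
qed

definition bas :: "'k::field => nat => (nat \<times> nat) list => nat => 'k tvec" where
 "bas v n p a = (op_F v n ^^ a) (mu v p)"

text \<open>The coordinate at F^a \<mu>(p).\<close>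

definition crd :: "'k::field => nat => (nat \<times> nat) list => nat => 'k tvec => 'k" where
 "crd v n p a x = tform n x (bas v n p a) / tform n (bas v n p a) (bas v n p a)"

text \<open>The matrix unit of the commutant that carries the string of p to the string of q.\<close>

definition munit :: "'k::field => nat => (nat \<times> nat) list => (nat \<times> nat) list => 'k tvec => 'k tvec" where
 "munit v n q p x = (\<Sum>a\<le>wtp p. tscale (crd v n p a x) (bas v n q a))"

lemma crd_add: "crd v n p a (x + y) = crd v n p a x + crd v n p a y"
 by (simp add: crd_def tform_add add_divide_distrib)
lemma crd_scale: "crd v n p a (tscale c x) = c * crd v n p a x"
 by (simp add: crd_def tform_scale)
lemma crd_zero [simp]: "crd v n p a 0 = 0" by (simp add: crd_def)
lemma crd_sum: "crd v n p a (sum f S) = (\<Sum>i\<in>S. crd v n p a (f i))"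
 by (induction S rule: infinite_finite_induct) (auto simp: crd_add)

lemma munit_add: "munit v n q p (x + y) = munit v n q p x + munit v n q p y"
 by (simp add: munit_def crd_add tvec.scale_left_distrib sum.distrib)
lemma munit_scale: "munit v n q p (tscale c x) = tscale c (munit v n q p x)"
 by (simp add: munit_def crd_scale tvec.scale_sum_right)

context quantum_N begin

abbreviation "\<beta> \<equiv> bas v"

lemma hw_walks: "p \<in> walks n ==> n \<le> N ==> hw n (wtp p) (\<mu> p)"
 using walks_walk[of p n] mu_hw[of "last p" p n] by (simp add: wtp_def)

lemma weight_walks: "p \<in> walks n ==> n \<le> N ==> weight n (\<mu> p) = int (wtp p)"
 using walks_walk[of p n] mu_weight[of "last p" p n] by (simp add: wtp_def)

lemma mu_nonzero: "p \<in> walks n ==> n \<le> N ==> \<mu> p \<noteq> 0"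
 using walks_walk[of p n] mu_norm[of "last p" p n] by auto

lemma bas_0: "\<beta> n p 0 = \<mu> p" by (simp add: bas_def)

lemma bas_TS: "p \<in> walks n ==> n \<le> N ==> \<beta> n p a \<in> TS n"
 unfolding bas_def by (rule Fpow_TS[OF hw_TS[OF hw_walks]])

lemma bas_wt: "p \<in> walks n ==> n \<le> N ==> has_wt n (int (wtp p) - 2 * int a) (\<beta> n p a)"
 unfolding bas_def by (rule Fpow_wt[OF hw_wt[OF hw_walks]])

lemma bas_zero: "p \<in> walks n ==> n \<le> N ==> wtp p < a ==> \<beta> n p a = 0"
 unfolding bas_def by (rule Fpow_hw_zero[OF hw_walks])

lemma F_bas: "F n (\<beta> n p a) = \<beta> n p (Suc a)" by (simp add: bas_def)

lemma E_bas_0: "p \<in> walks n ==> n \<le> N ==> E n (\<beta> n p 0) = 0"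
 using hw_walks[of p n] by (simp add: bas_def hw_def)

text \<open>The factor by which E climbs one step in a string of highest weight k.\<close>

definition lad :: "nat => nat => 'k" where
 "lad k a = qint v (int (Suc a)) * qint v (int k - int a)"

lemma E_bas_Suc: "p \<in> walks n ==> n \<le> N ==> E n (\<beta> n p (Suc a)) = tscale (lad (wtp p) a) (\<beta> n p a)"
 using EF_hw[OF hw_wt[OF hw_walks[of p n]], of a] hw_walks[of p n] unfolding bas_def lad_def hw_def by blast

lemma idem_bas: "p \<in> walks n ==> n \<le> N ==> op_idem i (\<beta> n p a) = (if i = int (wtp p) - 2 * int a then \<beta> n p a else 0)"
 using bas_wt[of p n a] op_idem_idem[of i "int (wtp p) - 2 * int a" "\<beta> n p a"] unfolding has_wt_def by (auto split: if_splits)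

lemma mu_orth': "p \<in> walks n ==> q \<in> walks n ==> n \<le> N ==> p \<noteq> q ==> tform n (\<mu> p) (\<mu> q) = 0"
proof (cases "last p = last q")
 case True
 assume "p \<in> walks n" "q \<in> walks n" "n \<le> N" "p \<noteq> q"
 then show ?thesis using walks_walk[of p n] walks_walk[of q n] mu_orth[of "last p" p q] True by auto
next
 case False
 assume a: "p \<in> walks n" "q \<in> walks n" "n \<le> N"
 then have "wtp p \<noteq> wtp q" using walks_wtp_eq False by blast
 then show ?thesis using tform_wt[OF hw_wt[OF hw_walks[OF a(1,3)]] hw_wt[OF hw_walks[OF a(2,3)]]] by simp
qed

lemma bas_orth:
 assumes a: "p \<in> walks n" "q \<in> walks n" "n \<le> N" and ne: "(p, a) \<noteq> (q, b)"
 shows "tform n (\<beta> n p a) (\<beta> n q b) = 0"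
proof (cases "p = q")
 case True
 have h: "hw n (wtp p) (\<mu> p)" using hw_walks a by blast
 from ne True have "a < b \<or> b < a" by auto
 then show ?thesis using form_Fpow_less[OF h h, of a b] form_Fpow_less[OF h h, of b a] tform_commute[of n] True
  unfolding bas_def by metis
next
 case False
 show ?thesis unfolding bas_def
  by (rule form_Fpow_zero[OF hw_walks[OF a(1,3)] hw_walks[OF a(2,3)] mu_orth'[OF a False]])
qed

lemma bas_norm:
 assumes a: "p \<in> walks n" "n \<le> N" "a \<le> wtp p"
 shows "tform n (\<beta> n p a) (\<beta> n p a) \<noteq> 0"
 unfolding bas_def using walks_walk[OF a(1)] wtp_le[OF a(1)] a
 by (intro form_Fpow_nonzero[OF hw_walks[OF a(1,2)] mu_norm[of "last p"]]) auto

lemma crd_bas: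
 assumes "p \<in> walks n" "q \<in> walks n" "n \<le> N" "a \<le> wtp p"
 shows "crd v n p a (\<beta> n q b) = (if p = q \<and> a = b then 1 else 0)"
 using bas_orth[OF assms(2,1,3), of b a] bas_norm[OF assms(1,3,4)] by (auto simp: crd_def)

definition idx :: "nat => ((nat \<times> nat) list \<times> nat) set" where
 "idx n = (SIGMA p:walks n. {..wtp p})"

lemma idx_frozen: "n \<le> N ==> (SIGMA p:walks n. {a. int a \<le> weight n (\<mu> p)}) = idx n"
 unfolding idx_def by (rule Sigma_cong) (auto simp: weight_walks)

lemma finite_idx [simp]: "finite (idx n)" by (simp add: idx_def)

abbreviation "SB n \<equiv> tvec.span ((\<lambda>(p, a). \<beta> n p a) ` idx n)"

lemma bas_SB: "p \<in> walks n ==> n \<le> N ==> \<beta> n p a \<in> SB n"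
proof (cases "a \<le> wtp p")
 case True
 assume "p \<in> walks n"
 with True show ?thesis by (intro tvec.span_base) (auto simp: idx_def image_iff intro!: bexI[of _ "(p, a)"])
qed (simp add: bas_zero tvec.span_zero)

lemma walks_Up: "p \<in> walks n ==> p @ [(Suc (fst (last p)), snd (last p))] \<in> walks (Suc n)"
 using walks_walk[of p n] walk.Up[of "fst (last p)" "snd (last p)" p] by (auto simp: walks_iff intro!: exI)

lemma walks_Diag:
 assumes "p \<in> walks n" "wtp p = Suc k"
 shows "p @ [(fst (last p), Suc (snd (last p)))] \<in> walks (Suc n)"
proof -
 have w: "walk (fst (last p), snd (last p)) p" "fst (last p) + snd (last p) = n"
  using walks_walk[OF assms(1)] by auto
 have "walk (fst (last p), Suc (snd (last p))) (p @ [(fst (last p), Suc (snd (last p)))])"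
  using w(1) by (rule walk.Diag) (use assms(2) in \<open>simp add: wtp_def\<close>)
 moreover have "fst (fst (last p), Suc (snd (last p))) + snd (fst (last p), Suc (snd (last p))) = Suc n"
  using w(2) by simp
 ultimately show ?thesis unfolding walks_iff by blast
qed

lemma mu_walks_Up: "p \<in> walks n ==> \<mu> (p @ [(Suc (fst (last p)), snd (last p))]) = ty (\<mu> p) 1"
 using walks_walk[of p n] mu_Up[of "fst (last p)" "snd (last p)" p] by simp

lemma mu_walks_Diag: "p \<in> walks n ==> n \<le> N ==>
  \<mu> (p @ [(fst (last p), Suc (snd (last p)))]) = Phi2k n (int (wtp p)) (\<mu> p)"
 using walks_walk[of p n] mu_Diag[of "fst (last p)" "snd (last p)" p] by (simp add: wtp_def)

text \<open>The basis spans. If b = \<mu>(p) has weight k, then v^{k+1} F^{a+1} \<Phi>_1(b) + F^a \<Phi>_2(b)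
 equals v^{a+1} [k + 1] F^a b \<otimes> y_{-1}; this puts F^a b \<otimes> y_{-1} into the span, and
 then F^{a+1} \<Phi>_1(b) yields F^{a+1} b \<otimes> y_1.\<close>

lemma TS_SB: "n \<le> N ==> x \<in> TS n ==> x \<in> SB n"
proof (induction n arbitrary: x)
 case 0
 have "[(0, 0)] \<in> walks 0" by (auto simp: walks_iff intro: walk.Nil)
 then have "ybasis [] \<in> SB 0" using bas_SB[of "[(0, 0)]" 0 0] by (simp add: bas_0 mu_Nil)
 moreover have "x = tscale (x []) (ybasis [])"
  using 0 by (auto simp: fun_eq_iff tscale_apply ybasis_def TS_def sign_words_0)
 ultimately show ?case using tvec.span_scale by metis
next
 case (Suc n)
 have m: "ty (\<beta> n p a) (-1) \<in> SB (Suc n)" if p: "p \<in> walks n" and a: "a \<le> wtp p" for p a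
 proof -
  let ?k = "wtp p" and ?b = "\<mu> p"
  have nN: "n \<le> N" using Suc.prems by simp
  have h: "hw n ?k ?b" and t: "?b \<in> TS n" using hw_walks[OF p nN] hw_TS by auto
  have up: "(F (Suc n) ^^ Suc a) (ty ?b 1) \<in> SB (Suc n)"
   using bas_SB[OF walks_Up[OF p] Suc.prems(1), of "Suc a"] by (simp only: bas_def mu_walks_Up[OF p])
  have di: "(F (Suc n) ^^ a) (Phi2k n (int ?k) ?b) \<in> SB (Suc n)"
  proof (cases ?k)
   case 0
   then have "F n ?b = 0" "a = 0" using h a by (auto simp: hw_def)
   then show ?thesis using 0 by (simp add: Phi2k_def tvec.span_zero)
  next
   case (Suc j)
   show ?thesis
    using bas_SB[OF walks_Diag[OF p Suc] Suc.prems(1), of a] by (simp only: bas_def mu_walks_Diag[OF p nN])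
  qed
  have "qint v (int ?k - int a) = qint v (- int (Suc a) + (int ?k + 1))" by simp
  (* the coefficient of the term ending in -1; the other terms of the combination cancel *)
  then have c1: "qint v (int ?k - int a) = v powi (int a + 1) * qint v (int ?k + 1) - v powi (int ?k + 1) * qint v (int (Suc a))"
   unfolding qint_add qint_uminus minus_minus by (simp add: add.commute)
  have c2: "v powi (int ?k + 1) * v powi (- int (Suc a)) = v powi (int ?k - int a)"
   using powi_add[of "int ?k + 1" "- int (Suc a)"] by simp
  have "tscale (v powi (int ?k + 1)) ((F (Suc n) ^^ Suc a) (ty ?b 1)) + (F (Suc n) ^^ a) (Phi2k n (int ?k) ?b)
    = tscale (v powi (int a + 1) * qint v (int ?k + 1)) (ty ((F n ^^ a) ?b) (-1))"
   unfolding Fpow_tensor_plus[OF t] Fpow_Phi2k[OF t] c1 c2[symmetric]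
   by (intro ext) (simp only: fun_app, simp add: algebra_simps)
  then have "tscale (v powi (int a + 1) * qint v (int ?k + 1)) (ty ((F n ^^ a) ?b) (-1)) \<in> SB (Suc n)"
   using tvec.span_add[OF tvec.span_scale[OF up] di] by metis
  moreover have "qint v (int ?k + 1) \<noteq> 0"
   by (rule qint_nonzero') (use wtp_le[OF p] Suc.prems in auto)
  then have "v powi (int a + 1) * qint v (int ?k + 1) \<noteq> 0" by (simp add: v_nonzero)
  ultimately show ?thesis
   unfolding bas_def by (blast intro: span_scale_cancel)
 qed
 have pl: "ty (\<beta> n p a) 1 \<in> SB (Suc n)" if p: "p \<in> walks n" and a: "a \<le> wtp p" for p a
 proof (cases a)
  case 0
  then show ?thesis using bas_SB[OF walks_Up[OF p] Suc.prems(1), of 0] by (simp add: bas_0 mu_walks_Up[OF p])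
 next
  case (Suc c)
  have nN: "n \<le> N" using Suc.prems by simp
  have t: "\<mu> p \<in> TS n" using hw_walks[OF p nN] hw_TS by auto
  have up: "(F (Suc n) ^^ Suc c) (ty (\<mu> p) 1) \<in> SB (Suc n)"
   using bas_SB[OF walks_Up[OF p] Suc.prems(1), of "Suc c"] by (simp only: bas_def mu_walks_Up[OF p])
  have "ty (\<beta> n p a) 1 = tscale (v powi (int (Suc c))) ((F (Suc n) ^^ Suc c) (ty (\<mu> p) 1)
    - tscale (qint v (int (Suc c))) (ty (\<beta> n p c) (-1)))"
   unfolding Fpow_tensor_plus[OF t] bas_def Suc using powi_cancel[of "- int (Suc c)"]
   by (intro ext) (simp only: fun_app minus_minus, simp add: algebra_simps del: funpow.simps of_nat_Suc flip: mult.assoc)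
  also have "\<dots> \<in> SB (Suc n)" using m[OF p, of c] a Suc by (intro tvec.span_scale tvec.span_diff up) auto
  finally show ?thesis .
 qed
 from Suc.prems(2) show ?case
 proof (induction rule: TS_Suc_induct)
  case (add a b)
  then show ?case by (rule tvec.span_add)
 next
  case (tensor a s)
  then have "a \<in> SB n" using Suc by simp
  then show ?case
  proof (induction rule: tvec.span_induct_alt)
   case base
   then show ?case by (simp add: tvec.span_zero)
  next
   case (step c x y)
   obtain p a where x: "x = \<beta> n p a" "p \<in> walks n" "a \<le> wtp p" using step(1) by (auto simp: idx_def)
   have "ty x s \<in> SB (Suc n)" using pl[OF x(2,3)] m[OF x(2,3)] tensor(2) by (auto simp: x(1))
   then show ?case using step(2) by (simp only: tensor_y_linear) (intro tvec.span_add tvec.span_scale)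
  qed
 qed
qed

lemma SB_TS: "n \<le> N ==> SB n = TS n"
proof -
 assume n: "n \<le> N"
 have "SB n \<subseteq> TS n"
  by (rule tvec.span_minimal[OF _ subspace_TS]) (auto simp: idx_def intro: bas_TS[OF _ n])
 then show ?thesis using TS_SB[OF n] by blast
qed

lemma expand:
 assumes "x \<in> TS n" "n \<le> N"
 shows "x = (\<Sum>(p, a)\<in>idx n. tscale (crd v n p a x) (\<beta> n p a))"
proof -
 have "x = (\<Sum>i\<in>idx n. tscale (tform n x (case i of (p, a) => \<beta> n p a) /
   tform n (case i of (p, a) => \<beta> n p a) (case i of (p, a) => \<beta> n p a)) (case i of (p, a) => \<beta> n p a))"
 proof (rule orth_expand)
  show "x \<in> SB n" using TS_SB assms by blast
 next
  fix i j assume "i \<in> idx n" "j \<in> idx n" "i \<noteq> j"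
  then show "tform n (case i of (p, a) => \<beta> n p a) (case j of (p, a) => \<beta> n p a) = 0"
   by (auto simp: idx_def intro!: bas_orth[OF _ _ assms(2)])
 next
  fix i assume "i \<in> idx n"
  then show "tform n (case i of (p, a) => \<beta> n p a) (case i of (p, a) => \<beta> n p a) \<noteq> 0"
   using bas_norm[OF _ assms(2)] by (auto simp: idx_def)
 qed simp
 then show ?thesis by (simp add: crd_def case_prod_unfold)
qed

lemma expand':
 assumes "x \<in> TS n" "n \<le> N"
 shows "x = (\<Sum>p\<in>walks n. \<Sum>a\<le>wtp p. tscale (crd v n p a x) (\<beta> n p a))"
 using expand[OF assms] unfolding idx_def by (simp only: sum.Sigma[OF finite_walks ballI[OF finite_atMost]])

lemma bas_induct [consumes 2, case_names zero add scale bas]: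
 assumes x: "x \<in> TS n" "n \<le> N" and "P 0" "\<And>a b. P a ==> P b ==> P (a + b)" "\<And>c a. P a ==> P (tscale c a)"
  "\<And>p a. p \<in> walks n ==> a \<le> wtp p ==> P (\<beta> n p a)"
 shows "P x"
proof -
 have "P (\<Sum>(p, a)\<in>S. tscale (crd v n p a x) (\<beta> n p a))" if "finite S" "S \<subseteq> idx n" for S
  using that by (induction S) (auto simp: idx_def intro!: assms)
 then have "P (\<Sum>(p, a)\<in>idx n. tscale (crd v n p a x) (\<beta> n p a))" by simp
 then show ?thesis using expand[OF x] by simp
qed

lemma munit_bas:
 assumes "p \<in> walks n" "r \<in> walks n" "n \<le> N" "wtp p = wtp q"  "q \<in> walks n"
 shows "munit v n q p (\<beta> n r a) = (if r = p then \<beta> n q a else 0)"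
proof -
 have "munit v n q p (\<beta> n r a) = (\<Sum>b\<le>wtp p. if b = a then (if r = p then \<beta> n q a else 0) else 0)"
  unfolding munit_def by (rule sum.cong) (auto simp: crd_bas[OF assms(1,2,3)])
 also have "\<dots> = (if r = p then \<beta> n q a else 0)"
  using bas_zero[OF assms(5,3), of a] assms(4) by (auto simp: not_le)
 finally show ?thesis .
qed

lemma munit_mu:
 assumes "p \<in> walks n" "r \<in> walks n" "n \<le> N" "wtp p = wtp q"  "q \<in> walks n"
 shows "munit v n q p (\<mu> r) = (if r = p then \<mu> q else 0)"
 using munit_bas[OF assms, of 0] by (simp add: bas_0)

text \<open>Linearity is required on tensor space only, so that restricted homomorphisms qualify.\<close>

definition intertw :: "nat => ('k tvec => 'k tvec) => bool" where
 "intertw n f \<longleftrightarrow> (\<forall>x\<in>TS n. \<forall>y\<in>TS n. f (x + y) = f x + f y) \<and> (\<forall>c. \<forall>x\<in>TS n. f (tscale c x) = tscale c (f x)) \<and>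
   (\<forall>x\<in>TS n. f x \<in> TS n \<and> f (E n x) = E n (f x) \<and> f (F n x) = F n (f x) \<and> (\<forall>i. f (op_idem i x) = op_idem i (f x)))"

lemma intertw_zero: "intertw n f ==> f 0 = 0"
proof -
 assume "intertw n f"
 then have "f (tscale 0 0) = tscale 0 (f 0)" unfolding intertw_def using TS_0 by blast
 then show ?thesis by simp
qed

lemma intertw_Fpow: "intertw n f ==> x \<in> TS n ==> f ((F n ^^ a) x) = (F n ^^ a) (f x)"
proof (induction a)
 case (Suc a)
 then have "f (F n ((F n ^^ a) x)) = F n (f ((F n ^^ a) x))" using Fpow_TS by (simp add: intertw_def)
 then show ?case using Suc by simp
qed simp

lemma intertw_bas: "intertw n f ==> p \<in> walks n ==> n \<le> N ==> f (\<beta> n p a) = (F n ^^ a) (f (\<mu> p))"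
 unfolding bas_def by (rule intertw_Fpow[OF _ hw_TS[OF hw_walks]])

text \<open>A commuting operator is determined by its values on the highest weight vectors, because these
 generate.\<close>

lemma intertw_eqI:
 assumes f: "intertw n f" and g: "intertw n g" and n: "n \<le> N"
  and eq: "\<And>p. p \<in> walks n ==> f (\<mu> p) = g (\<mu> p)" and x: "x \<in> TS n"
 shows "f x = g x"
proof -
 have "x \<in> TS n \<and> f x = g x" using x n
 proof (induction rule: bas_induct)
  case (bas p a)
  then show ?case using intertw_bas[OF f _ n] intertw_bas[OF g _ n] eq bas_TS n by simp
 qed (use f g in \<open>auto simp: intertw_zero intertw_def\<close>)
 then show ?thesis ..
qed

lemma munit_intertw:
 assumes pq: "p \<in> walks n" "q \<in> walks n" "n \<le> N" "wtp p = wtp q"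
 shows "intertw n (munit v n q p)"
proof -
 have T: "munit v n q p x \<in> TS n" for x
  unfolding munit_def by (intro TS_sum TS_scale bas_TS pq)
 have z: "munit v n q p 0 = 0" by (simp add: munit_def)
 note mb = munit_bas[OF pq(1) _ pq(3,4,2)]
 have "munit v n q p (E n x) = E n (munit v n q p x) \<and> munit v n q p (F n x) = F n (munit v n q p x) \<and>
   (\<forall>i. munit v n q p (op_idem i x) = op_idem i (munit v n q p x))" if "x \<in> TS n" for x
  using that pq(3)
 proof (induction rule: bas_induct)
  case (bas r a)
  have "munit v n q p (E n (\<beta> n r a)) = E n (munit v n q p (\<beta> n r a))"
   by (cases a) (auto simp: mb bas E_bas_0 E_bas_Suc pq munit_scale z)
  then show ?case using bas pq by (auto simp: mb F_bas idem_bas z)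
 qed (auto simp: munit_add munit_scale EF_linear op_idem_linear z)
 then show ?thesis unfolding intertw_def using T by (auto simp: munit_add munit_scale)
qed

lemma crd_maximal:
 assumes "x \<in> TS n" "E n x = 0" "p \<in> walks n" "n \<le> N"
 shows "crd v n p (Suc a) x = 0"
proof -
 have "tform n (F n (\<beta> n p a)) x = 0"
  using form_F[OF bas_wt[OF assms(3,4)] assms(1), of a] assms(2) by simp
 then show ?thesis by (simp add: crd_def F_bas tform_commute[of n x])
qed

lemma crd_wt:
 assumes "has_wt n k x" "p \<in> walks n" "n \<le> N" "k \<noteq> int (wtp p) - 2 * int a"
 shows "crd v n p a x = 0"
 using tform_wt[OF assms(1) bas_wt[OF assms(2,3)] assms(4)] by (simp add: crd_def)

text \<open>E acts injectively on the part of each string below its top, and the weight selects the strings.\<close>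

lemma maximal_expand:
 assumes l: "l \<in> two_row_partitions n" and n: "n \<le> N"
  and x: "has_wt n (int (fst l) - int (snd l)) x" "E n x = 0"
 shows "x = (\<Sum>p\<in>walks_to l. tscale (crd v n p 0 x) (\<mu> p))"
proof -
 have xT: "x \<in> TS n" using x has_wt_TS by blast
 have k: "int (wtp p) = int (fst l) - int (snd l) \<longleftrightarrow> last p = l" if "p \<in> walks n" for p
 proof -
  have "snd (last p) \<le> fst (last p)" using walks_walk[OF that] walk_props by blast
  moreover have "snd l \<le> fst l" "fst l + snd l = n" using l by (auto simp: two_row_partitions_def)
  ultimately show ?thesis using walks_walk[OF that] by (simp add: wtp_def prod_eq_iff) arith
 qed
 have s: "(\<Sum>a\<le>wtp p. tscale (crd v n p a x) (\<beta> n p a)) = tscale (crd v n p 0 x) (\<mu> p)" if "p \<in> walks n" for p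
 proof -
  have "(\<Sum>a\<le>wtp p. tscale (crd v n p a x) (\<beta> n p a)) = (\<Sum>a\<in>{0}. tscale (crd v n p a x) (\<beta> n p a))"
  proof (rule sum.mono_neutral_right)
   show "\<forall>a\<in>{..wtp p} - {0}. tscale (crd v n p a x) (\<beta> n p a) = 0"
   proof
    fix a assume "a \<in> {..wtp p} - {0}"
    then obtain c where "a = Suc c" by (cases a) auto
    then show "tscale (crd v n p a x) (\<beta> n p a) = 0" using crd_maximal[OF xT x(2) that n] by simp
   qed
  qed auto
  then show ?thesis by (simp add: bas_0)
 qed
 have "x = (\<Sum>p\<in>walks n. tscale (crd v n p 0 x) (\<mu> p))"
  using expand'[OF xT n] s by simp
 also have "\<dots> = (\<Sum>p\<in>walks_to l. tscale (crd v n p 0 x) (\<mu> p))"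
 proof (rule sum.mono_neutral_right)
  show "walks_to l \<subseteq> walks n" using walks_to_walks[OF l] by blast
  show "\<forall>p\<in>walks n - walks_to l. tscale (crd v n p 0 x) (\<mu> p) = 0"
  proof
   fix p assume p: "p \<in> walks n - walks_to l"
   then have "int (fst l) - int (snd l) \<noteq> int (wtp p) - 2 * int 0"
    using k[of p] walks_to_walks[OF l] by auto
   then have "crd v n p 0 x = 0" using crd_wt[OF x(1) _ n] p by blast
   then show "tscale (crd v n p 0 x) (\<mu> p) = 0" by simp
  qed
 qed simp
 finally show ?thesis .
qed

lemma intertw_mu_expand:
 assumes f: "intertw n f" and l: "l \<in> two_row_partitions n" and n: "n \<le> N" and p: "p \<in> walks_to l"
 shows "f (\<mu> p) = (\<Sum>q\<in>walks_to l. tscale (crd v n q 0 (f (\<mu> p))) (\<mu> q))"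
proof (rule maximal_expand[OF l n])
 have pw: "p \<in> walks n" "last p = l" using walks_to_walks[OF l] p by auto
 have h: "hw n (fst l - snd l) (\<mu> p)" using hw_walks[OF pw(1) n] pw(2) by (simp add: wtp_def)
 have le: "snd l \<le> fst l" using l by (auto simp: two_row_partitions_def)
 have T: "\<mu> p \<in> TS n" using h hw_TS by blast
 have fs: "f (\<mu> p) \<in> TS n" "f (E n (\<mu> p)) = E n (f (\<mu> p))" "f (op_idem i (\<mu> p)) = op_idem i (f (\<mu> p))" for i
  using f T unfolding intertw_def by blast+
 show "has_wt n (int (fst l) - int (snd l)) (f (\<mu> p))"
  using hw_wt[OF h] le fs(1) fs(3)[of "int (fst l - snd l)"] by (simp add: has_wt_def of_nat_diff)
 show "E n (f (\<mu> p)) = 0" using fs(2) h intertw_zero[OF f] by (simp add: hw_def)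
qed

text \<open>The matrix units span the commutant: a commuting operator preserves maximal vectors of each weight,
 so its matrix on the \<mu>(p) is block diagonal.\<close>

lemma intertw_expand:
 assumes f: "intertw n f" and n: "n \<le> N" and x: "x \<in> TS n"
 shows "f x = (\<Sum>p\<in>walks n. \<Sum>q\<in>walks_to (last p). tscale (crd v n q 0 (f (\<mu> p))) (munit v n q p x))"
proof -
 let ?g = "\<lambda>x. \<Sum>p\<in>walks n. \<Sum>q\<in>walks_to (last p). tscale (crd v n q 0 (f (\<mu> p))) (munit v n q p x)"
 have pq: "q \<in> walks n" "wtp p = wtp q" "last p = last q" if "p \<in> walks n" "q \<in> walks_to (last p)" for p q
  using walks_to_walks[OF last_two_row[OF that(1)]] that(2) by (auto simp: wtp_def)
 have mi: "intertw n (munit v n q p)" if "p \<in> walks n" "q \<in> walks_to (last p)" for p q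
  by (rule munit_intertw) (use pq[OF that] that n in auto)
 have "intertw n ?g" unfolding intertw_def
 proof (intro conjI ballI allI)
  fix x y :: "'k tvec" assume x: "x \<in> TS n" and y: "y \<in> TS n"
  show "?g (x + y) = ?g x + ?g y" by (simp add: munit_add tvec.scale_right_distrib sum.distrib)
 next
  fix x :: "'k tvec" and c show "?g (tscale c x) = tscale c (?g x)" by (simp add: munit_scale tvec.scale_sum_right mult.commute)
 next
  fix x :: "'k tvec" assume x: "x \<in> TS n"
  show "?g x \<in> TS n" using mi x by (intro TS_sum TS_scale) (simp add: intertw_def)
  have E0: "E n (sum h S) = (\<Sum>i\<in>S. E n (h i))" for h :: "_ => 'k tvec" and S :: "(nat \<times> nat) list set"
   by (induction S rule: infinite_finite_induct) (auto simp: op_E_add)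
  have F0: "F n (sum h S) = (\<Sum>i\<in>S. F n (h i))" for h :: "_ => 'k tvec" and S :: "(nat \<times> nat) list set"
   by (induction S rule: infinite_finite_induct) (auto simp: op_F_add)
  have I0: "op_idem j (sum h S) = (\<Sum>i\<in>S. op_idem j (h i :: 'k tvec))" for j h and S :: "(nat \<times> nat) list set"
   by (induction S rule: infinite_finite_induct) (auto simp: op_idem_add)
  show "?g (E n x) = E n (?g x)" unfolding E0 op_E_scale using mi x
   by (intro sum.cong refl) (simp add: intertw_def)
  show "?g (F n x) = F n (?g x)" unfolding F0 op_F_scale using mi x
   by (intro sum.cong refl) (simp add: intertw_def)
  show "?g (op_idem i x) = op_idem i (?g x)" for i unfolding I0 op_idem_scale using mi x
   by (intro sum.cong refl) (simp add: intertw_def)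
 qed
 then show ?thesis
 proof (rule intertw_eqI[OF f _ n _ x])
  fix r assume r: "r \<in> walks n"
  have "?g (\<mu> r) = (\<Sum>p\<in>walks n. if p = r then (\<Sum>q\<in>walks_to (last p). tscale (crd v n q 0 (f (\<mu> p))) (\<mu> q)) else 0)"
  proof (rule sum.cong[OF refl])
   fix p assume p: "p \<in> walks n"
   have "munit v n q p (\<mu> r) = (if p = r then \<mu> q else 0)" if "q \<in> walks_to (last p)" for q
    using munit_mu[OF p r n pq(2)[OF p that] pq(1)[OF p that]] by auto
   then show "(\<Sum>q\<in>walks_to (last p). tscale (crd v n q 0 (f (\<mu> p))) (munit v n q p (\<mu> r)))
     = (if p = r then (\<Sum>q\<in>walks_to (last p). tscale (crd v n q 0 (f (\<mu> p))) (\<mu> q)) else 0)"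
    by (cases "p = r") (auto intro!: sum.cong sum.neutral)
  qed
  also have "\<dots> = (\<Sum>q\<in>walks_to (last r). tscale (crd v n q 0 (f (\<mu> r))) (\<mu> q))"
   using r by simp
  also have "\<dots> = f (\<mu> r)"
   using intertw_mu_expand[OF f last_two_row[OF r] n, of r] walks_to_walks[OF last_two_row[OF r]] r by simp
  finally show "f (\<mu> r) = ?g (\<mu> r)" ..
 qed
qed

lemma mu_basis:
 assumes l: "l \<in> two_row_partitions n" and n: "n \<le> N"
 shows "is_basis (walks_to l) \<mu> (insert 0 (maximal_vectors v n (int (fst l) - int (snd l))))"
proof -
 let ?M = "{b. has_wt n (int (fst l) - int (snd l)) b \<and> E n b = 0}"
 have M: "insert 0 (maximal_vectors v n (int (fst l) - int (snd l))) = ?M"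
  by (auto simp: maximal_vectors_def weight_vector_iff has_wt_linear)
 have w: "p \<in> walks n" "last p = l" if "p \<in> walks_to l" for p using walks_to_walks[OF l] that by auto
 have le: "snd l \<le> fst l" using l by (auto simp: two_row_partitions_def)
 have mM: "\<mu> p \<in> ?M" if "p \<in> walks_to l" for p
  using hw_walks[OF w(1)[OF that] n] w(2)[OF that] le by (simp add: hw_def wtp_def of_nat_diff)
 have "tvec.span (\<mu> ` walks_to l) = ?M"
 proof
  show "tvec.span (\<mu> ` walks_to l) \<subseteq> ?M"
   by (rule tvec.span_minimal, use mM in blast)
    (rule tvec.subspaceI, auto simp: has_wt_linear EF_linear)
  show "?M \<subseteq> tvec.span (\<mu> ` walks_to l)"
  proof
   fix x assume "x \<in> ?M"
   then have "x = (\<Sum>p\<in>walks_to l. tscale (crd v n p 0 x) (\<mu> p))" using maximal_expand[OF l n] by blast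
   also have "\<dots> \<in> tvec.span (\<mu> ` walks_to l)" by (intro tvec.span_sum tvec.span_scale tvec.span_base) auto
   finally show "x \<in> tvec.span (\<mu> ` walks_to l)" .
  qed
 qed
 moreover have "is_basis (walks_to l) \<mu> (tvec.span (\<mu> ` walks_to l))"
 proof (rule orth_basis)
  fix i j assume "i \<in> walks_to l" "j \<in> walks_to l" "i \<noteq> j"
  then show "tform n (\<mu> i) (\<mu> j) = 0" using mu_orth'[OF w(1) w(1) n] by blast
 next
  fix i assume "i \<in> walks_to l"
  then show "tform n (\<mu> i) (\<mu> i) \<noteq> 0" using bas_norm[OF w(1) n, of i 0] by (simp add: bas_0)
 qed
 ultimately show ?thesis unfolding M by simp
qed

lemma bas_basis:
 assumes n: "n \<le> N"
 shows "is_basis (idx n) (\<lambda>(p, a). \<beta> n p a) (TS n)"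
 unfolding SB_TS[OF n, symmetric]
 by (rule orth_basis) (use bas_norm[OF _ n] in \<open>auto simp: idx_def intro!: bas_orth[OF _ _ n]\<close>)

lemma bas_orthogonal:
 assumes n: "n \<le> N"
 shows "pairwise_orthogonal n (idx n) (\<lambda>(p, a). \<beta> n p a)"
 by (auto simp: pairwise_orthogonal_def idx_def intro!: bas_orth[OF _ _ n])

lemma bas_string_basis:
 assumes n: "n \<le> N" and p: "p \<in> walks n"
 shows "is_basis {..wtp p} (\<beta> n p) (tvec.span (\<beta> n p ` {..wtp p}))"
 by (rule orth_basis) (use bas_norm[OF p n] in \<open>auto intro!: bas_orth[OF p p n]\<close>)

end

section \<open>Matrix units from the Temperley--Lieb algebra\<close>

abbreviation tl_gens :: "nat => nat set" where "tl_gens n \<equiv> {1..<n}"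
abbreviation TF :: "nat => (nat word \<Rightarrow>\<^sub>0 'k::field) set" where "TF n \<equiv> FA (tl_gens n)"

lemma presentation_tl: "presentation (tl_gens n) (tl_relations n \<delta>)"
proof
 have "x \<in> tl_relations n \<delta> ==> x \<in> TF n" for x
  unfolding tl_relations_def Let_def
  by (elim UnE CollectE exE conjE; hypsubst; intro FA_diff FA_mult FA_pscale FA_gen; assumption)
 then show "tl_relations n \<delta> \<subseteq> TF n" by blast
qed

lemma free_rep_tvec:
 assumes "\<And>i x y. g i (x + y) = g i x + g i y" "\<And>i c x. g i (tscale c x) = tscale c (g i x)"
 shows "free_rep tscale g"
 by unfold_locales (use assms in auto)

lemma (in free_rep) ev_commute:
 assumes p: "p \<in> FA G" and U: "subspace U" "x \<in> U" and g: "\<And>i y. i \<in> G ==> y \<in> U ==> g i y \<in> U"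
  and T: "\<And>x y. T (x + y) = T x + T y" "\<And>c x. T (scale c x) = scale c (T x)"
  and c: "\<And>i y. i \<in> G ==> y \<in> U ==> T (g i y) = g i (T y)"
 shows "T (ev p x) = ev p (T x)"
proof -
 have T0: "T 0 = 0" using T(2)[of 0 0] by simp
 have "ev p x \<in> U \<and> ev p (T x) = T (ev p x)"
  by (rule ev_word_induct[OF p, where P = "\<lambda>a b. a \<in> U \<and> b = T a"])
    (use U g T c T0 in \<open>auto simp: subspace_0 subspace_add subspace_scale\<close>)
 then show ?thesis by simp
qed

locale tl = quantum_N v N for v :: "'k::field" and N :: nat +
 fixes \<epsilon> \<delta> :: 'k
 assumes eps: "\<epsilon> = 1 \<or> \<epsilon> = -1" and delta: "\<delta> = \<epsilon> * (v + inverse v)"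
begin

lemma eps_square: "\<epsilon> * \<epsilon> = 1" and eps_nonzero: "\<epsilon> \<noteq> 0"
 using eps by auto

text \<open>The generator acts by - \<epsilon> times op_e, which turns the loop parameter - (v + v^{-1}) into
 \<delta>.\<close>

definition tlg :: "nat => nat => 'k tvec => 'k tvec" where
 "tlg n i x = tscale (- \<epsilon>) (e n i x)"

abbreviation "tlact n \<equiv> act tscale (tlg n)"

sublocale tlr: free_rep tscale "tlg n" for n
 by (rule free_rep_tvec) (simp_all only: tlg_def op_e_linear tvec.scale_right_distrib tvec.scale_scale mult.commute)

sublocale tlp: presentation "tl_gens n" "tl_relations n \<delta>" for n
 by (rule presentation_tl)

lemma tlg_TS: "i \<in> tl_gens n ==> x \<in> TS n ==> tlg n i x \<in> TS n"
 unfolding tlg_def by (rule TS_scale[OF e_TS]) auto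

lemma tlact_TS: "p \<in> TF n ==> x \<in> TS n ==> tlact n p x \<in> TS n"
 by (rule tlr.ev_induct[OF _ subspace_TS]) (auto intro: tlg_TS)

lemma tl_relations_act:
 assumes "r \<in> tl_relations n \<delta>" and x: "x \<in> TS n"
 shows "tlact n r x = 0"
proof -
 have ss: "\<epsilon> * (\<epsilon> * a) = a" for a using eps_square by (simp flip: mult.assoc)
 from assms(1) consider
   i where "r = gen i * gen i - pscale \<delta> (gen i)" "i \<in> tl_gens n"
  | i j where "r = gen i * gen j * gen i - gen i" "i \<in> tl_gens n" "j \<in> tl_gens n" "\<bar>int i - int j\<bar> = 1"
  | i j where "r = gen i * gen j - gen j * gen i" "i \<in> tl_gens n" "j \<in> tl_gens n" "\<bar>int i - int j\<bar> > 1"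
  unfolding tl_relations_def Let_def by blast
 then show ?thesis
 proof cases
  case 1
  have "e n i (e n i x) = tscale (- (v + inverse v)) (e n i x)" using e_square[OF x] 1 by auto
  then show ?thesis unfolding 1
   by (simp only: tlr.ev_diff tlr.ev_mult tlr.ev_pscale tlr.ev_gen tlg_def op_e_linear tvec.scale_scale delta right_minus_eq)
     (simp add: algebra_simps ss)
 next
  case 2
  then consider "j = Suc i" "Suc i < n" "1 \<le> i" | "i = Suc j" "Suc j < n" "1 \<le> j" by fastforce
  then have "e n i (e n j (e n i x)) = e n i x" using e_braid[OF x] by cases auto
  then show ?thesis unfolding 2
   by (simp only: tlr.ev_diff tlr.ev_mult tlr.ev_pscale tlr.ev_gen tlg_def op_e_linear tvec.scale_scale delta right_minus_eq)
     (simp add: algebra_simps ss)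
 next
  case 3
  then consider "Suc i < j" "j < n" "1 \<le> i" | "Suc j < i" "i < n" "1 \<le> j" by fastforce
  then have "e n i (e n j x) = e n j (e n i x)" using e_commute[OF x] by cases auto
  then show ?thesis unfolding 3
   by (simp only: tlr.ev_diff tlr.ev_mult tlr.ev_gen tlg_def op_e_linear tvec.scale_scale) simp
 qed
qed

abbreviation "IT n \<equiv> idl (tl_gens n) (tl_relations n \<delta>)"

lemma IT_act: "p \<in> IT n ==> x \<in> TS n ==> tlact n p x = 0"
 by (rule tlp.ev_I_zero[OF tlr.free_rep_axioms subspace_TS]) (auto intro: tlg_TS tl_relations_act)

lemma tlact_commute:
 assumes p: "p \<in> TF n" and x: "x \<in> TS n"
 shows "tlact n p (E n x) = E n (tlact n p x)" "tlact n p (F n x) = F n (tlact n p x)"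
  "tlact n p (op_idem i x) = op_idem i (tlact n p x)"
proof -
 have g: "\<And>i y. i \<in> tl_gens n ==> y \<in> TS n ==> tlg n i y \<in> TS n" by (rule tlg_TS)
 show "tlact n p (E n x) = E n (tlact n p x)"
  by (rule tlr.ev_commute[OF p subspace_TS x g, symmetric]) (simp_all add: EF_linear tlg_def e_E)
 show "tlact n p (F n x) = F n (tlact n p x)"
  by (rule tlr.ev_commute[OF p subspace_TS x g, symmetric]) (simp_all add: EF_linear tlg_def e_F)
 show "tlact n p (op_idem i x) = op_idem i (tlact n p x)"
  by (rule tlr.ev_commute[OF p subspace_TS x g, symmetric]) (simp_all add: op_idem_linear tlg_def e_idem)
qed

lemma tlact_intertw: "p \<in> TF n ==> intertw n (tlact n p)"
 unfolding intertw_def by (auto simp: tlr.ev_add_right tlr.ev_scale_right tlact_TS tlact_commute)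

lemma tlact_tensor_y:
 assumes p: "p \<in> TF n" and x: "x \<in> TS n" and s: "s \<in> {1, -1}"
 shows "tlact (Suc n) p (ty x s) = ty (tlact n p x) s"
proof -
 have "tlact n p x \<in> TS n \<and> tlact (Suc n) p (ty x s) = ty (tlact n p x) s"
  by (rule tlr.ev_word_induct[OF p, where P = "\<lambda>a b. a \<in> TS n \<and> b = ty a s"])
   (use x s in \<open>auto simp: tensor_y_linear tlg_TS, simp_all add: tlg_def op_e_tensor_y tensor_y_linear\<close>)
 then show ?thesis ..
qed

end

text \<open>A step is encoded by a boolean, true for a step up; the two steps can then be treated uniformly, and
 the complementary step is negation.\<close>

definition stp :: "bool => nat \<times> nat => nat \<times> nat" where
 "stp i l = (if i then (Suc (fst l), snd l) else (fst l, Suc (snd l)))"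

definition stp_ok :: "bool => nat \<times> nat => bool" where
 "stp_ok i l \<longleftrightarrow> i \<or> snd l < fst l"

lemma walk_stp: "walk l p ==> stp_ok i l ==> walk (stp i l) (p @ [stp i l])"
 using walk.Up[of "fst l" "snd l" p] walk.Diag[of "fst l" "snd l" p] by (auto simp: stp_def stp_ok_def)

lemma walks_stp: "p \<in> walks n ==> stp_ok i (last p) ==> p @ [stp i (last p)] \<in> walks (Suc n)"
proof -
 assume p: "p \<in> walks n" "stp_ok i (last p)"
 then have "walk (stp i (last p)) (p @ [stp i (last p)])" using walk_stp walks_walk by blast
 moreover have "fst (stp i (last p)) + snd (stp i (last p)) = Suc n" using walks_walk[OF p(1)] by (auto simp: stp_def)
 ultimately show ?thesis using walks_iff by blast
qed

lemma walks_Suc_cases: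
 assumes "p \<in> walks (Suc n)"
 obtains q i where "q \<in> walks n" "stp_ok i (last q)" "p = q @ [stp i (last q)]"
proof -
 have w: "walk (last p) p" "fst (last p) + snd (last p) = Suc n" using walks_walk[OF assms] by auto
 from w(1) show ?thesis
 proof (cases rule: walk.cases)
  case Nil
  then show ?thesis using w(2) by simp
 next
  case (Up a b q)
  have "last q = (a, b)" using walk_props[OF Up(3)] by blast
  moreover have "q \<in> walks n" using Up w(2) walks_iff by force
  ultimately show ?thesis using that[of q True] Up by (simp add: stp_ok_def stp_def)
 next
  case (Diag a b q)
  have "last q = (a, b)" using walk_props[OF Diag(3)] by blast
  moreover have "q \<in> walks n" using Diag w(2) walks_iff by force
  ultimately show ?thesis using that[of q False] Diag by (simp add: stp_ok_def stp_def)
 qed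
qed

lemma wtp_stp: "stp_ok i (last p) ==> p \<in> walks n ==> wtp (p @ [stp i (last p)]) = (if i then Suc (wtp p) else wtp p - 1)"
proof -
 assume p: "p \<in> walks n"
 then have "snd (last p) \<le> fst (last p)" using walks_walk walk_props by blast
 then show ?thesis by (auto simp: wtp_def stp_def)
qed

lemma stp_stp: "stp (\<not> i) (stp i l) = (Suc (fst l), Suc (snd l))"
 by (auto simp: stp_def)

lemma stp_inj: "stp i l = stp j l \<longleftrightarrow> i = j"
 by (auto simp: stp_def prod_eq_iff)

context tl begin

text \<open>The map \<Phi>_1 or \<Phi>_2 belonging to a step.\<close>

definition Phi :: "nat => int => bool => 'k tvec => 'k tvec" where
 "Phi n k i b = (if i then ty b 1 else Phi2k n k b)"

lemma Phi_zero [simp]: "Phi n k i 0 = 0" by (simp add: Phi_def)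
lemma mu_stp: "p \<in> walks n ==> stp_ok i (last p) ==> n \<le> N ==>
  \<mu> (p @ [stp i (last p)]) = Phi n (int (wtp p)) i (\<mu> p)"
 by (auto simp: Phi_def stp_def mu_walks_Up mu_walks_Diag)

lemma tlact_Phi:
 assumes p: "p \<in> TF n" and x: "x \<in> TS n"
 shows "tlact (Suc n) p (Phi n k i x) = Phi n k i (tlact n p x)"
 unfolding Phi_def Phi2k_def
 by (simp add: tlr.ev_diff_right tlr.ev_scale_right tlact_tensor_y[OF p x] tlact_tensor_y[OF p F_TS[OF x]]
   tlact_commute[OF p x])

lemma e_Phi_same:
 assumes b: "b \<in> TS m" "has_wt m k b"
 shows "e (Suc (Suc m)) (Suc m) (Phi (Suc m) (if i then k + 1 else k - 1) i (Phi m k i b)) = 0"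
proof (cases i)
 case True
 then show ?thesis by (simp add: Phi_def e_last_simps[OF b(1)])
next
 case False
 have F1: "F m b \<in> TS m" and F2: "F m (F m b) \<in> TS m" using b by auto
 have q: "v * qint v k - v powi k = qint v (k - 1)"
 proof -
  have "qint v k = inverse v * qint v (k - 1) + v powi (k - 1)" using qint_Suc'[of "k - 1"] by simp
  then show ?thesis using v_nonzero v_powi_1[of "k - 1"] by (simp add: algebra_simps)
 qed
 have p: "v powi k = v * v powi (k - 1)" by (simp add: v_powi_1)
 have FP: "F (Suc m) (Phi2k m k b) = tscale (qint v (k - 1)) (ty (F m b) (-1)) - tscale (v powi (k - 1)) (ty (F m (F m b)) 1)"
  using Fpow_Phi2k[OF b(1), of 1 k] by simp
 show ?thesis
  by (simp add: False Phi_def Phi2k_def[of "Suc m"] FP)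
   (simp add: Phi2k_def tensor_y_linear op_e_linear e_last_simps[OF b(1)] e_last_simps[OF F1] e_last_simps[OF F2],
    simp add: p v_nonzero fun_eq_iff fun_app algebra_simps)
qed

text \<open>The factor produced by the last generator on a vector that first makes the step i from weight k and
 then the opposite step.\<close>

definition ecoeff :: "int => bool => 'k" where
 "ecoeff k i = (if i then - qint v (k + 2) else qint v k)"

text \<open>Two opposite steps from b, in either order, give two vectors. The generator maps both to the line of
 the singlet, which is 1/[k + 1] times their difference.\<close>

lemma e_Phi_diff:
 assumes b: "b \<in> TS m"
 shows "e (Suc (Suc m)) (Suc m) (Phi (Suc m) (if i then k + 1 else k - 1) (\<not> i) (Phi m k i b)) = tscale (ecoeff k i) (singlet v b)"
  (is "?A = ?B")
  and "tscale (qint v (k + 1)) (singlet v b) = Phi (Suc m) (k + 1) False (Phi m k True b) - Phi (Suc m) (k - 1) True (Phi m k False b)"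
  (is "?C = ?D")
proof -
 have F1: "F m b \<in> TS m" using b by auto
 have q: "qint v (k + 2) = inverse v * qint v (k + 1) + v powi (k + 1)" using qint_Suc'[of "k + 1"] by (simp add: add.commute)
 show "?A = ?B"
 proof (cases i)
  case True
  have "?A = tscale (- (inverse v * qint v (k + 1)) - v powi (k + 1)) (singlet v b)"
   by (simp add: True Phi_def Phi2k_def F_plus[OF b])
    (simp add: tensor_y_linear op_e_linear e_last_simps[OF b] e_last_simps[OF F1] tvec.scale_left_diff_distrib
     tvec.scale_right_distrib mult.commute)
  then show ?thesis by (simp add: True ecoeff_def q)
 next
  case False
  then show ?thesis
   by (simp add: Phi_def Phi2k_def tensor_y_linear op_e_linear e_last_simps[OF b] e_last_simps[OF F1] ecoeff_def)
 qed
 have q2: "v * qint v (k + 1) = qint v k + v powi (k + 1)"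
  using qint_Suc'[of k] v_nonzero v_powi_1[of k] by (simp add: algebra_simps)
 have p: "v powi (k + 1) = v * v powi k" "v powi (1 + k) = v * v powi k" by (simp_all add: v_powi_1 add.commute)
 have "?D = tscale (qint v (k + 1)) (ty (ty b 1) (-1)) - tscale (v powi (k + 1) + qint v k) (ty (ty b (-1)) 1)"
  unfolding Phi_def Phi2k_def by (simp only: if_True if_False F_plus[OF b] tensor_y_linear)
   (simp add: p v_nonzero fun_eq_iff fun_app algebra_simps)
 also have "v powi (k + 1) + qint v k = v * qint v (k + 1)" using q2 by (simp add: add.commute)
 also have "tscale (qint v (k + 1)) (ty (ty b 1) (-1)) - tscale (v * qint v (k + 1)) (ty (ty b (-1)) 1) = ?C"
  by (simp add: singlet_def tvec.scale_right_diff_distrib mult.commute)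
 finally show "?C = ?D" ..
qed

text \<open>Elements of the free algebra acting as the matrix units; only their classes in the Temperley--Lieb
 algebra matter.\<close>

definition is_tu :: "nat => (nat \<times> nat) list => (nat \<times> nat) list => (nat word \<Rightarrow>\<^sub>0 'k) => bool" where
 "is_tu n q p t \<longleftrightarrow> t \<in> TF n \<and> (\<forall>x\<in>TS n. tlact n t x = munit v n q p x)"

lemma is_tuI:
 assumes n: "n \<le> N" and pq: "p \<in> walks n" "q \<in> walks n" "last p = last q" and t: "t \<in> TF n"
  and mu: "\<And>r. r \<in> walks n ==> tlact n t (\<mu> r) = (if r = p then \<mu> q else 0)"
 shows "is_tu n q p t"
 unfolding is_tu_def
proof (intro conjI ballI t)
 fix x :: "'k tvec" assume x: "x \<in> TS n"
 have w: "wtp p = wtp q" using pq by (simp add: wtp_def)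
 show "tlact n t x = munit v n q p x"
  by (rule intertw_eqI[OF tlact_intertw[OF t] munit_intertw[OF pq(1,2) n w] n _ x])
   (simp add: mu munit_mu[OF pq(1) _ n w pq(2)])
qed

lemma is_tu_mu:
 assumes "is_tu n q p t" "n \<le> N" "p \<in> walks n" "q \<in> walks n" "last p = last q" "r \<in> walks n"
 shows "tlact n t (\<mu> r) = (if r = p then \<mu> q else 0)"
 using assms munit_mu[of p n r q] hw_TS[OF hw_walks[OF assms(6,2)]] by (simp add: is_tu_def wtp_def)

text \<open>Elements of level n act on n + 1 factors without touching the last step of a walk.\<close>

lemma is_tu_lift:
 assumes t: "is_tu n q p t" and n: "Suc n \<le> N" and pq: "p \<in> walks n" "q \<in> walks n" "last p = last q"
  and r: "r \<in> walks n" "stp_ok i (last r)"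
 shows "tlact (Suc n) t (\<mu> (r @ [stp i (last r)])) = (if r = p then \<mu> (q @ [stp i (last r)]) else 0)"
proof -
 have nN: "n \<le> N" using n by simp
 have tF: "t \<in> TF n" using t by (simp add: is_tu_def)
 have "tlact (Suc n) t (\<mu> (r @ [stp i (last r)])) = Phi n (int (wtp r)) i (tlact n t (\<mu> r))"
  by (simp add: mu_stp[OF r nN] tlact_Phi[OF tF hw_TS[OF hw_walks[OF r(1) nN]]])
 also have "\<dots> = Phi n (int (wtp r)) i (if r = p then \<mu> q else 0)"
  by (simp add: is_tu_mu[OF t nN pq r(1)])
 also have "\<dots> = (if r = p then \<mu> (q @ [stp i (last r)]) else 0)"
  using mu_stp[OF pq(2) _ nN, of i] r pq(3) by (auto simp: wtp_def)
 finally show ?thesis .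
qed

lemma e_mu_same:
 assumes R: "R \<in> walks m" "stp_ok i (last R)" "stp_ok i (stp i (last R))" and n: "Suc (Suc m) \<le> N"
 shows "e (Suc (Suc m)) (Suc m) (\<mu> (R @ [stp i (last R)] @ [stp i (stp i (last R))])) = 0"
proof -
 have mN: "m \<le> N" "Suc m \<le> N" using n by auto
 have "stp_ok i (last (R @ [stp i (last R)]))" using R by simp
 from mu_stp[OF walks_stp[OF R(1,2)] this mN(2)]
 have m: "\<mu> (R @ [stp i (last R)] @ [stp i (stp i (last R))])
  = Phi (Suc m) (int (wtp (R @ [stp i (last R)]))) i (Phi m (int (wtp R)) i (\<mu> R))"
  by (simp add: mu_stp[OF R(1,2) mN(1)])
 have k: "int (wtp (R @ [stp i (last R)])) = (if i then int (wtp R) + 1 else int (wtp R) - 1)"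
  using wtp_stp[OF R(2,1)] R(2) by (auto simp: stp_ok_def wtp_def)
 show ?thesis unfolding m k
  by (rule e_Phi_same[OF hw_TS[OF hw_walks[OF R(1) mN(1)]] hw_wt[OF hw_walks[OF R(1) mN(1)]]])
qed

lemma mu_two_steps:
 assumes R: "R \<in> walks m" "stp_ok i (last R)" and n: "Suc (Suc m) \<le> N"
 shows "\<mu> (R @ [stp i (last R)] @ [(Suc (fst (last R)), Suc (snd (last R)))])
  = Phi (Suc m) (if i then int (wtp R) + 1 else int (wtp R) - 1) (\<not> i) (Phi m (int (wtp R)) i (\<mu> R))"
proof -
 have mN: "m \<le> N" "Suc m \<le> N" using n by auto
 have le: "snd (last R) \<le> fst (last R)" using walks_walk[OF R(1)] walk_props by blast
 then have "stp_ok (\<not> i) (last (R @ [stp i (last R)]))" using R by (auto simp: stp_ok_def stp_def)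
 from mu_stp[OF walks_stp[OF R(1,2)] this mN(2)]
 have m: "\<mu> (R @ [stp i (last R)] @ [(Suc (fst (last R)), Suc (snd (last R)))])
  = Phi (Suc m) (int (wtp (R @ [stp i (last R)]))) (\<not> i) (Phi m (int (wtp R)) i (\<mu> R))"
  using stp_stp[of i "last R"] by (simp add: mu_stp[OF R(1,2) mN(1)])
 have k: "int (wtp (R @ [stp i (last R)])) = (if i then int (wtp R) + 1 else int (wtp R) - 1)"
  using wtp_stp[OF R(2,1)] R(2) by (auto simp: stp_ok_def wtp_def)
 show ?thesis unfolding m k ..
qed

lemma ecoeff_nonzero: "R \<in> walks m ==> stp_ok i (last R) ==> Suc (Suc m) \<le> N ==> ecoeff (int (wtp R)) i \<noteq> 0"
proof -
 assume R: "R \<in> walks m" "stp_ok i (last R)" "Suc (Suc m) \<le> N"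
 have "qint v (int (wtp R) + 2) \<noteq> 0" by (rule qint_nonzero') (use wtp_le[OF R(1)] R(3) in auto)
 moreover have "qint v (int (wtp R)) \<noteq> 0" if "\<not> i"
  by (rule qint_nonzero') (use that wtp_le[OF R(1)] R in \<open>auto simp: stp_ok_def wtp_def\<close>)
 ultimately show ?thesis by (auto simp: ecoeff_def)
qed

text \<open>The unit on the right leads from p to the extension of R by the step j; adding the opposite step and
 applying e produces the singlet over \<mu>(R), which has a nonzero component along each available
 extension of R by two opposite steps; the unit on the left selects the one that starts with i.\<close>

lemma sandwich_act:
 assumes n: "Suc (Suc m) \<le> N" and R: "R \<in> walks m"
  and q: "q \<in> walks (Suc m)" "last q = stp i (last R)" "stp_ok i (last R)"
  and p: "p \<in> walks (Suc m)" "last p = stp j (last R)" "stp_ok j (last R)"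
  and tq: "is_tu (Suc m) q (R @ [stp i (last R)]) tq"
  and tp: "is_tu (Suc m) (R @ [stp j (last R)]) p tp"
 defines "l \<equiv> (Suc (fst (last R)), Suc (snd (last R)))"
 shows "\<exists>c. c \<noteq> 0 \<and> (\<forall>r\<in>walks (Suc (Suc m)).
   tlact (Suc (Suc m)) (tq * gen (Suc m) * tp) (\<mu> r) = (if r = p @ [l] then tscale c (\<mu> (q @ [l])) else 0))"
proof -
 let ?n = "Suc (Suc m)" and ?k = "int (wtp R)"
 have mN: "m \<le> N" "Suc m \<le> N" using n by auto
 have Rw: "R @ [stp i (last R)] \<in> walks (Suc m)" "R @ [stp j (last R)] \<in> walks (Suc m)"
  using walks_stp R q(3) p(3) by blast+
 have le: "snd (last R) \<le> fst (last R)" using walks_walk[OF R] walk_props by blast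
 have ok': "stp_ok (\<not> i) (stp i (last R))" if "stp_ok i (last R)" for i
  using that le by (auto simp: stp_ok_def stp_def)
 have l: "l = stp (\<not> i) (stp i (last R))" for i by (simp add: l_def stp_stp)
 (* the sign records that the extension starting with a step down enters the singlet with coefficient -1 *)
 define c where "c = - \<epsilon> * ecoeff ?k j * inverse (qint v (?k + 1)) * (if i then 1 else - 1)"
 have qk: "qint v (?k + 1) \<noteq> 0" by (rule qint_nonzero') (use wtp_le[OF R] n in auto)
 have "c \<noteq> 0" using ecoeff_nonzero[OF R p(3) n] qk eps_nonzero by (auto simp: c_def)
 moreover have "tlact ?n (tq * gen (Suc m) * tp) (\<mu> r) = (if r = p @ [l] then tscale c (\<mu> (q @ [l])) else 0)"
  if r: "r \<in> walks ?n" for r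
 proof -
  obtain r' s where r': "r' \<in> walks (Suc m)" "stp_ok s (last r')" "r = r' @ [stp s (last r')]"
   using walks_Suc_cases[OF r] .
  have lastR: "last (R @ [stp j (last R)]) = last p" using p by simp
  have 1: "tlact ?n tp (\<mu> r) = (if r' = p then \<mu> ((R @ [stp j (last R)]) @ [stp s (last r')]) else 0)"
   unfolding r'(3) by (rule is_tu_lift[OF tp n p(1) Rw(2) _ r'(1,2)]) (simp add: p)
  show ?thesis
  proof (cases "r' = p")
   case False
   then have "r \<noteq> p @ [l]" using r'(3) by auto
   then show ?thesis using False 1 by (simp add: tlr.ev_mult tlg_def)
  next
   case True
   then have rl: "r = p @ [l] \<longleftrightarrow> s = (\<not> j)"
    unfolding l[of j] using r'(3) p(2) stp_inj by simp
   have okR: "stp_ok s (stp j (last R))" using r'(2) True p(2) by simp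
   show ?thesis
   proof (cases "s = j")
    case same: True
    have "e ?n (Suc m) (\<mu> ((R @ [stp j (last R)]) @ [stp s (last r')])) = 0"
     using e_mu_same[OF R p(3) _ n] okR True p(2) same by simp
    then show ?thesis using 1 True same rl by (simp add: tlr.ev_mult tlg_def)
   next
    case False
    then have s: "s = (\<not> j)" by auto
    let ?b = "\<mu> R"
    have bT: "?b \<in> TS m" using hw_TS[OF hw_walks[OF R mN(1)]] .
    have "e ?n (Suc m) (\<mu> ((R @ [stp j (last R)]) @ [stp s (last r')])) = tscale (ecoeff ?k j) (singlet v ?b)"
     using mu_two_steps[OF R p(3) n] e_Phi_diff(1)[OF bT, of j ?k] True p(2) s stp_stp[of j "last R"] by simp
    then have 2: "tlact ?n (gen (Suc m) * tp) (\<mu> r) = tscale (- \<epsilon> * ecoeff ?k j) (singlet v ?b)"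
     using 1 True by (simp add: tlr.ev_mult tlg_def)
    have lift: "tlact ?n tq (\<mu> ((R @ [stp s (last R)]) @ [l])) = (if s = i then \<mu> (q @ [l]) else 0)"
     if s: "stp_ok s (last R)" for s
    proof -
     have w: "R @ [stp s (last R)] \<in> walks (Suc m)" using walks_stp[OF R s] .
     have o: "stp_ok (\<not> s) (last (R @ [stp s (last R)]))" using ok'[OF s] by simp
     have "last (R @ [stp i (last R)]) = last q" using q by simp
     from is_tu_lift[OF tq n Rw(1) q(1) this w o] show ?thesis
      using stp_inj[of s "last R" i] by (simp add: l_def stp_stp)
    qed
    have 3: "tscale (qint v (?k + 1)) (tlact ?n tq (singlet v ?b)) = tscale (if i then 1 else - 1) (\<mu> (q @ [l]))"
    proof -
     let ?u = "Phi (Suc m) (?k + 1) False (Phi m ?k True ?b)" and ?w = "Phi (Suc m) (?k - 1) True (Phi m ?k False ?b)"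
     have u: "?u = \<mu> ((R @ [stp True (last R)]) @ [l])"
      using mu_two_steps[OF R _ n, of True] by (simp add: stp_ok_def l_def)
     have tu: "tlact ?n tq ?u = (if i then \<mu> (q @ [l]) else 0)"
      unfolding u using lift[of True] by (simp add: stp_ok_def)
     (* for weight 0 the step down is not available, and the corresponding vector is zero *)
     have tw: "tlact ?n tq ?w = (if i then 0 else \<mu> (q @ [l]))"
     proof (cases "stp_ok False (last R)")
      case True
      have "?w = \<mu> ((R @ [stp False (last R)]) @ [l])"
       using mu_two_steps[OF R True n] by (simp add: l_def)
      then show ?thesis using lift[OF True] by simp
     next
      case False
      then have k0: "wtp R = 0" and i using q(3) by (auto simp: stp_ok_def wtp_def)
      have "F m ?b = 0" using hw_walks[OF R mN(1)] k0 by (simp add: hw_def)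
      then have "Phi m ?k False ?b = 0" by (simp add: Phi_def Phi2k_def k0)
      then show ?thesis using \<open>i\<close> by simp
     qed
     have "tscale (qint v (?k + 1)) (tlact ?n tq (singlet v ?b)) = tlact ?n tq (tscale (qint v (?k + 1)) (singlet v ?b))"
      by (simp only: tlr.ev_scale_right)
     also have "\<dots> = tlact ?n tq ?u - tlact ?n tq ?w"
      by (simp only: e_Phi_diff(2)[OF bT] tlr.ev_diff_right)
     finally show ?thesis unfolding tu tw by auto
    qed
    have "tlact ?n tq (singlet v ?b) = tscale (inverse (qint v (?k + 1))) (tscale (qint v (?k + 1)) (tlact ?n tq (singlet v ?b)))"
     using qk by simp
    then have 4: "tlact ?n tq (singlet v ?b) = tscale (inverse (qint v (?k + 1)) * (if i then 1 else - 1)) (\<mu> (q @ [l]))"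
     unfolding 3 by (simp only: tvec.scale_scale)
    have "tlact ?n (tq * gen (Suc m) * tp) (\<mu> r) = tscale (- \<epsilon> * ecoeff ?k j) (tlact ?n tq (singlet v ?b))"
     using 2 by (simp only: mult.assoc tlr.ev_mult tlr.ev_scale_right)
    then show ?thesis unfolding 4 using rl s by (simp only: tvec.scale_scale c_def mult.assoc simp_thms if_True)
   qed
  qed
 qed
 ultimately show ?thesis by blast
qed

lemma walk_Suc_parts:
 assumes "P \<in> walks (Suc n)"
 shows "butlast P \<in> walks n" "\<exists>i. stp_ok i (last (butlast P)) \<and> last P = stp i (last (butlast P))" "P = butlast P @ [last P]"
proof -
 obtain q i where "q \<in> walks n" "stp_ok i (last q)" "P = q @ [stp i (last q)]"
  using walks_Suc_cases[OF assms] .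
 then show "butlast P \<in> walks n" "\<exists>i. stp_ok i (last (butlast P)) \<and> last P = stp i (last (butlast P))"
  "P = butlast P @ [last P]" by auto
qed

text \<open>A walk ending one box further in each row than R passes, one step before its end, through a
 neighbour of the end of R.\<close>

lemma walk_shrink:
 assumes P: "P \<in> walks (Suc (Suc m))" and R: "last P = (Suc (fst (last R)), Suc (snd (last R)))" and Rw: "R \<in> walks m"
 shows "\<exists>i. stp_ok i (last R) \<and> last (butlast P) = stp i (last R)"
proof -
 obtain j where j: "stp_ok j (last (butlast P))" "last P = stp j (last (butlast P))" using walk_Suc_parts[OF P] by blast
 have "last (butlast P) = stp (\<not> j) (last R)" using j(2) R by (cases j) (auto simp: stp_def prod_eq_iff)
 moreover have "stp_ok (\<not> j) (last R)"
 proof (cases j)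
  case True
  have "snd (last (butlast P)) \<le> fst (last (butlast P))"
   using walks_walk[OF walk_Suc_parts(1)[OF P]] walk_props by blast
  then show ?thesis using True calculation by (auto simp: stp_ok_def stp_def)
 qed (simp add: stp_ok_def)
 ultimately show ?thesis by blast
qed

lemma walk_single_row: "walk l p ==> snd l = 0 ==> walk l q ==> p = q"
proof (induction arbitrary: q rule: walk.induct)
 case Nil
 then show ?case by (auto elim: walk.cases)
next
 case (Up a b p)
 from Up.prems(2) show ?case
  by (cases rule: walk.cases) (use Up in auto)
qed simp

definition shrink :: "nat \<times> nat => nat \<times> nat" where "shrink l = (fst l - 1, snd l - 1)"

text \<open>A fixed walk for each end; the elements built from it below depend on the choice only up to the
 ideal.\<close>

definition some_walk :: "nat \<times> nat => (nat \<times> nat) list" where "some_walk l = (SOME p. walk l p)"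

lemma some_walk_shrink:
 assumes P: "P \<in> walks (Suc (Suc m))" and "snd (last P) \<noteq> 0"
 shows "some_walk (shrink (last P)) \<in> walks m"
  "last P = (Suc (fst (last (some_walk (shrink (last P))))), Suc (snd (last (some_walk (shrink (last P))))))"
proof -
 have le: "snd (last P) \<le> fst (last P)" using walks_walk[OF P] walk_props by blast
 have w: "walk (shrink (last P)) (some_walk (shrink (last P)))"
  unfolding some_walk_def by (rule someI_ex) (use le in \<open>auto simp: shrink_def intro!: walk_exists\<close>)
 have l: "last (some_walk (shrink (last P))) = shrink (last P)" using walk_props[OF w] by blast
 have "fst (shrink (last P)) + snd (shrink (last P)) = m"
  using walks_walk[OF P] le assms(2) by (auto simp: shrink_def)
 then show "some_walk (shrink (last P)) \<in> walks m" using w walks_iff by blast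
 show "last P = (Suc (fst (last (some_walk (shrink (last P))))), Suc (snd (last (some_walk (shrink (last P))))))"
  unfolding l using le assms(2) by (simp add: shrink_def prod_eq_iff)
qed

lemma two_rows_length: "P \<in> walks n ==> snd (last P) \<noteq> 0 ==> \<exists>m. n = Suc (Suc m)"
proof -
 assume P: "P \<in> walks n" "snd (last P) \<noteq> 0"
 have "snd (last P) \<le> fst (last P)" "fst (last P) + snd (last P) = n" using walks_walk[OF P(1)] walk_props by blast+
 then have "n \<ge> 2" using P(2) by linarith
 then show ?thesis by (metis Suc_le_D numeral_2_eq_2 Suc_le_mono)
qed

text \<open>By induction on n: sandwich elements give all units for ends with a nonempty second row, and the
 identity minus these diagonal units gives the only remaining one.\<close>

theorem tu_exists:
 "n \<le> N ==> p \<in> walks n ==> q \<in> walks n ==> last p = last q ==> \<exists>t. is_tu n q p t"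
proof (induction n arbitrary: p q rule: less_induct)
 case (less n)
 have two: "\<exists>t. is_tu n q p t" if pq: "p \<in> walks n" "q \<in> walks n" "last p = last q" "snd (last p) \<noteq> 0" for p q
 proof -
  obtain m where n: "n = Suc (Suc m)" using two_rows_length[OF pq(1,4)] by blast
  let ?R = "some_walk (shrink (last p))"
  have p: "p \<in> walks (Suc (Suc m))" and q: "q \<in> walks (Suc (Suc m))" using pq n by auto
  note R = some_walk_shrink[OF p pq(4)]
  obtain i where i: "stp_ok i (last ?R)" "last (butlast q) = stp i (last ?R)"
   using walk_shrink[OF q _ R(1)] R(2) pq(3) by auto
  obtain j where j: "stp_ok j (last ?R)" "last (butlast p) = stp j (last ?R)"
   using walk_shrink[OF p R(2) R(1)] by auto
  note bq = walk_Suc_parts[OF q] and bp = walk_Suc_parts[OF p]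
  have mN: "Suc (Suc m) \<le> N" "Suc m < n" "Suc m \<le> N" using less.prems n by auto
  obtain tq where tq: "is_tu (Suc m) (butlast q) (?R @ [stp i (last ?R)]) tq"
   using less.IH[OF mN(2,3) walks_stp[OF R(1) i(1)] bq(1)] i(2) by auto
  obtain tp where tp: "is_tu (Suc m) (?R @ [stp j (last ?R)]) (butlast p) tp"
   using less.IH[OF mN(2,3) bp(1) walks_stp[OF R(1) j(1)]] j(2) by auto
  obtain c where c: "c \<noteq> 0" "\<And>r. r\<in>walks (Suc (Suc m)) ==>
    tlact (Suc (Suc m)) (tq * gen (Suc m) * tp) (\<mu> r) = (if r = p then tscale c (\<mu> q) else 0)"
   using sandwich_act[OF mN(1) R(1) bq(1) i(2,1) bp(1) j(2,1) tq tp] bq(3) bp(3) R(2) pq(3) by metis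
  have tF: "tq \<in> TF (Suc m)" "tp \<in> TF (Suc m)" using tp tq by (auto simp: is_tu_def)
  have F: "TF (Suc m) \<subseteq> TF n" by (rule FA_mono) (auto simp: n)
  have "tq * gen (Suc m) * tp \<in> TF n"
   using tF F n by (intro FA_mult FA_gen) auto
  then have "is_tu n q p (pscale (inverse c) (tq * gen (Suc m) * tp))"
   using pq c by (intro is_tuI) (auto simp: n tlr.ev_pscale mN intro: FA_pscale)
  then show ?thesis ..
 qed
 show ?case
 proof (cases "snd (last p) = 0")
  case False
  then show ?thesis using two less.prems by blast
 next
  case True
  have qp: "q = p" using walk_single_row[OF _ True, of p q] walks_walk less.prems by metis
  let ?S = "walks n - {p}"
  have other: "snd (last r) \<noteq> 0" if r: "r \<in> ?S" for r
  proof
   assume "snd (last r) = 0"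
   then have "last r = last p" using True walks_walk[of r n] walks_walk[of p n] r less.prems by (auto simp: prod_eq_iff)
   then show False using walk_single_row[OF _ True, of p r] walks_walk[of r n] walks_walk[of p n] r less.prems by auto
  qed
  define t where "t r = (SOME t. is_tu n r r t)" for r
  have t: "is_tu n r r (t r)" if "r \<in> ?S" for r
   unfolding t_def by (rule someI_ex) (use two[of r r] other that in auto)
  have "is_tu n p p (1 - (\<Sum>r\<in>?S. t r))"
  proof (rule is_tuI)
   show "1 - (\<Sum>r\<in>?S. t r) \<in> TF n"
    using t by (intro FA_diff FA_sum FA_1) (auto simp: is_tu_def)
   fix s assume s: "s \<in> walks n"
   have "(\<Sum>r\<in>?S. tlact n (t r) (\<mu> s)) = (\<Sum>r\<in>?S. if r = s then \<mu> s else 0)"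
    by (rule sum.cong) (auto simp: is_tu_mu[OF t less.prems(1) _ _ _ s])
   also have "\<dots> = (if s = p then 0 else \<mu> s)" using s by simp
   finally show "tlact n (1 - (\<Sum>r\<in>?S. t r)) (\<mu> s) = (if s = p then \<mu> p else 0)"
    by (auto simp: tlr.ev_diff tlr.ev_sum)
  qed (use less.prems in auto)
  then show ?thesis unfolding qp by blast
 qed
qed

end

section \<open>Faithfulness of the Temperley--Lieb representation\<close>

text \<open>The free algebra acting on itself by left multiplication, for inductions over words.\<close>

lemma free_rep_regular: "free_rep pscale (\<lambda>i x. gen i * x :: 'g word \<Rightarrow>\<^sub>0 'k::field)"
 by unfold_locales (auto simp: ring_distribs pscale_mult_right)

lemma act_regular: "act pscale (\<lambda>i x. gen i * x) p y = p * (y :: 'g word \<Rightarrow>\<^sub>0 'k::field)"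
proof -
 interpret free_rep pscale "\<lambda>i x. gen i * x :: 'g word \<Rightarrow>\<^sub>0 'k" by (rule free_rep_regular)
 have w: "foldr (\<lambda>i x. gen i * x) ws y = single (Word ws) 1 * y" for ws
 proof (induction ws)
  case Nil
  have "(single (Word []) 1 :: 'g word \<Rightarrow>\<^sub>0 'k) = 1" by (simp flip: zero_word_def)
  then show ?case by simp
 qed (simp add: gen_def mult_single plus_word_def flip: mult.assoc)
 show ?thesis
 proof (induction p rule: pm_induct)
  case (single w c)
  show ?case
   by (simp add: ev_single w pscale_single flip: pscale_mult_left)
 qed (auto simp: ev_add ring_distribs)
qed

lemma FA_left_induct [consumes 1, case_names zero one add scale gen]:
 fixes p :: "'g word \<Rightarrow>\<^sub>0 'k::field"
 assumes p: "p \<in> FA G" and "P 0" "P 1" "\<And>a b. P a ==> P b ==> P (a + b)" "\<And>c a. P a ==> P (pscale c a)"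
  "\<And>i a. i \<in> G ==> P a ==> P (gen i * a)"
 shows "P p"
proof -
 interpret free_rep pscale "\<lambda>i x. gen i * x :: 'g word \<Rightarrow>\<^sub>0 'k" by (rule free_rep_regular)
 have "P (ev p 1)"
  by (rule ev_induct[OF p, of "Collect P", simplified]) (use assms in \<open>auto simp: pvec.subspace_def\<close>)
 then show ?thesis by (simp add: act_regular)
qed

lemma span_Un_coeffs:
 fixes f :: "'i => ('x \<Rightarrow>\<^sub>0 'k::field)"
 assumes x: "x \<in> pvec.span (f ` A \<union> I)" and A: "finite A" and I: "pvec.subspace I"
 shows "\<exists>c. x - (\<Sum>a\<in>A. pscale (c a) (f a)) \<in> I"
proof -
 let ?V = "{x. \<exists>c. x - (\<Sum>a\<in>A. pscale (c a) (f a)) \<in> I}"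
 have I0: "0 \<in> I" by (rule pvec.subspace_0[OF I])
 have "pvec.span (f ` A \<union> I) \<subseteq> ?V"
 proof (rule pvec.span_minimal)
  show "f ` A \<union> I \<subseteq> ?V"
  proof
   fix y assume "y \<in> f ` A \<union> I"
   then consider b where "b \<in> A" "y = f b" | "y \<in> I" by auto
   then show "y \<in> ?V"
   proof cases
    case 1
    have "(\<Sum>a\<in>A. pscale (if a = b then 1 else 0) (f a)) = (\<Sum>a\<in>A. if a = b then f b else 0)"
     by (rule sum.cong) auto
    also have "\<dots> = y" using 1 A by simp
    finally have "y - (\<Sum>a\<in>A. pscale (if a = b then 1 else 0) (f a)) \<in> I" using I0 by simp
    then show ?thesis by (intro CollectI exI[of _ "\<lambda>a. if a = b then 1 else 0"])
   next
    case 2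
    then have "y - (\<Sum>a\<in>A. pscale 0 (f a)) \<in> I" by simp
    then show ?thesis by (intro CollectI exI[of _ "\<lambda>_. 0"])
   qed
  qed
  show "pvec.subspace ?V"
  proof (rule pvec.subspaceI)
   have "0 - (\<Sum>a\<in>A. pscale 0 (f a)) \<in> I" using I0 by simp
   then show "0 \<in> ?V" by (intro CollectI exI[of _ "\<lambda>_. 0"])
  next
   fix y z assume "y \<in> ?V" "z \<in> ?V"
   then obtain c d where "y - (\<Sum>a\<in>A. pscale (c a) (f a)) \<in> I" "z - (\<Sum>a\<in>A. pscale (d a) (f a)) \<in> I" by blast
   then have "(y - (\<Sum>a\<in>A. pscale (c a) (f a))) + (z - (\<Sum>a\<in>A. pscale (d a) (f a))) \<in> I" by (rule pvec.subspace_add[OF I])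
   then have "y + z - (\<Sum>a\<in>A. pscale (c a + d a) (f a)) \<in> I"
    by (simp only: pvec.scale_left_distrib sum.distrib add_diff_add)
   then show "y + z \<in> ?V" by (intro CollectI exI[of _ "\<lambda>a. c a + d a"])
  next
   fix t y assume "y \<in> ?V"
   then obtain c where "y - (\<Sum>a\<in>A. pscale (c a) (f a)) \<in> I" by blast
   then have "pscale t (y - (\<Sum>a\<in>A. pscale (c a) (f a))) \<in> I" by (rule pvec.subspace_scale[OF I])
   then have "pscale t y - (\<Sum>a\<in>A. pscale (t * c a) (f a)) \<in> I"
    by (simp only: pvec.scale_right_diff_distrib pvec.scale_sum_right pvec.scale_scale)
   then show "pscale t y \<in> ?V" by (intro CollectI exI[of _ "\<lambda>a. t * c a"])
  qed
 qed
 then show ?thesis using x by blast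
qed

declare One_nat_def [simp del]

context tl begin

lemma IT_mono: assumes "m \<le> n" shows "IT m \<subseteq> IT n"
proof -
 have F: "TF m \<subseteq> TF n" by (rule FA_mono) (use assms in auto)
 have R: "tl_relations m \<delta> \<subseteq> tl_relations n \<delta>"
  unfolding tl_relations_def Let_def using assms by fastforce
 have "IT m \<subseteq> IT n \<inter> TF m"
 proof (rule tlp.I_minimal)
  show "pvec.subspace (IT n \<inter> TF m)"
   by (rule pvec.subspace_inter[OF tlp.subspace_I subspace_FA])
  show "tl_relations m \<delta> \<subseteq> IT n \<inter> TF m"
   using R tlp.Rel_I tlp.Rel by blast
 qed (use F in \<open>auto intro: tlp.I_mult_left tlp.I_mult_right\<close>)
 then show ?thesis by blast
qed

lemma FA_tl_mono: "m \<le> n ==> TF m \<subseteq> TF n"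
 by (rule FA_mono) auto

lemma rel_square: "i \<in> tl_gens n ==> gen i * gen i - pscale \<delta> (gen i) \<in> IT n"
 by (rule tlp.Rel_I) (auto simp: tl_relations_def)
lemma rel_braid: "i \<in> tl_gens n ==> j \<in> tl_gens n ==> \<bar>int i - int j\<bar> = 1 ==> gen i * gen j * gen i - gen i \<in> IT n"
 by (rule tlp.Rel_I) (auto simp: tl_relations_def)
lemma rel_commute: "i \<in> tl_gens n ==> j \<in> tl_gens n ==> \<bar>int i - int j\<bar> > 1 ==> gen i * gen j - gen j * gen i \<in> IT n"
 by (rule tlp.Rel_I) (auto simp: tl_relations_def)

text \<open>The span modulo the ideal.\<close>

definition MS :: "nat => (nat word \<Rightarrow>\<^sub>0 'k) set => (nat word \<Rightarrow>\<^sub>0 'k) set" where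
 "MS n S = pvec.span (S \<union> IT n)"

lemma subspace_MS: "pvec.subspace (MS n S)" by (simp add: MS_def)
lemma MS_base: "x \<in> S ==> x \<in> MS n S" by (simp add: MS_def pvec.span_base)
lemma MS_I: "x \<in> IT n ==> x \<in> MS n S" by (simp add: MS_def pvec.span_base)
lemmas MS_add = pvec.subspace_add[OF subspace_MS] and MS_scale = pvec.subspace_scale[OF subspace_MS]
 and MS_0 = pvec.subspace_0[OF subspace_MS]

lemma MS_cong: "y \<in> MS n S ==> x - y \<in> IT n ==> x \<in> MS n S"
 using MS_add[of y n S "x - y"] MS_I[of "x - y" n S] by simp

lemma MS_mono: "S \<subseteq> T ==> MS n S \<subseteq> MS n T"
 unfolding MS_def by (rule pvec.span_mono) auto

lemma MS_linear:
 assumes x: "x \<in> MS n S" and f: "\<And>a b. f (a + b) = f a + f b" "\<And>c a. f (pscale c a) = pscale c (f a)"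
  and S: "\<And>s. s \<in> S ==> f s \<in> MS m T" and I: "\<And>s. s \<in> IT n ==> f s \<in> MS m T"
 shows "f x \<in> MS m T"
proof -
 have f0: "f 0 = 0" using f(2)[of 0 0] by simp
 show ?thesis
  using x unfolding MS_def[of n S]
 proof (rule pvec.span_induct[where P = "\<lambda>x. f x \<in> MS m T"])
  show "pvec.subspace (Collect (\<lambda>x. f x \<in> MS m T))"
   by (rule pvec.subspaceI) (auto simp: f f0 MS_0 MS_add MS_scale)
 qed (use S I in auto)
qed

lemma comm_last: "x \<in> TF k ==> gen (Suc k) * x - x * gen (Suc k) \<in> IT (Suc (Suc k))"
proof -
 let ?e = "gen (Suc k) :: nat word \<Rightarrow>\<^sub>0 'k"
 assume "x \<in> TF k"
 then have "x \<in> TF (Suc (Suc k)) \<and> ?e * x - x * ?e \<in> IT (Suc (Suc k))"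
 proof (induction rule: FA_left_induct)
  case (add a b)
  then show ?case using pvec.subspace_add[OF tlp.subspace_I, of "?e * a - a * ?e" _ "?e * b - b * ?e"]
   by (auto simp: algebra_simps)
 next
  case (scale c a)
  then show ?case using pvec.subspace_scale[OF tlp.subspace_I, of "?e * a - a * ?e" _ c]
   by (auto simp: pscale_mult_left pscale_mult_right pvec.scale_right_diff_distrib)
 next
  case (gen i a)
  have i: "gen i \<in> TF (Suc (Suc k))" using gen by auto
  have "?e * gen i - gen i * ?e \<in> IT (Suc (Suc k))" by (rule rel_commute) (use gen in auto)
  then have "(?e * gen i - gen i * ?e) * a + gen i * (?e * a - a * ?e) \<in> IT (Suc (Suc k))"
   using gen i by (intro pvec.subspace_add[OF tlp.subspace_I] tlp.I_mult_left tlp.I_mult_right) auto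
  moreover have "(?e * gen i - gen i * ?e) * a + gen i * (?e * a - a * ?e) = ?e * (gen i * a) - gen i * a * ?e"
   by (simp add: algebra_simps)
  ultimately show ?case using i gen by auto
 qed (auto simp: pvec.subspace_0[OF tlp.subspace_I])
 then show ?thesis ..
qed

text \<open>Products in which the last generator occurs exactly once.\<close>

definition JL :: "nat => (nat word \<Rightarrow>\<^sub>0 'k) set" where
 "JL k = {a * gen k * b | a b. 1 \<le> k \<and> a \<in> TF k \<and> b \<in> TF k}"

text \<open>The Temperley--Lieb counterpart of Jones normal form: if the last generator occurs twice, the part
 between two occurrences contains by induction at most one e_k, and e_{k+1} e_k e_{k+1} = e_{k+1} or
 e_{k+1}^2 = \<delta> e_{k+1} removes one of them. Lower generators are absorbed by e_i = e_i e_{i+1}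
 e_i.\<close>

lemma one_last_generator: "TF (Suc k) \<subseteq> MS (Suc k) (insert 1 (JL k))"
proof (induction k)
 case 0
 show ?case
 proof
  fix x :: "nat word \<Rightarrow>\<^sub>0 'k" assume "x \<in> TF (Suc 0)"
  then show "x \<in> MS (Suc 0) (insert 1 (JL 0))"
   by (induction rule: FA_left_induct) (auto intro: MS_0 MS_base MS_add MS_scale)
 qed
next
 case (Suc k)
 let ?K = "Suc k" let ?n = "Suc ?K" let ?e = "gen ?K :: nat word \<Rightarrow>\<^sub>0 'k"
 have eF: "?e \<in> TF ?n" by auto
 have FK: "a \<in> TF ?n" if "a \<in> TF ?K" for a using FA_tl_mono[of ?K ?n] that by auto
 have JI: "a * ?e * b \<in> MS ?n (JL ?K)" if "a \<in> TF ?K" "b \<in> TF ?K" for a b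
  using that by (intro MS_base) (auto simp: JL_def)
 (* by the induction hypothesis the part between two occurrences of e contains e_k at most once *)
 have key: "?e * a * ?e * b \<in> MS ?n (JL ?K)" if a: "a \<in> TF ?K" and b: "b \<in> TF ?K" for a b
 proof (rule MS_linear[where f = "\<lambda>a. ?e * a * ?e * b" and n = ?K and S = "insert 1 (JL k)"])
  show "a \<in> MS ?K (insert 1 (JL k))" using Suc a by blast
  show "?e * s * ?e * b \<in> MS ?n (JL ?K)" if "s \<in> IT ?K" for s
  proof (rule MS_I)
   have "s \<in> IT ?n" using IT_mono[of ?K ?n] that by auto
   then show "?e * s * ?e * b \<in> IT ?n" by (intro tlp.I_mult_right tlp.I_mult_left FK[OF b] eF)
  qed
  fix s assume s: "s \<in> insert 1 (JL k)"
  show "?e * s * ?e * b \<in> MS ?n (JL ?K)"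
  proof (cases "s = 1")
   case True
   have "?e * ?e * b - pscale \<delta> ?e * b \<in> IT ?n"
    by (rule tlp.I_mult_right_cong[OF FK[OF b] rel_square]) auto
   moreover have "pscale \<delta> ?e * b = pscale \<delta> (1 * ?e * b)" by (simp add: pscale_mult_left)
   ultimately show ?thesis using MS_cong[OF MS_scale[OF JI[OF FA_1 b]]] True by simp
  next
   case False
   then obtain a1 b1 where ab: "s = a1 * gen k * b1" "1 \<le> k" "a1 \<in> TF k" "b1 \<in> TF k"
    using s by (auto simp: JL_def)
   have m: "a1 \<in> TF ?K" "b1 \<in> TF ?K" using ab FA_tl_mono[of k ?K] by auto
   have f: "gen k \<in> TF ?n" using ab by auto
   note mn = FK[OF m(1)] FK[OF m(2)] FK[OF b]
   have 1: "?e * a1 * (gen k * b1 * ?e * b) - a1 * ?e * (gen k * b1 * ?e * b) \<in> IT ?n"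
    by (rule tlp.I_mult_right_cong[OF _ comm_last[OF ab(3)]]) (intro FA_mult f mn eF)
   have 2: "(a1 * ?e * gen k) * (?e * b1) * b - (a1 * ?e * gen k) * (b1 * ?e) * b \<in> IT ?n"
    by (intro tlp.I_mult_right_cong[OF mn(3)] tlp.I_mult_left_cong comm_last[OF ab(4)] FA_mult f mn eF)
   have "?e * gen k * ?e - ?e \<in> IT ?n" by (rule rel_braid) (use ab in auto)
   then have 3: "a1 * (?e * gen k * ?e) * (b1 * b) - a1 * ?e * (b1 * b) \<in> IT ?n"
    by (intro tlp.I_mult_right_cong tlp.I_mult_left_cong FA_mult f mn eF)
   have "?e * s * ?e * b - a1 * ?e * (b1 * b) \<in> IT ?n"
   proof (rule tlp.I_trans[OF _ tlp.I_trans[OF tlp.I_sym 3]])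
    show "?e * s * ?e * b - a1 * ?e * (gen k * b1 * ?e * b) \<in> IT ?n" using 1 by (simp add: ab mult.assoc)
    show "a1 * (?e * gen k * ?e) * (b1 * b) - a1 * ?e * (gen k * b1 * ?e * b) \<in> IT ?n"
     using 2 by (simp add: mult.assoc)
   qed
   then show ?thesis using MS_cong[OF JI[OF m(1) FA_mult[OF m(2) b]]] by blast
  qed
 qed (simp_all add: ring_distribs pscale_mult_left pscale_mult_right)
 have left: "a * x \<in> MS ?n (JL ?K)" if "x \<in> MS ?n (JL ?K)" "a \<in> TF ?K" for a x
  using that(1)
 proof (rule MS_linear)
  fix s assume "s \<in> JL ?K"
  then obtain b c where s: "s = b * ?e * c" "b \<in> TF ?K" "c \<in> TF ?K" by (auto simp: JL_def)
  show "a * s \<in> MS ?n (JL ?K)" using JI[OF FA_mult[OF that(2) s(2)] s(3)] by (simp add: s(1) mult.assoc)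
 qed (use that(2) FK in \<open>auto simp: ring_distribs pscale_mult_right intro: MS_I tlp.I_mult_left\<close>)
 have right: "x * a \<in> MS ?n (JL ?K)" if "x \<in> MS ?n (JL ?K)" "a \<in> TF ?K" for a x
  using that(1)
 proof (rule MS_linear)
  fix s assume "s \<in> JL ?K"
  then obtain b c where s: "s = b * ?e * c" "b \<in> TF ?K" "c \<in> TF ?K" by (auto simp: JL_def)
  show "s * a \<in> MS ?n (JL ?K)" using JI[OF s(2) FA_mult[OF s(3) that(2)]] by (simp add: s(1) mult.assoc)
 qed (use that(2) FK in \<open>auto simp: ring_distribs pscale_mult_left intro: MS_I tlp.I_mult_right\<close>)
 have eJ: "?e * x \<in> MS ?n (JL ?K)" if "x \<in> MS ?n (JL ?K)" for x
  using that
 proof (rule MS_linear)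
  fix s assume "s \<in> JL ?K"
  then obtain b c where s: "s = b * ?e * c" "b \<in> TF ?K" "c \<in> TF ?K" by (auto simp: JL_def)
  show "?e * s \<in> MS ?n (JL ?K)" using key[OF s(2,3)] by (simp add: s(1) mult.assoc)
 qed (use eF in \<open>auto simp: ring_distribs pscale_mult_right intro: MS_I tlp.I_mult_left\<close>)
 have gJ: "gen i \<in> MS ?n (JL ?K)" if "1 \<le> i" "i \<le> ?K" for i
  using that(2,1)
 proof (induction rule: inc_induct)
  case base
  show ?case using JI[of 1 1] by simp
 next
  case (step i)
  have "gen i * gen (Suc i) * gen i \<in> MS ?n (JL ?K)"
   using step by (intro left right) auto
  moreover have "gen i - gen i * gen (Suc i) * gen i \<in> IT ?n"
   by (rule tlp.I_sym[OF rel_braid]) (use step in auto)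
  ultimately show ?case by (rule MS_cong)
 qed
 have gl: "gen i * x \<in> MS ?n (JL ?K)" if "x \<in> MS ?n (JL ?K)" "i \<in> tl_gens ?n" for i x
  using left[OF that(1) FA_gen, of i] eJ[OF that(1)] that(2) by (cases "i = ?K") auto
 show ?case
 proof
  fix x :: "nat word \<Rightarrow>\<^sub>0 'k" assume "x \<in> TF ?n"
  then show "x \<in> MS ?n (insert 1 (JL ?K))"
  proof (induction rule: FA_left_induct)
   case (gen i a)
   show ?case using gen(2)
   proof (rule MS_linear)
    fix s assume "s \<in> insert 1 (JL ?K)"
    then have "gen i * s \<in> MS ?n (JL ?K)" using gl[OF MS_base gen(1)] gJ[of i] gen(1) by auto
    then show "gen i * s \<in> MS ?n (insert 1 (JL ?K))" using MS_mono[of "JL ?K"] by blast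
   next
    fix s assume "s \<in> IT ?n"
    then show "gen i * s \<in> MS ?n (insert 1 (JL ?K))" by (intro MS_I tlp.I_mult_left FA_gen gen(1))
   qed (simp_all add: ring_distribs pscale_mult_right)
  qed (auto intro: MS_0 MS_base MS_add MS_scale)
 qed
qed

definition tu :: "nat => (nat \<times> nat) list => (nat \<times> nat) list => (nat word \<Rightarrow>\<^sub>0 'k)" where
 "tu n q p = (SOME t. is_tu n q p t)"

lemma tu: "n \<le> N ==> p \<in> walks n ==> q \<in> walks n ==> last p = last q ==> is_tu n q p (tu n q p)"
 unfolding tu_def by (rule someI_ex) (rule tu_exists)

text \<open>Faithfulness for n strands, as an induction hypothesis.\<close>

definition inj_tl :: "nat => bool" where
 "inj_tl n \<longleftrightarrow> (\<forall>x\<in>TF n. (\<forall>y\<in>TS n. tlact n x y = 0) --> x \<in> IT n)"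

lemma inj_cong:
 assumes "inj_tl n" "n \<le> N" "x \<in> TF n" "y \<in> TF n"
  and eq: "\<And>r. r \<in> walks n ==> tlact n x (\<mu> r) = tlact n y (\<mu> r)"
 shows "x - y \<in> IT n"
proof -
 have "tlact n x z = tlact n y z" if "z \<in> TS n" for z
  by (rule intertw_eqI[OF tlact_intertw[OF assms(3)] tlact_intertw[OF assms(4)] assms(2) eq that])
 then have "\<forall>z\<in>TS n. tlact n (x - y) z = 0" by (simp add: tlr.ev_diff)
 then show ?thesis using assms(1,3,4) FA_diff unfolding inj_tl_def by blast
qed

text \<open>Under faithfulness, an identity between operators is an identity in the algebra, so the matrix units
 span the algebra.\<close>

lemma units_span:
 assumes inj: "inj_tl n" and n: "n \<le> N"
 shows "TF n \<subseteq> MS n {tu n q p | q p. p \<in> walks n \<and> q \<in> walks n \<and> last p = last q}"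
proof
 fix x :: "nat word \<Rightarrow>\<^sub>0 'k" assume x: "x \<in> TF n"
 have pq: "q \<in> walks n" "last p = last q" if "p \<in> walks n" "q \<in> walks_to (last p)" for p q
  using walks_to_walks[OF last_two_row[OF that(1)]] that(2) by auto
 let ?c = "\<lambda>p q. crd v n q 0 (tlact n x (\<mu> p))"
 let ?y = "\<Sum>p\<in>walks n. \<Sum>q\<in>walks_to (last p). pscale (?c p q) (tu n q p)"
 have t: "is_tu n q p (tu n q p)" if "p \<in> walks n" "q \<in> walks_to (last p)" for p q
  by (rule tu[OF n that(1)]) (use pq[OF that] in auto)
 have "?y \<in> TF n" using t by (intro FA_sum FA_pscale) (simp add: is_tu_def)
 then have d: "x - ?y \<in> TF n" by (rule FA_diff[OF x])
 have "tlact n x z = tlact n ?y z" if z: "z \<in> TS n" for z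
  unfolding intertw_expand[OF tlact_intertw[OF x] n z] tlr.ev_sum tlr.ev_pscale
  using t z by (intro sum.cong refl) (simp add: is_tu_def)
 then have "\<forall>z\<in>TS n. tlact n (x - ?y) z = 0" by (simp only: tlr.ev_diff right_minus_eq) blast
 then have "x - ?y \<in> IT n" using inj d unfolding inj_tl_def by blast
 moreover have "?y \<in> MS n {tu n q p | q p. p \<in> walks n \<and> q \<in> walks n \<and> last p = last q}"
  using pq by (intro pvec.subspace_sum[OF subspace_MS] MS_scale MS_base) blast
 ultimately show "x \<in> MS n {tu n q p | q p. p \<in> walks n \<and> q \<in> walks n \<and> last p = last q}"
  by (rule MS_cong[rotated])
qed

text \<open>The sandwich element for the pair (Q, P). It is defined without the normalizing factor, since only
 its span is needed.\<close>

definition YL :: "nat => (nat \<times> nat) list => (nat \<times> nat) list => (nat word \<Rightarrow>\<^sub>0 'k)" where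
 "YL n Q P = (let k = n - 1; R = some_walk (shrink (last P)) in
   tu k (butlast Q) (R @ [last (butlast Q)]) * gen k * tu k (R @ [last (butlast P)]) (butlast P))"

definition pairs :: "nat => ((nat \<times> nat) list \<times> (nat \<times> nat) list) set" where
 "pairs n = {(Q, P). Q \<in> walks n \<and> P \<in> walks n \<and> last Q = last P \<and> snd (last P) \<noteq> 0}"

lemma finite_pairs [simp]: "finite (pairs n)"
 by (rule finite_subset[of _ "walks n \<times> walks n"]) (auto simp: pairs_def)

lemma YL_act:
 assumes QP: "(Q, P) \<in> pairs n" and n: "n \<le> N"
 shows "YL n Q P \<in> TF n \<and> (\<exists>c. c \<noteq> 0 \<and> (\<forall>r\<in>walks n. tlact n (YL n Q P) (\<mu> r) = (if r = P then tscale c (\<mu> Q) else 0)))"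
proof -
 have Q: "Q \<in> walks n" and P: "P \<in> walks n" "snd (last P) \<noteq> 0" and l: "last Q = last P"
  using QP by (auto simp: pairs_def)
 obtain m where m: "n = Suc (Suc m)" using two_rows_length[OF P] by blast
 let ?R = "some_walk (shrink (last P))"
 note R = some_walk_shrink[OF P(1)[unfolded m] P(2)]
 obtain i where i: "stp_ok i (last ?R)" "last (butlast Q) = stp i (last ?R)"
  using walk_shrink[OF Q[unfolded m] _ R(1)] R(2) l by auto
 obtain j where j: "stp_ok j (last ?R)" "last (butlast P) = stp j (last ?R)"
  using walk_shrink[OF P(1)[unfolded m] R(2) R(1)] by auto
 note bQ = walk_Suc_parts[OF Q[unfolded m]] and bP = walk_Suc_parts[OF P(1)[unfolded m]]
 have mN: "Suc (Suc m) \<le> N" "Suc m \<le> N" using n m by auto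
 have tq: "is_tu (Suc m) (butlast Q) (?R @ [stp i (last ?R)]) (tu (Suc m) (butlast Q) (?R @ [stp i (last ?R)]))"
  by (rule tu[OF mN(2) walks_stp[OF R(1) i(1)] bQ(1)]) (simp add: i)
 have tp: "is_tu (Suc m) (?R @ [stp j (last ?R)]) (butlast P) (tu (Suc m) (?R @ [stp j (last ?R)]) (butlast P))"
  by (rule tu[OF mN(2) bP(1) walks_stp[OF R(1) j(1)]]) (simp add: j)
 have Y: "YL n Q P = tu (Suc m) (butlast Q) (?R @ [stp i (last ?R)]) * gen (Suc m) * tu (Suc m) (?R @ [stp j (last ?R)]) (butlast P)"
  by (simp add: YL_def Let_def m i j)
 have "YL n Q P \<in> TF n"
  unfolding Y using tq tp FA_tl_mono[of "Suc m" n] by (intro FA_mult FA_gen) (auto simp: is_tu_def m)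
 moreover have eQ: "butlast Q @ [last P] = Q" and eP: "butlast P @ [last P] = P" using bQ(3) bP(3) l by auto
 have "\<exists>c. c \<noteq> 0 \<and> (\<forall>r\<in>walks n. tlact n (YL n Q P) (\<mu> r) = (if r = P then tscale c (\<mu> Q) else 0))"
  using sandwich_act[OF mN(1) R(1) bQ(1) i(2,1) bP(1) j(2,1) tq tp]
  unfolding R(2)[symmetric] eQ eP Y[symmetric] m[symmetric] .
 ultimately show ?thesis by blast
qed

text \<open>A unit of level m + 1 through an extension of S can be rerouted through any other walk with the same
 end as S, at the expense of a unit of level m.\<close>

lemma units_mult:
 assumes inj: "inj_tl (Suc m)" and m: "Suc m \<le> N"
  and S: "S \<in> walks m" "S' \<in> walks m" "last S = last S'" and i: "stp_ok i (last S)" and q: "q \<in> walks (Suc m)" "last q = stp i (last S)"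
 shows "tu (Suc m) q (S @ [stp i (last S)]) - tu (Suc m) q (S' @ [stp i (last S)]) * tu m S' S \<in> IT (Suc m)"
  and "tu (Suc m) (S @ [stp i (last S)]) q - tu m S S' * tu (Suc m) (S' @ [stp i (last S)]) q \<in> IT (Suc m)"
proof -
 have mN: "m \<le> N" using m by simp
 have w: "S @ [stp i (last S)] \<in> walks (Suc m)" "S' @ [stp i (last S)] \<in> walks (Suc m)"
  using walks_stp[OF S(1) i] walks_stp[OF S(2), of i] S i by auto
 have t1: "is_tu (Suc m) q (S @ [stp i (last S)]) (tu (Suc m) q (S @ [stp i (last S)]))"
  and t2: "is_tu (Suc m) q (S' @ [stp i (last S)]) (tu (Suc m) q (S' @ [stp i (last S)]))"
  and t3: "is_tu (Suc m) (S @ [stp i (last S)]) q (tu (Suc m) (S @ [stp i (last S)]) q)"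
  and t4: "is_tu (Suc m) (S' @ [stp i (last S)]) q (tu (Suc m) (S' @ [stp i (last S)]) q)"
  by (rule tu[OF m]; use w q in simp)+
 have t5: "is_tu m S' S (tu m S' S)" and t6: "is_tu m S S' (tu m S S')"
  by (rule tu[OF mN]; use S in simp)+
 have F: "TF m \<subseteq> TF (Suc m)" by (rule FA_tl_mono) simp
 have fa: "tu (Suc m) q (S @ [stp i (last S)]) \<in> TF (Suc m)" "tu (Suc m) q (S' @ [stp i (last S)]) * tu m S' S \<in> TF (Suc m)"
  "tu (Suc m) (S @ [stp i (last S)]) q \<in> TF (Suc m)" "tu m S S' * tu (Suc m) (S' @ [stp i (last S)]) q \<in> TF (Suc m)"
  using t1 t2 t3 t4 t5 t6 F by (auto simp: is_tu_def)
 note mu1 = is_tu_mu[OF t1 m w(1) q(1) _] and mu2 = is_tu_mu[OF t2 m w(2) q(1) _]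
  and mu3 = is_tu_mu[OF t3 m q(1) w(1) _] and mu4 = is_tu_mu[OF t4 m q(1) w(2) _]
 note li5 = is_tu_lift[OF t5 m S(1,2) S(3)] and li6 = is_tu_lift[OF t6 m S(2,1) S(3)[symmetric]]
 show "tu (Suc m) q (S @ [stp i (last S)]) - tu (Suc m) q (S' @ [stp i (last S)]) * tu m S' S \<in> IT (Suc m)"
 proof (rule inj_cong[OF inj m fa(1,2)])
  fix r assume r: "r \<in> walks (Suc m)"
  obtain r' s where r': "r' \<in> walks m" "stp_ok s (last r')" "r = r' @ [stp s (last r')]"
   using walks_Suc_cases[OF r] .
  show "tlact (Suc m) (tu (Suc m) q (S @ [stp i (last S)])) (\<mu> r) =
     tlact (Suc m) (tu (Suc m) q (S' @ [stp i (last S)]) * tu m S' S) (\<mu> r)"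
  proof (cases "r' = S")
   case True
   have "S' @ [stp s (last S)] \<in> walks (Suc m)" using walks_stp[OF S(2), of s] S r' True by auto
   then show ?thesis
    using li5[OF r'(1,2)] True S r mu1[OF _ r] mu2 q by (simp add: tlr.ev_mult r'(3) stp_inj)
  next
   case False
   then show ?thesis using li5[OF r'(1,2)] mu1[OF _ r] q r'(3) by (simp add: tlr.ev_mult)
  qed
 qed
 show "tu (Suc m) (S @ [stp i (last S)]) q - tu m S S' * tu (Suc m) (S' @ [stp i (last S)]) q \<in> IT (Suc m)"
 proof (rule inj_cong[OF inj m fa(3,4)])
  fix r assume r: "r \<in> walks (Suc m)"
  have "stp_ok i (last S')" using i S by simp
  from li6[OF S(2) this] show "tlact (Suc m) (tu (Suc m) (S @ [stp i (last S)]) q) (\<mu> r) =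
     tlact (Suc m) (tu m S S' * tu (Suc m) (S' @ [stp i (last S)]) q) (\<mu> r)"
   using mu3[OF _ r] mu4[OF _ r] q S by (simp add: tlr.ev_mult)
 qed
qed

text \<open>After expanding a and b in matrix units, consider t_{qp} e t_{rs}. Rerouting moves units of level m
 = k - 1 next to e, and these commute with e. If p and r restrict to different walks, orthogonal
 idempotents of level m meet and the product vanishes; otherwise both are rerouted through the chosen
 walk and the product becomes YL.\<close>

lemma YL_span:
 assumes inj: "inj_tl k" and kN: "Suc k \<le> N"
 shows "JL k \<subseteq> MS (Suc k) ((\<lambda>(Q, P). YL (Suc k) Q P) ` pairs (Suc k))"
proof
 let ?Y = "(\<lambda>(Q, P). YL (Suc k) Q P) ` pairs (Suc k)"
 let ?U = "{tu k q p | q p. p \<in> walks k \<and> q \<in> walks k \<and> last p = last q}"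
 let ?e = "gen k :: nat word \<Rightarrow>\<^sub>0 'k"
 fix x assume "x \<in> JL k"
 then obtain a b where x: "x = a * ?e * b" "1 \<le> k" "a \<in> TF k" "b \<in> TF k"
  by (auto simp: JL_def)
 have kN': "k \<le> N" using kN by simp
 have Fk: "TF k \<subseteq> TF (Suc k)" by (rule FA_tl_mono) simp
 have eF: "?e \<in> TF (Suc k)" using x by auto
 have Ik: "IT k \<subseteq> IT (Suc k)" by (rule IT_mono) simp
 obtain m where m: "k = Suc m" using x by (cases k) auto
 have mN: "Suc m \<le> N" "m \<le> N" using kN m by auto
 have main: "tu k q p * ?e * tu k r s \<in> MS (Suc k) ?Y"
  if q: "q \<in> walks k" and p: "p \<in> walks k" "last p = last q" and r: "r \<in> walks k" and s: "s \<in> walks k" "last s = last r" for p q r s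
 proof -
  obtain p' i where p': "p' \<in> walks m" "stp_ok i (last p')" "p = p' @ [stp i (last p')]"
   using walks_Suc_cases[OF p(1)[unfolded m]] .
  obtain r' j where r': "r' \<in> walks m" "stp_ok j (last r')" "r = r' @ [stp j (last r')]"
   using walks_Suc_cases[OF r[unfolded m]] .
  have lq: "last q = stp i (last p')" and ls: "last s = stp j (last r')" using p s p' r' by auto
  (* reroute both units and move the units of level m across e *)
  have general: "tu k q p * ?e * tu k r s - tu k q (R @ [stp i (last p')]) * ?e * (tu m R p' * tu m r' R' * tu k (R' @ [stp j (last r')]) s) \<in> IT (Suc k)"
   if R: "R \<in> walks m" "last R = last p'" "R' \<in> walks m" "last R' = last r'" for R R'
  proof -
   have 1: "tu k q p - tu k q (R @ [stp i (last p')]) * tu m R p' \<in> IT k"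
    using units_mult(1)[OF inj[unfolded m] mN(1) p'(1) R(1) R(2)[symmetric] p'(2) q[unfolded m] lq] by (simp add: m p')
   have 2: "tu k r s - tu m r' R' * tu k (R' @ [stp j (last r')]) s \<in> IT k"
    using units_mult(2)[OF inj[unfolded m] mN(1) r'(1) R(3) R(4)[symmetric] r'(2) s(1)[unfolded m] ls] by (simp add: m r')
   have w: "R @ [stp i (last p')] \<in> walks k" "R' @ [stp j (last r')] \<in> walks k"
    using walks_stp[OF R(1), of i] walks_stp[OF R(3), of j] R p' r' m by auto
   have t: "tu k r s \<in> TF k" "tu k q (R @ [stp i (last p')]) \<in> TF k" "tu k (R' @ [stp j (last r')]) s \<in> TF k"
    using tu[OF kN' s(1) r s(2)] tu[OF kN' w(1) q] tu[OF kN' s(1) w(2)] lq ls by (auto simp: is_tu_def)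
   have tm: "tu m R p' \<in> TF m" "tu m r' R' \<in> TF m"
    using tu[OF mN(2) p'(1) R(1)] tu[OF mN(2) R(3) r'(1)] R by (auto simp: is_tu_def)
   have tmk: "tu m R p' \<in> TF (Suc k)" "tu m r' R' \<in> TF (Suc k)"
    using tm FA_tl_mono[of m "Suc k"] m by auto
   note tk = subsetD[OF Fk t(1)] subsetD[OF Fk t(2)] subsetD[OF Fk t(3)]
   have c: "?e * tu m R p' - tu m R p' * ?e \<in> IT (Suc k)" using comm_last[OF tm(1)] m by simp
   have A: "tu k q p * (?e * tu k r s) - tu k q (R @ [stp i (last p')]) * tu m R p' * (?e * tu k r s) \<in> IT (Suc k)"
    using 1 Ik by (intro tlp.I_mult_right_cong FA_mult eF tk) auto
   have B: "tu k q (R @ [stp i (last p')]) * (tu m R p' * ?e) * tu k r s - tu k q (R @ [stp i (last p')]) * (?e * tu m R p') * tu k r s \<in> IT (Suc k)"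
    by (intro tlp.I_mult_right_cong tlp.I_mult_left_cong tlp.I_sym[OF c] tk)
   have C: "tu k q (R @ [stp i (last p')]) * ?e * tu m R p' * tu k r s - tu k q (R @ [stp i (last p')]) * ?e * tu m R p' * (tu m r' R' * tu k (R' @ [stp j (last r')]) s) \<in> IT (Suc k)"
    using 2 Ik by (intro tlp.I_mult_left_cong FA_mult eF tk tmk) auto
   show ?thesis
    using tlp.I_trans[OF A tlp.I_trans[OF _ C]] B by (simp add: mult.assoc)
  qed
  show ?thesis
  proof (cases "p' = r'")
   case False
   have t1: "is_tu m p' p' (tu m p' p')" "is_tu m r' r' (tu m r' r')" by (rule tu[OF mN(2)]; use p' r' in simp)+
   have t2: "is_tu k r s (tu k r s)" by (rule tu[OF kN' s(1) r s(2)])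
   have fa: "tu m p' p' * tu m r' r' * tu k r s \<in> TF k"
    using t1 t2 FA_tl_mono[of m k] m by (auto simp: is_tu_def)
   have "tu m p' p' * tu m r' r' * tu k r s - 0 \<in> IT k"
   proof (rule inj_cong[OF inj kN' fa FA_0])
    fix z assume z: "z \<in> walks k"
    have "tlact k (tu m p' p' * tu m r' r' * tu k r s) (\<mu> z) = tlact k (tu m p' p') (tlact k (tu m r' r') (if z = s then \<mu> r else 0))"
     by (simp add: tlr.ev_mult is_tu_mu[OF t2 kN' s(1) r s(2) z])
    then show "tlact k (tu m p' p' * tu m r' r' * tu k r s) (\<mu> z) = tlact k 0 (\<mu> z)"
     using is_tu_lift[OF t1(2) mN(1) r'(1,1) refl r'(1,2)] is_tu_lift[OF t1(1) mN(1) p'(1,1) refl r'(1,2)] False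
     by (simp add: r'(3) m)
   qed
   then have z: "tu m p' p' * tu m r' r' * tu k r s \<in> IT (Suc k)" using Ik by auto
   have "tu k q p \<in> TF (Suc k)" using tu[OF kN' p(1) q p(2)] Fk by (auto simp: is_tu_def)
   then have "tu k q p * ?e * (tu m p' p' * tu m r' r' * tu k r s) \<in> IT (Suc k)"
    using tlp.I_mult_left[OF FA_mult[OF _ eF] z] by blast
   moreover have "tu k q p * ?e * tu k r s - tu k q p * ?e * (tu m p' p' * tu m r' r' * tu k r s) \<in> IT (Suc k)"
    using general[OF p'(1) refl r'(1) refl] by (simp add: p' r')
   ultimately have "tu k q p * ?e * tu k r s \<in> IT (Suc k)"
    by (rule tlp.I_cong)
   then show ?thesis by (rule MS_I)
  next
   case True
   let ?l = "(Suc (fst (last p')), Suc (snd (last p')))"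
   have le: "snd (last p') \<le> fst (last p')" using walks_walk[OF p'(1)] walk_props by blast
   have okk: "stp_ok (\<not> i) (stp i (last p'))" if "stp_ok i (last p')" for i
    using that le by (auto simp: stp_ok_def stp_def)
   have Q: "q @ [?l] \<in> walks (Suc k)" using walks_stp[OF q, of "\<not> i"] okk[OF p'(2)] by (simp add: lq stp_stp)
   have P: "s @ [?l] \<in> walks (Suc k)" using walks_stp[OF s(1), of "\<not> j"] okk[of j] r'(2) True by (simp add: ls stp_stp)
   have pr: "(q @ [?l], s @ [?l]) \<in> pairs (Suc k)" using Q P by (simp add: pairs_def)
   let ?R = "some_walk (shrink ?l)"
   have "?R \<in> walks m" "last (s @ [?l]) = (Suc (fst (last ?R)), Suc (snd (last ?R)))"
    using some_walk_shrink[of "s @ [?l]" m] P m by auto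
   then have R: "?R \<in> walks m" "last ?R = last p'" by (auto simp: prod_eq_iff)
   have Y: "YL (Suc k) (q @ [?l]) (s @ [?l]) = tu k q (?R @ [stp i (last p')]) * ?e * tu k (?R @ [stp j (last r')]) s"
    by (simp add: YL_def Let_def lq ls)
   have w: "?R @ [stp j (last r')] \<in> walks k" using walks_stp[OF R(1), of j] R r' True m by auto
   have t1: "is_tu m ?R p' (tu m ?R p')" "is_tu m p' ?R (tu m p' ?R)" by (rule tu[OF mN(2)]; use p' R in simp)+
   have t2: "is_tu k (?R @ [stp j (last r')]) s (tu k (?R @ [stp j (last r')]) s)" by (rule tu[OF kN' s(1) w]) (simp add: ls)
   have fa: "tu m ?R p' * tu m p' ?R * tu k (?R @ [stp j (last r')]) s \<in> TF k" "tu k (?R @ [stp j (last r')]) s \<in> TF k"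
    using t1 t2 FA_tl_mono[of m k] m by (auto simp: is_tu_def)
   have z: "tu m ?R p' * tu m p' ?R * tu k (?R @ [stp j (last r')]) s - tu k (?R @ [stp j (last r')]) s \<in> IT k"
   proof (rule inj_cong[OF inj kN' fa])
    fix z assume z: "z \<in> walks k"
    have j: "stp_ok j (last ?R)" "stp_ok j (last p')" "last ?R = last r'" using R r' True by auto
    have t2z: "tlact k (tu k (?R @ [stp j (last r')]) s) (\<mu> z) = (if z = s then \<mu> (?R @ [stp j (last r')]) else 0)"
     by (rule is_tu_mu[OF t2 kN' s(1) w _ z]) (simp add: ls)
    have "tlact k (tu m p' ?R) (\<mu> (?R @ [stp j (last r')])) = \<mu> (p' @ [stp j (last r')])"
     using is_tu_lift[OF t1(2) mN(1) R(1) p'(1) R(2) R(1) j(1)] j by (simp add: m)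
    moreover have "tlact k (tu m ?R p') (\<mu> (p' @ [stp j (last r')])) = \<mu> (?R @ [stp j (last r')])"
     using is_tu_lift[OF t1(1) mN(1) p'(1) R(1) R(2)[symmetric] p'(1) j(2)] j R by (simp add: m)
    ultimately show "tlact k (tu m ?R p' * tu m p' ?R * tu k (?R @ [stp j (last r')]) s) (\<mu> z) = tlact k (tu k (?R @ [stp j (last r')]) s) (\<mu> z)"
     by (simp add: tlr.ev_mult t2z)
   qed
   have w': "?R @ [stp i (last p')] \<in> walks k" using walks_stp[OF R(1), of i] R p' m by auto
   have "tu k q (?R @ [stp i (last p')]) \<in> TF (Suc k)"
    using tu[OF kN' w' q] Fk lq by (auto simp: is_tu_def)
   then have "tu k q (?R @ [stp i (last p')]) * ?e * (tu m ?R p' * tu m p' ?R * tu k (?R @ [stp j (last r')]) s) - YL (Suc k) (q @ [?l]) (s @ [?l]) \<in> IT (Suc k)"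
    unfolding Y using z Ik by (intro tlp.I_mult_left_cong FA_mult eF) auto
   then have "tu k q p * ?e * tu k r s - YL (Suc k) (q @ [?l]) (s @ [?l]) \<in> IT (Suc k)"
    using tlp.I_trans[OF general[OF R(1,2) R(1)]] R True by simp
   moreover have "YL (Suc k) (q @ [?l]) (s @ [?l]) \<in> MS (Suc k) ?Y" using pr by (intro MS_base) force
   ultimately show ?thesis by (rule MS_cong[rotated])
  qed
 qed
 have aU: "a \<in> MS k ?U" and bU: "b \<in> MS k ?U" using units_span[OF inj kN'] x by auto
 show "x \<in> MS (Suc k) ?Y" unfolding x(1)
 proof (rule MS_linear[OF aU, where f = "\<lambda>a. a * ?e * b"])
  fix t assume "t \<in> ?U"
  then obtain q p where t: "t = tu k q p" "p \<in> walks k" "q \<in> walks k" "last p = last q" by blast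
  show "t * ?e * b \<in> MS (Suc k) ?Y"
  proof (rule MS_linear[OF bU, where f = "\<lambda>b. t * ?e * b"])
   fix u assume "u \<in> ?U"
   then show "t * ?e * u \<in> MS (Suc k) ?Y" using main t by blast
  next
   fix u assume u: "u \<in> IT k"
   have "t \<in> TF (Suc k)" using tu[OF kN' t(2,3,4)] Fk t by (auto simp: is_tu_def)
   then show "t * ?e * u \<in> MS (Suc k) ?Y" using u Ik by (intro MS_I tlp.I_mult_left FA_mult eF) auto
  qed (simp_all add: ring_distribs pscale_mult_left pscale_mult_right)
 next
  fix u assume u: "u \<in> IT k"
  then show "u * ?e * b \<in> MS (Suc k) ?Y" using Ik Fk x by (intro MS_I tlp.I_mult_right eF) auto
 qed (simp_all add: ring_distribs pscale_mult_left pscale_mult_right)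
qed

text \<open>The elements spanning the algebra modulo the ideal act independently: the identity is detected on
 the walk to (n, 0), which no sandwich element touches, and the sandwich elements act as multiples of
 distinct matrix units.\<close>

theorem tl_faithful: "n \<le> N ==> inj_tl n"
proof (induction n rule: less_induct)
 case (less n)
 let ?Y = "(\<lambda>(Q, P). YL n Q P) ` pairs n"
 have sp: "TF n \<subseteq> MS n (insert 1 ?Y)"
 proof (cases n)
  case 0
  show ?thesis
  proof
   fix x :: "nat word \<Rightarrow>\<^sub>0 'k" assume "x \<in> TF n"
   then show "x \<in> MS n (insert 1 ?Y)"
    by (induction rule: FA_left_induct) (use 0 in \<open>auto intro: MS_0 MS_base MS_add MS_scale\<close>)
  qed
 next
  case (Suc k)
  have J: "JL k \<subseteq> MS n ?Y" using YL_span[of k] less Suc by simp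
  show ?thesis
  proof
   fix x :: "nat word \<Rightarrow>\<^sub>0 'k" assume "x \<in> TF n"
   then have "x \<in> MS n (insert 1 (JL k))" using one_last_generator[of k] Suc by auto
   then show "x \<in> MS n (insert 1 ?Y)"
    by (rule MS_linear[where f = "\<lambda>x. x"]) (use J MS_mono[of ?Y "insert 1 ?Y" n] in \<open>auto intro: MS_base MS_I\<close>)
  qed
 qed
 show "inj_tl n" unfolding inj_tl_def
 proof (intro ballI impI)
  fix x :: "nat word \<Rightarrow>\<^sub>0 'k" assume x: "x \<in> TF n" and zero: "\<forall>y\<in>TS n. tlact n x y = 0"
  let ?f = "\<lambda>c d. pscale c 1 + (\<Sum>(Q, P)\<in>pairs n. pscale (d (Q, P)) (YL n Q P))"
  have "x \<in> pvec.span ((\<lambda>(Q, P). YL n Q P) ` pairs n \<union> pvec.span (insert 1 (IT n)))"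
  proof -
   have "insert 1 ?Y \<union> IT n \<subseteq> ?Y \<union> pvec.span (insert 1 (IT n))"
    using pvec.span_superset[of "insert 1 (IT n)"] by blast
   then show ?thesis using sp x pvec.span_mono unfolding MS_def by blast
  qed
  then obtain d where d: "x - (\<Sum>(Q, P)\<in>pairs n. pscale (d (Q, P)) (YL n Q P)) \<in> pvec.span (insert 1 (IT n))"
   using span_Un_coeffs[OF _ finite_pairs pvec.subspace_span, of x "\<lambda>(Q, P). YL n Q P" n "insert 1 (IT n)"]
   by (auto simp: case_prod_unfold)
  then obtain c where "x - (\<Sum>(Q, P)\<in>pairs n. pscale (d (Q, P)) (YL n Q P)) - pscale c 1 \<in> IT n"
   by (auto simp: pvec.span_insert pvec.span_eq_iff[THEN iffD2, OF tlp.subspace_I])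
  then have cd: "x - ?f c d \<in> IT n" by (simp add: algebra_simps)
  have YA: "\<exists>g. g \<noteq> 0 \<and> (\<forall>r\<in>walks n. tlact n (YL n Q P) (\<mu> r) = (if r = P then tscale g (\<mu> Q) else 0))"
   if "(Q, P) \<in> pairs n" for Q P using YL_act[OF that less.prems] by blast
  define g where "g Q P = (SOME g. g \<noteq> 0 \<and> (\<forall>r\<in>walks n. tlact n (YL n Q P) (\<mu> r) = (if r = P then tscale g (\<mu> Q) else 0)))" for Q P
  have g: "g Q P \<noteq> 0" "\<And>r. r \<in> walks n ==> tlact n (YL n Q P) (\<mu> r) = (if r = P then tscale (g Q P) (\<mu> Q) else 0)"
   if "(Q, P) \<in> pairs n" for Q P using someI_ex[OF YA[OF that]] unfolding g_def by blast+
  have rel: "tscale c (\<mu> r) + (\<Sum>(Q, P)\<in>pairs n. if P = r then tscale (d (Q, P) * g Q P) (\<mu> Q) else 0) = 0" if r: "r \<in> walks n" for r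
  proof -
   have rT: "\<mu> r \<in> TS n" using hw_TS[OF hw_walks[OF r less.prems]] .
   have "tlact n (?f c d) (\<mu> r) = 0" using IT_act[OF cd rT] zero rT by (simp add: tlr.ev_diff)
   moreover have "tlact n (?f c d) (\<mu> r) = tscale c (\<mu> r) + (\<Sum>(Q, P)\<in>pairs n. if P = r then tscale (d (Q, P) * g Q P) (\<mu> Q) else 0)"
    unfolding tlr.ev_add tlr.ev_sum case_prod_unfold tlr.ev_pscale tlr.ev_one
    by (rule arg_cong[where f = "\<lambda>z. _ + z"], rule sum.cong[OF refl]) (use g(2)[OF _ r] in auto)
   ultimately show ?thesis by simp
  qed
  (* on the walk along the first row only the identity acts nontrivially *)
  have c0: "c = 0"
  proof -
   obtain r where r: "walk (n, 0) r" using walk_exists[of 0 n] by auto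
   have rw: "r \<in> walks n" using r walks_iff by force
   have lr: "last r = (n, 0)" using walk_props[OF r] by blast
   have "(\<Sum>(Q, P)\<in>pairs n. if P = r then tscale (d (Q, P) * g Q P) (\<mu> Q) else 0) = 0"
    by (rule sum.neutral) (use lr in \<open>auto simp: pairs_def\<close>)
   then have "tscale c (\<mu> r) = 0" using rel[OF rw] by simp
   then show ?thesis using mu_nonzero[OF rw less.prems] by simp
  qed
  have d0: "d (Q, P) = 0" if QP: "(Q, P) \<in> pairs n" for Q P
  proof -
   have Q: "Q \<in> walks n" and P: "P \<in> walks n" using QP by (auto simp: pairs_def)
   have "crd v n Q 0 (\<Sum>(Q', P')\<in>pairs n. if P' = P then tscale (d (Q', P') * g Q' P') (\<mu> Q') else 0) = 0"
    using rel[OF P] c0 by simp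
   moreover have "crd v n Q 0 (\<Sum>(Q', P')\<in>pairs n. if P' = P then tscale (d (Q', P') * g Q' P') (\<mu> Q') else 0)
     = (\<Sum>x\<in>pairs n. if x = (Q, P) then d (Q, P) * g Q P else 0)"
    unfolding crd_sum
   proof (rule sum.cong[OF refl])
    fix y assume y: "y \<in> pairs n"
    then have "crd v n Q 0 (\<mu> (fst y)) = (if Q = fst y then 1 else 0)"
     using crd_bas[OF Q _ less.prems, of "fst y" 0 0] by (auto simp: pairs_def bas_0)
    then show "crd v n Q 0 (case y of (Q', P') => if P' = P then tscale (d (Q', P') * g Q' P') (\<mu> Q') else 0) = (if y = (Q, P) then d (Q, P) * g Q P else 0)"
     by (cases y) (auto simp: crd_scale)
   qed
   moreover have "\<dots> = d (Q, P) * g Q P" using QP by simp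
   ultimately show ?thesis using g(1)[OF QP] by simp
  qed
  have "?f c d = 0" using c0 d0 by (auto intro!: sum.neutral)
  then show "x \<in> IT n" using cd by simp
 qed
qed

end

section \<open>The Schur algebra acting on tensor space\<close>

declare One_nat_def [simp]

definition sgens :: "nat => schur_gen set" where "sgens n = {GE, GF} \<union> GI ` weights n"

abbreviation SF :: "nat => (schur_gen word \<Rightarrow>\<^sub>0 'k::field) set" where "SF n \<equiv> FA (sgens n)"

lemma sgens_simps [simp]: "GE \<in> sgens n" "GF \<in> sgens n" "GI j \<in> sgens n \<longleftrightarrow> j \<in> weights n"
 by (auto simp: sgens_def)

lemma sgens_cases:
 assumes "i \<in> sgens n"
 obtains "i = GE" | "i = GF" | j where "i = GI j" "j \<in> weights n"
 using assms by (auto simp: sgens_def)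

lemma finite_weights [simp]: "finite (weights n)"
 by (rule finite_subset[of _ "{- int n..int n}"]) (auto simp: weights_def)

lemma gen_idem_FA [intro]: "gen_idem n j \<in> SF n"
 by (auto simp: gen_idem_def)

lemma presentation_schur: "presentation (sgens n) (schur_relations v n)"
proof
 have "x \<in> schur_relations v n ==> x \<in> SF n" for x
  unfolding schur_relations_def Let_def
  by (auto intro!: FA_diff FA_mult FA_sum FA_pscale FA_gen)
 then show "schur_relations v n \<subseteq> SF n" by blast
qed

context quantum begin

sublocale sp: presentation "sgens n" "schur_relations v n" for n
 by (rule presentation_schur)

abbreviation "IS n \<equiv> idl (sgens n) (schur_relations v n)"

definition sop :: "nat => schur_gen => 'k tvec => 'k tvec" where
 "sop n x = (case x of GE => E n | GF => F n | GI i => op_idem i)"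

lemma sop_simps [simp]: "sop n GE = E n" "sop n GF = F n" "sop n (GI i) = op_idem i"
 by (simp_all add: sop_def)

sublocale sr: free_rep tscale "sop n" for n
proof (rule free_rep_tvec)
 fix i x y c
 show "sop n i (x + y) = sop n i x + sop n i y" by (cases i) (simp_all add: EF_linear op_idem_add)
 show "sop n i (tscale c x) = tscale c (sop n i x)" by (cases i) (simp_all add: EF_linear op_idem_scale)
qed

abbreviation "sact n \<equiv> act tscale (sop n)"

lemma sop_TS: "x \<in> TS n ==> sop n i x \<in> TS n"
 by (cases i) auto

lemma sact_TS: "p \<in> SF n ==> x \<in> TS n ==> sact n p x \<in> TS n"
 by (rule sr.ev_induct[OF _ subspace_TS]) (auto intro: sop_TS)

lemma sum_list_weights: "w \<in> sign_words n ==> sum_list w \<in> weights n"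
proof (induction n arbitrary: w)
 case 0 then show ?case by (simp add: sign_words_0 weights_def)
next
 case (Suc n)
 then obtain u s where w: "w = u @ [s]" "u \<in> sign_words n" "s \<in> {1, -1}" by (auto simp: sign_words_Suc)
 then have "sum_list u \<in> weights n" using Suc by blast
 then show ?case using w(3) unfolding w(1) weights_def by (auto; presburger)
qed

lemma sact_gen_idem: "x \<in> TS n ==> sact n (gen_idem n j) x = op_idem j x"
proof (cases "j \<in> weights n")
 case False
 assume x: "x \<in> TS n"
 have "op_idem j x = 0"
  using False x sum_list_weights by (force simp: op_idem_def TS_def fun_eq_iff zero_fun_apply)
 then show ?thesis using False by (simp add: gen_idem_def)
qed (simp add: gen_idem_def)

lemma sum_idem:
 assumes "x \<in> TS n" shows "(\<Sum>i\<in>weights n. tscale (c i) (op_idem i x)) = (\<lambda>w. c (sum_list w) * x w)"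
proof
 fix w
 have "(\<Sum>i\<in>weights n. tscale (c i) (op_idem i x)) w = (\<Sum>i\<in>weights n. if i = sum_list w then c i * x w else 0)"
  unfolding fun_sum_apply by (rule sum.cong) (auto simp: tscale_apply op_idem_def)
 also have "\<dots> = c (sum_list w) * x w"
  using assms sum_list_weights[of w n] by (auto simp: TS_def)
 finally show "(\<Sum>i\<in>weights n. tscale (c i) (op_idem i x)) w = c (sum_list w) * x w" .
qed

lemma schur_relations_act:
 assumes r: "r \<in> schur_relations v n" and x: "x \<in> TS n"
 shows "sact n r x = 0"
proof -
 note g = sact_gen_idem[OF x] sact_gen_idem[OF E_TS[OF x]] sact_gen_idem[OF F_TS[OF x]] sact_gen_idem[OF idem_TS[OF x]]
 note ev = sr.ev_diff sr.ev_mult sr.ev_add sr.ev_gen sr.ev_one sr.ev_zero sr.ev_sum sr.ev_pscale sop_simps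
 from r consider
   i j where "r = gen_idem n i * gen_idem n j - (if i = j then gen_idem n i else 0)"
  | "r = (\<Sum>i\<in>weights n. gen_idem n i) - 1"
  | "r = gen GE * gen GF - gen GF * gen GE - (\<Sum>i\<in>weights n. pscale (qint v i) (gen_idem n i))"
  | i where "r = gen GE * gen_idem n i - gen_idem n (i + 2) * gen GE"
  | i where "r = gen GF * gen_idem n i - gen_idem n (i - 2) * gen GF"
  | i where "r = gen_idem n i * gen GE - gen GE * gen_idem n (i - 2)"
  | i where "r = gen_idem n i * gen GF - gen GF * gen_idem n (i + 2)"
  unfolding schur_relations_def Let_def by blast
 then show ?thesis
 proof cases
  case 1 then show ?thesis by (simp add: ev g op_idem_idem)
 next
  case 2
  have "(\<Sum>i\<in>weights n. op_idem i x) = x" using sum_idem[OF x, of "\<lambda>_. 1"] by (simp add: fun_eq_iff)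
  then show ?thesis by (simp add: 2 ev g)
 next
  case 3
  have "(\<Sum>i\<in>weights n. tscale (qint v i) (op_idem i x)) = H x" by (simp add: sum_idem[OF x] Hop_def)
  then show ?thesis using EF_commutator[OF x] by (simp add: 3 ev g)
 qed (simp_all add: ev g idem_E[OF v_nonzero x] idem_F[OF v_nonzero x])
qed

lemma IS_act: "p \<in> IS n ==> x \<in> TS n ==> sact n p x = 0"
 by (rule sp.ev_I_zero[OF sr.free_rep_axioms subspace_TS]) (auto intro: sop_TS schur_relations_act)

lemma sact_GFpow: "sact n (gen GF ^ a) x = (F n ^^ a) x"
 by (induction a) (simp_all add: sr.ev_mult)
lemma sact_GEpow: "sact n (gen GE ^ a) x = (E n ^^ a) x"
 by (induction a) (simp_all add: sr.ev_mult)

end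

context quantum_N begin

text \<open>The factor of E^a on the c-th vector of a string of highest weight k.\<close>

definition gam :: "nat => nat => nat => 'k" where
 "gam k c a = (\<Prod>i<a. lad k (c - 1 - i))"

lemma Epow_bas: "p \<in> walks n ==> n \<le> N ==> (E n ^^ a) (\<beta> n p c) = (if a \<le> c then tscale (gam (wtp p) c a) (\<beta> n p (c - a)) else 0)"
proof (induction a)
 case 0
 then show ?case by (simp add: gam_def)
next
 case (Suc a)
 show ?case
 proof (cases "a < c")
  case True
  then obtain d where d: "c - a = Suc d" "d = c - 1 - a" by (metis Suc_diff_Suc diff_Suc_1 diff_commute)
  have "(E n ^^ Suc a) (\<beta> n p c) = E n (tscale (gam (wtp p) c a) (\<beta> n p (Suc d)))"
   using Suc True d by simp
  then show ?thesis using True d by (simp add: op_E_scale E_bas_Suc[OF Suc.prems] gam_def)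
 next
  case False
  then show ?thesis using Suc by (auto simp: op_E_scale E_bas_0)
 qed
qed

lemma gam_nonzero: "a \<le> c ==> c \<le> k ==> k \<le> N ==> gam k c a \<noteq> 0"
proof -
 assume h: "a \<le> c" "c \<le> k" "k \<le> N"
 have "lad k (c - 1 - i) \<noteq> 0" if "i < a" for i
 proof -
  have "qint v (int (Suc (c - 1 - i))) \<noteq> 0" by (rule qint_nonzero') (use that h in auto)
  moreover have "qint v (int k - int (c - 1 - i)) \<noteq> 0" by (rule qint_nonzero') (use that h in auto)
  ultimately show ?thesis by (simp add: lad_def)
 qed
 then show ?thesis by (simp add: gam_def prod_zero_iff)
qed

definition kl :: "nat \<times> nat => nat" where "kl l = fst l - snd l"

lemma wtp_kl: "wtp p = kl (last p)" by (simp add: wtp_def kl_def)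

lemma kl_weights: "l \<in> two_row_partitions n ==> a \<le> kl l ==> int (kl l) - 2 * int a \<in> weights n"
 unfolding two_row_partitions_def kl_def weights_def by (auto; presburger)

text \<open>The operator F^b E^a 1_i, with i the weight in position a of the strings of type l, kills shorter
 strings and has the right effect on the strings of type l. On longer strings, that is, for smaller
 second row, it acts like a multiple of a unit shifted by the difference d of the second rows; these
 are subtracted by induction.\<close>

lemma schur_units:
 assumes n: "n \<le> N"
 shows "l \<in> two_row_partitions n ==> a \<le> kl l ==> b \<le> kl l ==>
  \<exists>s\<in>SF n. \<forall>p\<in>walks n. \<forall>c\<le>wtp p. sact n s (\<beta> n p c) = (if last p = l \<and> c = a then \<beta> n p b else 0)"
proof (induction "snd l" arbitrary: l a b rule: less_induct)
 case less
 let ?k = "kl l"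
 let ?L = "{l' \<in> two_row_partitions n. snd l' < snd l}"
 have lk: "int (kl l') = int n - 2 * int (snd l')" if "l' \<in> two_row_partitions n" for l'
  using that by (auto simp: two_row_partitions_def kl_def)
 (* strings of type l are shifted by d against strings of type l' *)
 define d where "d l' = snd l - snd l'" for l' :: "nat \<times> nat"
 have "\<exists>s. \<forall>l'\<in>?L. s l' \<in> SF n \<and> (\<forall>p\<in>walks n. \<forall>c\<le>wtp p. sact n (s l') (\<beta> n p c) = (if last p = l' \<and> c = a + d l' then \<beta> n p (d l' + b) else 0))"
 proof (rule bchoice, rule ballI)
  fix l' assume l': "l' \<in> ?L"
  have "a + d l' \<le> kl l'" "d l' + b \<le> kl l'"
   using lk[of l'] lk[of l] l' less.prems by (auto simp: d_def)
  then show "\<exists>s. s \<in> SF n \<and> (\<forall>p\<in>walks n. \<forall>c\<le>wtp p. sact n s (\<beta> n p c) = (if last p = l' \<and> c = a + d l' then \<beta> n p (d l' + b) else 0))"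
   using less.hyps[of l' "a + d l'" "d l' + b"] l' by blast
 qed
 then obtain s where s: "\<And>l'. l' \<in> ?L ==> s l' \<in> SF n"
  "\<And>l' p c. l' \<in> ?L ==> p \<in> walks n ==> c \<le> wtp p ==> sact n (s l') (\<beta> n p c) = (if last p = l' \<and> c = a + d l' then \<beta> n p (d l' + b) else 0)"
  by blast
 (* the leading term; sl below subtracts its effect on the longer strings *)
 define s0 :: "schur_gen word \<Rightarrow>\<^sub>0 'k" where "s0 = gen GF ^ b * (gen GE ^ a * gen (GI (int ?k - 2 * int a)))"
 have s0F: "s0 \<in> SF n"
  unfolding s0_def using kl_weights[OF less.prems(1,2)] by (intro FA_mult FA_power FA_gen) auto
 have s0a: "sact n s0 (\<beta> n p c) = (if int ?k - 2 * int a = int (wtp p) - 2 * int c \<and> a \<le> c then tscale (gam (wtp p) c a) (\<beta> n p (c - a + b)) else 0)"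
  if p: "p \<in> walks n" for p c
 proof -
  have z: "(F n ^^ b) 0 = 0" "(E n ^^ a) 0 = 0" by (induction b, auto) (induction a, auto)
  have "(F n ^^ b) (\<beta> n p (c - a)) = \<beta> n p (c - a + b)"
   by (simp add: bas_def funpow_add[symmetric] add.commute flip: o_apply[of "F n ^^ b"])
  then show ?thesis
   by (simp add: s0_def sr.ev_mult sact_GFpow sact_GEpow idem_bas[OF p n] Epow_bas[OF p n] Fpow_scale z)
 qed
 define sl where "sl = s0 - (\<Sum>l'\<in>?L. pscale (gam (kl l') (a + d l') a) (s l'))"
 have g0: "gam ?k a a \<noteq> 0" by (rule gam_nonzero) (use less.prems lk[OF less.prems(1)] n in auto)
 have "sact n sl (\<beta> n p c) = (if last p = l \<and> c = a then tscale (gam ?k a a) (\<beta> n p b) else 0)"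
  if p: "p \<in> walks n" and c: "c \<le> wtp p" for p c
 proof -
  have lp: "last p \<in> two_row_partitions n" by (rule last_two_row[OF p])
  have sum: "sact n (\<Sum>l'\<in>?L. pscale (gam (kl l') (a + d l') a) (s l')) (\<beta> n p c)
   = (if snd (last p) < snd l \<and> c = a + d (last p) then tscale (gam (wtp p) (a + d (last p)) a) (\<beta> n p (d (last p) + b)) else 0)"
  proof -
   have "sact n (\<Sum>l'\<in>?L. pscale (gam (kl l') (a + d l') a) (s l')) (\<beta> n p c)
    = (\<Sum>l'\<in>?L. if l' = last p then (if c = a + d (last p) then tscale (gam (wtp p) (a + d (last p)) a) (\<beta> n p (d (last p) + b)) else 0) else 0)"
    unfolding sr.ev_sum sr.ev_pscale by (rule sum.cong[OF refl]) (auto simp: s(2)[OF _ p c] wtp_kl)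
   then show ?thesis using lp by auto
  qed
  have wk: "int (wtp p) = int n - 2 * int (snd (last p))" using lk[OF lp] by (simp add: wtp_kl)
  note kk = lk[OF less.prems(1)]
  show ?thesis
  proof (cases "snd (last p)" "snd l" rule: linorder_cases)
   case less
   then have ne: "last p \<noteq> l" by auto
   have "int ?k - 2 * int a = int (wtp p) - 2 * int c \<and> a \<le> c \<longleftrightarrow> c = a + d (last p)"
    using less wk kk by (auto simp: d_def)
   then show ?thesis using less ne by (simp add: sl_def sr.ev_diff s0a[OF p] sum add.commute)
  next
   case equal
   then have e: "last p = l" using lp \<open>l \<in> two_row_partitions n\<close> by (auto simp: two_row_partitions_def prod_eq_iff)
   have "int ?k - 2 * int a = int (wtp p) - 2 * int c \<and> a \<le> c \<longleftrightarrow> c = a" using e by (auto simp: wtp_kl)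
   then show ?thesis using equal e by (simp add: sl_def sr.ev_diff s0a[OF p] sum wtp_kl)
  next
   case greater
   then have ne: "last p \<noteq> l" by auto
   have "\<not> (int ?k - 2 * int a = int (wtp p) - 2 * int c \<and> a \<le> c)" using greater wk kk by auto
   then show ?thesis using greater ne by (auto simp: sl_def sr.ev_diff s0a[OF p] sum)
  qed
 qed
 moreover have "sl \<in> SF n" unfolding sl_def using s(1) s0F by (intro FA_diff FA_sum FA_pscale) auto
 ultimately show ?case using g0
  by (intro bexI[of _ "pscale (inverse (gam ?k a a)) sl"]) (auto simp: sr.ev_pscale)
qed

text \<open>An operator commuting with all matrix units acts on each string of type l by the same matrix, which
 is read off from one chosen walk and realized by units of the Schur algebra.\<close>

lemma schur_image:
 assumes n: "n \<le> N"
  and X: "\<And>x y. x \<in> TS n ==> y \<in> TS n ==> X (x + y) = X x + X y" "\<And>c x. x \<in> TS n ==> X (tscale c x) = tscale c (X x)"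
   "\<And>x. x \<in> TS n ==> X x \<in> TS n"
  and comm: "\<And>p q x. p \<in> walks n ==> q \<in> walks n ==> last p = last q ==> x \<in> TS n ==> X (munit v n q p x) = munit v n q p (X x)"
 shows "\<exists>s\<in>SF n. \<forall>x\<in>TS n. sact n s x = X x"
proof -
 have X0: "X 0 = 0" using X(2)[OF TS_0, of 0] by simp
 let ?I = "SIGMA l:two_row_partitions n. {..kl l} \<times> {..kl l}"
 have "\<exists>s. \<forall>i\<in>?I. s i \<in> SF n \<and> (\<forall>p\<in>walks n. \<forall>c\<le>wtp p. sact n (s i) (\<beta> n p c) = (if last p = fst i \<and> c = fst (snd i) then \<beta> n p (snd (snd i)) else 0))"
 proof (rule bchoice, rule ballI)
  fix i assume i: "i \<in> ?I"
  then obtain l a b where lab: "i = (l, a, b)" "l \<in> two_row_partitions n" "a \<le> kl l" "b \<le> kl l"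
   by (cases i) auto
  from schur_units[OF n lab(2-4)]
  show "\<exists>s. s \<in> SF n \<and> (\<forall>p\<in>walks n. \<forall>c\<le>wtp p. sact n s (\<beta> n p c) = (if last p = fst i \<and> c = fst (snd i) then \<beta> n p (snd (snd i)) else 0))"
   unfolding lab(1) fst_conv snd_conv by blast
 qed
 then obtain s where s': "\<forall>i\<in>?I. s i \<in> SF n \<and> (\<forall>p\<in>walks n. \<forall>c\<le>wtp p. sact n (s i) (\<beta> n p c) = (if last p = fst i \<and> c = fst (snd i) then \<beta> n p (snd (snd i)) else 0))" ..
 have s: "s (l, a, b) \<in> SF n"
  "p \<in> walks n ==> c \<le> wtp p ==> sact n (s (l, a, b)) (\<beta> n p c) = (if last p = l \<and> c = a then \<beta> n p b else 0)"
  if "l \<in> two_row_partitions n" "a \<le> kl l" "b \<le> kl l" for l a b p c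
  using bspec[OF s', of "(l, a, b)"] that by simp_all
 define R where "R l = (SOME p. walk l p)" for l
 have R: "R l \<in> walks n" "last (R l) = l" if "l \<in> two_row_partitions n" for l
 proof -
  have "\<exists>p. walk l p" using that walk_exists by (auto simp: two_row_partitions_def)
  then have "walk l (R l)" unfolding R_def by (rule someI_ex)
  then have "R l \<in> walks_to l" by (simp add: walks_to_iff)
  then show "R l \<in> walks n" "last (R l) = l" using walks_to_walks[OF that] by auto
 qed
 let ?x = "\<lambda>l a b. crd v n (R l) b (X (\<beta> n (R l) a))"
 let ?s = "\<Sum>l\<in>two_row_partitions n. \<Sum>a\<le>kl l. \<Sum>b\<le>kl l. pscale (?x l a b) (s (l, a, b))"
 have sF: "?s \<in> SF n" using s(1) by (intro FA_sum FA_pscale) auto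
 have key: "sact n ?s (\<beta> n p c) = X (\<beta> n p c)" if p: "p \<in> walks n" and c: "c \<le> wtp p" for p c
 proof -
  let ?l = "last p"
  have l: "?l \<in> two_row_partitions n" by (rule last_two_row[OF p])
  have "sact n ?s (\<beta> n p c) = (\<Sum>l\<in>two_row_partitions n. if l = ?l then (\<Sum>b\<le>wtp p. tscale (?x ?l c b) (\<beta> n p b)) else 0)"
   unfolding sr.ev_sum sr.ev_pscale
  proof (rule sum.cong[OF refl])
   fix l' assume l': "l' \<in> two_row_partitions n"
   have "(\<Sum>a\<le>kl l'. \<Sum>b\<le>kl l'. tscale (?x l' a b) (sact n (s (l', a, b)) (\<beta> n p c)))
    = (\<Sum>a\<le>kl l'. if a = c then (if l' = ?l then \<Sum>b\<le>kl l'. tscale (?x l' c b) (\<beta> n p b) else 0) else 0)"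
    by (rule sum.cong[OF refl]) (auto simp: s(2)[OF l' _ _ p c] intro!: sum.neutral)
   also have "\<dots> = (if l' = ?l then (\<Sum>b\<le>wtp p. tscale (?x ?l c b) (\<beta> n p b)) else 0)"
    using c by (auto simp: wtp_kl)
   finally show "(\<Sum>a\<le>kl l'. \<Sum>b\<le>kl l'. tscale (?x l' a b) (sact n (s (l', a, b)) (\<beta> n p c)))
    = (if l' = ?l then (\<Sum>b\<le>wtp p. tscale (?x ?l c b) (\<beta> n p b)) else 0)" .
  qed
  also have "\<dots> = (\<Sum>b\<le>wtp p. tscale (?x ?l c b) (\<beta> n p b))" using l by simp
  also have "\<dots> = munit v n p (R ?l) (X (\<beta> n (R ?l) c))" using R(2)[OF l] by (simp add: munit_def wtp_kl)
  also have "\<dots> = X (munit v n p (R ?l) (\<beta> n (R ?l) c))"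
   by (rule comm[symmetric, OF R(1)[OF l] p R(2)[OF l] bas_TS[OF R(1)[OF l] n]])
  also have "munit v n p (R ?l) (\<beta> n (R ?l) c) = \<beta> n p c"
   using munit_bas[OF R(1)[OF l] R(1)[OF l] n _ p, of c] R(2)[OF l] by (simp add: wtp_kl)
  finally show ?thesis .
 qed
 have "x \<in> TS n \<and> sact n ?s x = X x" if "x \<in> TS n" for x
  using that n by (induction rule: bas_induct)
   (auto simp: sr.ev_add_right sr.ev_scale_right X X0 key bas_TS[OF _ n])
 then show ?thesis using sF by blast
qed

text \<open>The submodule generated by \<mu>(p).\<close>

definition string :: "nat => (nat \<times> nat) list => 'k tvec set" where
 "string n p = tvec.span (\<beta> n p ` {..wtp p})"

lemma bas_string: "p \<in> walks n ==> n \<le> N ==> \<beta> n p a \<in> string n p"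
 using bas_zero[of p n a] tvec.span_base[of "\<beta> n p a" "\<beta> n p ` {..wtp p}"]
 by (cases "a \<le> wtp p") (auto simp: string_def tvec.span_zero)

lemma subspace_string: "tvec.subspace (string n p)" by (simp add: string_def)

lemma string_TS: "p \<in> walks n ==> n \<le> N ==> string n p \<subseteq> TS n"
 unfolding string_def by (rule tvec.span_minimal[OF _ subspace_TS]) (auto intro: bas_TS)

lemma string_expand:
 assumes "p \<in> walks n" "n \<le> N" "x \<in> string n p"
 shows "x = (\<Sum>a\<le>wtp p. tscale (crd v n p a x) (\<beta> n p a))"
 using orth_expand[of "{..wtp p}" n "\<beta> n p" x] bas_orth[OF assms(1,1,2)] bas_norm[OF assms(1,2)] assms(3)
 by (simp add: string_def crd_def)

lemma sact_string:
 assumes p: "p \<in> walks n" "n \<le> N" and s: "s \<in> SF n" and x: "x \<in> string n p"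
 shows "sact n s x \<in> string n p"
proof (rule sr.ev_induct[OF s subspace_string x])
 fix i y assume y: "y \<in> string n p"
 from y[unfolded string_def] show "sop n i y \<in> string n p"
 proof (induction rule: tvec.span_induct_alt)
  case base
  then show ?case using tvec.subspace_0[OF subspace_string] sr.g_scale[of n i 0 0] by simp
 next
  case (step c x y)
  then obtain a where a: "x = \<beta> n p a" by auto
  have "sop n i x \<in> string n p"
  proof (cases i)
   case GE
   then show ?thesis unfolding a
    by (cases a) (auto simp: E_bas_0[OF p] E_bas_Suc[OF p] tvec.subspace_0[OF subspace_string]
      intro!: tvec.subspace_scale[OF subspace_string] bas_string[OF p])
  qed (auto simp: a F_bas idem_bas[OF p] bas_string[OF p] tvec.subspace_0[OF subspace_string])
  then show ?case using step(2) unfolding sr.g_add sr.g_scale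
   by (intro tvec.subspace_add[OF subspace_string] tvec.subspace_scale[OF subspace_string])
 qed
qed

lemma string_transitive:
 assumes p: "p \<in> walks n" "n \<le> N" and x: "x \<in> string n p" "x \<noteq> 0" and y: "y \<in> string n p"
 shows "\<exists>s\<in>SF n. sact n s x = y"
proof -
 let ?k = "wtp p"
 have l: "last p \<in> two_row_partitions n" by (rule last_two_row[OF p(1)])
 have "\<exists>i\<le>?k. crd v n p i x \<noteq> 0"
 proof (rule ccontr)
  assume "\<not> ?thesis"
  then have "x = 0" using string_expand[OF p x(1)] by simp
  then show False using x by simp
 qed
 then obtain i where i: "i \<le> ?k" "crd v n p i x \<noteq> 0" by blast
 have "\<exists>s. \<forall>b\<in>{..?k}. s b \<in> SF n \<and> (\<forall>q\<in>walks n. \<forall>c\<le>wtp q. sact n (s b) (\<beta> n q c) = (if last q = last p \<and> c = i then \<beta> n q b else 0))"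
 proof (rule bchoice, rule ballI)
  fix b assume "b \<in> {..?k}"
  then show "\<exists>s. s \<in> SF n \<and> (\<forall>q\<in>walks n. \<forall>c\<le>wtp q. sact n s (\<beta> n q c) = (if last q = last p \<and> c = i then \<beta> n q b else 0))"
   using schur_units[OF p(2) l, of i b] i(1) by (auto simp only: wtp_kl atMost_iff)
 qed
 then obtain s where s': "\<forall>b\<in>{..?k}. s b \<in> SF n \<and> (\<forall>q\<in>walks n. \<forall>c\<le>wtp q. sact n (s b) (\<beta> n q c) = (if last q = last p \<and> c = i then \<beta> n q b else 0))" ..
 have s: "s b \<in> SF n" "c \<le> ?k ==> sact n (s b) (\<beta> n p c) = (if c = i then \<beta> n p b else 0)"
  if "b \<le> ?k" for b c
  using bspec[OF s', of b] that p(1) by simp_all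
 have sx: "sact n (s b) x = tscale (crd v n p i x) (\<beta> n p b)" if b: "b \<le> ?k" for b
 proof -
  have "sact n (s b) x = (\<Sum>a\<le>?k. tscale (crd v n p a x) (sact n (s b) (\<beta> n p a)))"
   using arg_cong[OF string_expand[OF p x(1)], of "sact n (s b)"] by (simp only: sr.ev_sum_right sr.ev_scale_right)
  also have "\<dots> = (\<Sum>a\<le>?k. if a = i then tscale (crd v n p i x) (\<beta> n p b) else 0)"
   by (rule sum.cong) (auto simp: s(2)[OF b])
  finally show ?thesis using i by simp
 qed
 let ?s = "\<Sum>b\<le>?k. pscale (crd v n p b y / crd v n p i x) (s b)"
 have "sact n ?s x = (\<Sum>b\<le>?k. tscale (crd v n p b y) (\<beta> n p b))"
  unfolding sr.ev_sum sr.ev_pscale by (rule sum.cong) (use i sx in auto)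
 then have "sact n ?s x = y" using string_expand[OF p y] by simp
 moreover have "?s \<in> SF n" using s(1) by (intro FA_sum FA_pscale) auto
 ultimately show ?thesis by blast
qed

end

section \<open>Weyl modules\<close>

text \<open>The elements F^a 1_m, which will be a basis of V(m).\<close>

definition wz :: "nat => nat => (schur_gen word \<Rightarrow>\<^sub>0 'k::field)" where
 "wz m a = gen GF ^ a * gen (GI (int m))"

lemma top_weight [simp]: "int m \<in> weights m" by (simp add: weights_def)

lemma wz_FA [intro]: "wz m a \<in> SF m"
 unfolding wz_def by (intro FA_mult FA_power FA_gen) auto

context quantum_N begin

abbreviation "gE \<equiv> (gen GE :: schur_gen word \<Rightarrow>\<^sub>0 'k)"
abbreviation "gF \<equiv> (gen GF :: schur_gen word \<Rightarrow>\<^sub>0 'k)"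
abbreviation "g1 m j \<equiv> (gen_idem m j :: schur_gen word \<Rightarrow>\<^sub>0 'k)"

lemma gEF_FA [intro]: "gE \<in> SF m" "gF \<in> SF m" by auto

lemma idem_mult: "g1 m i * g1 m j - (if i = j then g1 m i else 0) \<in> IS m"
proof (cases "i \<in> weights m \<and> j \<in> weights m")
 case True
 then show ?thesis by (intro sp.Rel_I) (auto simp: schur_relations_def Let_def)
qed (auto simp: gen_idem_def)

lemma idem_gF: "g1 m j * gF - gF * g1 m (j + 2) \<in> IS m"
proof -
 have r: "g1 m j * gF - gF * g1 m (j + 2) \<in> IS m" if "j \<in> weights m"
  by (rule sp.Rel_I) (use that in \<open>auto simp: schur_relations_def Let_def\<close>)
 have "gF * g1 m (j + 2) - g1 m (j + 2 - 2) * gF \<in> IS m" if "j + 2 \<in> weights m"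
  by (rule sp.Rel_I) (use that in \<open>unfold schur_relations_def Let_def, blast\<close>)
 then have r': "g1 m j * gF - gF * g1 m (j + 2) \<in> IS m" if "j + 2 \<in> weights m"
  using that sp.I_sym by simp
 show ?thesis
 proof (cases "j \<in> weights m \<or> j + 2 \<in> weights m")
  case False
  then show ?thesis by (simp add: gen_idem_def)
 qed (use r r' in blast)
qed

lemma gE_idem: "gE * g1 m j - g1 m (j + 2) * gE \<in> IS m" if "j \<in> weights m"
 by (rule sp.Rel_I) (use that in \<open>auto simp: schur_relations_def Let_def\<close>)

lemma idem_gFpow: "g1 m j * gF ^ a - gF ^ a * g1 m (j + 2 * int a) \<in> IS m"
proof (induction a arbitrary: j)
 case (Suc a)
 have "g1 m j * gF * gF ^ a - gF * g1 m (j + 2) * gF ^ a \<in> IS m"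
  by (rule sp.I_mult_right_cong[OF _ idem_gF]) auto?
 moreover have "gF * (g1 m (j + 2) * gF ^ a) - gF * (gF ^ a * g1 m (j + 2 + 2 * int a)) \<in> IS m"
  by (rule sp.I_mult_left_cong[OF _ Suc]) auto?
 ultimately have "g1 m j * gF * gF ^ a - gF * (gF ^ a * g1 m (j + 2 + 2 * int a)) \<in> IS m"
  using sp.I_trans by (simp only: mult.assoc)
 then show ?case by (simp add: mult.assoc algebra_simps)
qed simp

lemma wz_eq: "wz m a = gF ^ a * g1 m (int m)" by (simp add: wz_def gen_idem_def)

lemma idem_wz: "g1 m j * wz m a - (if j = int m - 2 * int a then wz m a else 0) \<in> IS m"
proof -
 have "g1 m j * gF ^ a * g1 m (int m) - gF ^ a * g1 m (j + 2 * int a) * g1 m (int m) \<in> IS m"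
  by (rule sp.I_mult_right_cong[OF _ idem_gFpow]) auto?
 moreover have "gF ^ a * (g1 m (j + 2 * int a) * g1 m (int m)) - gF ^ a * (if j + 2 * int a = int m then g1 m (j + 2 * int a) else 0) \<in> IS m"
  by (rule sp.I_mult_left_cong[OF _ idem_mult]) auto?
 ultimately have "g1 m j * gF ^ a * g1 m (int m) - gF ^ a * (if j + 2 * int a = int m then g1 m (j + 2 * int a) else 0) \<in> IS m"
  using sp.I_trans by (simp only: mult.assoc)
 moreover have "j + 2 * int a = int m \<longleftrightarrow> j = int m - 2 * int a" by auto
 ultimately show ?thesis unfolding wz_eq by (cases "j = int m - 2 * int a") (simp_all add: mult.assoc)
qed

text \<open>F^a 1_m vanishes in the algebra for a > m: its weight m - 2 a is below - m.\<close>

lemma wz_top: "m < a ==> wz m a \<in> IS m"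
proof -
 assume "m < a"
 then have "int m - 2 * int a \<notin> weights m" by (auto simp: weights_def)
 then have "g1 m (int m - 2 * int a) = 0" by (simp add: gen_idem_def)
 then show ?thesis using idem_wz[of m "int m - 2 * int a" a] sp.I_sym[of 0 "wz m a" m] by simp
qed

lemma gF_wz: "gF * wz m a = wz m (Suc a)" by (simp add: wz_def mult.assoc)

lemma gE_wz_0: "gE * wz m 0 \<in> IS m"
proof -
 have "int m + 2 \<notin> weights m" by (auto simp: weights_def)
 then have "g1 m (int m + 2) = 0" by (simp add: gen_idem_def)
 then show ?thesis using gE_idem[of "int m" m] by (simp add: wz_eq)
qed

lemma EF_wz:
 assumes "a \<le> m"
 shows "gE * wz m (Suc a) - (gF * (gE * wz m a) + pscale (qint v (int m - 2 * int a)) (wz m a)) \<in> IS m"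
proof -
 have w: "int m - 2 * int a \<in> weights m" using assms by (auto simp: weights_def) presburger
 have "gE * gF - gF * gE - (\<Sum>i\<in>weights m. pscale (qint v i) (g1 m i)) \<in> IS m"
  by (rule sp.Rel_I) (auto simp: schur_relations_def Let_def)
 then have "(gE * gF - gF * gE - (\<Sum>i\<in>weights m. pscale (qint v i) (g1 m i))) * wz m a \<in> IS m"
  by (rule sp.I_mult_right[OF wz_FA])
 then have 1: "gE * wz m (Suc a) - (gF * (gE * wz m a) + (\<Sum>i\<in>weights m. pscale (qint v i) (g1 m i * wz m a))) \<in> IS m"
  by (simp add: algebra_simps sum_distrib_right pscale_mult_left mult.assoc gF_wz)
 have "(\<Sum>i\<in>weights m. pscale (qint v i) (g1 m i * wz m a - (if i = int m - 2 * int a then wz m a else 0))) \<in> IS m"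
  by (intro pvec.subspace_sum[OF sp.subspace_I] pvec.subspace_scale[OF sp.subspace_I] idem_wz)
 moreover have "(\<Sum>i\<in>weights m. pscale (qint v i) (if i = int m - 2 * int a then wz m a else 0)) = pscale (qint v (int m - 2 * int a)) (wz m a)"
 proof -
  have "(\<Sum>i\<in>weights m. pscale (qint v i) (if i = int m - 2 * int a then wz m a else 0)) = (\<Sum>i\<in>weights m. if i = int m - 2 * int a then pscale (qint v i) (wz m a) else 0)"
   by (rule sum.cong) auto
  then show ?thesis using w by simp
 qed
 ultimately have 2: "(\<Sum>i\<in>weights m. pscale (qint v i) (g1 m i * wz m a)) - pscale (qint v (int m - 2 * int a)) (wz m a) \<in> IS m"
  by (simp add: pvec.scale_right_diff_distrib sum_subtractf)
 have "(gF * (gE * wz m a) + (\<Sum>i\<in>weights m. pscale (qint v i) (g1 m i * wz m a))) - (gF * (gE * wz m a) + pscale (qint v (int m - 2 * int a)) (wz m a)) \<in> IS m"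
  using sp.I_add_cong[OF _ 2, of "gF * (gE * wz m a)" "gF * (gE * wz m a)"] by simp
 then show ?thesis using sp.I_trans[OF 1] by blast
qed

lemma lad_Suc: "lad k a + qint v (int k - 2 * int (Suc a)) = lad k (Suc a)"
 using qint_ladder[of "int (Suc a)" "int k - 2 * int (Suc a)"] by (simp add: lad_def algebra_simps)

lemma gE_wz_Suc: "a \<le> m ==> gE * wz m (Suc a) - pscale (lad m a) (wz m a) \<in> IS m"
proof (induction a)
 case 0
 have "gF * (gE * wz m 0) + pscale (qint v (int m)) (wz m 0) - pscale (qint v (int m)) (wz m 0) \<in> IS m"
  using sp.I_mult_left[OF gEF_FA(2) gE_wz_0] by simp
 then show ?case using sp.I_trans[OF EF_wz[of 0 m]] by (simp add: lad_def)
next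
 case (Suc a)
 have "gF * (gE * wz m (Suc a)) - gF * pscale (lad m a) (wz m a) \<in> IS m"
  using Suc by (intro sp.I_mult_left_cong) auto
 then have "gF * (gE * wz m (Suc a)) - pscale (lad m a) (wz m (Suc a)) \<in> IS m"
  by (simp add: pscale_mult_right gF_wz)
 then have "(gF * (gE * wz m (Suc a)) + pscale (qint v (int m - 2 * int (Suc a))) (wz m (Suc a)))
   - (pscale (lad m a) (wz m (Suc a)) + pscale (qint v (int m - 2 * int (Suc a))) (wz m (Suc a))) \<in> IS m"
  by (simp only: add_diff_cancel_right)
 then have "(gF * (gE * wz m (Suc a)) + pscale (qint v (int m - 2 * int (Suc a))) (wz m (Suc a)))
   - pscale (lad m (Suc a)) (wz m (Suc a)) \<in> IS m"
  by (simp only: lad_Suc flip: pvec.scale_left_distrib)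
 then show ?case using sp.I_trans[OF EF_wz[of "Suc a" m]] Suc.prems by blast
qed

text \<open>An element of V(m) with given coordinates.\<close>

definition WC :: "nat => (nat => 'k) => (schur_gen word \<Rightarrow>\<^sub>0 'k)" where
 "WC m c = (\<Sum>a\<le>m. pscale (c a) (wz m a))"

lemma WC_FA [intro]: "WC m c \<in> SF m" unfolding WC_def by (intro FA_sum FA_pscale) auto

text \<open>The span of the F^a 1_m is stable under left multiplication by the generators, by the commutation
 relations.\<close>

lemma ideal_mult_idem:
 assumes p: "p \<in> SF m"
 shows "\<exists>c. p * gen (GI (int m)) - WC m c \<in> IS m"
proof -
 let ?S = "pvec.span (wz m ` {..m} \<union> IS m)"
 have base: "x \<in> ?S" if "x \<in> IS m" for x using that by (intro pvec.span_base) auto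
 have wzS: "wz m a \<in> ?S" for a
 proof (cases "a \<le> m")
  case True then show ?thesis by (intro pvec.span_base) auto
 next
  case False then show ?thesis by (intro base wz_top) auto
 qed
 have cong: "x \<in> ?S" if "y \<in> ?S" "x - y \<in> IS m" for x y
  using pvec.span_add[OF that(1) base[OF that(2)]] by simp
 have gen_wz: "gen i * wz m a \<in> ?S" if i: "i \<in> sgens m" and a: "a \<le> m" for i a
 proof -
  from i show ?thesis
  proof (cases rule: sgens_cases)
   case 1
   show ?thesis
   proof (cases a)
    case 0 then show ?thesis using 1 gE_wz_0 base by simp
   next
    case (Suc b)
    then show ?thesis using cong[OF pvec.span_scale[OF wzS] gE_wz_Suc[of b m]] a 1 by simp
   qed
  next
   case 2 then show ?thesis using wzS by (simp add: gF_wz)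
  next
   case (3 j)
   then have "gen i = g1 m j" by (simp add: gen_idem_def)
   moreover have "(if j = int m - 2 * int a then wz m a else 0) \<in> ?S" by (simp add: wzS pvec.span_zero)
   ultimately show ?thesis using cong[OF _ idem_wz[of m j a]] by simp
  qed
 qed
 have "p * gen (GI (int m)) \<in> ?S"
  using p
 proof (induction rule: FA_left_induct)
  case one
  show ?case using wzS[of 0] by (simp add: wz_def)
 next
  case (gen i q)
  from gen(2) have "gen i * (q * gen (GI (int m))) \<in> ?S"
  proof (rule pvec.span_induct[where P = "\<lambda>x. gen i * x \<in> ?S"])
   show "pvec.subspace (Collect (\<lambda>x. gen i * x \<in> ?S))"
    by (rule pvec.subspaceI) (auto simp: ring_distribs pscale_mult_right pvec.span_zero pvec.span_add pvec.span_scale)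
   fix x assume "x \<in> wz m ` {..m} \<union> IS m"
   then show "gen i * x \<in> ?S" using gen_wz[OF gen(1)] base sp.I_mult_left[OF FA_gen[OF gen(1)]] by auto
  qed
  then show ?case by (simp add: mult.assoc)
 qed (auto simp: ring_distribs pscale_mult_left pvec.span_zero pvec.span_add pvec.span_scale)
 from span_Un_coeffs[OF this _ sp.subspace_I] show ?thesis unfolding WC_def by auto
qed

text \<open>Applied to the highest weight vector y_1 \<otimes> \<dots> \<otimes> y_1 of V^{\<otimes>m}, these
 elements give the string of that vector.\<close>

lemma WC_independent:
 assumes m: "m \<le> N" and c: "WC m c \<in> IS m" and a: "a \<le> m"
 shows "c a = 0"
proof -
 (* the walk along the first row, with highest weight vector y_1...1 *)
 obtain r where r: "walk (m, 0) r" using walk_exists[of 0 m] by auto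
 have rw: "r \<in> walks m" using r walks_iff by force
 have wr: "wtp r = m" using wtp_walk[OF r] by simp
 have T: "\<mu> r \<in> TS m" using hw_TS[OF hw_walks[OF rw m]] .
 have i: "op_idem (int m) (\<mu> r) = \<mu> r" using idem_bas[OF rw m, of "int m" 0] by (simp add: bas_0 wr)
 have "sact m (WC m c) (\<mu> r) = (\<Sum>b\<le>m. tscale (c b) (\<beta> m r b))"
  by (simp add: WC_def sr.ev_sum sr.ev_pscale wz_def sr.ev_mult sact_GFpow i bas_def)
 then have "(\<Sum>b\<le>m. tscale (c b) (\<beta> m r b)) = 0" using IS_act[OF c T] by simp
 then have "crd v m r a (\<Sum>b\<le>m. tscale (c b) (\<beta> m r b)) = 0" by simp
 moreover have "crd v m r a (\<Sum>b\<le>m. tscale (c b) (\<beta> m r b)) = (\<Sum>b\<le>m. if b = a then c a else 0)"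
  unfolding crd_sum crd_scale by (rule sum.cong) (use crd_bas[OF rw rw m, of a] a wr in auto)
 ultimately show ?thesis using a by simp
qed

text \<open>The substitution inducing the surjection from S(n) to S(m), as operators of left multiplication:
 idempotents outside the weights of m go to zero, as built into gen_idem.\<close>

definition sb :: "nat => schur_gen => (schur_gen word \<Rightarrow>\<^sub>0 'k) => (schur_gen word \<Rightarrow>\<^sub>0 'k)" where
 "sb m x b = (case x of GI i => g1 m i | _ => gen x) * b"

lemma sb_simps [simp]: "sb m GE b = gE * b" "sb m GF b = gF * b" "sb m (GI i) b = g1 m i * b"
 by (simp_all add: sb_def)

sublocale sbr: free_rep pscale "sb m" for m
 by unfold_locales (auto simp: sb_def ring_distribs pscale_mult_right)

abbreviation "sbact m \<equiv> act pscale (sb m)"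

lemma sb_FA: "b \<in> SF m ==> sb m x b \<in> SF m"
 by (cases x) (simp_all add: FA_mult gen_idem_FA gEF_FA)

lemma sbact_FA: "p \<in> FA G ==> b \<in> SF m ==> sbact m p b \<in> SF m"
 by (rule sbr.ev_induct[OF _ subspace_FA]) (auto intro: sb_FA)

lemma sbact_IS: "p \<in> FA G ==> b \<in> IS m ==> sbact m p b \<in> IS m"
 by (rule sbr.ev_induct[OF _ sp.subspace_I])
  (auto simp: sb_def intro!: sp.I_mult_left split: schur_gen.splits)

lemma sbact_mult_right: "sbact m p (b * c) = sbact m p b * c"
proof -
 have "foldr (sb m) w (b * c) = foldr (sb m) w b * c" for w
  by (induction w) (auto simp: sb_def mult.assoc)
 then show ?thesis by (simp add: act_def sum_distrib_right pscale_mult_left)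
qed

lemma weights_subset: "m \<le> n ==> m mod 2 = n mod 2 ==> weights m \<subseteq> weights n"
proof -
 assume h: "m \<le> n" "m mod 2 = n mod 2"
 have "int m mod 2 = int (m mod 2)" "int n mod 2 = int (n mod 2)" by (simp_all add: zmod_int)
 then have "int m mod 2 = int n mod 2" using h(2) by simp
 then show ?thesis using h(1) unfolding weights_def by auto
qed

lemma sbact_gen_idem: "weights m \<subseteq> weights n ==> sbact m (gen_idem n j) q = g1 m j * q"
 by (auto simp: gen_idem_def)

text \<open>The relations of S(n) go to relations of S(m), or to trivial ones where an idempotent is zero; the
 boundary cases use that products such as E 1_m and F 1_{-m} vanish in S(m).\<close>

lemma sbact_relations:
 assumes W: "weights m \<subseteq> weights n" and r: "r \<in> schur_relations v n" and q: "q \<in> SF m"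
 shows "sbact m r q \<in> IS m"
proof -
 note ev = sbr.ev_diff sbr.ev_mult sbr.ev_add sbr.ev_gen sbr.ev_one sbr.ev_zero sbr.ev_sum sbr.ev_pscale sb_simps sbact_gen_idem[OF W]
 have I: "x * q - y * q \<in> IS m" if "x - y \<in> IS m" for x y using that q sp.I_mult_right_cong by blast
 have sumW: "(\<Sum>i\<in>weights n. pscale (c i) (g1 m i)) = (\<Sum>i\<in>weights m. pscale (c i) (g1 m i))" for c
  by (rule sum.mono_neutral_right) (use W in \<open>auto simp: gen_idem_def\<close>)
 from r consider
   i j where "r = gen_idem n i * gen_idem n j - (if i = j then gen_idem n i else 0)"
  | "r = (\<Sum>i\<in>weights n. gen_idem n i) - 1"
  | "r = gen GE * gen GF - gen GF * gen GE - (\<Sum>i\<in>weights n. pscale (qint v i) (gen_idem n i))"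
  | i where "r = gen GE * gen_idem n i - gen_idem n (i + 2) * gen GE"
  | i where "r = gen GF * gen_idem n i - gen_idem n (i - 2) * gen GF"
  | i where "r = gen_idem n i * gen GE - gen GE * gen_idem n (i - 2)"
  | i where "r = gen_idem n i * gen GF - gen GF * gen_idem n (i + 2)"
  unfolding schur_relations_def Let_def by blast
 then show ?thesis
 proof cases
  case 1
  have "sbact m r q = g1 m i * g1 m j * q - (if i = j then g1 m i else 0) * q"
   by (simp add: 1 ev mult.assoc)
  then show ?thesis using I[OF idem_mult] by simp
 next
  case 2
  have "(\<Sum>i\<in>weights m. g1 m i) - 1 \<in> IS m" by (rule sp.Rel_I) (auto simp: schur_relations_def Let_def)
  then have "(\<Sum>i\<in>weights n. g1 m i) - 1 \<in> IS m" using sumW[of "\<lambda>_. 1"] by simp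
  from I[OF this] show ?thesis by (simp add: 2 ev sum_distrib_right)
 next
  case 3
  have "gE * gF - gF * gE - (\<Sum>i\<in>weights m. pscale (qint v i) (g1 m i)) \<in> IS m"
   by (rule sp.Rel_I) (auto simp: schur_relations_def Let_def)
  then have "gE * gF - gF * gE - (\<Sum>i\<in>weights n. pscale (qint v i) (g1 m i)) \<in> IS m" by (simp only: sumW)
  from I[OF this] show ?thesis by (simp add: 3 ev sum_distrib_right left_diff_distrib pscale_mult_left mult.assoc)
 next
  case 4
  have "gE * g1 m i - g1 m (i + 2) * gE \<in> IS m"
  proof (cases "i \<in> weights m")
   case False
   have "g1 m (i + 2) * gE - gE * g1 m (i + 2 - 2) \<in> IS m" if "i + 2 \<in> weights m"
    by (rule sp.Rel_I) (use that in \<open>unfold schur_relations_def Let_def, blast\<close>)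
   then have "gE * g1 m i - g1 m (i + 2) * gE \<in> IS m" if "i + 2 \<in> weights m" using sp.I_sym that by simp
   then show ?thesis using False by (cases "i + 2 \<in> weights m") (simp_all add: gen_idem_def)
  qed (rule gE_idem)
  from I[OF this] show ?thesis by (simp add: 4 ev mult.assoc)
 next
  case 5
  from I[OF sp.I_sym[OF idem_gF[of m "i - 2"]]] show ?thesis by (simp add: 5 ev mult.assoc)
 next
  case 6
  have "g1 m i * gE - gE * g1 m (i - 2) \<in> IS m"
  proof (cases "i \<in> weights m")
   case True
   then show ?thesis by (intro sp.Rel_I) (unfold schur_relations_def Let_def, blast)
  next
   case False
   have "gE * g1 m (i - 2) - g1 m (i - 2 + 2) * gE \<in> IS m" if "i - 2 \<in> weights m"
    using gE_idem[OF that] .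
   then have "g1 m i * gE - gE * g1 m (i - 2) \<in> IS m" if "i - 2 \<in> weights m" using sp.I_sym that by simp
   then show ?thesis using False by (cases "i - 2 \<in> weights m") (simp_all add: gen_idem_def)
  qed
  from I[OF this] show ?thesis by (simp add: 6 ev mult.assoc)
 next
  case 7
  from I[OF idem_gF[of m i]] show ?thesis by (simp add: 7 ev mult.assoc)
 qed
qed

lemma sbact_ideal:
 assumes W: "weights m \<subseteq> weights n" and p: "p \<in> IS n" and q: "q \<in> SF m"
 shows "sbact m p q \<in> IS m"
proof -
 have "IS n \<subseteq> {p \<in> SF n. \<forall>q\<in>SF m. sbact m p q \<in> IS m}"
 proof (rule sp.I_minimal)
  show "pvec.subspace {p \<in> SF n. \<forall>q\<in>SF m. sbact m p q \<in> IS m}"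
   by (rule pvec.subspaceI)
    (auto simp: sbr.ev_add sbr.ev_pscale intro: pvec.subspace_add[OF sp.subspace_I] pvec.subspace_scale[OF sp.subspace_I])
 qed (use sp.Rel sbact_relations[OF W] sbact_IS sbact_FA in \<open>auto simp: sbr.ev_mult\<close>)
 then show ?thesis using p q by blast
qed

text \<open>The projection of tensor space to the string of p, read in V(m). That it intertwines is checked on
 generators, since both strings obey the same ladder formulas.\<close>

definition psi :: "nat => (nat \<times> nat) list => 'k tvec => (schur_gen word \<Rightarrow>\<^sub>0 'k)" where
 "psi n p x = WC (wtp p) (\<lambda>a. crd v n p a x)"

lemma WC_add: "WC m (\<lambda>a. c a + d a) = WC m c + WC m d"
 by (simp add: WC_def pvec.scale_left_distrib sum.distrib)
lemma WC_scale: "WC m (\<lambda>a. t * c a) = pscale t (WC m c)"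
 by (simp add: WC_def pvec.scale_sum_right)

lemma psi_add: "psi n p (x + y) = psi n p x + psi n p y" by (simp add: psi_def crd_add WC_add)
lemma psi_scale: "psi n p (tscale c x) = pscale c (psi n p x)" by (simp add: psi_def crd_scale WC_scale)
lemma psi_zero [simp]: "psi n p 0 = 0" by (simp add: psi_def WC_def)
lemma psi_FA [intro]: "psi n p x \<in> SF (wtp p)" by (auto simp: psi_def)

lemma psi_bas:
 assumes p: "p \<in> walks n" and q: "q \<in> walks n" and n: "n \<le> N"
 shows "psi n p (\<beta> n q b) - (if p = q then wz (wtp p) b else 0) \<in> IS (wtp p)"
proof (cases "b \<le> wtp q")
 case True
 have "psi n p (\<beta> n q b) = (\<Sum>a\<le>wtp p. if a = b then (if p = q then wz (wtp p) b else 0) else 0)"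
  unfolding psi_def WC_def by (rule sum.cong[OF refl]) (auto simp: crd_bas[OF p q n])
 also have "\<dots> = (if p = q then wz (wtp p) b else 0)" using True by simp
 finally show ?thesis by simp
next
 case False
 then show ?thesis using bas_zero[OF q n, of b] wz_top[of "wtp p" b] pvec.subspace_neg[OF sp.subspace_I, of "wz (wtp p) b" "wtp p"]
  by auto
qed

lemma psi_gen:
 assumes p: "p \<in> walks n" and n: "n \<le> N" and x: "x \<in> TS n"
 shows "psi n p (sop n i x) - sb (wtp p) i (psi n p x) \<in> IS (wtp p)"
 using x n
proof (induction rule: bas_induct)
 case zero
 then show ?case using sr.g_scale[of n i 0 0] sbr.g_scale[of "wtp p" i 0 0] by simp
next
 case (add a b)
 then show ?case unfolding sr.g_add psi_add sbr.g_add by (rule sp.I_add_cong)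
next
 case (scale c a)
 then show ?case unfolding sr.g_scale psi_scale sbr.g_scale by (rule sp.I_scale_cong)
next
 case (bas q b)
 let ?m = "wtp p" and ?w = "\<lambda>b. if p = q then wz (wtp p) b else 0"
 note pb = psi_bas[OF p bas(1) n]
 have r: "sb ?m i (psi n p (\<beta> n q b)) - sb ?m i (?w b) \<in> IS ?m"
  using pb[of b] unfolding sb_def
  by (intro sp.I_mult_left_cong) (auto split: schur_gen.splits)
 have "psi n p (sop n i (\<beta> n q b)) - sb ?m i (?w b) \<in> IS ?m"
 proof (cases i)
  case GE
  show ?thesis
  proof (cases b)
   case 0
   then show ?thesis using GE gE_wz_0[of ?m] pvec.subspace_neg[OF sp.subspace_I, of "gE * wz ?m 0" ?m]
    by (auto simp: E_bas_0[OF bas(1) n])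
  next
   case (Suc c)
   have "psi n p (sop n i (\<beta> n q b)) - pscale (lad (wtp q) c) (?w c) \<in> IS ?m"
    using sp.I_scale_cong[OF pb[of c]] Suc GE by (simp only: sop_simps E_bas_Suc[OF bas(1) n] psi_scale)
   moreover have "pscale (lad (wtp q) c) (?w c) - sb ?m i (?w b) \<in> IS ?m"
    using sp.I_sym[OF gE_wz_Suc[of c ?m]] Suc GE bas(2) by auto
   ultimately show ?thesis by (rule sp.I_trans)
  qed
 next
  case GF
  then show ?thesis using pb[of "Suc b"] by (auto simp: F_bas gF_wz)
 next
  case (GI j)
  have "psi n p (op_idem j (\<beta> n q b)) - (if j = int (wtp q) - 2 * int b then ?w b else 0) \<in> IS ?m"
   using pb[of b] by (auto simp: idem_bas[OF bas(1) n])
  moreover have "(if j = int (wtp q) - 2 * int b then ?w b else 0) - g1 ?m j * ?w b \<in> IS ?m"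
   using sp.I_sym[OF idem_wz[of ?m j b]] by auto
  ultimately show ?thesis unfolding GI sop_simps sb_simps by (rule sp.I_trans)
 qed
 then show ?case by (rule sp.I_trans[OF _ sp.I_sym[OF r]])
qed

lemma psi_sact:
 assumes p: "p \<in> walks n" and n: "n \<le> N" and x: "x \<in> TS n" and s: "s \<in> SF n"
 shows "psi n p (sact n s x) - sbact (wtp p) s (psi n p x) \<in> IS (wtp p)"
proof -
 have "sact n s x \<in> TS n \<and> psi n p (sact n s x) - sbact (wtp p) s (psi n p x) \<in> IS (wtp p)"
 proof (rule sr.ev_word_induct[OF s, where P = "\<lambda>a b. a \<in> TS n \<and> psi n p a - b \<in> IS (wtp p)"])
  fix i a b assume ab: "a \<in> TS n \<and> psi n p a - b \<in> IS (wtp p)"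
  have "sb (wtp p) i (psi n p a) - sb (wtp p) i b \<in> IS (wtp p)"
   using ab unfolding sb_def by (intro sp.I_mult_left_cong) (auto split: schur_gen.splits)
  then show "sop n i a \<in> TS n \<and> psi n p (sop n i a) - sb (wtp p) i b \<in> IS (wtp p)"
   using sp.I_trans[OF psi_gen[OF p n]] ab sop_TS by blast
 qed (use x in \<open>auto simp: psi_add psi_scale sp.I_add_cong sp.I_scale_cong\<close>)
 then show ?thesis ..
qed

lemma wtp_weights: "p \<in> walks n ==> weights (wtp p) \<subseteq> weights n"
proof (rule weights_subset[OF wtp_le])
 assume p: "p \<in> walks n"
 have "snd (last p) \<le> fst (last p)" "fst (last p) + snd (last p) = n" using walks_walk[OF p] walk_props by blast+
 then have "n = wtp p + 2 * snd (last p)" unfolding wtp_def by linarith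
 then show "wtp p mod 2 = n mod 2" by simp
qed

end

section \<open>Modules over presented algebras\<close>

text \<open>Finite sums in a quotient record are computed on representatives.\<close>

lemma finsum_transfer:
 fixes \<rho> :: "'v::comm_monoid_add => 'b"
 assumes B: "abelian_monoid B" and A: "finite A"
  and D: "0 \<in> D" "\<And>x y. x \<in> D ==> y \<in> D ==> x + y \<in> D"
  and \<rho>: "\<rho> 0 = \<zero>\<^bsub>B\<^esub>" "\<And>x y. x \<in> D ==> y \<in> D ==> \<rho> (x + y) = \<rho> x \<oplus>\<^bsub>B\<^esub> \<rho> y" "\<And>x. x \<in> D ==> \<rho> x \<in> carrier B"
  and V: "\<And>i. i \<in> A ==> V i \<in> D" "\<And>i. i \<in> A ==> f i = \<rho> (V i)"
 shows "finsum B f A = \<rho> (\<Sum>i\<in>A. V i)"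
proof -
 interpret abelian_monoid B by (rule B)
 have "finsum B f A = \<rho> (\<Sum>i\<in>A. V i) \<and> (\<Sum>i\<in>A. V i) \<in> D"
  using A V
 proof (induction A)
  case empty
  then show ?case by (simp add: finsum_empty \<rho> D)
 next
  case (insert a A)
  have c: "f i \<in> carrier B" if "i \<in> insert a A" for i
   using insert.prems(1)[OF that] insert.prems(2)[OF that] \<rho>(3) by simp
  have "finsum B f (insert a A) = f a \<oplus>\<^bsub>B\<^esub> finsum B f A"
   by (rule finsum_insert) (use insert.hyps c in auto)
  moreover have "finsum B f A = \<rho> (\<Sum>i\<in>A. V i) \<and> (\<Sum>i\<in>A. V i) \<in> D"
   using insert by simp
  ultimately show ?case using insert.prems(1)[of a] insert.prems(2)[of a] insert.hyps by (simp add: \<rho>(2) D(2))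
 qed
 then show ?thesis ..
qed

lemma left_module_axiomsD:
 assumes "left_module R M"
 shows "ring R" "abelian_group M"
 using assms by (auto simp: left_module_def)

lemma abelian_group_typeI:
 fixes M :: "('a, 'm::ab_group_add) module"
 assumes "add M = (+)" "zero M = 0" "0 \<in> carrier M" "\<And>x y. x \<in> carrier M ==> y \<in> carrier M ==> x + y \<in> carrier M"
  "\<And>x. x \<in> carrier M ==> - x \<in> carrier M"
 shows "abelian_group M"
proof (rule abelian_groupI)
 fix x assume "x \<in> carrier M"
 then show "\<exists>y\<in>carrier M. y \<oplus>\<^bsub>M\<^esub> x = \<zero>\<^bsub>M\<^esub>"
  using assms by (intro bexI[of _ "- x"]) auto
qed (use assms in \<open>auto simp: ac_simps\<close>)

lemma finsum_type:
 fixes M :: "('a, 'm::ab_group_add) module"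
 assumes "abelian_group M" "add M = (+)" "zero M = 0" "finite A" "\<And>i. i \<in> A ==> f i \<in> carrier M"
 shows "finsum M f A = sum f A"
proof -
 interpret abelian_group M by fact
 show ?thesis
  by (rule finsum_transfer[where \<rho> = "\<lambda>x. x" and D = "carrier M"])
   (use assms zero_closed a_closed in \<open>auto simp: abelian_monoid_axioms\<close>)
qed

lemma submoduleI:
 assumes M: "abelian_group M" and "N \<subseteq> carrier M" "\<zero>\<^bsub>M\<^esub> \<in> N" "\<And>x y. x \<in> N ==> y \<in> N ==> x \<oplus>\<^bsub>M\<^esub> y \<in> N"
  "\<And>x. x \<in> N ==> \<ominus>\<^bsub>M\<^esub> x \<in> N" "\<And>a x. a \<in> carrier R ==> x \<in> N ==> a \<odot>\<^bsub>M\<^esub> x \<in> N"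
 shows "submodule N R M"
proof -
 interpret abelian_group M by fact
 show ?thesis
  by (intro submodule.intro submodule_axioms.intro add.subgroupI) (use assms in auto)
qed

lemma a_minus_type:
 fixes M :: "('a, 'm::ab_group_add) module"
 assumes "abelian_group M" "add M = (+)" "zero M = 0" "x \<in> carrier M" "- x \<in> carrier M"
 shows "\<ominus>\<^bsub>M\<^esub> x = - x"
proof -
 interpret abelian_group M by fact
 show ?thesis by (rule minus_equality) (use assms in auto)
qed

text \<open>Simplicity is always shown in the form: every nonzero vector generates every other.\<close>

lemma simple_moduleI:
 assumes M: "left_module A M" and nz: "x0 \<in> carrier M" "x0 \<noteq> \<zero>\<^bsub>M\<^esub>"
  and gen: "\<And>x y. x \<in> carrier M ==> x \<noteq> \<zero>\<^bsub>M\<^esub> ==> y \<in> carrier M ==> \<exists>a\<in>carrier A. a \<odot>\<^bsub>M\<^esub> x = y"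
 shows "simple_module A M"
 unfolding simple_module_def
proof (intro conjI allI impI)
 show "left_module A M" by fact
 show "carrier M \<noteq> {\<zero>\<^bsub>M\<^esub>}" using nz by auto
 fix N assume N: "submodule N A M"
 interpret N: submodule N A M by (rule N)
 have sub: "N \<subseteq> carrier M" and z: "\<zero>\<^bsub>M\<^esub> \<in> N" using N.subset N.one_closed by auto
 show "N = {\<zero>\<^bsub>M\<^esub>} \<or> N = carrier M"
 proof (cases "N = {\<zero>\<^bsub>M\<^esub>}")
  case False
  then obtain x where x: "x \<in> N" "x \<noteq> \<zero>\<^bsub>M\<^esub>" using z by blast
  have "carrier M \<subseteq> N"
  proof
   fix y assume "y \<in> carrier M"
   then obtain a where "a \<in> carrier A" "a \<odot>\<^bsub>M\<^esub> x = y" using gen[of x y] x sub by blast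
   then show "y \<in> N" using N.smult_closed x(1) by blast
  qed
  then show ?thesis using sub by blast
 qed simp
qed

text \<open>Homomorphisms are extensional, so the inverse has to be restricted to the carrier.\<close>

lemma mod_iso_sym:
 assumes f: "f \<in> mod_iso A M N"
  and cl: "\<And>x y. x \<in> carrier M ==> y \<in> carrier M ==> x \<oplus>\<^bsub>M\<^esub> y \<in> carrier M"
   "\<And>a x. a \<in> carrier A ==> x \<in> carrier M ==> a \<odot>\<^bsub>M\<^esub> x \<in> carrier M"
 shows "mod_isomorphic A N M"
proof -
 have b: "bij_betw f (carrier M) (carrier N)"
  and add: "\<And>x y. x \<in> carrier M ==> y \<in> carrier M ==> f (x \<oplus>\<^bsub>M\<^esub> y) = f x \<oplus>\<^bsub>N\<^esub> f y"
  and sm: "\<And>a x. a \<in> carrier A ==> x \<in> carrier M ==> f (a \<odot>\<^bsub>M\<^esub> x) = a \<odot>\<^bsub>N\<^esub> f x"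
  using f by (auto simp: mod_iso_def mod_hom_def)
 let ?g = "restrict (the_inv_into (carrier M) f) (carrier N)"
 have inj: "inj_on f (carrier M)" using b by (rule bij_betw_imp_inj_on)
 have gb: "bij_betw ?g (carrier N) (carrier M)"
  using bij_betw_the_inv_into[OF b] by (simp cong: bij_betw_cong)
 have gf: "?g (f x) = x" if "x \<in> carrier M" for x
  using that b by (simp add: the_inv_into_f_f[OF inj] bij_betw_apply)
 have fg: "\<exists>x\<in>carrier M. y = f x" if "y \<in> carrier N" for y
  using b that by (auto simp: bij_betw_def)
 have "?g \<in> mod_hom A N M"
  unfolding mod_hom_def
 proof (intro CollectI conjI ballI)
  show "?g \<in> carrier N \<rightarrow>\<^sub>E carrier M" using gb by (auto simp: bij_betw_def)
 next
  fix x y assume "x \<in> carrier N" "y \<in> carrier N"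
  then obtain x' y' where xy: "x' \<in> carrier M" "y' \<in> carrier M" "x = f x'" "y = f y'" using fg by metis
  then show "?g (x \<oplus>\<^bsub>N\<^esub> y) = ?g x \<oplus>\<^bsub>M\<^esub> ?g y" by (simp only: add[symmetric] gf cl)
 next
  fix a x assume a: "a \<in> carrier A" and "x \<in> carrier N"
  then obtain x' where x: "x' \<in> carrier M" "x = f x'" using fg by metis
  then show "?g (a \<odot>\<^bsub>N\<^esub> x) = a \<odot>\<^bsub>M\<^esub> ?g x" using a by (simp only: sm[symmetric] gf cl)
 qed
 then show ?thesis using gb by (auto simp: mod_isomorphic_def mod_iso_def)
qed

context presentation begin

lemma left_module_PA:
 assumes M: "abelian_group M"
  and sm: "\<And>p x. p \<in> FA G ==> x \<in> carrier M ==> coset I p \<odot>\<^bsub>M\<^esub> x = A p x"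
  and cl: "\<And>p x. p \<in> FA G ==> x \<in> carrier M ==> A p x \<in> carrier M"
  and add: "\<And>p q x. p \<in> FA G ==> q \<in> FA G ==> x \<in> carrier M ==> A (p + q) x = A p x \<oplus>\<^bsub>M\<^esub> A q x"
  and addr: "\<And>p x y. p \<in> FA G ==> x \<in> carrier M ==> y \<in> carrier M ==> A p (x \<oplus>\<^bsub>M\<^esub> y) = A p x \<oplus>\<^bsub>M\<^esub> A p y"
  and mult: "\<And>p q x. p \<in> FA G ==> q \<in> FA G ==> x \<in> carrier M ==> A (p * q) x = A p (A q x)"
  and one: "\<And>x. x \<in> carrier M ==> A 1 x = x"
 shows "left_module PA M"
proof -
 interpret M: abelian_group M by fact
 interpret R: ring PA by (rule ring_PA)
 show ?thesis
 proof (intro left_module.intro left_module_axioms.intro)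
  show "ring PA" "abelian_group M" by (fact ring_PA, fact M)
  fix a b x y assume x: "x \<in> carrier M" and a: "a \<in> carrier PA"
  then obtain p where p: "p \<in> FA G" "a = coset I p" by (rule_tac PA_E)
  show "a \<odot>\<^bsub>M\<^esub> x \<in> carrier M" by (simp add: p sm x cl)
  show "a \<odot>\<^bsub>M\<^esub> (x \<oplus>\<^bsub>M\<^esub> y) = a \<odot>\<^bsub>M\<^esub> x \<oplus>\<^bsub>M\<^esub> a \<odot>\<^bsub>M\<^esub> y" if "y \<in> carrier M"
   using that by (simp add: p sm x addr)
  assume "b \<in> carrier PA"
  then obtain q where q: "q \<in> FA G" "b = coset I q" by (rule_tac PA_E)
  show "(a \<oplus>\<^bsub>PA\<^esub> b) \<odot>\<^bsub>M\<^esub> x = a \<odot>\<^bsub>M\<^esub> x \<oplus>\<^bsub>M\<^esub> b \<odot>\<^bsub>M\<^esub> x"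
   by (simp add: p q PA_add sm x add FA_add)
  show "(a \<otimes>\<^bsub>PA\<^esub> b) \<odot>\<^bsub>M\<^esub> x = a \<odot>\<^bsub>M\<^esub> (b \<odot>\<^bsub>M\<^esub> x)"
   by (simp add: p q PA_mult sm x mult FA_mult cl)
 next
  fix x assume x: "x \<in> carrier M"
  show "\<one>\<^bsub>PA\<^esub> \<odot>\<^bsub>M\<^esub> x = x" by (simp add: PA_one sm x one)
 qed
qed

lemma presented_hom_coset:
 assumes "p \<in> FA G" and "\<And>q. q \<in> FA G ==> q - p \<in> I ==> eval_free B g q = r"
 shows "presented_hom B g (coset I p) = r"
proof -
 have "eval_free B g ` coset I p = {r}"
 proof (intro equalityI subsetI)
  fix y assume "y \<in> eval_free B g ` coset I p"
  then obtain q where q: "q - p \<in> I" "y = eval_free B g q" by (auto simp: mem_coset)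
  have "(q - p) + p \<in> FA G" by (rule FA_add[OF subsetD[OF I_subset q(1)] assms(1)])
  then have "q \<in> FA G" by simp
  then show "y \<in> {r}" using q assms(2) by simp
 next
  fix y assume "y \<in> {r}"
  then have "y = eval_free B g p" using assms(2)[OF assms(1)] by (simp add: pvec.subspace_0[OF subspace_I])
  then show "y \<in> eval_free B g ` coset I p" using coset_self[OF subspace_I] by blast
 qed
 then show ?thesis by (simp add: presented_hom_def)
qed

text \<open>Evaluation in the endomorphism algebra is the action act, restricted to tensor space. The sum over
 monomials is transported from plain operators, where it is pointwise.\<close>

lemma presented_hom_tensor:
 fixes n :: nat
 assumes fr: "free_rep tscale g" and g: "\<And>i y. i \<in> G ==> y \<in> TS n ==> g i y \<in> TS n"
  and R: "\<And>r y. r \<in> Rel ==> y \<in> TS n ==> act tscale g r y = 0"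
  and h: "\<And>i. h i = restrict (g i) (TS n)"
  and p: "p \<in> FA G"
 shows "presented_hom (end_algebra base_field (tensor_power n)) h (coset I p) = restrict (act tscale g p) (TS n)"
proof (rule presented_hom_coset[OF p])
 interpret free_rep tscale g by (rule fr)
 let ?B = "end_algebra base_field (tensor_power n) :: ('k, 'k tvec => 'k tvec) module"
 let ?D = "{f. (\<forall>x y. f (x + y) = f x + f y) \<and> (\<forall>c x. f (tscale c x) = tscale c (f x)) \<and> (\<forall>x\<in>TS n. f x \<in> TS n)} :: ('k tvec => 'k tvec) set"
 have car: "carrier ?B = {f \<in> TS n \<rightarrow>\<^sub>E TS n. (\<forall>x\<in>TS n. \<forall>y\<in>TS n. f (x + y) = f x + f y) \<and> (\<forall>c. \<forall>x\<in>TS n. f (tscale c x) = tscale c (f x))}"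
  by (simp add: end_algebra_def mod_hom_def base_field_def)
 have Bs: "add ?B = (\<lambda>f g. \<lambda>x\<in>TS n. f x + g x)" "zero ?B = (\<lambda>x\<in>TS n. 0)" "one ?B = (\<lambda>x\<in>TS n. x)"
  "mult ?B = compose (TS n)" "smult ?B = (\<lambda>c f. \<lambda>x\<in>TS n. tscale c (f x))"
  by (simp_all add: end_algebra_def base_field_def fun_eq_iff)
 have B: "abelian_monoid ?B"
 proof (rule abelian_monoidI)
  fix f g assume fg: "f \<in> carrier ?B" "g \<in> carrier ?B"
  then show "f \<oplus>\<^bsub>?B\<^esub> g \<in> carrier ?B"
   unfolding car Bs by (auto simp: TS_add TS_scale tvec.scale_right_distrib PiE_def)
  show "f \<oplus>\<^bsub>?B\<^esub> g = g \<oplus>\<^bsub>?B\<^esub> f" by (simp add: Bs add.commute)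
 next
  show "\<zero>\<^bsub>?B\<^esub> \<in> carrier ?B" unfolding car Bs by (auto simp: TS_add TS_scale)
  fix f g h assume "f \<in> carrier ?B" "g \<in> carrier ?B" "h \<in> carrier ?B"
  then show "f \<oplus>\<^bsub>?B\<^esub> g \<oplus>\<^bsub>?B\<^esub> h = f \<oplus>\<^bsub>?B\<^esub> (g \<oplus>\<^bsub>?B\<^esub> h)"
   unfolding Bs by (auto simp: restrict_def fun_eq_iff add.assoc)
 next
  fix f assume "f \<in> carrier ?B"
  then show "\<zero>\<^bsub>?B\<^esub> \<oplus>\<^bsub>?B\<^esub> f = f" unfolding Bs car by (auto simp: restrict_def fun_eq_iff PiE_def extensional_def)
 qed
 have ev: "eval_free ?B h q = restrict (act tscale g q) (TS n)" if q: "q \<in> FA G" for q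
 proof -
  have fo: "foldr g w \<in> ?D" if "set w \<subseteq> G" for w
   using that by (induction w) (auto simp: g_add g_scale g)
  have w: "foldr (\<lambda>x b. h x \<otimes>\<^bsub>?B\<^esub> b) w \<one>\<^bsub>?B\<^esub> = restrict (foldr g w) (TS n)" if "set w \<subseteq> G" for w
   using that
  proof (induction w)
   case Nil
   then show ?case by (simp add: Bs restrict_def fun_eq_iff)
  next
   case (Cons a w)
   then have IH: "foldr (\<lambda>x b. h x \<otimes>\<^bsub>?B\<^esub> b) w \<one>\<^bsub>?B\<^esub> = restrict (foldr g w) (TS n)"
    using Cons.IH Cons.prems by force
   have "foldr g w x \<in> TS n" if "x \<in> TS n" for x using fo[of w] Cons.prems that by auto
   then show ?case unfolding foldr.simps o_apply IH
    by (intro ext) (auto simp: Bs h compose_def restrict_def)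
  qed
  have "eval_free ?B h q = restrict (\<Sum>w\<in>keys q. (\<lambda>x. tscale (lookup q w) (foldr g (letters w) x))) (TS n)"
   unfolding eval_free_def
  proof (rule finsum_transfer[OF B, where \<rho> = "\<lambda>f. restrict f (TS n)" and D = ?D])
   show "0 \<in> ?D" by (auto simp: zero_fun_apply)
   show "restrict 0 (TS n) = \<zero>\<^bsub>?B\<^esub>" by (simp add: Bs restrict_def fun_eq_iff zero_fun_apply)
   fix f f' assume f: "f \<in> ?D"
   then show "restrict f (TS n) \<in> carrier ?B" unfolding car by (auto simp: TS_add TS_scale)
   assume f': "f' \<in> ?D"
   show "f + f' \<in> ?D" using f f' by (auto simp: plus_fun_apply[where 'a = "'k tvec"] tvec.scale_right_distrib intro!: TS_add)
   show "restrict (f + f') (TS n) = restrict f (TS n) \<oplus>\<^bsub>?B\<^esub> restrict f' (TS n)"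
    by (auto simp: Bs restrict_def fun_eq_iff plus_fun_apply)
  next
   fix w assume "w \<in> keys q"
   then have wG: "set (letters w) \<subseteq> G" using q by (auto simp: FA_def)
   show "(\<lambda>x. tscale (lookup q w) (foldr g (letters w) x)) \<in> ?D"
    using fo[OF wG] by (auto simp: tvec.scale_right_distrib mult.commute intro!: TS_scale)
   show "lookup q w \<odot>\<^bsub>?B\<^esub> foldr (\<lambda>x b. h x \<otimes>\<^bsub>?B\<^esub> b) (letters w) \<one>\<^bsub>?B\<^esub> =
     (\<lambda>x\<in>TS n. tscale (lookup q w) (foldr g (letters w) x))"
    unfolding w[OF wG] by (auto simp: Bs restrict_def fun_eq_iff)
  qed simp
  then show ?thesis by (simp add: act_def fun_sum_apply restrict_def fun_eq_iff)
 qed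
 fix q assume q: "q \<in> FA G" and I: "q - p \<in> I"
 have "act tscale g q x = act tscale g p x" if "x \<in> TS n" for x
 proof -
  have "act tscale g (q - p) x = 0" by (rule ev_I_zero[OF fr subspace_TS g R I that])
  then show ?thesis by (simp add: ev_diff)
 qed
 then show "eval_free ?B h q = restrict (act tscale g p) (TS n)"
  unfolding ev[OF q] by (auto simp: restrict_def fun_eq_iff)
qed

lemma rep_sub_module:
 assumes fr: "free_rep tscale g" and \<rho>: "\<And>p. p \<in> FA G ==> \<rho> (coset I p) = restrict (act tscale g p) (TS n)"
  and U: "tvec.subspace U" "U \<subseteq> TS n" and st: "\<And>p x. p \<in> FA G ==> x \<in> U ==> act tscale g p x \<in> U"
 shows "left_module PA ((rep_module \<rho> (tensor_power n))\<lparr>carrier := U\<rparr>)"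
proof (rule left_module_PA[where A = "act tscale g"])
 interpret free_rep tscale g by (rule fr)
 show "abelian_group ((rep_module \<rho> (tensor_power n))\<lparr>carrier := U\<rparr>)"
  by (rule abelian_group_typeI) (use U in \<open>auto simp: rep_module_def tvec.subspace_0 tvec.subspace_add tvec.subspace_neg\<close>)
 show "coset I p \<odot>\<^bsub>(rep_module \<rho> (tensor_power n))\<lparr>carrier := U\<rparr>\<^esub> x = act tscale g p x"
  if "p \<in> FA G" "x \<in> carrier ((rep_module \<rho> (tensor_power n))\<lparr>carrier := U\<rparr>)" for p x
  using that U \<rho> by (auto simp: rep_module_def)
qed (use st free_rep.ev_add[OF fr] free_rep.ev_mult[OF fr] free_rep.ev_add_right[OF fr] free_rep.ev_one[OF fr] in \<open>auto simp: rep_module_def\<close>)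

end

context quantum begin

text \<open>Short names for the algebra and for tensor space as a module over it.\<close>

abbreviation "SA n \<equiv> schur v n"
abbreviation "ST n \<equiv> schur_tensor v n"

lemma schur_PA: "SA n = sp.PA n" by (simp add: schur_def sgens_def)

lemma schur_rep_coset:
 assumes "s \<in> SF n"
 shows "schur_rep v n (coset (IS n) s) = restrict (sact n s) (TS n)"
 unfolding schur_rep_def
 by (rule sp.presented_hom_tensor[OF sr.free_rep_axioms sop_TS schur_relations_act _ assms])
  (auto simp: sop_def)

lemma schur_tensor_simps [simp]:
 "carrier (ST n) = TS n" "zero (ST n) = 0" "add (ST n) = (+)"
 by (simp_all add: schur_tensor_def rep_module_def)

lemma schur_tensor_smult:
 "s \<in> SF n ==> x \<in> TS n ==> coset (IS n) s \<odot>\<^bsub>ST n\<^esub> x = sact n s x"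
 by (simp add: schur_tensor_def rep_module_def schur_rep_coset)

lemma schur_sub_module:
 assumes U: "tvec.subspace U" "U \<subseteq> TS n" and st: "\<And>s x. s \<in> SF n ==> x \<in> U ==> sact n s x \<in> U"
 shows "left_module (SA n) ((ST n)\<lparr>carrier := U\<rparr>)"
 unfolding schur_PA schur_tensor_def
 by (rule sp.rep_sub_module[OF sr.free_rep_axioms schur_rep_coset U st])

lemma schur_tensor_module: "left_module (SA n) (ST n)"
 using schur_sub_module[OF subspace_TS order_refl sact_TS, of n] by (simp add: schur_tensor_def rep_module_def tensor_power_def)

lemma schur_scalar: "c \<odot>\<^bsub>SA n\<^esub> \<one>\<^bsub>SA n\<^esub> = coset (IS n) (pscale c 1)"
 unfolding schur_PA by (rule sp.PA_scalar)

lemma schur_carrier: "carrier (SA n) = coset (IS n) ` SF n"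
 unfolding schur_PA by (rule sp.PA_carrier)

end

context quantum_N begin

lemma crd_combination:
 assumes n: "n \<le> N" and p: "p \<in> walks n" and b: "b \<le> wtp p"
 shows "crd v n p b (\<Sum>q\<in>walks n. \<Sum>a\<le>wtp q. tscale (d q a) (\<beta> n q a)) = d p b"
proof -
 have "crd v n p b (\<Sum>q\<in>walks n. \<Sum>a\<le>wtp q. tscale (d q a) (\<beta> n q a)) = (\<Sum>q\<in>walks n. if q = p then d p b else 0)"
  unfolding crd_sum crd_scale
 proof (rule sum.cong[OF refl])
  fix q assume q: "q \<in> walks n"
  have "(\<Sum>a\<le>wtp q. d q a * crd v n p b (\<beta> n q a)) = (\<Sum>a\<le>wtp q. if a = b then (if q = p then d p b else 0) else 0)"
   by (rule sum.cong[OF refl]) (auto simp: crd_bas[OF p q n b])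
  then show "(\<Sum>a\<le>wtp q. d q a * crd v n p b (\<beta> n q a)) = (if q = p then d p b else 0)" using b by auto
 qed
 then show ?thesis using p by simp
qed

lemma crd_munit:
 assumes p: "p \<in> walks n" and q: "q \<in> walks n" and r: "r \<in> walks n" and n: "n \<le> N" and w: "wtp p = wtp q" and b: "b \<le> wtp r"
 shows "crd v n r b (munit v n q p x) = (if r = q then crd v n p b x else 0)"
proof -
 have "crd v n r b (munit v n q p x) = (\<Sum>a\<le>wtp p. if a = b then (if r = q then crd v n p b x else 0) else 0)"
  unfolding munit_def crd_sum crd_scale by (rule sum.cong[OF refl]) (auto simp: crd_bas[OF r q n b])
 then show ?thesis using b w by auto
qed

lemma cyclic_string:
 assumes n: "n \<le> N" and p: "p \<in> walks n"
 shows "cyclic_submodule (SA n) (ST n) (\<mu> p) = string n p"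
proof
 have mp: "\<mu> p \<in> string n p" "\<mu> p \<in> TS n" using bas_string[OF p n, of 0] string_TS[OF p n] by (auto simp: bas_0)
 show "cyclic_submodule (SA n) (ST n) (\<mu> p) \<subseteq> string n p"
  using mp sact_string[OF p n] by (auto simp: cyclic_submodule_def schur_carrier schur_tensor_smult)
 show "string n p \<subseteq> cyclic_submodule (SA n) (ST n) (\<mu> p)"
 proof
  fix y assume "y \<in> string n p"
  then obtain s where "s \<in> SF n" "sact n s (\<mu> p) = y"
   using string_transitive[OF p n mp(1) mu_nonzero[OF p n]] by blast
  then show "y \<in> cyclic_submodule (SA n) (ST n) (\<mu> p)"
   using mp schur_tensor_smult[of s n "\<mu> p"] by (auto simp: cyclic_submodule_def schur_carrier image_iff intro!: bexI[of _ s])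
 qed
qed

lemma string_simple:
 assumes n: "n \<le> N" and p: "p \<in> walks n"
 shows "simple_module (SA n) ((ST n)\<lparr>carrier := string n p\<rparr>)"
proof (rule simple_moduleI)
 show "left_module (SA n) ((ST n)\<lparr>carrier := string n p\<rparr>)"
  by (rule schur_sub_module[OF subspace_string string_TS[OF p n] sact_string[OF p n]])
 show "\<mu> p \<in> carrier ((ST n)\<lparr>carrier := string n p\<rparr>)" using bas_string[OF p n, of 0] by (simp add: bas_0)
 show "\<mu> p \<noteq> \<zero>\<^bsub>(ST n)\<lparr>carrier := string n p\<rparr>\<^esub>" using mu_nonzero[OF p n] by simp
 fix x y assume xy: "x \<in> carrier ((ST n)\<lparr>carrier := string n p\<rparr>)" "x \<noteq> \<zero>\<^bsub>(ST n)\<lparr>carrier := string n p\<rparr>\<^esub>"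
  "y \<in> carrier ((ST n)\<lparr>carrier := string n p\<rparr>)"
 then obtain s where "s \<in> SF n" "sact n s x = y" using string_transitive[OF p n, of x y] by auto
 then show "\<exists>a\<in>carrier (SA n). a \<odot>\<^bsub>(ST n)\<lparr>carrier := string n p\<rparr>\<^esub> x = y"
  using xy string_TS[OF p n] schur_tensor_smult[of s n x] by (auto simp: schur_carrier)
qed

lemma crd_string:
 assumes "p \<in> walks n" "q \<in> walks n" "n \<le> N" "x \<in> string n q" "p \<noteq> q" "a \<le> wtp p"
 shows "crd v n p a x = 0"
proof -
 have "crd v n p a x = crd v n p a (\<Sum>b\<le>wtp q. tscale (crd v n q b x) (\<beta> n q b))"
  using string_expand[OF assms(2,3,4)] by simp
 then show ?thesis using crd_bas[OF assms(1,2,3,6)] assms(5) by (simp add: crd_sum crd_scale)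
qed

text \<open>Existence and uniqueness of the components both come from the coordinates.\<close>

lemma tensor_direct_sum:
 assumes n: "n \<le> N"
 shows "internal_direct_sum (SA n) (ST n) (walks n) (string n)"
 unfolding internal_direct_sum_def
proof (intro conjI ballI)
 have ag: "abelian_group (ST n)" by (rule left_module_axiomsD(2)[OF schur_tensor_module])
 fix p assume p: "p \<in> walks n"
 show "submodule (string n p) (SA n) (ST n)"
 proof (rule submoduleI[OF ag])
  fix x assume x: "x \<in> string n p"
  have "- x \<in> string n p" by (rule tvec.subspace_neg[OF subspace_string x])
  moreover have "x \<in> TS n" "- x \<in> TS n" using x calculation string_TS[OF p n] by (auto dest: subsetD)
  ultimately show "\<ominus>\<^bsub>ST n\<^esub> x \<in> string n p"
   using a_minus_type[OF ag, of x] by simp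
 next
  fix a x assume "a \<in> carrier (SA n)" "x \<in> string n p"
  then show "a \<odot>\<^bsub>ST n\<^esub> x \<in> string n p"
   using sact_string[OF p n] string_TS[OF p n] by (auto simp: schur_carrier schur_tensor_smult subset_iff)
 qed (use string_TS[OF p n] in \<open>auto simp: tvec.subspace_0[OF subspace_string] tvec.subspace_add[OF subspace_string]\<close>)
next
 have ag: "abelian_group (ST n)" by (rule left_module_axiomsD(2)[OF schur_tensor_module])
 fix x assume x: "x \<in> carrier (ST n)"
 then have xT: "x \<in> TS n" by simp
 have fs: "finsum (ST n) f {i \<in> walks n. f i \<noteq> \<zero>\<^bsub>ST n\<^esub>} = (\<Sum>p\<in>walks n. f p)"
  if "f \<in> (\<Pi>\<^sub>E i\<in>walks n. string n i)" for f
 proof -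
  have "finsum (ST n) f {i \<in> walks n. f i \<noteq> 0} = sum f {i \<in> walks n. f i \<noteq> 0}"
   by (rule finsum_type[OF ag]) (use that string_TS[OF _ n] in \<open>auto simp: PiE_def Pi_def subset_iff\<close>)
  also have "\<dots> = sum f (walks n)" by (rule sum.mono_neutral_left) auto
  finally show ?thesis by simp
 qed
 let ?f = "\<lambda>p\<in>walks n. \<Sum>a\<le>wtp p. tscale (crd v n p a x) (\<beta> n p a)"
 have f: "?f \<in> (\<Pi>\<^sub>E i\<in>walks n. string n i)"
  by (auto intro!: tvec.subspace_sum[OF subspace_string] tvec.subspace_scale[OF subspace_string] bas_string[OF _ n])
 have fx: "x = (\<Sum>p\<in>walks n. ?f p)"
 proof -
  have "(\<Sum>p\<in>walks n. ?f p) = (\<Sum>p\<in>walks n. \<Sum>a\<le>wtp p. tscale (crd v n p a x) (\<beta> n p a))"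
   by (rule sum.cong) auto
  then show ?thesis using expand'[OF xT n] by simp
 qed
 show "\<exists>!f. f \<in> (\<Pi>\<^sub>E i\<in>walks n. string n i) \<and> finite {i \<in> walks n. f i \<noteq> \<zero>\<^bsub>ST n\<^esub>} \<and>
    x = finsum (ST n) f {i \<in> walks n. f i \<noteq> \<zero>\<^bsub>ST n\<^esub>}"
 proof (rule ex1I[of _ ?f])
  show "?f \<in> (\<Pi>\<^sub>E i\<in>walks n. string n i) \<and> finite {i \<in> walks n. ?f i \<noteq> \<zero>\<^bsub>ST n\<^esub>} \<and>
    x = finsum (ST n) ?f {i \<in> walks n. ?f i \<noteq> \<zero>\<^bsub>ST n\<^esub>}"
   using f fx unfolding fs[OF f] by simp
  fix g assume "g \<in> (\<Pi>\<^sub>E i\<in>walks n. string n i) \<and> finite {i \<in> walks n. g i \<noteq> \<zero>\<^bsub>ST n\<^esub>} \<and>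
    x = finsum (ST n) g {i \<in> walks n. g i \<noteq> \<zero>\<^bsub>ST n\<^esub>}"
  then have g: "g \<in> (\<Pi>\<^sub>E i\<in>walks n. string n i)" and gx: "x = (\<Sum>p\<in>walks n. g p)" using fs by auto
  show "g = ?f"
  proof (rule PiE_ext[OF g f])
   fix p assume p: "p \<in> walks n"
   have gp: "g q \<in> string n q" if "q \<in> walks n" for q using g that by auto
   have c: "crd v n p a x = crd v n p a (g p)" if a: "a \<le> wtp p" for a
   proof -
    have "crd v n p a x = (\<Sum>q\<in>walks n. crd v n p a (g q))" by (subst gx) (rule crd_sum)
    also have "\<dots> = (\<Sum>q\<in>walks n. if q = p then crd v n p a (g p) else 0)"
     by (rule sum.cong[OF refl]) (use crd_string[OF p _ n gp _ a] in auto)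
    finally show ?thesis using p by simp
   qed
   show "g p = ?f p" using string_expand[OF p n gp[OF p]] c p by simp
  qed
 qed
qed

section \<open>Weyl modules as modules over the larger Schur algebra\<close>

text \<open>Elements of V(m) as classes; coordinates up to m determine them.\<close>

definition cw :: "nat => (nat => 'k) => 'k schur_elt" where
 "cw m c = coset (IS m) (WC m c)"

lemma schur_class_eq: "schur_class v m x = coset (IS m) (gen x)"
 unfolding schur_class_def using sp.rcos[of m "gen x"] by (simp add: idl_def sgens_def)

text \<open>The surjection is well defined on classes because the substitution respects relations, and its value
 on a class can be computed by letting a representative act on 1.\<close>

lemma schur_surj_coset:
 assumes W: "weights m \<subseteq> weights n" and W': "\<And>i. i \<in> weights n ==> \<bar>i\<bar> \<le> int m \<longleftrightarrow> i \<in> weights m" and p: "p \<in> SF n"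
 shows "schur_surj v m (coset (IS n) p) = coset (IS m) (sbact m p 1)"
 unfolding schur_surj_def
proof (rule sp.presented_hom_coset[OF p])
 let ?g = "\<lambda>x. case x of GI i => if \<bar>i\<bar> \<le> int m then schur_class v m (GI i) else \<zero>\<^bsub>SA m\<^esub> | _ => schur_class v m x"
 have R: "ring (SA m)" unfolding schur_PA by (rule sp.ring_PA)
 interpret R: ring "SA m" by (rule R)
 have gx: "?g x = coset (IS m) (sb m x 1)" if "x \<in> sgens n" for x
  using that W' by (elim sgens_cases) (auto simp: schur_class_eq gen_idem_def schur_PA sp.PA_zero)
 have ev: "eval_free (SA m) ?g q = coset (IS m) (sbact m q 1)" if q: "q \<in> SF n" for q
 proof -
  have fo: "foldr (sb m) w 1 \<in> SF m" for w
   by (induction w) (auto intro: sb_FA)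
  have w: "foldr (\<lambda>x b. ?g x \<otimes>\<^bsub>SA m\<^esub> b) w \<one>\<^bsub>SA m\<^esub> = coset (IS m) (foldr (sb m) w 1)" if "set w \<subseteq> sgens n" for w
   using that
  proof (induction w)
   case Nil then show ?case by (simp add: schur_PA sp.PA_one)
  next
   case (Cons a w)
   have "sb m a 1 * foldr (sb m) w 1 = sb m a (foldr (sb m) w 1)" by (simp add: sb_def)
   then show ?case using Cons gx[of a] fo sb_FA[OF FA_1, of m a] by (simp add: schur_PA sp.PA_mult)
  qed
  have "eval_free (SA m) ?g q = coset (IS m) (\<Sum>w\<in>keys q. pscale (lookup q w) (foldr (sb m) (letters w) 1))"
   unfolding eval_free_def
  proof (rule finsum_transfer[where \<rho> = "coset (IS m)" and D = "SF m"])
   show "abelian_monoid (SA m)" by (rule R.abelian_monoid_axioms)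
   fix w assume "w \<in> keys q"
   then have wG: "set (letters w) \<subseteq> sgens n" using q by (auto simp: FA_def)
   show "lookup q w \<odot>\<^bsub>SA m\<^esub> foldr (\<lambda>x b. ?g x \<otimes>\<^bsub>SA m\<^esub> b) (letters w) \<one>\<^bsub>SA m\<^esub>
     = coset (IS m) (pscale (lookup q w) (foldr (sb m) (letters w) 1))"
    unfolding w[OF wG] by (simp add: schur_PA sp.PA_smult)
  qed (auto simp: schur_PA sp.PA_simps sp.PA_I fo)
  then show ?thesis by (simp add: act_def)
 qed
 fix q assume q: "q \<in> SF n" and I: "q - p \<in> IS n"
 have "sbact m (q - p) 1 \<in> IS m" by (rule sbact_ideal[OF W I FA_1])
 then show "eval_free (SA m) ?g q = coset (IS m) (sbact m p 1)"
  unfolding ev[OF q] by (simp add: sp.PA_eq sbr.ev_diff)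
qed

lemma weyl_simps:
 "zero (weyl_module v m) = coset (IS m) 0"
 "coset (IS m) x \<oplus>\<^bsub>weyl_module v m\<^esub> coset (IS m) y = coset (IS m) (x + y)"
 by (simp_all add: weyl_module_def Let_def schur_PA sp.PA_zero sp.PA_add)

lemma weyl_carrier: "carrier (weyl_module v m) = range (cw m)"
proof (intro equalityI subsetI)
 fix x assume "x \<in> carrier (weyl_module v m)"
 then obtain p where p: "p \<in> SF m" "x = coset (IS m) p \<otimes>\<^bsub>SA m\<^esub> coset (IS m) (gen (GI (int m)))"
  by (auto simp: weyl_module_def Let_def schur_carrier schur_class_eq)
 have g: "(gen (GI (int m)) :: schur_gen word \<Rightarrow>\<^sub>0 'k) \<in> SF m" by (intro FA_gen) simp
 have x: "x = coset (IS m) (p * gen (GI (int m)))" using p g by (simp add: schur_PA sp.PA_mult)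
 obtain c where "p * gen (GI (int m)) - WC m c \<in> IS m" using ideal_mult_idem[OF p(1)] by blast
 then show "x \<in> range (cw m)" by (auto simp: x cw_def sp.PA_eq)
next
 fix x assume "x \<in> range (cw m)"
 then obtain c where x: "x = cw m c" by auto
 let ?p = "\<Sum>a\<le>m. pscale (c a) (gF ^ a)"
 have pF: "?p \<in> SF m" by (intro FA_sum FA_pscale FA_power gEF_FA)
 have g: "(gen (GI (int m)) :: schur_gen word \<Rightarrow>\<^sub>0 'k) \<in> SF m" by (intro FA_gen) simp
 have "WC m c = ?p * gen (GI (int m))"
  by (simp add: WC_def wz_def sum_distrib_right pscale_mult_left)
 then have "x = coset (IS m) ?p \<otimes>\<^bsub>SA m\<^esub> schur_class v m (GI (int m))"
  using pF g by (simp add: x cw_def schur_class_eq schur_PA sp.PA_mult)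
 then show "x \<in> carrier (weyl_module v m)"
  using pF by (auto simp: weyl_module_def Let_def schur_carrier)
qed

lemma weights_abs: "weights m \<subseteq> weights n ==> i \<in> weights n ==> \<bar>i\<bar> \<le> int m \<longleftrightarrow> i \<in> weights m"
 using top_weight[of m] by (auto simp: weights_def)

lemma weyl_smult:
 assumes W: "weights m \<subseteq> weights n" and s: "s \<in> SF n" and x: "x \<in> SF m"
 shows "coset (IS n) s \<odot>\<^bsub>weyl_module v m\<^esub> coset (IS m) x = coset (IS m) (sbact m s x)"
proof -
 have "coset (IS n) s \<odot>\<^bsub>weyl_module v m\<^esub> coset (IS m) x = coset (IS m) (sbact m s 1) \<otimes>\<^bsub>SA m\<^esub> coset (IS m) x"
  using schur_surj_coset[OF W weights_abs[OF W] s] by (simp add: weyl_module_def Let_def)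
 also have "\<dots> = coset (IS m) (sbact m s 1 * x)"
  using sbact_FA[OF s FA_1] x by (simp add: schur_PA sp.PA_mult)
 finally show ?thesis by (simp flip: sbact_mult_right)
qed

lemma cw_add: "cw m c \<oplus>\<^bsub>weyl_module v m\<^esub> cw m d = cw m (\<lambda>a. c a + d a)"
 by (simp add: cw_def weyl_simps WC_add)

lemma WC_diff: "WC m c - WC m d = WC m (\<lambda>a. c a - d a)"
 by (simp add: WC_def pvec.scale_left_diff_distrib sum_subtractf)

lemma cw_eq:
 assumes m: "m \<le> N"
 shows "cw m c = cw m d \<longleftrightarrow> (\<forall>a\<le>m. c a = d a)"
proof
 assume "cw m c = cw m d"
 then have "WC m (\<lambda>a. c a - d a) \<in> IS m" by (simp add: cw_def sp.PA_eq WC_diff)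
 then show "\<forall>a\<le>m. c a = d a" using WC_independent[OF m] by fastforce
next
 assume "\<forall>a\<le>m. c a = d a"
 then have "WC m c = WC m d" by (simp add: WC_def)
 then show "cw m c = cw m d" by (simp add: cw_def)
qed

lemma weyl_zero: "zero (weyl_module v m) = cw m (\<lambda>_. 0)"
 by (simp add: weyl_simps cw_def WC_def)

text \<open>The image in V(m) of the component of x in the string of p.\<close>

definition wproj :: "nat => (nat \<times> nat) list => 'k tvec => 'k schur_elt" where
 "wproj n p x = cw (wtp p) (\<lambda>a. crd v n p a x)"

lemma wproj_psi: "wproj n p x = coset (IS (wtp p)) (psi n p x)"
 by (simp add: wproj_def cw_def psi_def)

lemma wproj_carrier: "wproj n p x \<in> carrier (weyl_module v (wtp p))"
 by (simp add: wproj_def weyl_carrier)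

lemma wproj_add: "wproj n p (x + y) = wproj n p x \<oplus>\<^bsub>weyl_module v (wtp p)\<^esub> wproj n p y"
 by (simp add: wproj_def cw_add crd_add)

lemma wproj_smult:
 assumes p: "p \<in> walks n" and n: "n \<le> N" and x: "x \<in> TS n" and s: "s \<in> SF n"
 shows "wproj n p (sact n s x) = coset (IS n) s \<odot>\<^bsub>weyl_module v (wtp p)\<^esub> wproj n p x"
 unfolding wproj_psi weyl_smult[OF wtp_weights[OF p] s psi_FA] using psi_sact[OF p n x s] by (simp add: sp.PA_eq)

lemma wproj_surj:
 assumes p: "p \<in> walks n" and n: "n \<le> N"
 shows "wproj n p (\<Sum>a\<le>wtp p. tscale (c a) (\<beta> n p a)) = cw (wtp p) c"
proof -
 have "crd v n p b (\<Sum>a\<le>wtp p. tscale (c a) (\<beta> n p a)) = c b" if b: "b \<le> wtp p" for b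
 proof -
  have "crd v n p b (\<Sum>a\<le>wtp p. tscale (c a) (\<beta> n p a)) = (\<Sum>a\<le>wtp p. if a = b then c b else 0)"
   unfolding crd_sum crd_scale by (rule sum.cong[OF refl]) (auto simp: crd_bas[OF p p n b])
  then show ?thesis using b by simp
 qed
 then show ?thesis using cw_eq[of "wtp p"] wtp_le[OF p] n by (simp add: wproj_def)
qed

text \<open>Closure under the action uses that every element of V(m) is the image of a vector of tensor space.\<close>

lemma weyl_left_module:
 assumes p: "p \<in> walks n" and n: "n \<le> N"
 shows "left_module (SA n) (weyl_module v (wtp p))"
 unfolding schur_PA
proof (rule sp.left_module_PA[where A = "\<lambda>s X. coset (IS n) s \<odot>\<^bsub>weyl_module v (wtp p)\<^esub> X"])
 let ?W = "weyl_module v (wtp p)"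
 note W = wtp_weights[OF p]
 have car: "\<exists>x\<in>SF (wtp p). X = coset (IS (wtp p)) x" if "X \<in> carrier ?W" for X
  using that by (auto simp: weyl_carrier cw_def)
 show "abelian_group ?W"
 proof (rule abelian_groupI)
  fix X assume "X \<in> carrier ?W"
  then obtain c where X: "X = cw (wtp p) c" by (auto simp: weyl_carrier)
  show "\<exists>Y\<in>carrier ?W. Y \<oplus>\<^bsub>?W\<^esub> X = \<zero>\<^bsub>?W\<^esub>"
   by (rule bexI[of _ "cw (wtp p) (\<lambda>a. - c a)"]) (auto simp: X cw_add weyl_zero weyl_carrier)
 qed (auto simp: weyl_carrier cw_add weyl_zero ac_simps)
 let ?A = "\<lambda>s X. coset (IS n) s \<odot>\<^bsub>?W\<^esub> X"
 have cl: "sbact (wtp p) s x \<in> SF (wtp p)" if "s \<in> SF n" "x \<in> SF (wtp p)" for s x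
  using sbact_FA[OF that] .
 show "coset (IS n) s \<odot>\<^bsub>?W\<^esub> X = ?A s X" for s X ..
 fix s :: "schur_gen word \<Rightarrow>\<^sub>0 'k" and X assume s: "s \<in> SF n" and X: "X \<in> carrier ?W"
 obtain c where c: "X = cw (wtp p) c" using X by (auto simp: weyl_carrier)
 have "?A s X = wproj n p (sact n s (\<Sum>a\<le>wtp p. tscale (c a) (\<beta> n p a)))"
  using wproj_smult[OF p n _ s, of "\<Sum>a\<le>wtp p. tscale (c a) (\<beta> n p a)"] wproj_surj[OF p n, of c] c
  by (simp add: TS_sum TS_scale bas_TS[OF p n])
 then show "?A s X \<in> carrier ?W" using wproj_carrier by simp
 obtain x where x: "x \<in> SF (wtp p)" "X = coset (IS (wtp p)) x" using car[OF X] by blast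
 show "?A (s + t) X = ?A s X \<oplus>\<^bsub>?W\<^esub> ?A t X" if "t \<in> SF n" for t
  using s that by (simp add: x weyl_smult[OF W] FA_add weyl_simps sbr.ev_add)
 show "?A (s * t) X = ?A s (?A t X)" if "t \<in> SF n" for t
  using s that by (simp add: x weyl_smult[OF W] FA_mult cl sbr.ev_mult)
 fix Y assume "Y \<in> carrier ?W"
 then obtain y where y: "y \<in> SF (wtp p)" "Y = coset (IS (wtp p)) y" using car by blast
 show "?A s (X \<oplus>\<^bsub>?W\<^esub> Y) = ?A s X \<oplus>\<^bsub>?W\<^esub> ?A s Y"
  using s by (simp add: x y weyl_simps weyl_smult[OF W] FA_add sbr.ev_add_right)
next
 fix X assume "X \<in> carrier (weyl_module v (wtp p))"
 then show "coset (IS n) 1 \<odot>\<^bsub>weyl_module v (wtp p)\<^esub> X = X"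
  using weyl_smult[OF wtp_weights[OF p] FA_1 WC_FA] by (auto simp: weyl_carrier cw_def)
qed

lemma weyl_simple:
 assumes p: "p \<in> walks n" and n: "n \<le> N"
 shows "simple_module (SA n) (weyl_module v (wtp p))"
proof (rule simple_moduleI)
 let ?W = "weyl_module v (wtp p)"
 have m: "wtp p \<le> N" using wtp_le[OF p] n by simp
 have w0: "wproj n p x = \<zero>\<^bsub>?W\<^esub> \<longleftrightarrow> (\<forall>a\<le>wtp p. crd v n p a x = 0)" for x
  by (simp add: wproj_def weyl_zero cw_eq[OF m])
 show "left_module (SA n) ?W" by (rule weyl_left_module[OF p n])
 show "wproj n p (\<beta> n p 0) \<in> carrier ?W" by (rule wproj_carrier)
 show "wproj n p (\<beta> n p 0) \<noteq> \<zero>\<^bsub>?W\<^esub>" unfolding w0 using crd_bas[OF p p n, of 0 0] by auto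
 fix X Y assume X: "X \<in> carrier ?W" "X \<noteq> \<zero>\<^bsub>?W\<^esub>" and Y: "Y \<in> carrier ?W"
 have st: "(\<Sum>a\<le>wtp p. tscale (c a) (\<beta> n p a)) \<in> string n p" for c
  by (intro tvec.subspace_sum[OF subspace_string] tvec.subspace_scale[OF subspace_string] bas_string[OF p n])
 have "\<exists>x\<in>string n p. Z = wproj n p x" if "Z \<in> carrier ?W" for Z
  using that wproj_surj[OF p n] st by (fastforce simp: weyl_carrier)
 then obtain x y where x: "x \<in> string n p" "X = wproj n p x" and y: "y \<in> string n p" "Y = wproj n p y" using X Y by metis
 have "x \<noteq> 0" using X(2) x by (auto simp: w0)
 then obtain s where s: "s \<in> SF n" "sact n s x = y" using string_transitive[OF p n x(1) _ y(1)] by blast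
 then have "coset (IS n) s \<odot>\<^bsub>?W\<^esub> X = Y" using wproj_smult[OF p n _ s(1), of x] string_TS[OF p n] x y by auto
 then show "\<exists>a\<in>carrier (SA n). a \<odot>\<^bsub>?W\<^esub> X = Y" using s(1) by (auto simp: schur_carrier)
qed

lemma weyl_of_eq: "weyl_of v l = weyl_module v (kl l)" by (simp add: weyl_of_def kl_def)

text \<open>Collecting wproj over all walks is an isomorphism; walks to l are numbered to match the
 multiplicities.\<close>

lemma tensor_weyl_iso:
 assumes n: "n \<le> N"
 shows "mod_isomorphic (SA n) (ST n)
    (direct_sum (SIGMA l:two_row_partitions n. {..<num_walks l}) (\<lambda>(l, j). weyl_of v l))"
proof -
 let ?I = "SIGMA l:two_row_partitions n. {..<num_walks l}"
 have "\<forall>l. \<exists>e. bij_betw e {..<num_walks l} (walks_to l)"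
  unfolding num_walks_def using ex_bij_betw_nat_finite[OF finite_walks_to] by (auto simp: atLeast0LessThan)
 then obtain e where e: "\<And>l. bij_betw (e l) {..<num_walks l} (walks_to l)" by metis
 define P where "P i = e (fst i) (snd i)" for i
 have P: "P i \<in> walks n" "last (P i) = fst i" "wtp (P i) = kl (fst i)" if "i \<in> ?I" for i
 proof -
  have l: "fst i \<in> two_row_partitions n" and "P i \<in> walks_to (fst i)"
   using that bij_betw_apply[OF e] by (auto simp: P_def)
  then show "P i \<in> walks n" "last (P i) = fst i" using walks_to_walks by blast+
  then show "wtp (P i) = kl (fst i)" by (simp add: wtp_kl)
 qed
 have Pbij: "bij_betw P ?I (walks n)"
 proof (rule bij_betw_imageI)
  show "inj_on P ?I"
  proof (rule inj_onI)
   fix i j assume i: "i \<in> ?I" and j: "j \<in> ?I" and eq: "P i = P j"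
   then have f: "fst i = fst j" using P(2) by metis
   then have "snd i = snd j" using eq i j bij_betw_imp_inj_on[OF e[of "fst i"]] by (auto simp: P_def inj_on_def)
   then show "i = j" using f by (simp add: prod_eq_iff)
  qed
  show "P ` ?I = walks n"
  proof
   show "walks n \<subseteq> P ` ?I"
   proof
    fix p assume p: "p \<in> walks n"
    have l: "last p \<in> two_row_partitions n" by (rule last_two_row[OF p])
    then have "p \<in> walks_to (last p)" using walks_to_walks p by blast
    then obtain j where "j < num_walks (last p)" "p = e (last p) j" using e[of "last p"] by (auto simp: bij_betw_def)
    then show "p \<in> P ` ?I" using l by (intro image_eqI[of _ _ "(last p, j)"]) (auto simp: P_def)
   qed
   show "P ` ?I \<subseteq> walks n" using P(1) by blast
  qed
 qed
 let ?M = "\<lambda>(l, j::nat). weyl_of v l" and ?D = "direct_sum ?I (\<lambda>(l, j). weyl_of v l)"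
 have M: "(case i of (l, j) => weyl_of v l) = weyl_module v (wtp (P i))" if "i \<in> ?I" for i
  using P(3)[OF that] by (cases i) (simp add: weyl_of_eq)
 have finI: "finite ?I" by auto
 have Dcar: "carrier ?D = (\<Pi>\<^sub>E i\<in>?I. carrier (weyl_module v (wtp (P i))))"
  using finI by (simp add: direct_sum_def M cong: PiE_cong)
 let ?f = "\<lambda>x\<in>TS n. \<lambda>i\<in>?I. wproj n (P i) x"
 have fc: "(\<lambda>i\<in>?I. wproj n (P i) x) \<in> carrier ?D" for x
  unfolding Dcar restrict_PiE_iff by (simp add: wproj_carrier)
 have "?f \<in> mod_hom (SA n) (ST n) ?D"
  unfolding mod_hom_def
 proof (intro CollectI conjI ballI)
  show "?f \<in> carrier (ST n) \<rightarrow>\<^sub>E carrier ?D"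
   unfolding restrict_PiE_iff schur_tensor_simps using fc by blast
 next
  fix x y assume "x \<in> carrier (ST n)" "y \<in> carrier (ST n)"
  then show "?f (x \<oplus>\<^bsub>ST n\<^esub> y) = ?f x \<oplus>\<^bsub>?D\<^esub> ?f y"
   by (simp add: TS_add direct_sum_def M wproj_add cong: restrict_cong)
 next
  fix a x assume "a \<in> carrier (SA n)" and x: "x \<in> carrier (ST n)"
  then obtain s where s: "s \<in> SF n" "a = coset (IS n) s" by (auto simp: schur_carrier)
  have "wproj n (P i) (sact n s x) = coset (IS n) s \<odot>\<^bsub>weyl_module v (wtp (P i))\<^esub> wproj n (P i) x" if "i \<in> ?I" for i
   using wproj_smult[OF P(1)[OF that] n _ s(1)] x by simp
  then show "?f (a \<odot>\<^bsub>ST n\<^esub> x) = a \<odot>\<^bsub>?D\<^esub> ?f x"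
   using x s by (simp add: direct_sum_def schur_tensor_smult M sact_TS cong: restrict_cong)
 qed
 moreover have "bij_betw ?f (TS n) (carrier ?D)"
 proof (rule bij_betw_imageI)
  show "inj_on ?f (TS n)"
  proof (rule inj_onI)
   fix x y assume x: "x \<in> TS n" and y: "y \<in> TS n" and eq: "?f x = ?f y"
   have "crd v n p a x = crd v n p a y" if p: "p \<in> walks n" and a: "a \<le> wtp p" for p a
   proof -
    have "p \<in> P ` ?I" using Pbij p by (simp only: bij_betw_def)
    then obtain i where i: "i \<in> ?I" "p = P i" by blast
    have "wproj n p x = wproj n p y" using fun_cong[OF eq, of i] x y i by simp
    then show ?thesis using cw_eq[of "wtp p"] wtp_le[OF p] n a by (simp add: wproj_def)
   qed
   then show "x = y" using expand'[OF x n] expand'[OF y n] by simp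
  qed
  show "?f ` TS n = carrier ?D"
  proof
   show "?f ` TS n \<subseteq> carrier ?D" using fc by (simp add: image_subset_iff)
   show "carrier ?D \<subseteq> ?f ` TS n"
   proof
    fix h assume h: "h \<in> carrier ?D"
    have "\<forall>i\<in>?I. \<exists>c. h i = cw (wtp (P i)) c" using h unfolding Dcar by (auto simp: weyl_carrier PiE_def Pi_def image_iff)
    then obtain c where c: "\<And>i. i \<in> ?I ==> h i = cw (wtp (P i)) (c i)" by metis
    define d where "d p = c (the_inv_into ?I P p)" for p
    let ?x = "\<Sum>p\<in>walks n. \<Sum>a\<le>wtp p. tscale (d p a) (\<beta> n p a)"
    have xT: "?x \<in> TS n" by (intro TS_sum TS_scale bas_TS[OF _ n])
    note cr = crd_combination[OF n]
    have "h = ?f ?x"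
    proof (rule PiE_ext[OF h[unfolded Dcar]])
     show "?f ?x \<in> (\<Pi>\<^sub>E i\<in>?I. carrier (weyl_module v (wtp (P i))))" using xT fc[of ?x, unfolded Dcar] by simp
     fix i assume i: "i \<in> ?I"
     have m: "wtp (P i) \<le> N" using wtp_le[OF P(1)[OF i]] n by simp
     have "d (P i) = c i" using the_inv_into_f_f[OF bij_betw_imp_inj_on[OF Pbij] i] by (simp add: d_def)
     then have "wproj n (P i) ?x = h i" using cr[OF P(1)[OF i]] by (simp add: wproj_def c[OF i] cw_eq[OF m])
     then show "h i = ?f ?x i" using xT i by simp
    qed
    then show "h \<in> ?f ` TS n" using xT by blast
   qed
  qed
 qed
 ultimately show ?thesis by (auto simp: mod_isomorphic_def mod_iso_def)
qed

end

section \<open>Cell modules of the Temperley--Lieb algebra\<close>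

declare One_nat_def [simp del]

context tl begin

text \<open>Classes in the Temperley--Lieb algebra, and short names for this algebra and for tensor space and
 the cells as modules over it.\<close>

abbreviation "cl n \<equiv> coset (IT n)"
abbreviation "TA n \<equiv> TL n \<delta>"
abbreviation "TT n \<equiv> tl_tensor v \<epsilon> n"
abbreviation "TC n l \<equiv> tl_cell v \<epsilon> n l"

lemma TL_PA: "TA n = tlp.PA n" by (simp add: TL_def)

lemma TL_carrier: "carrier (TA n) = cl n ` TF n"
 unfolding TL_PA by (rule tlp.PA_carrier)

lemma TL_scalar: "c \<odot>\<^bsub>TA n\<^esub> \<one>\<^bsub>TA n\<^esub> = cl n (pscale c 1)"
 unfolding TL_PA by (rule tlp.PA_scalar)

lemma TL_ring: "ring (TA n)"
 unfolding TL_PA by (rule tlp.ring_PA)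

lemma tl_rep_coset:
 assumes "t \<in> TF n"
 shows "tl_rep v \<epsilon> n (cl n t) = restrict (tlact n t) (TS n)"
 unfolding tl_rep_def
 by (rule tlp.presented_hom_tensor[OF tlr.free_rep_axioms tlg_TS tl_relations_act _ assms])
  (auto simp: tlg_def restrict_def)

lemma tl_tensor_simps [simp]:
 "carrier (TT n) = TS n" "zero (TT n) = 0" "add (TT n) = (+)"
 by (simp_all add: tl_tensor_def rep_module_def)

lemma tl_tensor_smult:
 "t \<in> TF n ==> x \<in> TS n ==> cl n t \<odot>\<^bsub>TT n\<^esub> x = tlact n t x"
 by (simp add: tl_tensor_def rep_module_def tl_rep_coset)

lemma tl_sub_module:
 assumes U: "tvec.subspace U" "U \<subseteq> TS n" and st: "\<And>t x. t \<in> TF n ==> x \<in> U ==> tlact n t x \<in> U"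
 shows "left_module (TA n) ((TT n)\<lparr>carrier := U\<rparr>)"
 unfolding TL_PA tl_tensor_def
 by (rule tlp.rep_sub_module[OF tlr.free_rep_axioms tl_rep_coset U st])

lemma tl_tensor_module: "left_module (TA n) (TT n)"
 using tl_sub_module[OF subspace_TS order_refl tlact_TS, of n]
 by (simp add: tl_tensor_def rep_module_def tensor_power_def)

lemma subspace_Cspace: "tvec.subspace (Cspace v l)" by (simp add: Cspace_def)

lemma mu_Cspace: "p \<in> walks_to l ==> \<mu> p \<in> Cspace v l"
 by (simp add: Cspace_def tvec.span_base)

lemma mu_TS: "p \<in> walks n ==> n \<le> N ==> \<mu> p \<in> TS n"
 using bas_TS[of p n 0] by (simp add: bas_0)

lemma crd_mu: "p \<in> walks n ==> q \<in> walks n ==> n \<le> N ==> crd v n p 0 (\<mu> q) = (if p = q then 1 else 0)"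
 using crd_bas[of p n q 0 0] by (simp add: bas_0)

lemma Cspace_TS:
 assumes "l \<in> two_row_partitions n" "n \<le> N" shows "Cspace v l \<subseteq> TS n"
 unfolding Cspace_def
 by (rule tvec.span_minimal[OF _ subspace_TS]) (use assms mu_TS walks_to_walks in blast)

lemma Cspace_expand:
 assumes l: "l \<in> two_row_partitions n" and n: "n \<le> N" and x: "x \<in> Cspace v l"
 shows "x = (\<Sum>p\<in>walks_to l. tscale (crd v n p 0 x) (\<mu> p))"
proof -
 have w: "p \<in> walks n" if "p \<in> walks_to l" for p using that walks_to_walks[OF l] by blast
 have "x = (\<Sum>p\<in>walks_to l. tscale (tform n x (\<mu> p) / tform n (\<mu> p) (\<mu> p)) (\<mu> p))"
 proof (rule orth_expand)
  show "tform n (\<mu> p) (\<mu> q) = 0" if "p \<in> walks_to l" "q \<in> walks_to l" "p \<noteq> q" for p q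
   by (rule mu_orth'[OF w w n]) (use that in auto)
  show "tform n (\<mu> p) (\<mu> p) \<noteq> 0" if "p \<in> walks_to l" for p
   using bas_norm[OF w n, of p 0] that by (simp add: bas_0)
 qed (use x in \<open>auto simp: Cspace_def finite_walks_to\<close>)
 then show ?thesis by (simp add: crd_def bas_0)
qed

lemma tlact_Cspace:
 assumes l: "l \<in> two_row_partitions n" and n: "n \<le> N" and t: "t \<in> TF n" and x: "x \<in> Cspace v l"
 shows "tlact n t x \<in> Cspace v l"
proof -
 have mu: "tlact n t (\<mu> p) \<in> Cspace v l" if p: "p \<in> walks_to l" for p
  by (subst intertw_mu_expand[OF tlact_intertw[OF t] l n p])
   (intro tvec.subspace_sum tvec.subspace_scale subspace_Cspace mu_Cspace)
 have "tlact n t x = tlact n t (\<Sum>p\<in>walks_to l. tscale (crd v n p 0 x) (\<mu> p))"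
  using Cspace_expand[OF l n x] by simp
 also have "\<dots> \<in> Cspace v l"
  unfolding tlr.ev_sum_right tlr.ev_scale_right
  by (intro tvec.subspace_sum tvec.subspace_scale subspace_Cspace mu)
 finally show ?thesis .
qed

text \<open>The element that maps \<mu>(P) to c and kills all other \<mu>(r). For fixed P these elements form a
 column of the matrix algebra, isomorphic to the cell module.\<close>

definition cu :: "nat => (nat \<times> nat) list => 'k tvec => (nat word \<Rightarrow>\<^sub>0 'k)" where
 "cu n P c = (\<Sum>q\<in>walks_to (last P). pscale (crd v n q 0 c) (tu n q P))"

lemma cu_FA:
 assumes P: "P \<in> walks n" and n: "n \<le> N" shows "cu n P c \<in> TF n"
 unfolding cu_def
proof (intro FA_sum FA_pscale)
 fix q assume "q \<in> walks_to (last P)"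
 then have "q \<in> walks n" "last P = last q" using walks_to_walks[OF last_two_row[OF P]] by auto
 then show "tu n q P \<in> TF n" using tu[OF n P] by (auto simp: is_tu_def)
qed

lemma cu_add: "cu n P (c + d) = cu n P c + cu n P d"
 by (simp add: cu_def crd_add pvec.scale_left_distrib sum.distrib)

lemma cu_zero [simp]: "cu n P 0 = 0"
 by (simp add: cu_def)

lemma cu_mu:
 assumes P: "P \<in> walks n" and n: "n \<le> N" and c: "c \<in> Cspace v (last P)" and r: "r \<in> walks n"
 shows "tlact n (cu n P c) (\<mu> r) = (if r = P then c else 0)"
proof -
 have l: "last P \<in> two_row_partitions n" by (rule last_two_row[OF P])
 have "tlact n (cu n P c) (\<mu> r) = (\<Sum>q\<in>walks_to (last P). tscale (crd v n q 0 c) (if r = P then \<mu> q else 0))"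
  unfolding cu_def tlr.ev_sum tlr.ev_pscale
 proof (rule sum.cong[OF refl])
  fix q assume "q \<in> walks_to (last P)"
  then have q: "q \<in> walks n" "last P = last q" using walks_to_walks[OF l] by auto
  show "tscale (crd v n q 0 c) (tlact n (tu n q P) (\<mu> r)) = tscale (crd v n q 0 c) (if r = P then \<mu> q else 0)"
   using is_tu_mu[OF tu[OF n P q] n P q r] by simp
 qed
 also have "\<dots> = (if r = P then c else 0)" using Cspace_expand[OF l n c] by simp
 finally show ?thesis .
qed

lemma cu_act:
 assumes P: "P \<in> walks n" and n: "n \<le> N" and c: "c \<in> Cspace v (last P)" and x: "x \<in> Cspace v (last P)"
 shows "tlact n (cu n P c) x = tscale (crd v n P 0 x) c"
proof -
 have l: "last P \<in> two_row_partitions n" by (rule last_two_row[OF P])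
 have Pl: "P \<in> walks_to (last P)" using walks_to_walks[OF l] P by blast
 have "tlact n (cu n P c) x = tlact n (cu n P c) (\<Sum>p\<in>walks_to (last P). tscale (crd v n p 0 x) (\<mu> p))"
  using Cspace_expand[OF l n x] by simp
 also have "\<dots> = (\<Sum>p\<in>walks_to (last P). if p = P then tscale (crd v n P 0 x) c else 0)"
  unfolding tlr.ev_sum_right tlr.ev_scale_right
 proof (rule sum.cong[OF refl])
  fix p assume "p \<in> walks_to (last P)"
  then have "p \<in> walks n" using walks_to_walks[OF l] by blast
  then show "tscale (crd v n p 0 x) (tlact n (cu n P c) (\<mu> p)) = (if p = P then tscale (crd v n P 0 x) c else 0)"
   using cu_mu[OF P n c] by simp
 qed
 also have "\<dots> = tscale (crd v n P 0 x) c" using Pl finite_walks_to by simp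
 finally show ?thesis .
qed

text \<open>Faithfulness, in the form in which it is used: elements agreeing on the highest weight vectors have
 the same class.\<close>

lemma TL_cong:
 assumes "n \<le> N" "x \<in> TF n" "y \<in> TF n"
  and "\<And>r. r \<in> walks n ==> tlact n x (\<mu> r) = tlact n y (\<mu> r)"
 shows "cl n x = cl n y"
 using inj_cong[OF tl_faithful[OF assms(1)] assms(1-3)] assms(4) by (simp add: tlp.PA_eq)

lemma TL_actD:
 assumes "cl n x = cl n y" "z \<in> TS n"
 shows "tlact n x z = tlact n y z"
 using assms IT_act[of "x - y" n z] by (simp add: tlp.PA_eq tlr.ev_diff)

lemma cu_mult:
 assumes P: "P \<in> walks n" and n: "n \<le> N" and c: "c \<in> Cspace v (last P)" and t: "t \<in> TF n"
 shows "cl n (t * cu n P c) = cl n (cu n P (tlact n t c))"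
proof (rule TL_cong[OF n])
 fix r assume "r \<in> walks n"
 then show "tlact n (t * cu n P c) (\<mu> r) = tlact n (cu n P (tlact n t c)) (\<mu> r)"
  using cu_mu[OF P n c] cu_mu[OF P n tlact_Cspace[OF last_two_row[OF P] n t c]] by (simp add: tlr.ev_mult)
qed (use FA_mult t cu_FA[OF P n] in auto)

lemma mu_last_Cspace: "P \<in> walks n ==> \<mu> P \<in> Cspace v (last P)"
 using walks_to_walks[OF last_two_row] mu_Cspace by blast

lemma Cspace_nonzero_crd:
 assumes l: "l \<in> two_row_partitions n" and n: "n \<le> N" and x: "x \<in> Cspace v l" "x \<noteq> 0"
 obtains P where "P \<in> walks n" "last P = l" "crd v n P 0 x \<noteq> 0"
proof -
 have "\<exists>P\<in>walks_to l. crd v n P 0 x \<noteq> 0"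
 proof (rule ccontr)
  assume "\<not> ?thesis"
  then have "(\<Sum>p\<in>walks_to l. tscale (crd v n p 0 x) (\<mu> p)) = 0" by (intro sum.neutral) simp
  then show False using Cspace_expand[OF l n x(1)] x(2) by simp
 qed
 then show ?thesis using that walks_to_walks[OF l] by blast
qed

text \<open>If the coordinate of x at P is nonzero, a multiple of the column element of P maps x to y.\<close>

lemma Cspace_transitive:
 assumes l: "l \<in> two_row_partitions n" and n: "n \<le> N" and x: "x \<in> Cspace v l" "x \<noteq> 0" and y: "y \<in> Cspace v l"
 shows "\<exists>t\<in>TF n. tlact n t x = y"
proof -
 obtain P where P: "P \<in> walks n" "last P = l" "crd v n P 0 x \<noteq> 0" by (rule Cspace_nonzero_crd[OF l n x])
 let ?t = "pscale (inverse (crd v n P 0 x)) (cu n P y)"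
 have "tlact n ?t x = y"
  unfolding tlr.ev_pscale using cu_act[OF P(1) n, of y x] x y P by simp
 moreover have "?t \<in> TF n" by (rule FA_pscale[OF cu_FA[OF P(1) n]])
 ultimately show ?thesis by blast
qed

lemma walk_to_exists:
 assumes "l \<in> two_row_partitions n" obtains P where "P \<in> walks n" "last P = l"
proof -
 obtain P where "walk (fst l, snd l) P" using walk_exists[of "snd l" "fst l"] assms by (auto simp: two_row_partitions_def)
 then have "P \<in> walks_to l" by (simp add: walks_to_iff)
 then show ?thesis using that walks_to_walks[OF assms] by blast
qed

lemma tl_cell_simps [simp]:
 "carrier (TC n l) = Cspace v l" "zero (TC n l) = 0" "add (TC n l) = (+)"
 by (simp_all add: tl_cell_def)

lemma tl_cell_smult:
 assumes "l \<in> two_row_partitions n" "n \<le> N" "t \<in> TF n" "x \<in> Cspace v l"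
 shows "cl n t \<odot>\<^bsub>TC n l\<^esub> x = tlact n t x"
proof -
 have "x \<in> TS n" using Cspace_TS[OF assms(1,2)] assms(4) by blast
 then show ?thesis using tl_tensor_smult[OF assms(3)] by (simp add: tl_cell_def)
qed

lemma tl_cell_module:
 assumes l: "l \<in> two_row_partitions n" and n: "n \<le> N"
 shows "left_module (TA n) (TC n l)"
 unfolding tl_cell_def by (rule tl_sub_module[OF subspace_Cspace Cspace_TS[OF l n] tlact_Cspace[OF l n]])

lemma tl_cell_simple:
 assumes l: "l \<in> two_row_partitions n" and n: "n \<le> N"
 shows "simple_module (TA n) (TC n l)"
proof -
 obtain P where P: "P \<in> walks n" "last P = l" by (rule walk_to_exists[OF l])
 show ?thesis
 proof (rule simple_moduleI[OF tl_cell_module[OF l n]])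
  show "\<mu> P \<in> carrier (TC n l)" using mu_last_Cspace[OF P(1)] P(2) by simp
  show "\<mu> P \<noteq> \<zero>\<^bsub>TC n l\<^esub>" using mu_nonzero[OF P(1) n] by simp
  fix x y assume "x \<in> carrier (TC n l)" "x \<noteq> \<zero>\<^bsub>TC n l\<^esub>" "y \<in> carrier (TC n l)"
  then have xy: "x \<in> Cspace v l" "x \<noteq> 0" "y \<in> Cspace v l" by simp_all
  obtain t where t: "t \<in> TF n" "tlact n t x = y" using Cspace_transitive[OF l n xy] by blast
  show "\<exists>a\<in>carrier (TA n). a \<odot>\<^bsub>TC n l\<^esub> x = y"
   using tl_cell_smult[OF l n t(1) xy(1)] t unfolding TL_carrier by blast
 qed
qed

lemma dim_Cspace:
 assumes l: "l \<in> two_row_partitions n" and n: "n \<le> N"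
 shows "tvec.dim (Cspace v l) = num_walks l"
proof -
 have b: "inj_on \<mu> (walks_to l)" "tvec.independent (\<mu> ` walks_to l)"
  using mu_basis[OF l n] by (auto simp: is_basis_def)
 show ?thesis
  unfolding Cspace_def num_walks_def using tvec.dim_span_eq_card_independent[OF b(2)] card_image[OF b(1)] by simp
qed

text \<open>A diagonal unit for a walk to l kills the cell module of every other l', but not that of l.\<close>

lemma tl_cells_distinct:
 assumes l: "l \<in> two_row_partitions n" and l': "l' \<in> two_row_partitions n" and n: "n \<le> N" and ne: "l \<noteq> l'"
 shows "\<not> mod_isomorphic (TA n) (TC n l) (TC n l')"
proof
 assume "mod_isomorphic (TA n) (TC n l) (TC n l')"
 then obtain f where f: "f \<in> mod_iso (TA n) (TC n l) (TC n l')" by (auto simp: mod_isomorphic_def)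
 then have inj: "inj_on f (Cspace v l)" and fC: "\<And>x. x \<in> Cspace v l ==> f x \<in> Cspace v l'"
  by (auto simp: mod_iso_def mod_hom_def bij_betw_def)
 have fs: "f (tlact n t x) = tlact n t (f x)" if t: "t \<in> TF n" and x: "x \<in> Cspace v l" for t x
 proof -
  have "cl n t \<in> carrier (TA n)" using t by (simp add: TL_carrier)
  then have "f (cl n t \<odot>\<^bsub>TC n l\<^esub> x) = cl n t \<odot>\<^bsub>TC n l'\<^esub> f x"
   using f x unfolding mod_iso_def mod_hom_def tl_cell_simps by blast
  then show ?thesis using tl_cell_smult[OF l n t x] tl_cell_smult[OF l' n t fC[OF x]] by simp
 qed
 obtain P where P: "P \<in> walks n" "last P = l" by (rule walk_to_exists[OF l])
 have c: "\<mu> P \<in> Cspace v l" using mu_last_Cspace[OF P(1)] P(2) by simp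
 have "f (\<mu> P) = f (tlact n (cu n P (\<mu> P)) (\<mu> P))"
  using cu_mu[OF P(1) n _ P(1), of "\<mu> P"] c P(2) by simp
 also have "\<dots> = tlact n (cu n P (\<mu> P)) (f (\<mu> P))" by (rule fs[OF cu_FA[OF P(1) n] c])
 also have "\<dots> = tlact n (cu n P (\<mu> P)) (\<Sum>q\<in>walks_to l'. tscale (crd v n q 0 (f (\<mu> P))) (\<mu> q))"
  using Cspace_expand[OF l' n fC[OF c]] by simp
 also have "\<dots> = 0"
  unfolding tlr.ev_sum_right tlr.ev_scale_right
 proof (rule sum.neutral, rule ballI)
  fix q assume "q \<in> walks_to l'"
  then have q: "q \<in> walks n" "last q = l'" using walks_to_walks[OF l'] by auto
  then have "q \<noteq> P" using P ne by auto
  then show "tscale (crd v n q 0 (f (\<mu> P))) (tlact n (cu n P (\<mu> P)) (\<mu> q)) = 0"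
   using cu_mu[OF P(1) n _ q(1), of "\<mu> P"] c P(2) by simp
 qed
 also have "\<dots> = f 0" using fs[OF FA_0 tvec.subspace_0[OF subspace_Cspace]] by simp
 finally have "\<mu> P = 0" using inj_onD[OF inj _ c tvec.subspace_0[OF subspace_Cspace]] by simp
 then show False using mu_nonzero[OF P(1) n] by simp
qed

section \<open>The centralizer algebras\<close>

lemma tl_schur_commute:
 assumes t: "t \<in> TF n" and s: "s \<in> SF n" and x: "x \<in> TS n"
 shows "tlact n t (sact n s x) = sact n s (tlact n t x)"
proof (rule sr.ev_commute[OF s subspace_TS x sop_TS])
 show "tlact n t (sop n i y) = sop n i (tlact n t y)" if "y \<in> TS n" for i y
  using tlact_commute[OF t that] by (cases i) simp_all
qed (auto simp: tlr.ev_add_right tlr.ev_scale_right)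

lemma op_idem_outside: "(x :: 'k tvec) \<in> TS n ==> i \<notin> weights n ==> op_idem i x = 0"
 using sact_gen_idem[of x n i] by (simp add: gen_idem_def)

text \<open>Scalars and idempotents act through the Schur algebra; idempotents outside the weights act as zero.\<close>

lemma mod_hom_intertw:
 assumes f: "f \<in> mod_hom (SA n) (ST n) (ST n)"
 shows "intertw n f"
proof -
 have fT: "f x \<in> TS n" if "x \<in> TS n" for x using f that by (auto simp: mod_hom_def)
 have s: "f (sact n s x) = sact n s (f x)" if s: "s \<in> SF n" and x: "x \<in> TS n" for s x
 proof -
  have "coset (IS n) s \<in> carrier (SA n)" using s by (simp add: schur_carrier)
  then have "f (coset (IS n) s \<odot>\<^bsub>ST n\<^esub> x) = coset (IS n) s \<odot>\<^bsub>ST n\<^esub> f x"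
   using f x unfolding mod_hom_def schur_tensor_simps by blast
  then show ?thesis using schur_tensor_smult s x fT by simp
 qed
 have sc: "f (tscale c x) = tscale c (f x)" if "x \<in> TS n" for c x
  using s[OF FA_pscale[OF FA_1] that, of c] by (simp add: sr.ev_pscale)
 have f0: "f 0 = 0" using sc[of 0 0] tvec.subspace_0[OF subspace_TS] by simp
 have id: "f (op_idem i x) = op_idem i (f x)" if x: "x \<in> TS n" for i x
 proof (cases "i \<in> weights n")
  case True
  then show ?thesis using s[of "gen (GI i)", OF _ x] by (simp add: FA_gen)
 next
  case False
  then show ?thesis using op_idem_outside x fT[OF x] f0 by simp
 qed
 show ?thesis
  unfolding intertw_def
 proof (intro conjI ballI allI)
  show "f (x + y) = f x + f y" if "x \<in> TS n" "y \<in> TS n" for x y using f that by (simp add: mod_hom_def)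
  show "f (E n x) = E n (f x)" "f (F n x) = F n (f x)" if "x \<in> TS n" for x
   using s[of "gen GE", OF _ that] s[of "gen GF", OF _ that] by (simp_all add: FA_gen)
 qed (use sc fT id in auto)
qed

lemma intertw_tlact:
 assumes n: "n \<le> N" and f: "intertw n f"
 shows "\<exists>t\<in>TF n. \<forall>x\<in>TS n. tlact n t x = f x"
proof (intro bexI ballI)
 let ?t = "\<Sum>p\<in>walks n. \<Sum>q\<in>walks_to (last p). pscale (crd v n q 0 (f (\<mu> p))) (tu n q p)"
 have w: "is_tu n q p (tu n q p)" if "p \<in> walks n" "q \<in> walks_to (last p)" for p q
  using that tu[OF n, of p q] walks_to_walks[OF last_two_row[OF that(1)]] by simp
 show "?t \<in> TF n"
  by (intro FA_sum FA_pscale) (use w in \<open>auto simp: is_tu_def\<close>)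
 fix x :: "'k tvec" assume x: "x \<in> TS n"
 have "tlact n ?t x = (\<Sum>p\<in>walks n. \<Sum>q\<in>walks_to (last p). tscale (crd v n q 0 (f (\<mu> p))) (munit v n q p x))"
  unfolding tlr.ev_sum tlr.ev_pscale
  by (intro sum.cong refl) (use w x in \<open>auto simp: is_tu_def\<close>)
 then show "tlact n ?t x = f x" using intertw_expand[OF f n x] by simp
qed

lemma tl_rep_mod_hom:
 assumes t: "t \<in> TF n"
 shows "restrict (tlact n t) (TS n) \<in> mod_hom (SA n) (ST n) (ST n)"
 unfolding mod_hom_def
proof (intro CollectI conjI ballI)
 show "restrict (tlact n t) (TS n) \<in> carrier (ST n) \<rightarrow>\<^sub>E carrier (ST n)"
  using tlact_TS[OF t] by auto
 fix a x assume "a \<in> carrier (SA n)" and x: "x \<in> carrier (ST n)"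
 then obtain s where s: "s \<in> SF n" "a = coset (IS n) s" by (auto simp: schur_carrier)
 show "restrict (tlact n t) (TS n) (a \<odot>\<^bsub>ST n\<^esub> x) = a \<odot>\<^bsub>ST n\<^esub> restrict (tlact n t) (TS n) x"
  using tl_schur_commute[OF t s(1)] x tlact_TS[OF t] sact_TS[OF s(1)] by (simp add: s(2) schur_tensor_smult[OF s(1)])
qed (auto simp: TS_add tlr.ev_add_right)

lemma tl_image:
 assumes n: "n \<le> N"
 shows "tl_rep v \<epsilon> n ` carrier (TA n) = mod_hom (SA n) (ST n) (ST n)"
proof (intro equalityI subsetI)
 fix f assume "f \<in> tl_rep v \<epsilon> n ` carrier (TA n)"
 then show "f \<in> mod_hom (SA n) (ST n) (ST n)"
  using tl_rep_mod_hom by (auto simp: TL_carrier tl_rep_coset)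
next
 fix f assume f: "f \<in> mod_hom (SA n) (ST n) (ST n)"
 obtain t where t: "t \<in> TF n" "\<And>x. x \<in> TS n ==> tlact n t x = f x"
  using intertw_tlact[OF n mod_hom_intertw[OF f]] by blast
 have "f \<in> extensional (TS n)" using f by (auto simp: mod_hom_def PiE_def)
 then have "f = restrict (tlact n t) (TS n)"
  by (intro extensionalityI[of _ "TS n"]) (auto simp: t(2))
 then have "f = tl_rep v \<epsilon> n (cl n t)" using tl_rep_coset[OF t(1)] by simp
 then show "f \<in> tl_rep v \<epsilon> n ` carrier (TA n)" using t(1) by (auto simp: TL_carrier)
qed

lemma tl_rep_iso:
 assumes n: "n \<le> N"
 shows "tl_rep v \<epsilon> n \<in> alg_iso (TA n) (end_algebra (SA n) (ST n))"
proof -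
 let ?B = "end_algebra (SA n) (ST n)"
 have Bs: "carrier ?B = mod_hom (SA n) (ST n) (ST n)"
  "add ?B = (\<lambda>f g. \<lambda>x\<in>TS n. f x + g x)" "one ?B = (\<lambda>x\<in>TS n. x)"
  "mult ?B = compose (TS n)"
  by (simp_all add: end_algebra_def fun_eq_iff)
 have Bsm: "c \<odot>\<^bsub>?B\<^esub> f = (\<lambda>x\<in>TS n. tscale c (f x))" if "f \<in> TS n \<rightarrow> TS n" for c f
  using that by (auto simp: end_algebra_def schur_scalar schur_tensor_smult[OF FA_pscale[OF FA_1]] sr.ev_pscale Pi_def restrict_def fun_eq_iff)
 have rT: "restrict (tlact n t) (TS n) \<in> TS n \<rightarrow> TS n" if "t \<in> TF n" for t using tlact_TS[OF that] by auto
 have sm: "tl_rep v \<epsilon> n (c \<odot>\<^bsub>TA n\<^esub> a) = c \<odot>\<^bsub>?B\<^esub> tl_rep v \<epsilon> n a" if a: "a \<in> carrier (TA n)" for c a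
 proof -
  obtain t where t: "t \<in> TF n" "a = cl n t" using a by (auto simp: TL_carrier)
  then show ?thesis unfolding t(2) TL_PA tlp.PA_smult tl_rep_coset[OF t(1)] tl_rep_coset[OF FA_pscale[OF t(1)]] Bsm[OF rT[OF t(1)]]
   by (simp add: tlr.ev_pscale cong: restrict_cong)
 qed
 have "tl_rep v \<epsilon> n \<in> ring_hom (TA n) ?B"
 proof (rule ring_hom_memI)
  fix x assume x: "x \<in> carrier (TA n)"
  then show "tl_rep v \<epsilon> n x \<in> carrier ?B" using tl_image[OF n] unfolding Bs by blast
  fix y assume y: "y \<in> carrier (TA n)"
  obtain s t where st: "s \<in> TF n" "x = cl n s" "t \<in> TF n" "y = cl n t"
   using x y by (auto simp: TL_carrier)
  show "tl_rep v \<epsilon> n (x \<otimes>\<^bsub>TA n\<^esub> y) = tl_rep v \<epsilon> n x \<otimes>\<^bsub>?B\<^esub> tl_rep v \<epsilon> n y"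
   using st tlact_TS[OF st(3)]
   by (simp add: TL_PA tlp.PA_mult tl_rep_coset FA_mult Bs compose_def tlr.ev_mult restrict_def fun_eq_iff)
  show "tl_rep v \<epsilon> n (x \<oplus>\<^bsub>TA n\<^esub> y) = tl_rep v \<epsilon> n x \<oplus>\<^bsub>?B\<^esub> tl_rep v \<epsilon> n y"
   using st by (simp add: TL_PA tlp.PA_add tl_rep_coset FA_add Bs tlr.ev_add restrict_def fun_eq_iff)
 next
  show "tl_rep v \<epsilon> n \<one>\<^bsub>TA n\<^esub> = \<one>\<^bsub>?B\<^esub>"
   using tl_rep_coset[OF FA_1, of n] by (simp add: TL_PA tlp.PA_one Bs restrict_def fun_eq_iff)
 qed
 moreover have "inj_on (tl_rep v \<epsilon> n) (carrier (TA n))"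
 proof (rule inj_onI)
  fix x y assume "x \<in> carrier (TA n)" "y \<in> carrier (TA n)" and eq: "tl_rep v \<epsilon> n x = tl_rep v \<epsilon> n y"
  then obtain s t where st: "s \<in> TF n" "x = cl n s" "t \<in> TF n" "y = cl n t"
   by (auto simp: TL_carrier)
  show "x = y"
   unfolding st
  proof (rule TL_cong[OF n st(1,3)])
   fix r assume "r \<in> walks n"
   then show "tlact n s (\<mu> r) = tlact n t (\<mu> r)"
    using fun_cong[OF eq, of "\<mu> r"] mu_TS[OF _ n] by (simp add: st tl_rep_coset)
  qed
 qed
 ultimately show ?thesis using tl_image[OF n] sm by (auto simp: alg_iso_def alg_hom_def bij_betw_def Bs)
qed

lemma tl_tensor_faithful:
 assumes n: "n \<le> N"
 shows "faithful_module (TA n) (TT n)"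
 unfolding faithful_module_def
proof (intro conjI ballI impI)
 show "left_module (TA n) (TT n)" by (rule tl_tensor_module)
 fix a assume "a \<in> carrier (TA n)" and z: "\<forall>x\<in>carrier (TT n). a \<odot>\<^bsub>TT n\<^esub> x = \<zero>\<^bsub>TT n\<^esub>"
 then obtain t where t: "t \<in> TF n" "a = cl n t" by (auto simp: TL_carrier)
 show "a = \<zero>\<^bsub>TA n\<^esub>"
  unfolding t(2) TL_PA tlp.PA_zero
 proof (rule TL_cong[OF n t(1) FA_0])
  fix r assume "r \<in> walks n"
  then show "tlact n t (\<mu> r) = tlact n 0 (\<mu> r)"
   using z mu_TS[OF _ n, of r] tl_tensor_smult[OF t(1), of "\<mu> r"] by (simp add: t(2))
 qed
qed

lemma schur_tl_bimodule: "bimodule (SA n) (TA n) (ST n) (TT n)"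
 unfolding bimodule_def
proof (intro conjI allI ballI)
 fix c x assume "x \<in> carrier (ST n)"
 then show "(c \<odot>\<^bsub>SA n\<^esub> \<one>\<^bsub>SA n\<^esub>) \<odot>\<^bsub>ST n\<^esub> x = (c \<odot>\<^bsub>TA n\<^esub> \<one>\<^bsub>TA n\<^esub>) \<odot>\<^bsub>TT n\<^esub> x"
  by (simp add: schur_scalar TL_scalar schur_tensor_smult tl_tensor_smult FA_pscale FA_1 sr.ev_pscale tlr.ev_pscale)
next
 fix a b x assume a: "a \<in> carrier (SA n)" and b: "b \<in> carrier (TA n)" and x: "x \<in> carrier (ST n)"
 obtain s where s: "s \<in> SF n" "a = coset (IS n) s" using a by (auto simp: schur_carrier)
 obtain t where t: "t \<in> TF n" "b = cl n t" using b by (auto simp: TL_carrier)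
 show "a \<odot>\<^bsub>ST n\<^esub> (b \<odot>\<^bsub>TT n\<^esub> x) = b \<odot>\<^bsub>TT n\<^esub> (a \<odot>\<^bsub>ST n\<^esub> x)"
  using x tl_schur_commute[OF t(1) s(1), of x] tlact_TS[OF t(1), of x] sact_TS[OF s(1), of x]
  by (simp add: s(2) t(2) schur_tensor_smult[OF s(1)] tl_tensor_smult[OF t(1)])
qed (auto simp: schur_tensor_module tl_tensor_module)

abbreviation "EndB n \<equiv> end_algebra base_field (tensor_power n) :: ('k, 'k tvec => 'k tvec) module"

lemma EndB_carrier: "f \<in> carrier (EndB n) \<longleftrightarrow> f \<in> TS n \<rightarrow>\<^sub>E TS n \<and> (\<forall>x\<in>TS n. \<forall>y\<in>TS n. f (x + y) = f x + f y) \<and> (\<forall>c. \<forall>x\<in>TS n. f (tscale c x) = tscale c (f x))"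
 by (simp add: end_algebra_def mod_hom_def base_field_def)

lemma restrict_eq_iff: "restrict f A = restrict g A \<longleftrightarrow> (\<forall>x\<in>A. f x = g x)"
proof
 assume eq: "restrict f A = restrict g A"
 show "\<forall>x\<in>A. f x = g x"
 proof
  fix x assume "x \<in> A"
  then show "f x = g x" using fun_cong[OF eq, of x] by simp
 qed
qed (simp cong: restrict_cong)

text \<open>Commuting with the restricted operators means commuting pointwise on tensor space.\<close>

lemma centralizer_EndB:
 assumes st: "\<And>a x. a \<in> X ==> x \<in> TS n ==> A a x \<in> TS n"
 shows "f \<in> centralizer (EndB n) ((\<lambda>a. restrict (A a) (TS n)) ` X) \<longleftrightarrow>
  f \<in> carrier (EndB n) \<and> (\<forall>a\<in>X. \<forall>x\<in>TS n. f (A a x) = A a (f x))"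
proof -
 have "f \<otimes>\<^bsub>EndB n\<^esub> restrict (A a) (TS n) = restrict (A a) (TS n) \<otimes>\<^bsub>EndB n\<^esub> f \<longleftrightarrow> (\<forall>x\<in>TS n. f (A a x) = A a (f x))"
  if f: "f \<in> carrier (EndB n)" and a: "a \<in> X" for a
 proof -
  have "f x \<in> TS n" if "x \<in> TS n" for x using f that by (auto simp: EndB_carrier)
  then have "f \<otimes>\<^bsub>EndB n\<^esub> restrict (A a) (TS n) = (\<lambda>x\<in>TS n. f (A a x))"
   "restrict (A a) (TS n) \<otimes>\<^bsub>EndB n\<^esub> f = (\<lambda>x\<in>TS n. A a (f x))"
   using st[OF a] by (simp_all add: end_algebra_def compose_def cong: restrict_cong)
  then show ?thesis by (simp only: restrict_eq_iff)
 qed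
 then show ?thesis by (auto simp: centralizer_def)
qed

lemma rep_images:
 "schur_rep v n ` carrier (SA n) = (\<lambda>s. restrict (sact n s) (TS n)) ` SF n"
 "tl_rep v \<epsilon> n ` carrier (TA n) = (\<lambda>t. restrict (tlact n t) (TS n)) ` TF n"
 by (simp_all add: schur_carrier TL_carrier image_image schur_rep_coset tl_rep_coset cong: image_cong)

lemma tl_centralizer:
 "f \<in> centralizer (EndB n) (tl_rep v \<epsilon> n ` carrier (TA n)) \<longleftrightarrow>
  f \<in> carrier (EndB n) \<and> (\<forall>t\<in>TF n. \<forall>x\<in>TS n. f (tlact n t x) = tlact n t (f x))"
 unfolding rep_images
 by (rule centralizer_EndB) (rule tlact_TS)

lemma schur_centralizer:
 "f \<in> centralizer (EndB n) (schur_rep v n ` carrier (SA n)) \<longleftrightarrow>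
  f \<in> carrier (EndB n) \<and> (\<forall>s\<in>SF n. \<forall>x\<in>TS n. f (sact n s x) = sact n s (f x))"
 unfolding rep_images
 by (rule centralizer_EndB) (rule sact_TS)

lemma restrict_EndB:
 assumes "\<And>x y. g (x + y) = g x + g y" "\<And>c x. g (tscale c x) = tscale c (g x)" "\<And>x. x \<in> TS n ==> g x \<in> TS n"
 shows "restrict g (TS n) \<in> carrier (EndB n)"
 using assms unfolding EndB_carrier by (auto simp: TS_add TS_scale)

lemma schur_rep_image:
 assumes n: "n \<le> N"
 shows "schur_rep v n ` carrier (SA n) = centralizer (EndB n) (tl_rep v \<epsilon> n ` carrier (TA n))"
proof (intro equalityI subsetI)
 fix f assume "f \<in> schur_rep v n ` carrier (SA n)"
 then obtain s where s: "s \<in> SF n" "f = restrict (sact n s) (TS n)" unfolding rep_images by blast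
 have "f \<in> carrier (EndB n)"
  unfolding s(2) by (rule restrict_EndB) (simp_all add: sr.ev_add_right sr.ev_scale_right sact_TS[OF s(1)])
 then show "f \<in> centralizer (EndB n) (tl_rep v \<epsilon> n ` carrier (TA n))"
  unfolding tl_centralizer using tl_schur_commute[OF _ s(1)] tlact_TS by (simp add: s(2))
next
 fix f assume "f \<in> centralizer (EndB n) (tl_rep v \<epsilon> n ` carrier (TA n))"
 then have fE: "f \<in> carrier (EndB n)" and comm: "\<And>t x. t \<in> TF n ==> x \<in> TS n ==> f (tlact n t x) = tlact n t (f x)"
  unfolding tl_centralizer by blast+
 then have fT: "f \<in> TS n \<rightarrow> TS n" by (auto simp: EndB_carrier)
 have "\<exists>s\<in>SF n. \<forall>x\<in>TS n. sact n s x = f x"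
 proof (rule schur_image[OF n])
  fix p q and x :: "'k tvec" assume p: "p \<in> walks n" and q: "q \<in> walks n" and l: "last p = last q" and x: "x \<in> TS n"
  have u: "tu n q p \<in> TF n" "\<And>y. y \<in> TS n ==> tlact n (tu n q p) y = munit v n q p y"
   using tu[OF n p q l] by (auto simp: is_tu_def)
  show "f (munit v n q p x) = munit v n q p (f x)"
   using comm[OF u(1) x] u(2)[OF x] u(2)[OF funcset_mem[OF fT x]] by simp
 qed (use fE in \<open>auto simp: EndB_carrier\<close>)
 then obtain s where s: "s \<in> SF n" "\<And>x. x \<in> TS n ==> sact n s x = f x" by blast
 have "f \<in> extensional (TS n)" using fE by (auto simp: EndB_carrier PiE_def)
 then have "f = restrict (sact n s) (TS n)"
  by (intro extensionalityI[of _ "TS n"]) (auto simp: s(2))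
 then show "f \<in> schur_rep v n ` carrier (SA n)" unfolding rep_images using s(1) by blast
qed

lemma tl_rep_image:
 assumes n: "n \<le> N"
 shows "tl_rep v \<epsilon> n ` carrier (TA n) = centralizer (EndB n) (schur_rep v n ` carrier (SA n))"
proof (rule Set.set_eqI)
 fix f
 have "f \<in> mod_hom (SA n) (ST n) (ST n) \<longleftrightarrow>
  f \<in> TS n \<rightarrow>\<^sub>E TS n \<and> (\<forall>x\<in>TS n. \<forall>y\<in>TS n. f (x + y) = f x + f y) \<and> (\<forall>s\<in>SF n. \<forall>x\<in>TS n. f (sact n s x) = sact n s (f x))"
 proof (cases "f \<in> TS n \<rightarrow>\<^sub>E TS n")
  case True
  show ?thesis using True by (simp add: mod_hom_def schur_carrier schur_tensor_smult PiE_mem[OF True])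
 qed (simp add: mod_hom_def)
 moreover have "f (tscale c x) = tscale c (f x)"
  if "\<forall>s\<in>SF n. \<forall>x\<in>TS n. f (sact n s x) = sact n s (f x)" "x \<in> TS n" for c x
  using that(1)[THEN bspec, OF FA_pscale[OF FA_1], THEN bspec, OF that(2), of c] by (simp add: sr.ev_pscale)
 ultimately show "f \<in> tl_rep v \<epsilon> n ` carrier (TA n) \<longleftrightarrow> f \<in> centralizer (EndB n) (schur_rep v n ` carrier (SA n))"
  unfolding tl_image[OF n] schur_centralizer EndB_carrier by (safe; simp)
qed

end

section \<open>The simple modules of the Temperley--Lieb algebra\<close>

lemma finsum_additive:
 fixes h :: "'b => 'v::comm_monoid_add"
 assumes B: "abelian_monoid B" and A: "finite A" and f: "\<And>i. i \<in> A ==> f i \<in> carrier B"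
  and h: "h \<zero>\<^bsub>B\<^esub> = 0" "\<And>x y. x \<in> carrier B ==> y \<in> carrier B ==> h (x \<oplus>\<^bsub>B\<^esub> y) = h x + h y"
 shows "h (finsum B f A) = (\<Sum>i\<in>A. h (f i))"
proof -
 interpret abelian_monoid B by (rule B)
 show ?thesis
  using A f
 proof (induction A)
  case empty
  then show ?case by (simp add: finsum_empty h)
 next
  case (insert a A)
  have fA: "f \<in> A \<rightarrow> carrier B" "f a \<in> carrier B" using insert.prems by auto
  have "finsum B f (insert a A) = f a \<oplus>\<^bsub>B\<^esub> finsum B f A"
   by (rule finsum_insert) (use insert.hyps fA in auto)
  then show ?case using insert h(2)[OF fA(2) finsum_closed[OF fA(1)]] by simp
 qed
qed

context left_module begin

lemma smult_l_null: "x \<in> carrier M ==> \<zero>\<^bsub>R\<^esub> \<odot>\<^bsub>M\<^esub> x = \<zero>\<^bsub>M\<^esub>"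
proof -
 assume x: "x \<in> carrier M"
 have c: "\<zero>\<^bsub>R\<^esub> \<odot>\<^bsub>M\<^esub> x \<in> carrier M" by (rule smult_closed[OF R.zero_closed x])
 have "\<zero>\<^bsub>R\<^esub> \<odot>\<^bsub>M\<^esub> x \<oplus>\<^bsub>M\<^esub> \<zero>\<^bsub>R\<^esub> \<odot>\<^bsub>M\<^esub> x = \<zero>\<^bsub>R\<^esub> \<odot>\<^bsub>M\<^esub> x"
  using smult_l_distr[OF R.zero_closed R.zero_closed x] by simp
 then show ?thesis using M.add.r_cancel_one[OF c c] by simp
qed

lemma smult_r_null: "a \<in> carrier R ==> a \<odot>\<^bsub>M\<^esub> \<zero>\<^bsub>M\<^esub> = \<zero>\<^bsub>M\<^esub>"
proof -
 assume a: "a \<in> carrier R"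
 have c: "a \<odot>\<^bsub>M\<^esub> \<zero>\<^bsub>M\<^esub> \<in> carrier M" by (rule smult_closed[OF a M.zero_closed])
 have "a \<odot>\<^bsub>M\<^esub> \<zero>\<^bsub>M\<^esub> \<oplus>\<^bsub>M\<^esub> a \<odot>\<^bsub>M\<^esub> \<zero>\<^bsub>M\<^esub> = a \<odot>\<^bsub>M\<^esub> \<zero>\<^bsub>M\<^esub>"
  using smult_r_distr[OF a M.zero_closed M.zero_closed] by simp
 then show ?thesis using M.add.r_cancel_one[OF c c] by simp
qed

lemma finsum_smult_zero:
 assumes "finite A" "\<And>i. i \<in> A ==> f i \<in> carrier R" "y \<in> carrier M" "\<And>i. i \<in> A ==> f i \<odot>\<^bsub>M\<^esub> y = \<zero>\<^bsub>M\<^esub>"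
 shows "finsum R f A \<odot>\<^bsub>M\<^esub> y = \<zero>\<^bsub>M\<^esub>"
 using assms
proof (induction A)
 case empty
 then show ?case by (simp add: R.finsum_empty smult_l_null)
next
 case (insert a A)
 have fA: "f \<in> A \<rightarrow> carrier R" "f a \<in> carrier R" using insert.prems by auto
 have "finsum R f (insert a A) = f a \<oplus>\<^bsub>R\<^esub> finsum R f A"
  by (rule R.finsum_insert) (use insert.hyps fA in auto)
 then show ?case using insert smult_l_distr[OF fA(2) R.finsum_closed[OF fA(1)] \<open>y \<in> carrier M\<close>] by simp
qed

lemma module_submodule:
 assumes N: "submodule N R M"
 shows "left_module R (M\<lparr>carrier := N\<rparr>)"
proof -
 interpret N: submodule N R M by (rule N)
 have s: "N \<subseteq> carrier M" using N.subset by simp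
 have sc: "x \<in> carrier M" if "x \<in> N" for x using s that by blast
 have z: "\<zero>\<^bsub>M\<^esub> \<in> N" using N.one_closed by simp
 have a: "x \<oplus>\<^bsub>M\<^esub> y \<in> N" if "x \<in> N" "y \<in> N" for x y using N.m_closed[OF that] by simp
 have i: "\<ominus>\<^bsub>M\<^esub> x \<in> N" if "x \<in> N" for x using N.m_inv_closed[OF that] by (simp add: a_inv_def)
 have ag: "abelian_group (M\<lparr>carrier := N\<rparr>)"
 proof (rule abelian_groupI)
  fix x assume x: "x \<in> carrier (M\<lparr>carrier := N\<rparr>)"
  then have "x \<in> carrier M" using s by auto
  then show "\<exists>y\<in>carrier (M\<lparr>carrier := N\<rparr>). y \<oplus>\<^bsub>M\<lparr>carrier := N\<rparr>\<^esub> x = \<zero>\<^bsub>M\<lparr>carrier := N\<rparr>\<^esub>"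
   using x by (intro bexI[of _ "\<ominus>\<^bsub>M\<^esub> x"]) (auto simp: i M.l_neg)
 qed (auto simp: z a sc intro: M.a_assoc M.a_comm)
 show ?thesis
  by (intro left_module.intro left_module_axioms.intro R.ring_axioms ag)
   (auto simp: sc N.smult_closed intro: smult_l_distr smult_r_distr smult_assoc smult_one)
qed

end

lemma left_module_regular:
 assumes "ring A" shows "left_module A (regular_module A)"
proof -
 interpret ring A by fact
 have "abelian_group (regular_module A)"
 proof (rule abelian_groupI)
  fix x assume "x \<in> carrier (regular_module A)"
  then show "\<exists>y\<in>carrier (regular_module A). y \<oplus>\<^bsub>regular_module A\<^esub> x = \<zero>\<^bsub>regular_module A\<^esub>"
   by (intro bexI[of _ "\<ominus>\<^bsub>A\<^esub> x"]) (auto simp: regular_module_def l_neg)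
 qed (auto simp: regular_module_def a_ac)
 then show ?thesis
  by (intro left_module.intro left_module_axioms.intro ring_axioms)
   (auto simp: regular_module_def l_distr r_distr m_assoc)
qed

context tl begin

lemma TL_finsum:
 assumes "finite A" "\<And>i. i \<in> A ==> V i \<in> TF n" "\<And>i. i \<in> A ==> f i = cl n (V i)"
 shows "finsum (TA n) f A = cl n (\<Sum>i\<in>A. V i)"
proof (rule finsum_transfer[where D = "TF n"])
 interpret ring "TA n" by (rule TL_ring)
 show "abelian_monoid (TA n)" by (rule abelian_monoid_axioms)
qed (use assms in \<open>auto simp: TL_PA tlp.PA_zero tlp.PA_add tlp.PA_I\<close>)

lemma cu_sum_one:
 assumes n: "n \<le> N"
 shows "cl n (\<Sum>P\<in>walks n. cu n P (\<mu> P)) = cl n 1"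
proof (rule TL_cong[OF n])
 fix r assume r: "r \<in> walks n"
 have "(\<Sum>P\<in>walks n. tlact n (cu n P (\<mu> P)) (\<mu> r)) = (\<Sum>P\<in>walks n. if P = r then \<mu> r else 0)"
  by (rule sum.cong[OF refl]) (use cu_mu[OF _ n mu_last_Cspace r] in auto)
 then show "tlact n (\<Sum>P\<in>walks n. cu n P (\<mu> P)) (\<mu> r) = tlact n 1 (\<mu> r)"
  using r by (simp add: tlr.ev_sum)
qed (auto intro: FA_sum cu_FA[OF _ n] FA_1)

text \<open>The identity is the sum of the diagonal units, so one of them does not kill a given nonzero vector;
 the image is a fixed vector of this idempotent.\<close>

lemma TL_simple_generator:
 assumes n: "n \<le> N" and M: "simple_module (TA n) M"
 obtains P y where "P \<in> walks n" "y \<in> carrier M" "y \<noteq> \<zero>\<^bsub>M\<^esub>" "cl n (cu n P (\<mu> P)) \<odot>\<^bsub>M\<^esub> y = y"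
proof -
 interpret left_module "TA n" M using M by (simp add: simple_module_def)
 have "carrier M \<noteq> {\<zero>\<^bsub>M\<^esub>}" using M by (simp add: simple_module_def)
 then obtain y0 where y0: "y0 \<in> carrier M" "y0 \<noteq> \<zero>\<^bsub>M\<^esub>" using M.zero_closed by blast
 let ?e = "\<lambda>P. cl n (cu n P (\<mu> P))"
 have e: "?e P \<in> carrier (TA n)" if "P \<in> walks n" for P
  using cu_FA[OF that n] by (simp add: TL_carrier)
 have "finsum (TA n) ?e (walks n) = \<one>\<^bsub>TA n\<^esub>"
  using TL_finsum[of "walks n" "\<lambda>P. cu n P (\<mu> P)" n ?e] cu_FA[OF _ n] cu_sum_one[OF n] by (simp add: TL_PA tlp.PA_one)
 then have "\<not> (\<forall>P\<in>walks n. ?e P \<odot>\<^bsub>M\<^esub> y0 = \<zero>\<^bsub>M\<^esub>)"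
  using finsum_smult_zero[of "walks n" ?e y0] e y0 smult_one by auto
 then obtain P where P: "P \<in> walks n" "?e P \<odot>\<^bsub>M\<^esub> y0 \<noteq> \<zero>\<^bsub>M\<^esub>" by blast
 have mP: "\<mu> P \<in> Cspace v (last P)" by (rule mu_last_Cspace[OF P(1)])
 have "?e P \<otimes>\<^bsub>TA n\<^esub> ?e P = ?e P"
  using cu_mult[OF P(1) n mP cu_FA[OF P(1) n]] cu_FA[OF P(1) n] cu_mu[OF P(1) n mP P(1)] by (simp add: TL_PA tlp.PA_mult)
 then have "?e P \<odot>\<^bsub>M\<^esub> (?e P \<odot>\<^bsub>M\<^esub> y0) = ?e P \<odot>\<^bsub>M\<^esub> y0"
  using smult_assoc[OF e[OF P(1)] e[OF P(1)] y0(1)] by simp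
 then show ?thesis using that[OF P(1) smult_closed[OF e[OF P(1)] y0(1)] P(2)] by blast
qed

text \<open>The homomorphism from the cell module determined by a vector y, through the column of P.\<close>

definition colmap :: "nat => (nat \<times> nat) list => ('k tl_elt, 'w) module => 'w => 'k tvec => 'w" where
 "colmap n P M y c = cl n (cu n P c) \<odot>\<^bsub>M\<^esub> y"

lemma colmap_tlact:
 assumes n: "n \<le> N" and M: "left_module (TA n) M" and P: "P \<in> walks n" and y: "y \<in> carrier M"
  and t: "t \<in> TF n" and c: "c \<in> Cspace v (last P)"
 shows "colmap n P M y (tlact n t c) = cl n t \<odot>\<^bsub>M\<^esub> colmap n P M y c"
proof -
 interpret left_module "TA n" M by (rule M)
 have tc: "cl n t \<in> carrier (TA n)" "cl n (cu n P c) \<in> carrier (TA n)"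
  using t cu_FA[OF P n] by (simp_all add: TL_carrier)
 have "cl n (cu n P (tlact n t c)) = cl n t \<otimes>\<^bsub>TA n\<^esub> cl n (cu n P c)"
  using cu_mult[OF P n c t] t cu_FA[OF P n] by (simp add: TL_PA tlp.PA_mult)
 then show ?thesis using smult_assoc[OF tc y] by (simp add: colmap_def)
qed

text \<open>Injectivity holds because the cell module is generated by any nonzero vector and y \<noteq> 0;
 surjectivity because the image is a nonzero submodule.\<close>

lemma TL_simple_iso:
 assumes n: "n \<le> N" and M: "simple_module (TA n) M"
  and P: "P \<in> walks n" and y: "y \<in> carrier M" "y \<noteq> \<zero>\<^bsub>M\<^esub>" "cl n (cu n P (\<mu> P)) \<odot>\<^bsub>M\<^esub> y = y"
 shows "restrict (colmap n P M y) (Cspace v (last P)) \<in> mod_iso (TA n) (TC n (last P)) M"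
proof -
 interpret left_module "TA n" M using M by (simp add: simple_module_def)
 let ?C = "Cspace v (last P)" and ?f = "colmap n P M y"
 have l: "last P \<in> two_row_partitions n" by (rule last_two_row[OF P])
 have cu: "cl n (cu n P c) \<in> carrier (TA n)" for c using cu_FA[OF P n] by (simp add: TL_carrier)
 have fM: "?f c \<in> carrier M" for c unfolding colmap_def by (rule smult_closed[OF cu y(1)])
 have add: "?f (c + d) = ?f c \<oplus>\<^bsub>M\<^esub> ?f d" for c d
  using smult_l_distr[OF cu cu y(1), of c d] by (simp add: colmap_def cu_add TL_PA tlp.PA_add)
 have f0: "?f 0 = \<zero>\<^bsub>M\<^esub>"
  using smult_l_null[OF y(1)] by (simp add: colmap_def TL_PA tlp.PA_zero)
 have neg: "\<ominus>\<^bsub>M\<^esub> ?f c = ?f (- c)" for c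
  by (rule M.minus_equality) (use add[of "- c" c] f0 fM in auto)
 note sm = colmap_tlact[OF n left_module_axioms P y(1)]
 have inj: "c = 0" if c: "c \<in> ?C" and z: "?f c = \<zero>\<^bsub>M\<^esub>" for c
 proof (rule ccontr)
  assume "c \<noteq> 0"
  then obtain t where t: "t \<in> TF n" "tlact n t c = \<mu> P"
   using Cspace_transitive[OF l n c _ mu_last_Cspace[OF P]] by blast
  have tc: "cl n t \<in> carrier (TA n)" using t by (simp add: TL_carrier)
  have "y = ?f (\<mu> P)" using y(3) by (simp add: colmap_def)
  also have "\<dots> = cl n t \<odot>\<^bsub>M\<^esub> ?f c" using sm[OF t(1) c] t(2) by simp
  also have "\<dots> = \<zero>\<^bsub>M\<^esub>" using z smult_r_null[OF tc] by simp
  finally show False using y(2) by simp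
 qed
 have "inj_on ?f ?C"
 proof (rule inj_onI)
  fix c d assume c: "c \<in> ?C" and d: "d \<in> ?C" and eq: "?f c = ?f d"
  have cd: "c - d \<in> ?C" by (rule tvec.subspace_diff[OF subspace_Cspace c d])
  have "?f (c + - d) = ?f c \<oplus>\<^bsub>M\<^esub> \<ominus>\<^bsub>M\<^esub> ?f d" using add[of c "- d"] neg[of d] by simp
  then have "?f (c - d) = \<zero>\<^bsub>M\<^esub>" using eq fM[of d] by (simp add: M.r_neg)
  then show "c = d" using inj[OF cd] by simp
 qed
 moreover have "?f ` ?C = carrier M"
 proof -
  have "submodule (?f ` ?C) (TA n) M"
  proof (rule submoduleI)
   show "abelian_group M" by (rule M.abelian_group_axioms)
   show "?f ` ?C \<subseteq> carrier M" using fM by blast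
   show "\<zero>\<^bsub>M\<^esub> \<in> ?f ` ?C" using f0 tvec.subspace_0[OF subspace_Cspace] by (metis imageI)
   show "x \<oplus>\<^bsub>M\<^esub> z \<in> ?f ` ?C" if "x \<in> ?f ` ?C" "z \<in> ?f ` ?C" for x z
    using that by (auto simp: add[symmetric] intro!: imageI tvec.subspace_add[OF subspace_Cspace])
   show "\<ominus>\<^bsub>M\<^esub> x \<in> ?f ` ?C" if "x \<in> ?f ` ?C" for x
    using that by (auto simp: neg intro!: imageI tvec.subspace_neg[OF subspace_Cspace])
   show "a \<odot>\<^bsub>M\<^esub> x \<in> ?f ` ?C" if "a \<in> carrier (TA n)" "x \<in> ?f ` ?C" for a x
    using that by (auto simp: TL_carrier sm[symmetric] intro!: imageI tlact_Cspace[OF l n])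
  qed
  then have "?f ` ?C = {\<zero>\<^bsub>M\<^esub>} \<or> ?f ` ?C = carrier M" using M by (simp add: simple_module_def)
  moreover have "y \<in> ?f ` ?C" using y(3) mu_last_Cspace[OF P] by (force simp: colmap_def)
  ultimately show ?thesis using y(2) by blast
 qed
 ultimately have "bij_betw (restrict ?f ?C) ?C (carrier M)" by (simp add: bij_betw_def)
 moreover have "restrict ?f ?C \<in> mod_hom (TA n) (TC n (last P)) M"
  unfolding mod_hom_def
 proof (intro CollectI conjI ballI)
  show "restrict ?f ?C \<in> carrier (TC n (last P)) \<rightarrow>\<^sub>E carrier M" using fM by auto
  fix a x assume "a \<in> carrier (TA n)" and x: "x \<in> carrier (TC n (last P))"
  then obtain t where t: "t \<in> TF n" "a = cl n t" by (auto simp: TL_carrier)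
  show "restrict ?f ?C (a \<odot>\<^bsub>TC n (last P)\<^esub> x) = a \<odot>\<^bsub>M\<^esub> restrict ?f ?C x"
   using x tl_cell_smult[OF l n t(1)] tlact_Cspace[OF l n t(1)] sm[OF t(1)] by (simp add: t(2))
 qed (auto simp: add tvec.subspace_add[OF subspace_Cspace])
 ultimately show ?thesis by (simp add: mod_iso_def)
qed

lemma TL_simple_classification:
 assumes n: "n \<le> N" and M: "simple_module (TA n) M"
 shows "\<exists>l\<in>two_row_partitions n. mod_isomorphic (TA n) M (TC n l)"
proof -
 obtain P y where P: "P \<in> walks n" and y: "y \<in> carrier M" "y \<noteq> \<zero>\<^bsub>M\<^esub>" "cl n (cu n P (\<mu> P)) \<odot>\<^bsub>M\<^esub> y = y"
  by (rule TL_simple_generator[OF n M])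
 have l: "last P \<in> two_row_partitions n" by (rule last_two_row[OF P])
 have "mod_isomorphic (TA n) M (TC n (last P))"
  by (rule mod_iso_sym[OF TL_simple_iso[OF n M P y]])
   (use tl_cell_smult[OF l n] tlact_Cspace[OF l n] in \<open>auto simp: TL_carrier tvec.subspace_add[OF subspace_Cspace]\<close>)
 then show ?thesis using l by blast
qed

text \<open>An endomorphism sends y to a vector fixed by the same diagonal unit; in the cell module such vectors
 are multiples of \<mu>(P).\<close>

lemma TL_simple_End:
 assumes n: "n \<le> N" and M: "simple_module (TA n) M" and f: "f \<in> mod_hom (TA n) M M"
 shows "\<exists>c. \<forall>x\<in>carrier M. f x = (c \<odot>\<^bsub>TA n\<^esub> \<one>\<^bsub>TA n\<^esub>) \<odot>\<^bsub>M\<^esub> x"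
proof -
 interpret left_module "TA n" M using M by (simp add: simple_module_def)
 obtain P y where P: "P \<in> walks n" and y: "y \<in> carrier M" "y \<noteq> \<zero>\<^bsub>M\<^esub>" "cl n (cu n P (\<mu> P)) \<odot>\<^bsub>M\<^esub> y = y"
  by (rule TL_simple_generator[OF n M])
 let ?C = "Cspace v (last P)" and ?f = "colmap n P M y"
 have l: "last P \<in> two_row_partitions n" and mP: "\<mu> P \<in> ?C" by (rule last_two_row[OF P], rule mu_last_Cspace[OF P])
 have cF: "cu n P c \<in> TF n" for c by (rule cu_FA[OF P n])
 have cu: "cl n (cu n P c) \<in> carrier (TA n)" for c using cF by (simp add: TL_carrier)
 note sm = colmap_tlact[OF n left_module_axioms P y(1)]
 have surj: "\<exists>c\<in>?C. x = ?f c" if "x \<in> carrier M" for x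
  using TL_simple_iso[OF n M P y] that by (force simp: mod_iso_def bij_betw_def)
 have fM: "f y \<in> carrier M" and fs: "\<And>a x. a \<in> carrier (TA n) ==> x \<in> carrier M ==> f (a \<odot>\<^bsub>M\<^esub> x) = a \<odot>\<^bsub>M\<^esub> f x"
  using f y by (auto simp: mod_hom_def)
 obtain d where d: "d \<in> ?C" "f y = ?f d" using surj[OF fM] by blast
 let ?a = "crd v n P 0 d"
 have aP: "tscale ?a (\<mu> P) \<in> ?C" by (rule tvec.subspace_scale[OF subspace_Cspace mP])
 have "f y = cl n (cu n P (\<mu> P)) \<odot>\<^bsub>M\<^esub> ?f d" using fs[OF cu y(1), of "\<mu> P"] y(3) d(2) by simp
 also have "\<dots> = ?f (tscale ?a (\<mu> P))" using sm[OF cF d(1), of "\<mu> P"] cu_act[OF P n mP d(1)] by simp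
 finally have fy: "f y = ?f (tscale ?a (\<mu> P))" .
 have "f x = cl n (pscale ?a 1) \<odot>\<^bsub>M\<^esub> x" if x: "x \<in> carrier M" for x
 proof -
  obtain b where b: "b \<in> ?C" "x = ?f b" using surj[OF x] by blast
  have "f x = cl n (cu n P b) \<odot>\<^bsub>M\<^esub> f y" unfolding b(2) colmap_def by (rule fs[OF cu y(1)])
  also have "\<dots> = ?f (tscale ?a b)"
   unfolding fy using sm[OF cF aP, of b] cu_act[OF P n b(1) aP] crd_mu[OF P P n] by (simp add: crd_scale)
  also have "\<dots> = cl n (pscale ?a 1) \<odot>\<^bsub>M\<^esub> x"
   using sm[OF FA_pscale[OF FA_1] b(1), of ?a] by (simp add: b(2) tlr.ev_pscale)
  finally show ?thesis .
 qed
 then show ?thesis unfolding TL_scalar by blast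
qed

section \<open>Semisimplicity of the Temperley--Lieb algebra\<close>

text \<open>A minimal left ideal.\<close>

definition Col :: "nat => (nat \<times> nat) list => 'k tl_elt set" where
 "Col n P = (\<lambda>c. cl n (cu n P c)) ` Cspace v (last P)"

lemma cu_inj:
 assumes P: "P \<in> walks n" and Q: "Q \<in> walks n" and n: "n \<le> N" and c: "c \<in> Cspace v (last P)" and d: "d \<in> Cspace v (last Q)"
  and eq: "cl n (cu n P c) = cl n (cu n Q d)"
 shows "c = (if P = Q then d else 0)"
 using TL_actD[OF eq mu_TS[OF P n]] cu_mu[OF P n c P] cu_mu[OF Q n d P] by simp

lemma regular_simps: "carrier (regular_module A) = carrier A" "zero (regular_module A) = zero A" "add (regular_module A) = add A"
 "smult (regular_module A) = mult A"
 by (simp_all add: regular_module_def)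

lemma Col_submodule:
 assumes P: "P \<in> walks n" and n: "n \<le> N"
 shows "submodule (Col n P) (TA n) (regular_module (TA n))"
proof -
 interpret left_module "TA n" "regular_module (TA n)" by (rule left_module_regular[OF TL_ring])
 have l: "last P \<in> two_row_partitions n" by (rule last_two_row[OF P])
 have cF: "cu n P c \<in> TF n" for c by (rule cu_FA[OF P n])
 have neg: "\<ominus>\<^bsub>regular_module (TA n)\<^esub> cl n (cu n P c) = cl n (cu n P (- c))" for c
 proof (rule M.minus_equality)
  show "cl n (cu n P (- c)) \<oplus>\<^bsub>regular_module (TA n)\<^esub> cl n (cu n P c) = \<zero>\<^bsub>regular_module (TA n)\<^esub>"
   by (simp add: regular_simps TL_PA tlp.PA_add tlp.PA_zero flip: cu_add)
 qed (simp_all add: regular_simps TL_carrier cF)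
 show ?thesis
 proof (rule submoduleI)
  show "abelian_group (regular_module (TA n))" by (rule M.abelian_group_axioms)
  show "Col n P \<subseteq> carrier (regular_module (TA n))" by (auto simp: Col_def regular_simps TL_carrier cF)
  show "\<zero>\<^bsub>regular_module (TA n)\<^esub> \<in> Col n P"
   unfolding Col_def by (rule image_eqI[OF _ tvec.subspace_0[OF subspace_Cspace]]) (simp add: regular_simps TL_PA tlp.PA_zero)
  show "x \<oplus>\<^bsub>regular_module (TA n)\<^esub> y \<in> Col n P" if "x \<in> Col n P" "y \<in> Col n P" for x y
   using that by (auto simp: Col_def regular_simps TL_PA tlp.PA_add simp flip: cu_add intro!: imageI tvec.subspace_add[OF subspace_Cspace])
  show "\<ominus>\<^bsub>regular_module (TA n)\<^esub> x \<in> Col n P" if "x \<in> Col n P" for x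
   using that by (auto simp: Col_def neg intro!: imageI tvec.subspace_neg[OF subspace_Cspace])
  show "a \<odot>\<^bsub>regular_module (TA n)\<^esub> x \<in> Col n P" if "a \<in> carrier (TA n)" "x \<in> Col n P" for a x
  proof -
   obtain t where t: "t \<in> TF n" "a = cl n t" using \<open>a \<in> carrier (TA n)\<close> by (auto simp: TL_carrier)
   obtain c where c: "c \<in> Cspace v (last P)" "x = cl n (cu n P c)" using \<open>x \<in> Col n P\<close> by (auto simp: Col_def)
   have "a \<odot>\<^bsub>regular_module (TA n)\<^esub> x = cl n (cu n P (tlact n t c))"
    using cu_mult[OF P n c(1) t(1)] by (simp add: t(2) c(2) regular_simps TL_PA tlp.PA_mult t(1) cF)
   then show ?thesis unfolding Col_def by (rule image_eqI[OF _ tlact_Cspace[OF l n t(1) c(1)]])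
  qed
 qed
qed

lemma Col_simple:
 assumes P: "P \<in> walks n" and n: "n \<le> N"
 shows "simple_module (TA n) ((regular_module (TA n))\<lparr>carrier := Col n P\<rparr>)"
proof (rule simple_moduleI)
 let ?M = "(regular_module (TA n))\<lparr>carrier := Col n P\<rparr>"
 have l: "last P \<in> two_row_partitions n" by (rule last_two_row[OF P])
 have cF: "cu n P c \<in> TF n" for c by (rule cu_FA[OF P n])
 have z: "\<zero>\<^bsub>?M\<^esub> = cl n (cu n P 0)" by (simp add: regular_simps TL_PA tlp.PA_zero)
 show "left_module (TA n) ?M"
  by (rule left_module.module_submodule[OF left_module_regular[OF TL_ring] Col_submodule[OF P n]])
 show "cl n (cu n P (\<mu> P)) \<in> carrier ?M" using mu_last_Cspace[OF P] by (simp add: Col_def)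
 show "cl n (cu n P (\<mu> P)) \<noteq> \<zero>\<^bsub>?M\<^esub>"
  using cu_inj[OF P P n mu_last_Cspace[OF P] tvec.subspace_0[OF subspace_Cspace]] mu_nonzero[OF P n] unfolding z by auto
 fix x y assume x: "x \<in> carrier ?M" "x \<noteq> \<zero>\<^bsub>?M\<^esub>" and "y \<in> carrier ?M"
 then have "x \<in> Col n P" "y \<in> Col n P" by simp_all
 then obtain c d where c: "c \<in> Cspace v (last P)" "x = cl n (cu n P c)" and d: "d \<in> Cspace v (last P)" "y = cl n (cu n P d)"
  unfolding Col_def by blast
 have "c \<noteq> 0" using x(2) unfolding z c(2) by blast
 then obtain t where t: "t \<in> TF n" "tlact n t c = d" using Cspace_transitive[OF l n c(1) _ d(1)] by blast
 have "cl n t \<odot>\<^bsub>?M\<^esub> x = y"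
  using cu_mult[OF P n c(1) t(1)] t cF by (simp add: c(2) d(2) regular_simps TL_PA tlp.PA_mult)
 then show "\<exists>a\<in>carrier (TA n). a \<odot>\<^bsub>?M\<^esub> x = y" using t(1) by (auto simp: TL_carrier)
qed

text \<open>An element of the algebra is determined by these values, and its component in the column of P by the
 value at \<mu>(P).\<close>

definition colval :: "nat => (nat \<times> nat) list => 'k tl_elt => 'k tvec" where
 "colval n P X = tl_rep v \<epsilon> n X (\<mu> P)"

lemma colval_coset: "P \<in> walks n ==> n \<le> N ==> t \<in> TF n ==> colval n P (cl n t) = tlact n t (\<mu> P)"
 by (simp add: colval_def tl_rep_coset mu_TS)

lemma colval_C: "P \<in> walks n ==> n \<le> N ==> X \<in> carrier (TA n) ==> colval n P X \<in> Cspace v (last P)"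
 using tlact_Cspace[OF last_two_row _ _ mu_last_Cspace] by (auto simp: TL_carrier colval_coset)

lemma colval_eqI:
 assumes n: "n \<le> N" and X: "X \<in> carrier (TA n)" "Y \<in> carrier (TA n)" and eq: "\<And>P. P \<in> walks n ==> colval n P X = colval n P Y"
 shows "X = Y"
proof -
 obtain s t where st: "s \<in> TF n" "X = cl n s" "t \<in> TF n" "Y = cl n t"
  using X by (auto simp: TL_carrier)
 show ?thesis unfolding st using eq by (intro TL_cong[OF n st(1,3)]) (simp add: st colval_coset[OF _ n])
qed

lemma colval_Col:
 assumes P: "P \<in> walks n" and Q: "Q \<in> walks n" and n: "n \<le> N" and X: "X \<in> Col n P"
 shows "colval n Q X = (if P = Q then colval n P X else 0)" "X = cl n (cu n P (colval n P X))"
 using X cu_mu[OF P n _ Q] cu_mu[OF P n _ P] cu_FA[OF P n] by (auto simp: Col_def colval_coset P Q n)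

lemma colval_finsum:
 assumes P: "P \<in> walks n" and n: "n \<le> N" and "finite A" and f: "\<And>i. i \<in> A ==> f i \<in> carrier (TA n)"
 shows "colval n P (finsum (TA n) f A) = (\<Sum>i\<in>A. colval n P (f i))"
proof (rule finsum_additive[OF _ \<open>finite A\<close> f])
 interpret ring "TA n" by (rule TL_ring)
 show "abelian_monoid (TA n)" by (rule abelian_monoid_axioms)
 show "colval n P \<zero>\<^bsub>TA n\<^esub> = 0" using colval_coset[OF P n FA_0] by (simp add: TL_PA tlp.PA_zero)
 fix x y assume "x \<in> carrier (TA n)" "y \<in> carrier (TA n)"
 then obtain s t where st: "s \<in> TF n" "x = cl n s" "t \<in> TF n" "y = cl n t"
  by (auto simp: TL_carrier)
 show "colval n P (x \<oplus>\<^bsub>TA n\<^esub> y) = colval n P x + colval n P y"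
  using st by (simp add: TL_PA tlp.PA_add colval_coset[OF P n] FA_add tlr.ev_add)
qed

lemma Col_inj: "n \<le> N ==> inj_on (Col n) (walks n)"
proof (rule inj_onI)
 fix P Q assume n: "n \<le> N" and P: "P \<in> walks n" and Q: "Q \<in> walks n" and eq: "Col n P = Col n Q"
 have "cl n (cu n P (\<mu> P)) \<in> Col n P" unfolding Col_def by (rule imageI[OF mu_last_Cspace[OF P]])
 then have "cl n (cu n P (\<mu> P)) \<in> Col n Q" unfolding eq .
 then obtain d where "d \<in> Cspace v (last Q)" "cl n (cu n P (\<mu> P)) = cl n (cu n Q d)" by (auto simp: Col_def)
 then show "P = Q" using cu_inj[OF P Q n mu_last_Cspace[OF P]] mu_nonzero[OF P n] by (auto split: if_splits)
qed

text \<open>The regular module is indexed by the columns themselves, hence the inverse w of the injection Col n.\<close>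

lemma TL_regular_decomposition:
 assumes n: "n \<le> N"
 shows "internal_direct_sum (TA n) (regular_module (TA n)) (Col n ` walks n) (\<lambda>X. X)"
 unfolding internal_direct_sum_def
proof (intro conjI ballI)
 show "submodule U (TA n) (regular_module (TA n))" if "U \<in> Col n ` walks n" for U
  using that Col_submodule[OF _ n] by auto
next
 let ?T = "TA n" let ?M = "regular_module ?T" let ?K = "Col n ` walks n"
 fix x assume "x \<in> carrier ?M"
 then have x: "x \<in> carrier ?T" by (simp add: regular_simps)
 define w where "w = the_inv_into (walks n) (Col n)"
 have w: "w (Col n P) = P" if "P \<in> walks n" for P using the_inv_into_f_f[OF Col_inj[OF n] that] by (simp add: w_def)
 have KT: "U \<subseteq> carrier ?T" if "U \<in> ?K" for U
  using that cu_FA[OF _ n] by (auto simp: Col_def TL_carrier)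
 have fm: "finsum ?M f A = finsum ?T f A" for f A
  by (simp add: finsum_def finprod_def regular_module_def)
 have cv: "colval n P (finsum ?T f {U \<in> ?K. f U \<noteq> \<zero>\<^bsub>?M\<^esub>}) = colval n P (f (Col n P))"
  if f: "f \<in> (\<Pi>\<^sub>E U\<in>?K. U)" and P: "P \<in> walks n" for f P
 proof -
  have fU: "f U \<in> U" if "U \<in> ?K" for U using f that by (auto simp: PiE_def Pi_def)
  have fT: "f U \<in> carrier ?T" if "U \<in> ?K" for U using fU[OF that] KT[OF that] by blast
  have cz: "colval n P \<zero>\<^bsub>?M\<^esub> = 0"
   using colval_coset[OF P n FA_0] by (simp add: TL_PA tlp.PA_zero regular_simps)
  have "colval n P (finsum ?T f {U \<in> ?K. f U \<noteq> \<zero>\<^bsub>?M\<^esub>}) = (\<Sum>U\<in>{U \<in> ?K. f U \<noteq> \<zero>\<^bsub>?M\<^esub>}. colval n P (f U))"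
   by (rule colval_finsum[OF P n]) (use fT in auto)
  also have "\<dots> = (\<Sum>U\<in>?K. colval n P (f U))"
   by (rule sum.mono_neutral_left) (auto simp: cz)
  also have "\<dots> = (\<Sum>Q\<in>walks n. colval n P (f (Col n Q)))"
   by (rule sum.reindex_cong[OF Col_inj[OF n] refl refl])
  also have "\<dots> = (\<Sum>Q\<in>walks n. if Q = P then colval n P (f (Col n P)) else 0)"
   by (rule sum.cong[OF refl]) (use colval_Col(1)[OF _ P n fU] in auto)
  finally show ?thesis using P by simp
 qed
 let ?f = "\<lambda>U\<in>?K. cl n (cu n (w U) (colval n (w U) x))"
 have f: "?f \<in> (\<Pi>\<^sub>E U\<in>?K. U)"
 proof (rule restrict_PiE_iff[THEN iffD2], rule ballI)
  fix U assume "U \<in> ?K"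
  then obtain P where P: "P \<in> walks n" "U = Col n P" by blast
  show "cl n (cu n (w U) (colval n (w U) x)) \<in> U"
   using colval_C[OF P(1) n x] w[OF P(1)] by (simp add: P(2) Col_def)
 qed
 have fin: "finite {U \<in> ?K. g U \<noteq> \<zero>\<^bsub>?M\<^esub>}" for g :: "'k tl_elt set => 'k tl_elt" by simp
 have fsT: "finsum ?T g {U \<in> ?K. g U \<noteq> \<zero>\<^bsub>?M\<^esub>} \<in> carrier ?T" if "g \<in> (\<Pi>\<^sub>E U\<in>?K. U)" for g
 proof -
  interpret ring ?T by (rule TL_ring)
  show ?thesis by (rule finsum_closed) (use that KT in \<open>auto simp: PiE_def Pi_def\<close>)
 qed
 show "\<exists>!f. f \<in> (\<Pi>\<^sub>E U\<in>?K. U) \<and> finite {U \<in> ?K. f U \<noteq> \<zero>\<^bsub>?M\<^esub>} \<and> x = finsum ?M f {U \<in> ?K. f U \<noteq> \<zero>\<^bsub>?M\<^esub>}"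
 proof (rule ex1I[of _ ?f])
  have "x = finsum ?T ?f {U \<in> ?K. ?f U \<noteq> \<zero>\<^bsub>?M\<^esub>}"
  proof (rule colval_eqI[OF n x fsT[OF f]])
   fix P assume P: "P \<in> walks n"
   have "colval n P (?f (Col n P)) = colval n P x"
    using P w[OF P] colval_coset[OF P n cu_FA[OF P n]] cu_mu[OF P n colval_C[OF P n x] P] by simp
   then show "colval n P x = colval n P (finsum ?T ?f {U \<in> ?K. ?f U \<noteq> \<zero>\<^bsub>?M\<^esub>})"
    unfolding cv[OF f P] by simp
  qed
  then show "?f \<in> (\<Pi>\<^sub>E U\<in>?K. U) \<and> finite {U \<in> ?K. ?f U \<noteq> \<zero>\<^bsub>?M\<^esub>} \<and> x = finsum ?M ?f {U \<in> ?K. ?f U \<noteq> \<zero>\<^bsub>?M\<^esub>}"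
   using f fin unfolding fm by blast
 next
  fix g assume "g \<in> (\<Pi>\<^sub>E U\<in>?K. U) \<and> finite {U \<in> ?K. g U \<noteq> \<zero>\<^bsub>?M\<^esub>} \<and> x = finsum ?M g {U \<in> ?K. g U \<noteq> \<zero>\<^bsub>?M\<^esub>}"
  then have g: "g \<in> (\<Pi>\<^sub>E U\<in>?K. U)" and gx: "x = finsum ?T g {U \<in> ?K. g U \<noteq> \<zero>\<^bsub>?M\<^esub>}" unfolding fm by blast+
  show "g = ?f"
  proof (rule PiE_ext[OF g f])
   fix U assume U: "U \<in> ?K"
   then obtain P where P: "P \<in> walks n" "U = Col n P" by blast
   have gU: "g U \<in> Col n P" using g U P by (auto simp: PiE_def Pi_def)
   have "colval n P x = colval n P (g U)" using cv[OF g P(1)] gx P(2) by simp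
   then show "g U = ?f U" using colval_Col(2)[OF P(1) P(1) n gU] U w[OF P(1)] P(2) by simp
  qed
 qed
qed

lemma TL_split_semisimple:
 assumes n: "n \<le> N"
 shows "split_semisimple TYPE('w) (TA n)"
 unfolding split_semisimple_def semisimple_module_def
proof (intro conjI exI[of _ "Col n ` walks n"] allI impI ballI)
 show "left_module (TA n) (regular_module (TA n))" by (rule left_module_regular[OF TL_ring])
 show "internal_direct_sum (TA n) (regular_module (TA n)) (Col n ` walks n) (\<lambda>U. U)" by (rule TL_regular_decomposition[OF n])
qed (use Col_simple[OF _ n] TL_simple_End[OF n] in auto)

end

declare One_nat_def [simp]

section \<open>Tensor products\<close>

text \<open>Linear extension of a map from a basis.\<close>

definition plin :: "('k::field => 'v => 'v::ab_group_add) => ('x => 'v) => ('x \<Rightarrow>\<^sub>0 'k) => 'v" where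
 "plin scale g p = (\<Sum>z\<in>keys p. scale (lookup p z) (g z))"

context vector_space begin

lemma plin_superset:
 assumes "finite S" "keys p \<subseteq> S"
 shows "plin scale g p = (\<Sum>z\<in>S. scale (lookup p z) (g z))"
 unfolding plin_def by (rule sum.mono_neutral_left) (use assms in \<open>auto simp: in_keys_iff\<close>)

lemma plin_add: "plin scale g (p + q) = plin scale g p + plin scale g q"
proof -
 let ?S = "keys p \<union> keys q"
 have "keys (p + q) \<subseteq> ?S" by (rule Poly_Mapping.keys_add)
 then have "plin scale g (p + q) = (\<Sum>z\<in>?S. scale (lookup (p + q) z) (g z))"
  by (intro plin_superset) auto
 moreover have "plin scale g p = (\<Sum>z\<in>?S. scale (lookup p z) (g z))"
  "plin scale g q = (\<Sum>z\<in>?S. scale (lookup q z) (g z))"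
  by (intro plin_superset; auto)+
 ultimately show ?thesis by (simp add: lookup_add scale_left_distrib sum.distrib)
qed

lemma plin_pscale: "plin scale g (pscale c p) = scale c (plin scale g p)"
proof -
 have "plin scale g (pscale c p) = (\<Sum>z\<in>keys p. scale (lookup (pscale c p) z) (g z))"
  by (rule plin_superset) (auto simp: in_keys_iff lookup_pscale)
 then show ?thesis by (simp add: plin_def lookup_pscale scale_sum_right)
qed

lemma plin_zero [simp]: "plin scale g 0 = 0" by (simp add: plin_def)

lemma plin_diff: "plin scale g (p - q) = plin scale g p - plin scale g q"
 using plin_add[of g "p - q" q] by (simp add: algebra_simps)

lemma plin_sum: "plin scale g (sum f S) = (\<Sum>i\<in>S. plin scale g (f i))"
 by (induction S rule: infinite_finite_induct) (auto simp: plin_add)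

lemma plin_single [simp]: "plin scale g (single z c) = scale c (g z)"
 by (subst plin_superset[of "{z}"]) auto

lemma plin_span:
 assumes U: "subspace U" and R: "\<And>r. r \<in> R ==> plin scale g r \<in> U" and h: "h \<in> pvec.span R"
 shows "plin scale g h \<in> U"
proof -
 have "pvec.subspace {h. plin scale g h \<in> U}"
  by (rule pvec.subspaceI)
   (auto simp: plin_add plin_pscale subspace_0[OF U] subspace_add[OF U] subspace_scale[OF U])
 then show ?thesis using pvec.span_minimal[of R "{h. plin scale g h \<in> U}"] R h by auto
qed

end

abbreviation "pt x y \<equiv> single (x, y) (1 :: 'k::field)"
abbreviation "TRel A B \<equiv> pvec.span (tensor_relations A B)"

lemma subspace_TRel: "pvec.subspace (TRel A B)" by simp

lemma pt_add_left: "x \<in> carrier A ==> x' \<in> carrier A ==> y \<in> carrier B ==> pt (x \<oplus>\<^bsub>A\<^esub> x') y - pt x y - pt x' y \<in> TRel A B"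
 by (rule pvec.span_base) (auto simp: tensor_relations_def Let_def)

lemma pt_add_right: "x \<in> carrier A ==> y \<in> carrier B ==> y' \<in> carrier B ==> pt x (y \<oplus>\<^bsub>B\<^esub> y') - pt x y - pt x y' \<in> TRel A B"
 by (rule pvec.span_base) (auto simp: tensor_relations_def Let_def)

lemma pt_scale_left: "x \<in> carrier A ==> y \<in> carrier B ==> pt (c \<odot>\<^bsub>A\<^esub> x) y - pscale c (pt x y) \<in> TRel A B"
 by (rule pvec.span_base) (auto simp: tensor_relations_def Let_def)

lemma pt_scale_right: "x \<in> carrier A ==> y \<in> carrier B ==> pt x (c \<odot>\<^bsub>B\<^esub> y) - pscale c (pt x y) \<in> TRel A B"
 by (rule pvec.span_base) (auto simp: tensor_relations_def Let_def)

lemma tensor_relations_cases: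
 assumes "r \<in> tensor_relations A B"
 obtains (add_left) x x' y where "x \<in> carrier A" "x' \<in> carrier A" "y \<in> carrier B" "r = pt (x \<oplus>\<^bsub>A\<^esub> x') y - pt x y - pt x' y"
 | (add_right) x y y' where "x \<in> carrier A" "y \<in> carrier B" "y' \<in> carrier B" "r = pt x (y \<oplus>\<^bsub>B\<^esub> y') - pt x y - pt x y'"
 | (scale_left) c x y where "x \<in> carrier A" "y \<in> carrier B" "r = pt (c \<odot>\<^bsub>A\<^esub> x) y - pscale c (pt x y)"
 | (scale_right) c x y where "x \<in> carrier A" "y \<in> carrier B" "r = pt x (c \<odot>\<^bsub>B\<^esub> y) - pscale c (pt x y)"
 using assms unfolding tensor_relations_def Let_def by blast

lemma tensor_product_simps:
 fixes A :: "('k::field, 'm) module" and B :: "('k, 'n) module"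
 shows "carrier (tensor_product A B) = coset (TRel A B) ` {p. keys p \<subseteq> carrier A \<times> carrier B}"
  "zero (tensor_product A B) = TRel A B"
  "coset (TRel A B) p \<oplus>\<^bsub>tensor_product A B\<^esub> coset (TRel A B) q = coset (TRel A B) (p + q)"
proof -
 let ?F = "free_vector_space (carrier A \<times> carrier B) :: ('k, ('m \<times> 'n) \<Rightarrow>\<^sub>0 'k) module"
 have F: "add ?F = (+)" "carrier ?F = {p. keys p \<subseteq> carrier A \<times> carrier B}"
  by (simp_all add: free_vector_space_def)
 have c: "TRel A B +>\<^bsub>?F\<^esub> p = coset (TRel A B) p" for p by (rule a_r_coset_eq_coset[OF F(1)])
 show "carrier (tensor_product A B) = coset (TRel A B) ` {p. keys p \<subseteq> carrier A \<times> carrier B}"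
  by (auto simp: tensor_product_def quotient_module_def A_RCOSETS_def' c F)
 show "zero (tensor_product A B) = TRel A B"
  by (simp add: tensor_product_def quotient_module_def)
 show "coset (TRel A B) p \<oplus>\<^bsub>tensor_product A B\<^esub> coset (TRel A B) q = coset (TRel A B) (p + q)"
  by (simp add: tensor_product_def quotient_module_def coset_set_add[OF subspace_TRel F(1)])
qed

abbreviation push :: "('x => 'x) => ('x \<Rightarrow>\<^sub>0 'k::field) => ('x \<Rightarrow>\<^sub>0 'k)" where
 "push g \<equiv> plin pscale (\<lambda>z. single (g z) 1)"

lemma tensor_map_coset:
 assumes H: "pvec.subspace H" and g: "\<And>h. h \<in> H ==> push g h \<in> H"
 shows "tensor_map H g (coset H p) = coset H (push g p)"
proof -
 have c: "H +>\<^bsub>free_vector_space UNIV\<^esub> q = coset H q" for q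
  by (rule a_r_coset_eq_coset) (simp add: free_vector_space_def)
 have "tensor_map H g (coset H p) = (\<Union>q\<in>coset H p. coset H (push g q))"
  by (simp add: tensor_map_def c plin_def pscale_single)
 also have "\<dots> = coset H (push g p)"
  by (rule coset_UN_eq[OF H]) (use g in \<open>simp flip: pvec.plin_diff\<close>)
 finally show ?thesis .
qed

lemma push_left_TRel:
 assumes f: "\<And>x. x \<in> carrier A ==> f x \<in> carrier A" "\<And>x x'. x \<in> carrier A ==> x' \<in> carrier A ==> f (x \<oplus>\<^bsub>A\<^esub> x') = f x \<oplus>\<^bsub>A\<^esub> f x'"
   "\<And>c x. x \<in> carrier A ==> f (c \<odot>\<^bsub>A\<^esub> x) = c \<odot>\<^bsub>A\<^esub> f x"
  and h: "h \<in> TRel A B"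
 shows "push (\<lambda>(x, y). (f x, y)) h \<in> TRel A B"
proof (rule pvec.plin_span[OF subspace_TRel _ h])
 fix r assume "r \<in> tensor_relations A B"
 then show "push (\<lambda>(x, y). (f x, y)) r \<in> TRel A B"
  by (cases rule: tensor_relations_cases)
   (auto simp: pvec.plin_diff pvec.plin_pscale f intro: pt_add_left pt_add_right pt_scale_left pt_scale_right)
qed

lemma push_right_TRel:
 assumes f: "\<And>x. x \<in> carrier B ==> f x \<in> carrier B" "\<And>x x'. x \<in> carrier B ==> x' \<in> carrier B ==> f (x \<oplus>\<^bsub>B\<^esub> x') = f x \<oplus>\<^bsub>B\<^esub> f x'"
   "\<And>c x. x \<in> carrier B ==> f (c \<odot>\<^bsub>B\<^esub> x) = c \<odot>\<^bsub>B\<^esub> f x"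
  and h: "h \<in> TRel A B"
 shows "push (\<lambda>(x, y). (x, f y)) h \<in> TRel A B"
proof (rule pvec.plin_span[OF subspace_TRel _ h])
 fix r assume "r \<in> tensor_relations A B"
 then show "push (\<lambda>(x, y). (x, f y)) r \<in> TRel A B"
  by (cases rule: tensor_relations_cases)
   (auto simp: pvec.plin_diff pvec.plin_pscale f intro: pt_add_left pt_add_right pt_scale_left pt_scale_right)
qed

lemma vector_space_field: "vector_space ((*) :: 'k::field => 'k => 'k)"
 by standard (auto simp: algebra_simps)

text \<open>Such products of functionals are what separates the elements of a tensor product.\<close>

lemma functional_TRel:
 fixes \<alpha> :: "'m => 'k::field" and \<gamma> :: "'n => 'k"
 assumes a: "\<And>x x'. x \<in> carrier A ==> x' \<in> carrier A ==> \<alpha> (x \<oplus>\<^bsub>A\<^esub> x') = \<alpha> x + \<alpha> x'" "\<And>c x. x \<in> carrier A ==> \<alpha> (c \<odot>\<^bsub>A\<^esub> x) = c * \<alpha> x"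
  and g: "\<And>x x'. x \<in> carrier B ==> x' \<in> carrier B ==> \<gamma> (x \<oplus>\<^bsub>B\<^esub> x') = \<gamma> x + \<gamma> x'" "\<And>c x. x \<in> carrier B ==> \<gamma> (c \<odot>\<^bsub>B\<^esub> x) = c * \<gamma> x"
  and h: "h \<in> TRel A B"
 shows "plin (*) (\<lambda>z. \<alpha> (fst z) * \<gamma> (snd z)) h = 0"
proof -
 interpret F: vector_space "(*) :: 'k => 'k => 'k" by (rule vector_space_field)
 have "plin (*) (\<lambda>z. \<alpha> (fst z) * \<gamma> (snd z)) h \<in> {0}"
 proof (rule F.plin_span[OF F.subspace_single_0 _ h])
  fix r assume "r \<in> tensor_relations A B"
  then show "plin (*) (\<lambda>z. \<alpha> (fst z) * \<gamma> (snd z)) r \<in> {0}"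
   by (cases rule: tensor_relations_cases; hypsubst; simp add: F.plin_add F.plin_diff F.plin_pscale a g; simp add: algebra_simps)
 qed
 then show ?thesis by simp
qed

text \<open>A map that is linear modulo a subspace respects linear combinations modulo this subspace; applied to
 x \<otimes> y in each argument.\<close>

lemma mod_linear_sum:
 fixes \<phi> :: "'v::comm_monoid_add => ('x \<Rightarrow>\<^sub>0 'k::field)"
 assumes H: "pvec.subspace H" and S: "finite S" and D: "0 \<in> D" "\<And>x y. x \<in> D ==> y \<in> D ==> x + y \<in> D" "\<And>c x. x \<in> D ==> sc c x \<in> D"
  and \<phi>: "\<phi> 0 \<in> H" "\<And>x y. x \<in> D ==> y \<in> D ==> \<phi> (x + y) - \<phi> x - \<phi> y \<in> H" "\<And>c x. x \<in> D ==> \<phi> (sc c x) - pscale c (\<phi> x) \<in> H"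
  and x: "\<And>i. i \<in> S ==> x i \<in> D"
 shows "\<phi> (\<Sum>i\<in>S. sc (c i) (x i)) - (\<Sum>i\<in>S. pscale (c i) (\<phi> (x i))) \<in> H"
proof -
 have "\<phi> (\<Sum>i\<in>S. sc (c i) (x i)) - (\<Sum>i\<in>S. pscale (c i) (\<phi> (x i))) \<in> H \<and> (\<Sum>i\<in>S. sc (c i) (x i)) \<in> D"
  using S x
 proof (induction S)
  case empty
  then show ?case by (simp add: \<phi> D)
 next
  case (insert a S)
  let ?s = "\<Sum>i\<in>S. sc (c i) (x i)" and ?t = "\<Sum>i\<in>S. pscale (c i) (\<phi> (x i))"
  have xa: "x a \<in> D" using insert.prems by simp
  have IH: "\<phi> ?s - ?t \<in> H" "?s \<in> D" using insert by simp_all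
  have "(\<phi> (sc (c a) (x a) + ?s) - \<phi> (sc (c a) (x a)) - \<phi> ?s) + (\<phi> (sc (c a) (x a)) - pscale (c a) (\<phi> (x a))) + (\<phi> ?s - ?t) \<in> H"
   by (intro pvec.subspace_add[OF H] \<phi> IH D(3) xa)
  then show ?case using insert.hyps IH(2) D(2)[OF D(3)[OF xa] IH(2)] by (simp add: algebra_simps)
 qed
 then show ?thesis ..
qed

section \<open>Tensor space as a bimodule\<close>

declare One_nat_def [simp del]

lemma (in presentation) smult_scalar_commute:
 assumes "left_module PA M" "p \<in> FA G" "x \<in> carrier M"
 shows "coset I p \<odot>\<^bsub>M\<^esub> ((c \<odot>\<^bsub>PA\<^esub> \<one>\<^bsub>PA\<^esub>) \<odot>\<^bsub>M\<^esub> x) = (c \<odot>\<^bsub>PA\<^esub> \<one>\<^bsub>PA\<^esub>) \<odot>\<^bsub>M\<^esub> (coset I p \<odot>\<^bsub>M\<^esub> x)"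
proof -
 interpret left_module PA M by fact
 have c: "coset I (pscale c 1) \<in> carrier PA" "coset I p \<in> carrier PA"
  using assms by (auto intro: PA_I FA_pscale FA_1)
 show ?thesis
  unfolding PA_scalar using smult_assoc[OF c(2,1) assms(3)] smult_assoc[OF c assms(3)] assms(2)
  by (simp add: PA_mult FA_pscale FA_1 pscale_mult_left pscale_mult_right)
qed

context tl begin

abbreviation "WM n l \<equiv> restrict_scalars (SA n) (weyl_of v l)"
abbreviation "CM n l \<equiv> restrict_scalars (TA n) (TC n l)"
abbreviation "HR n l \<equiv> TRel (WM n l) (CM n l)"

lemma weyl_of_module:
 assumes l: "l \<in> two_row_partitions n" and n: "n \<le> N"
 shows "left_module (SA n) (weyl_of v l)"
proof -
 obtain P where P: "P \<in> walks n" "last P = l" by (rule walk_to_exists[OF l])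
 then show ?thesis using weyl_left_module[OF P(1) n] by (simp add: weyl_of_eq wtp_kl)
qed

lemma WM_carrier: "carrier (WM n l) = range (cw (kl l))"
 by (simp add: restrict_scalars_def weyl_of_eq weyl_carrier)

lemma WM_add: "cw (kl l) c \<oplus>\<^bsub>WM n l\<^esub> cw (kl l) d = cw (kl l) (\<lambda>a. c a + d a)"
 by (simp add: restrict_scalars_def weyl_of_eq cw_add)

lemma WM_scale:
 assumes l: "l \<in> two_row_partitions n"
 shows "k \<odot>\<^bsub>WM n l\<^esub> cw (kl l) c = cw (kl l) (\<lambda>a. k * c a)"
proof -
 obtain P where P: "P \<in> walks n" "last P = l" by (rule walk_to_exists[OF l])
 have W: "weights (kl l) \<subseteq> weights n" using wtp_weights[OF P(1)] P(2) by (simp add: wtp_kl)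
 have "k \<odot>\<^bsub>WM n l\<^esub> cw (kl l) c = coset (IS n) (pscale k 1) \<odot>\<^bsub>weyl_module v (kl l)\<^esub> coset (IS (kl l)) (WC (kl l) c)"
  by (simp add: restrict_scalars_def schur_scalar weyl_of_eq cw_def)
 also have "\<dots> = coset (IS (kl l)) (pscale k (WC (kl l) c))"
  using weyl_smult[OF W FA_pscale[OF FA_1] WC_FA] by (simp add: sbr.ev_pscale)
 finally show ?thesis by (simp add: cw_def WC_scale)
qed

lemma CM_simps:
 assumes l: "l \<in> two_row_partitions n" and n: "n \<le> N"
 shows "carrier (CM n l) = Cspace v l" "x \<oplus>\<^bsub>CM n l\<^esub> y = x + y"
  "x \<in> Cspace v l ==> k \<odot>\<^bsub>CM n l\<^esub> x = tscale k x"
 using tl_cell_smult[OF l n FA_pscale[OF FA_1], of x k]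
 by (simp_all add: restrict_scalars_def TL_scalar tlr.ev_pscale)

lemma cell_expand_HR:
 assumes l: "l \<in> two_row_partitions n" and n: "n \<le> N" and X: "X \<in> carrier (WM n l)" and y: "y \<in> Cspace v l"
 shows "pt X y - (\<Sum>q\<in>walks_to l. pscale (crd v n q 0 y) (pt X (\<mu> q))) \<in> HR n l"
proof -
 have "pt X (\<Sum>q\<in>walks_to l. tscale (crd v n q 0 y) (\<mu> q)) - (\<Sum>q\<in>walks_to l. pscale (crd v n q 0 y) (pt X (\<mu> q))) \<in> HR n l"
 proof (rule mod_linear_sum[where D = "Cspace v l"])
  have sc: "pt X (tscale c x) - pscale c (pt X x) \<in> HR n l" if "x \<in> Cspace v l" for c x
   using pt_scale_right[OF X, of x "CM n l" c] that by (simp add: CM_simps[OF l n])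
  then show "pt X (tscale c x) - pscale c (pt X x) \<in> HR n l" if "x \<in> Cspace v l" for c x using that .
  show "pt X 0 \<in> HR n l" using sc[OF tvec.subspace_0[OF subspace_Cspace], of 0] by simp
  show "pt X (x + y) - pt X x - pt X y \<in> HR n l" if "x \<in> Cspace v l" "y \<in> Cspace v l" for x y
   using pt_add_right[OF X, of x "CM n l" y] that by (simp add: CM_simps[OF l n])
 qed (auto simp: finite_walks_to mu_Cspace tvec.subspace_0[OF subspace_Cspace] tvec.subspace_add[OF subspace_Cspace] tvec.subspace_scale[OF subspace_Cspace])
 then show ?thesis using Cspace_expand[OF l n y] by simp
qed

text \<open>Bilinearity in the Weyl factor, on coordinate functions.\<close>

lemma weyl_sum_HR:
 assumes l: "l \<in> two_row_partitions n" and n: "n \<le> N" and y: "y \<in> Cspace v l" and S: "finite S"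
 shows "pt (cw (kl l) (\<lambda>a. \<Sum>i\<in>S. t i * c i a)) y - (\<Sum>i\<in>S. pscale (t i) (pt (cw (kl l) (c i)) y)) \<in> HR n l"
proof -
 have yC: "y \<in> carrier (CM n l)" using y by (simp add: CM_simps[OF l n])
 have "pt (cw (kl l) (\<Sum>i\<in>S. (\<lambda>k c a. k * c a) (t i) (c i))) y - (\<Sum>i\<in>S. pscale (t i) (pt (cw (kl l) (c i)) y)) \<in> HR n l"
 proof (rule mod_linear_sum[where D = UNIV and sc = "\<lambda>k c a. k * c a" and \<phi> = "\<lambda>c. pt (cw (kl l) c) y"])
  have sc: "pt (cw (kl l) (\<lambda>a. k * d a)) y - pscale k (pt (cw (kl l) d) y) \<in> HR n l" for k d
   using pt_scale_left[OF _ yC, of "cw (kl l) d" "WM n l" k] by (simp add: WM_carrier WM_scale[OF l])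
  then show "pt (cw (kl l) (\<lambda>a. k * d a)) y - pscale k (pt (cw (kl l) d) y) \<in> HR n l" for k d .
  show "pt (cw (kl l) 0) y \<in> HR n l" using sc[of 0 0] by (simp add: zero_fun_def)
  show "pt (cw (kl l) (d + d')) y - pt (cw (kl l) d) y - pt (cw (kl l) d') y \<in> HR n l" for d d'
   using pt_add_left[OF _ _ yC, of "cw (kl l) d" "WM n l" "cw (kl l) d'"] by (simp add: WM_carrier WM_add plus_fun_def)
 qed (use S in auto)
 moreover have "(\<Sum>i\<in>S. (\<lambda>k c a. k * c a) (t i) (c i)) = (\<lambda>a. \<Sum>i\<in>S. t i * c i a)"
  by (rule ext) (simp add: fun_sum_apply)
 ultimately show ?thesis by simp
qed

text \<open>The component at l of the isomorphism, on representatives: the sum over the walks p to l of wproj n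
 p x \<otimes> \<mu>(p).\<close>

definition bimap :: "nat => nat \<times> nat => 'k tvec => (('k schur_elt \<times> 'k tvec) \<Rightarrow>\<^sub>0 'k)" where
 "bimap n l x = (\<Sum>p\<in>walks_to l. pt (wproj n p x) (\<mu> p))"

lemma wproj_WM:
 assumes "p \<in> walks_to l" "l \<in> two_row_partitions n"
 shows "wproj n p x = cw (kl l) (\<lambda>a. crd v n p a x)" "wproj n p x \<in> carrier (WM n l)"
 using assms walks_to_walks by (auto simp: wproj_def wtp_kl WM_carrier)

lemma bimap_keys:
 assumes l: "l \<in> two_row_partitions n" and n: "n \<le> N"
 shows "keys (bimap n l x) \<subseteq> carrier (WM n l) \<times> carrier (CM n l)"
proof -
 have "keys (bimap n l x) \<subseteq> (\<Union>p\<in>walks_to l. keys (pt (wproj n p x) (\<mu> p)))"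
  unfolding bimap_def by (rule Poly_Mapping.keys_sum[THEN order_trans]) auto
 then show ?thesis using wproj_WM[OF _ l] mu_Cspace[of _ l] by (auto simp: CM_simps[OF l n])
qed

lemma sum_diff_in_subspace:
 assumes "pvec.subspace U" "\<And>i. i \<in> S ==> f i - g i \<in> U"
 shows "sum f S - sum g S \<in> U"
 unfolding sum_subtractf[symmetric] using assms by (intro pvec.subspace_sum)

lemma bimap_add:
 assumes l: "l \<in> two_row_partitions n" and n: "n \<le> N"
 shows "bimap n l (x + y) - (bimap n l x + bimap n l y) \<in> HR n l"
 unfolding bimap_def sum.distrib[symmetric]
proof (rule sum_diff_in_subspace[OF subspace_TRel])
 fix p assume p: "p \<in> walks_to l"
 then have "wtp p = kl l" using walks_to_walks[OF l] by (auto simp: wtp_kl)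
 then have "wproj n p (x + y) = wproj n p x \<oplus>\<^bsub>WM n l\<^esub> wproj n p y"
  by (simp add: wproj_add restrict_scalars_def weyl_of_eq)
 then show "pt (wproj n p (x + y)) (\<mu> p) - (pt (wproj n p x) (\<mu> p) + pt (wproj n p y) (\<mu> p)) \<in> HR n l"
  using pt_add_left[OF wproj_WM(2)[OF p l] wproj_WM(2)[OF p l], of "\<mu> p" "CM n l" x y] mu_Cspace[OF p]
  by (simp add: CM_simps[OF l n] diff_diff_eq)
qed

lemma bimap_sact:
 assumes l: "l \<in> two_row_partitions n" and n: "n \<le> N" and s: "s \<in> SF n" and x: "x \<in> TS n"
 shows "bimap n l (sact n s x) = push (\<lambda>(X, y). (coset (IS n) s \<odot>\<^bsub>weyl_of v l\<^esub> X, y)) (bimap n l x)"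
 unfolding bimap_def pvec.plin_sum
proof (rule sum.cong[OF refl])
 fix p assume p: "p \<in> walks_to l"
 then have "p \<in> walks n" "wtp p = kl l" using walks_to_walks[OF l] by (auto simp: wtp_kl)
 then show "pt (wproj n p (sact n s x)) (\<mu> p) = push (\<lambda>(X, y). (coset (IS n) s \<odot>\<^bsub>weyl_of v l\<^esub> X, y)) (pt (wproj n p x) (\<mu> p))"
  using wproj_smult[OF _ n x s] by (simp add: weyl_of_eq)
qed

text \<open>Elements of the Temperley--Lieb algebra act on all levels of the strings by their matrix on the
 highest weight vectors.\<close>

lemma crd_tlact:
 assumes l: "l \<in> two_row_partitions n" and n: "n \<le> N" and t: "t \<in> TF n" and x: "x \<in> TS n"
  and q: "q \<in> walks_to l" and a: "a \<le> kl l"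
 shows "crd v n q a (tlact n t x) = (\<Sum>p\<in>walks_to l. crd v n q 0 (tlact n t (\<mu> p)) * crd v n p a x)"
proof -
 have qw: "q \<in> walks n" "last q = l" using q walks_to_walks[OF l] by auto
 have aq: "a \<le> wtp q" using a qw by (simp add: wtp_kl)
 let ?\<tau> = "\<lambda>r p. crd v n r 0 (tlact n t (\<mu> p))"
 have "crd v n q a (tlact n t x) = (\<Sum>p\<in>walks n. \<Sum>r\<in>walks_to (last p). ?\<tau> r p * crd v n q a (munit v n r p x))"
  by (subst intertw_expand[OF tlact_intertw[OF t] n x]) (simp add: crd_sum crd_scale)
 also have "\<dots> = (\<Sum>p\<in>walks n. if p \<in> walks_to l then ?\<tau> q p * crd v n p a x else 0)"
 proof (rule sum.cong[OF refl])
  fix p assume p: "p \<in> walks n"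
  have lp: "last p \<in> two_row_partitions n" by (rule last_two_row[OF p])
  have "(\<Sum>r\<in>walks_to (last p). ?\<tau> r p * crd v n q a (munit v n r p x)) = (\<Sum>r\<in>walks_to (last p). if r = q then ?\<tau> q p * crd v n p a x else 0)"
  proof (rule sum.cong[OF refl])
   fix r assume "r \<in> walks_to (last p)"
   then have r: "r \<in> walks n" "last r = last p" using walks_to_walks[OF lp] by auto
   then have "wtp p = wtp r" by (simp add: wtp_kl)
   then show "?\<tau> r p * crd v n q a (munit v n r p x) = (if r = q then ?\<tau> q p * crd v n p a x else 0)"
    using crd_munit[OF p r(1) qw(1) n _ aq, of x] by auto
  qed
  also have "\<dots> = (if q \<in> walks_to (last p) then ?\<tau> q p * crd v n p a x else 0)"
   by (simp add: finite_walks_to)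
  also have "q \<in> walks_to (last p) \<longleftrightarrow> p \<in> walks_to l"
   using walks_to_walks[OF lp] walks_to_walks[OF l] p qw by auto
  finally show "(\<Sum>r\<in>walks_to (last p). ?\<tau> r p * crd v n q a (munit v n r p x)) = (if p \<in> walks_to l then ?\<tau> q p * crd v n p a x else 0)" .
 qed
 also have "\<dots> = (\<Sum>p\<in>walks_to l. ?\<tau> q p * crd v n p a x)"
  by (rule sum.mono_neutral_cong_right) (use walks_to_walks[OF l] in auto)
 finally show ?thesis .
qed

text \<open>Both sides reduce to \<Sum> \<tau>_{qp} wproj n p x \<otimes> \<mu>(q), where \<tau> is the matrix
 of t on the highest weight vectors; the two sides arise by expanding in the two different factors.\<close>

lemma bimap_tlact:
 assumes l: "l \<in> two_row_partitions n" and n: "n \<le> N" and t: "t \<in> TF n" and x: "x \<in> TS n"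
 shows "bimap n l (tlact n t x) - push (\<lambda>(X, y). (X, cl n t \<odot>\<^bsub>TC n l\<^esub> y)) (bimap n l x) \<in> HR n l"
proof -
 let ?\<tau> = "\<lambda>q p. crd v n q 0 (tlact n t (\<mu> p))"
 let ?m = "\<Sum>q\<in>walks_to l. \<Sum>p\<in>walks_to l. pscale (?\<tau> q p) (pt (wproj n p x) (\<mu> q))"
 have kN: "kl l \<le> N" using l n by (auto simp: kl_def two_row_partitions_def)
 have 1: "bimap n l (tlact n t x) - ?m \<in> HR n l"
  unfolding bimap_def
 proof (rule sum_diff_in_subspace[OF subspace_TRel])
  fix q assume q: "q \<in> walks_to l"
  have "wproj n q (tlact n t x) = cw (kl l) (\<lambda>a. \<Sum>p\<in>walks_to l. ?\<tau> q p * crd v n p a x)"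
   unfolding wproj_WM(1)[OF q l] cw_eq[OF kN] using crd_tlact[OF l n t x q] by blast
  then show "pt (wproj n q (tlact n t x)) (\<mu> q) - (\<Sum>p\<in>walks_to l. pscale (?\<tau> q p) (pt (wproj n p x) (\<mu> q))) \<in> HR n l"
   using weyl_sum_HR[OF l n mu_Cspace[OF q] finite_walks_to, of "?\<tau> q" "\<lambda>p a. crd v n p a x" l] wproj_WM(1)[OF _ l]
   by simp
 qed
 have "push (\<lambda>(X, y). (X, cl n t \<odot>\<^bsub>TC n l\<^esub> y)) (bimap n l x) = (\<Sum>p\<in>walks_to l. pt (wproj n p x) (tlact n t (\<mu> p)))"
  unfolding bimap_def pvec.plin_sum
  by (rule sum.cong[OF refl]) (simp add: tl_cell_smult[OF l n t mu_Cspace])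
 moreover have "(\<Sum>p\<in>walks_to l. pt (wproj n p x) (tlact n t (\<mu> p))) - (\<Sum>p\<in>walks_to l. \<Sum>q\<in>walks_to l. pscale (?\<tau> q p) (pt (wproj n p x) (\<mu> q))) \<in> HR n l"
 proof (rule sum_diff_in_subspace[OF subspace_TRel])
  fix p assume p: "p \<in> walks_to l"
  show "pt (wproj n p x) (tlact n t (\<mu> p)) - (\<Sum>q\<in>walks_to l. pscale (?\<tau> q p) (pt (wproj n p x) (\<mu> q))) \<in> HR n l"
   by (rule cell_expand_HR[OF l n wproj_WM(2)[OF p l] tlact_Cspace[OF l n t mu_Cspace[OF p]]])
 qed
 moreover have "(\<Sum>p\<in>walks_to l. \<Sum>q\<in>walks_to l. pscale (?\<tau> q p) (pt (wproj n p x) (\<mu> q))) = ?m" by (rule sum.swap)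
 ultimately have 2: "push (\<lambda>(X, y). (X, cl n t \<odot>\<^bsub>TC n l\<^esub> y)) (bimap n l x) - ?m \<in> HR n l" by simp
 show ?thesis using pvec.subspace_diff[OF subspace_TRel 1 2] by simp
qed

text \<open>A coordinate in V(m) times a coordinate in the cell is a functional on the tensor product recovering
 a coordinate of x.\<close>

lemma bimap_inj:
 assumes n: "n \<le> N" and x: "x \<in> TS n" and y: "y \<in> TS n"
  and eq: "\<And>l. l \<in> two_row_partitions n ==> bimap n l x - bimap n l y \<in> HR n l"
 shows "x = y"
proof -
 have "crd v n q a x = crd v n q a y" if qw: "q \<in> walks n" and a: "a \<le> wtp q" for q a
 proof -
  define l where "l = last q"
  have l: "l \<in> two_row_partitions n" and q: "q \<in> walks_to l"
   using last_two_row[OF qw] walks_to_walks[OF last_two_row[OF qw]] qw by (auto simp: l_def)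
  have kN: "kl l \<le> N" using l n by (auto simp: kl_def two_row_partitions_def)
  have al: "a \<le> kl l" using a by (simp add: wtp_kl l_def)
  (* a coordinate function on the Weyl module; independent of the choice by cw_eq *)
  define \<alpha> where "\<alpha> X = (SOME c. X = cw (kl l) c) a" for X
  have \<alpha>: "\<alpha> (cw (kl l) c) = c a" for c
  proof -
   have "cw (kl l) c = cw (kl l) (SOME d. cw (kl l) c = cw (kl l) d)" by (rule someI[of _ c]) simp
   then show ?thesis unfolding \<alpha>_def cw_eq[OF kN] using al by simp
  qed
  interpret F: vector_space "(*) :: 'k => 'k => 'k" by (rule vector_space_field)
  let ?L = "plin (*) (\<lambda>z. \<alpha> (fst z) * crd v n q 0 (snd z))"
  have L: "?L (bimap n l z) = crd v n q a z" for z
  proof -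
   have "?L (bimap n l z) = (\<Sum>p\<in>walks_to l. if p = q then crd v n q a z else 0)"
    unfolding bimap_def F.plin_sum
   proof (rule sum.cong[OF refl])
    fix p assume p: "p \<in> walks_to l"
    then have pw: "p \<in> walks n" using walks_to_walks[OF l] by blast
    show "?L (pt (wproj n p z) (\<mu> p)) = (if p = q then crd v n q a z else 0)"
     using crd_mu[OF qw pw n] by (simp add: F.plin_single wproj_WM(1)[OF p l] \<alpha>)
   qed
   then show ?thesis using q by (simp add: finite_walks_to)
  qed
  have "?L (bimap n l x - bimap n l y) = 0"
   by (rule functional_TRel[OF _ _ _ _ eq[OF l]])
    (auto simp: WM_carrier WM_add WM_scale[OF l] \<alpha> CM_simps[OF l n] crd_add crd_scale)
  then show ?thesis by (simp add: F.plin_diff L)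
 qed
 then show ?thesis using expand'[OF x n] expand'[OF y n] by simp
qed

text \<open>Both factors have bases, so every element of the tensor product can be written along the basis of
 the cell.\<close>

lemma tensor_normal_form:
 assumes l: "l \<in> two_row_partitions n" and n: "n \<le> N"
  and p: "keys p \<subseteq> carrier (WM n l) \<times> carrier (CM n l)"
 shows "\<exists>d. p - (\<Sum>q\<in>walks_to l. pt (cw (kl l) (d q)) (\<mu> q)) \<in> HR n l"
proof -
 let ?g = "\<lambda>d. \<Sum>q\<in>walks_to l. pt (cw (kl l) (d q)) (\<mu> q)"
 let ?U = "{p. \<exists>d. p - ?g d \<in> HR n l}"
 have mu: "\<mu> q \<in> carrier (CM n l)" if "q \<in> walks_to l" for q using mu_Cspace[OF that] by (simp add: CM_simps[OF l n])
 have add: "?g (\<lambda>q a. c q a + d q a) - (?g c + ?g d) \<in> HR n l" for c d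
  unfolding sum.distrib[symmetric]
 proof (rule sum_diff_in_subspace[OF subspace_TRel])
  fix q assume q: "q \<in> walks_to l"
  show "pt (cw (kl l) (\<lambda>a. c q a + d q a)) (\<mu> q) - (pt (cw (kl l) (c q)) (\<mu> q) + pt (cw (kl l) (d q)) (\<mu> q)) \<in> HR n l"
   using pt_add_left[OF _ _ mu[OF q], of "cw (kl l) (c q)" "WM n l" "cw (kl l) (d q)"]
   by (simp add: WM_carrier WM_add diff_diff_eq)
 qed
 have sc: "?g (\<lambda>q a. k * d q a) - pscale k (?g d) \<in> HR n l" for k d
  unfolding pvec.scale_sum_right
 proof (rule sum_diff_in_subspace[OF subspace_TRel])
  fix q assume q: "q \<in> walks_to l"
  show "pt (cw (kl l) (\<lambda>a. k * d q a)) (\<mu> q) - pscale k (pt (cw (kl l) (d q)) (\<mu> q)) \<in> HR n l"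
   using pt_scale_left[OF _ mu[OF q], of "cw (kl l) (d q)" "WM n l" k] by (simp add: WM_carrier WM_scale[OF l])
 qed
 have sub: "pvec.subspace ?U"
 proof (rule pvec.subspaceI)
  have "?g (\<lambda>q a. 0 * 0) - pscale 0 (?g (\<lambda>q a. 0)) \<in> HR n l" by (rule sc)
  then have "0 - ?g (\<lambda>q a. 0) \<in> HR n l" using pvec.subspace_neg[OF subspace_TRel] by fastforce
  then show "0 \<in> ?U" by (intro CollectI exI[of _ "\<lambda>q a. 0"])
  fix x y assume "x \<in> ?U" "y \<in> ?U"
  then obtain c d where c: "x - ?g c \<in> HR n l" and d: "y - ?g d \<in> HR n l" by blast
  have "(x - ?g c) + (y - ?g d) - (?g (\<lambda>q a. c q a + d q a) - (?g c + ?g d)) \<in> HR n l"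
   by (intro pvec.subspace_diff[OF subspace_TRel] pvec.subspace_add[OF subspace_TRel] c d add)
  moreover have "(x - ?g c) + (y - ?g d) - (?g (\<lambda>q a. c q a + d q a) - (?g c + ?g d)) = (x + y) - ?g (\<lambda>q a. c q a + d q a)"
   by (simp add: algebra_simps)
  ultimately have "(x + y) - ?g (\<lambda>q a. c q a + d q a) \<in> HR n l" by simp
  then show "x + y \<in> ?U" by (intro CollectI exI)
 next
  fix k x assume "x \<in> ?U"
  then obtain d where d: "x - ?g d \<in> HR n l" by blast
  have "pscale k (x - ?g d) - (?g (\<lambda>q a. k * d q a) - pscale k (?g d)) \<in> HR n l"
   by (intro pvec.subspace_diff[OF subspace_TRel] pvec.subspace_scale[OF subspace_TRel] d sc)
  then have "pscale k x - ?g (\<lambda>q a. k * d q a) \<in> HR n l" by (simp add: pvec.scale_right_diff_distrib)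
  then show "pscale k x \<in> ?U" by (intro CollectI exI)
 qed
 have base: "pt X y \<in> ?U" if X: "X \<in> carrier (WM n l)" and y: "y \<in> carrier (CM n l)" for X y
 proof -
  obtain c where c: "X = cw (kl l) c" using X by (auto simp: WM_carrier)
  have y': "y \<in> Cspace v l" using y by (simp add: CM_simps[OF l n])
  have 1: "pt X y - (\<Sum>q\<in>walks_to l. pscale (crd v n q 0 y) (pt X (\<mu> q))) \<in> HR n l"
   by (rule cell_expand_HR[OF l n X y'])
  have 2: "?g (\<lambda>q a. crd v n q 0 y * c a) - (\<Sum>q\<in>walks_to l. pscale (crd v n q 0 y) (pt X (\<mu> q))) \<in> HR n l"
  proof (rule sum_diff_in_subspace[OF subspace_TRel])
   fix q assume q: "q \<in> walks_to l"
   show "pt (cw (kl l) (\<lambda>a. crd v n q 0 y * c a)) (\<mu> q) - pscale (crd v n q 0 y) (pt X (\<mu> q)) \<in> HR n l"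
    using pt_scale_left[OF X mu[OF q], of "crd v n q 0 y"] by (simp add: c WM_scale[OF l])
  qed
  have "pt X y - ?g (\<lambda>q a. crd v n q 0 y * c a) \<in> HR n l" using pvec.subspace_diff[OF subspace_TRel 1 2] by simp
  then show ?thesis by (intro CollectI exI)
 qed
 have e: "(\<Sum>z\<in>keys p. pscale (lookup p z) (single z 1)) = p"
  by (rule poly_mapping_eqI) (simp add: lookup_sum lookup_pscale lookup_single when_def in_keys_iff if_distrib[of "\<lambda>c. _ * c"] cong: if_cong)
 have "(\<Sum>z\<in>keys p. pscale (lookup p z) (single z 1)) \<in> ?U"
 proof (intro pvec.subspace_sum[OF sub] pvec.subspace_scale[OF sub])
  fix z assume "z \<in> keys p"
  then have "fst z \<in> carrier (WM n l)" "snd z \<in> carrier (CM n l)" using p by auto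
  then show "single z 1 \<in> ?U" using base[of "fst z" "snd z"] by simp
 qed
 then show ?thesis unfolding e by (rule CollectD)
qed

lemma tensor_bimodule_iso:
 assumes n: "n \<le> N"
 shows "bimod_isomorphic (SA n) (TA n) (ST n) (TT n)
    (direct_sum (two_row_partitions n) (\<lambda>l. tensor_left (SA n) (TA n) (weyl_of v l) (TC n l)))
    (direct_sum (two_row_partitions n) (\<lambda>l. tensor_right (SA n) (TA n) (weyl_of v l) (TC n l)))"
proof -
 let ?L = "two_row_partitions n"
 let ?TL = "\<lambda>l. tensor_left (SA n) (TA n) (weyl_of v l) (TC n l)"
 let ?TR = "\<lambda>l. tensor_right (SA n) (TA n) (weyl_of v l) (TC n l)"
 let ?D = "direct_sum ?L ?TL" and ?D' = "direct_sum ?L ?TR"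
 define cr where "cr l = coset (HR n l) ` {p. keys p \<subseteq> carrier (WM n l) \<times> carrier (CM n l)}" for l
 have TLs: "carrier (?TL l) = cr l" "coset (HR n l) p \<oplus>\<^bsub>?TL l\<^esub> coset (HR n l) q = coset (HR n l) (p + q)"
   "a \<odot>\<^bsub>?TL l\<^esub> X = tensor_map (HR n l) (\<lambda>(x, y). (a \<odot>\<^bsub>weyl_of v l\<^esub> x, y)) X"
  and TRs: "carrier (?TR l) = cr l" "coset (HR n l) p \<oplus>\<^bsub>?TR l\<^esub> coset (HR n l) q = coset (HR n l) (p + q)"
   "b \<odot>\<^bsub>?TR l\<^esub> X = tensor_map (HR n l) (\<lambda>(x, y). (x, b \<odot>\<^bsub>TC n l\<^esub> y)) X" for l p q a b X
  by (simp_all add: tensor_left_def tensor_right_def Let_def rep_module_def tensor_product_simps cr_def)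
 have fin: "finite ?L" by (rule finite_two_row_partitions)
 have Dcar: "carrier ?D = (\<Pi>\<^sub>E l\<in>?L. cr l)" "carrier ?D' = (\<Pi>\<^sub>E l\<in>?L. cr l)"
  using fin by (simp_all add: direct_sum_def TLs(1) TRs(1))
 let ?f = "\<lambda>x\<in>TS n. \<lambda>l\<in>?L. coset (HR n l) (bimap n l x)"
 have fc: "(\<lambda>l\<in>?L. coset (HR n l) (bimap n l x)) \<in> (\<Pi>\<^sub>E l\<in>?L. cr l)" for x
  unfolding restrict_PiE_iff cr_def using bimap_keys[OF _ n] by blast
 have ca: "coset (HR n l) (bimap n l (x + y)) = coset (HR n l) (bimap n l x + bimap n l y)" if "l \<in> ?L" for l x y
  using bimap_add[OF that n] by (simp add: coset_eq_iff[OF subspace_TRel])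
 have "bij_betw ?f (TS n) (\<Pi>\<^sub>E l\<in>?L. cr l)"
 proof (rule bij_betw_imageI)
  show "inj_on ?f (TS n)"
  proof (rule inj_onI)
   fix x y assume x: "x \<in> TS n" and y: "y \<in> TS n" and eq: "?f x = ?f y"
   show "x = y"
   proof (rule bimap_inj[OF n x y])
    fix l assume "l \<in> ?L"
    then show "bimap n l x - bimap n l y \<in> HR n l"
     using fun_cong[OF eq, of l] x y by (simp add: coset_eq_iff[OF subspace_TRel])
   qed
  qed
  show "?f ` TS n = (\<Pi>\<^sub>E l\<in>?L. cr l)"
  proof
   show "?f ` TS n \<subseteq> (\<Pi>\<^sub>E l\<in>?L. cr l)" using fc by (simp add: image_subset_iff)
   show "(\<Pi>\<^sub>E l\<in>?L. cr l) \<subseteq> ?f ` TS n"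
   proof
    fix h assume h: "h \<in> (\<Pi>\<^sub>E l\<in>?L. cr l)"
    have "\<exists>d. h l = coset (HR n l) (\<Sum>q\<in>walks_to l. pt (cw (kl l) (d q)) (\<mu> q))" if l: "l \<in> ?L" for l
    proof -
     have "h l \<in> cr l" by (rule PiE_mem[OF h l])
     then obtain p where p: "keys p \<subseteq> carrier (WM n l) \<times> carrier (CM n l)" "h l = coset (HR n l) p"
      unfolding cr_def by blast
     obtain d where "p - (\<Sum>q\<in>walks_to l. pt (cw (kl l) (d q)) (\<mu> q)) \<in> HR n l" using tensor_normal_form[OF l n p(1)] ..
     then show ?thesis unfolding p(2) coset_eq_iff[OF subspace_TRel] by (rule exI[of _ d])
    qed
    then obtain d where d: "\<And>l. l \<in> ?L ==> h l = coset (HR n l) (\<Sum>q\<in>walks_to l. pt (cw (kl l) (d l q)) (\<mu> q))"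
     using bchoice[of ?L "\<lambda>l d. h l = coset (HR n l) (\<Sum>q\<in>walks_to l. pt (cw (kl l) (d q)) (\<mu> q))"] by blast
    let ?x = "\<Sum>q\<in>walks n. \<Sum>a\<le>wtp q. tscale (d (last q) q a) (\<beta> n q a)"
    have xT: "?x \<in> TS n" by (intro TS_sum TS_scale bas_TS[OF _ n])
    have "h = ?f ?x"
    proof (rule PiE_ext[OF h])
     show "?f ?x \<in> (\<Pi>\<^sub>E l\<in>?L. cr l)" using fc[of ?x] xT by simp
     fix l assume l: "l \<in> ?L"
     have kN: "kl l \<le> N" using l n by (auto simp: kl_def two_row_partitions_def)
     have "bimap n l ?x = (\<Sum>q\<in>walks_to l. pt (cw (kl l) (d l q)) (\<mu> q))"
      unfolding bimap_def
     proof (rule sum.cong[OF refl])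
      fix q assume q: "q \<in> walks_to l"
      then have qw: "q \<in> walks n" "last q = l" using walks_to_walks[OF l] by auto
      have "wproj n q ?x = cw (kl l) (d l q)"
       unfolding wproj_WM(1)[OF q l] cw_eq[OF kN] using crd_combination[OF n qw(1)] qw(2) by (simp add: wtp_kl)
      then show "pt (wproj n q ?x) (\<mu> q) = pt (cw (kl l) (d l q)) (\<mu> q)" by simp
     qed
     then show "h l = ?f ?x l" using d[OF l] xT l by simp
    qed
    then show "h \<in> ?f ` TS n" using xT by blast
   qed
  qed
 qed
 moreover have "?f \<in> mod_hom (SA n) (ST n) ?D"
  unfolding mod_hom_def
 proof (intro CollectI conjI ballI)
  show "?f \<in> carrier (ST n) \<rightarrow>\<^sub>E carrier ?D"
   unfolding schur_tensor_simps Dcar by (rule restrict_PiE_iff[THEN iffD2]) (rule ballI, rule fc)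
 next
  fix x y assume "x \<in> carrier (ST n)" "y \<in> carrier (ST n)"
  then show "?f (x \<oplus>\<^bsub>ST n\<^esub> y) = ?f x \<oplus>\<^bsub>?D\<^esub> ?f y"
   by (simp add: TS_add direct_sum_def TLs(2) ca cong: restrict_cong)
 next
  fix a x assume "a \<in> carrier (SA n)" and "x \<in> carrier (ST n)"
  then obtain s where s: "s \<in> SF n" "a = coset (IS n) s" and x: "x \<in> TS n" by (auto simp: schur_carrier)
  have "coset (HR n l) (bimap n l (sact n s x)) = a \<odot>\<^bsub>?TL l\<^esub> coset (HR n l) (bimap n l x)" if l: "l \<in> ?L" for l
  proof -
   interpret W: left_module "SA n" "weyl_of v l" by (rule weyl_of_module[OF l n])
   have "push (\<lambda>(X, y). (a \<odot>\<^bsub>weyl_of v l\<^esub> X, y)) h \<in> HR n l" if "h \<in> HR n l" for h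
   proof (rule push_left_TRel[OF _ _ _ that])
    have a: "a \<in> carrier (SA n)" using s by (simp add: schur_carrier)
    show "a \<odot>\<^bsub>weyl_of v l\<^esub> X \<in> carrier (WM n l)" if "X \<in> carrier (WM n l)" for X
     using W.smult_closed[OF a] that by (simp add: restrict_scalars_def)
    show "a \<odot>\<^bsub>weyl_of v l\<^esub> (X \<oplus>\<^bsub>WM n l\<^esub> Y) = a \<odot>\<^bsub>weyl_of v l\<^esub> X \<oplus>\<^bsub>WM n l\<^esub> a \<odot>\<^bsub>weyl_of v l\<^esub> Y"
     if "X \<in> carrier (WM n l)" "Y \<in> carrier (WM n l)" for X Y
     using W.smult_r_distr[OF a] that by (simp add: restrict_scalars_def)
    show "a \<odot>\<^bsub>weyl_of v l\<^esub> (c \<odot>\<^bsub>WM n l\<^esub> X) = c \<odot>\<^bsub>WM n l\<^esub> (a \<odot>\<^bsub>weyl_of v l\<^esub> X)" if "X \<in> carrier (WM n l)" for c X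
     using sp.smult_scalar_commute[OF W.left_module_axioms[unfolded schur_PA] s(1), of X c] that
     by (simp add: restrict_scalars_def schur_PA s(2))
   qed
   then show ?thesis
    using bimap_sact[OF l n s(1) x] by (simp add: TLs(3) tensor_map_coset[OF subspace_TRel] s(2))
  qed
  then show "?f (a \<odot>\<^bsub>ST n\<^esub> x) = a \<odot>\<^bsub>?D\<^esub> ?f x"
   using x s by (simp add: direct_sum_def schur_tensor_smult sact_TS cong: restrict_cong)
 qed
 moreover have "?f \<in> mod_hom (TA n) (TT n) ?D'"
  unfolding mod_hom_def
 proof (intro CollectI conjI ballI)
  show "?f \<in> carrier (TT n) \<rightarrow>\<^sub>E carrier ?D'"
   unfolding tl_tensor_simps Dcar by (rule restrict_PiE_iff[THEN iffD2]) (rule ballI, rule fc)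
 next
  fix x y assume "x \<in> carrier (TT n)" "y \<in> carrier (TT n)"
  then show "?f (x \<oplus>\<^bsub>TT n\<^esub> y) = ?f x \<oplus>\<^bsub>?D'\<^esub> ?f y"
   by (simp add: TS_add direct_sum_def TRs(2) ca cong: restrict_cong)
 next
  fix b x assume "b \<in> carrier (TA n)" and "x \<in> carrier (TT n)"
  then obtain t where t: "t \<in> TF n" "b = cl n t" and x: "x \<in> TS n" by (auto simp: TL_carrier)
  have "coset (HR n l) (bimap n l (tlact n t x)) = b \<odot>\<^bsub>?TR l\<^esub> coset (HR n l) (bimap n l x)" if l: "l \<in> ?L" for l
  proof -
   interpret C: left_module "TA n" "TC n l" by (rule tl_cell_module[OF l n])
   have "push (\<lambda>(X, y). (X, b \<odot>\<^bsub>TC n l\<^esub> y)) h \<in> HR n l" if "h \<in> HR n l" for h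
   proof (rule push_right_TRel[OF _ _ _ that])
    have b: "b \<in> carrier (TA n)" using t by (simp add: TL_carrier)
    show "b \<odot>\<^bsub>TC n l\<^esub> X \<in> carrier (CM n l)" if "X \<in> carrier (CM n l)" for X
     using C.smult_closed[OF b] that by (simp add: restrict_scalars_def)
    show "b \<odot>\<^bsub>TC n l\<^esub> (X \<oplus>\<^bsub>CM n l\<^esub> Y) = b \<odot>\<^bsub>TC n l\<^esub> X \<oplus>\<^bsub>CM n l\<^esub> b \<odot>\<^bsub>TC n l\<^esub> Y"
     if "X \<in> carrier (CM n l)" "Y \<in> carrier (CM n l)" for X Y
     using C.smult_r_distr[OF b, of X Y] that by (simp add: restrict_scalars_def)
    show "b \<odot>\<^bsub>TC n l\<^esub> (c \<odot>\<^bsub>CM n l\<^esub> X) = c \<odot>\<^bsub>CM n l\<^esub> (b \<odot>\<^bsub>TC n l\<^esub> X)" if "X \<in> carrier (CM n l)" for c X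
     using tlp.smult_scalar_commute[OF C.left_module_axioms[unfolded TL_PA] t(1), of X c] that
     by (simp add: restrict_scalars_def TL_PA t(2))
   qed
   then have "b \<odot>\<^bsub>?TR l\<^esub> coset (HR n l) (bimap n l x) = coset (HR n l) (push (\<lambda>(X, y). (X, b \<odot>\<^bsub>TC n l\<^esub> y)) (bimap n l x))"
    by (simp add: TRs(3) tensor_map_coset[OF subspace_TRel])
   then show ?thesis
    using bimap_tlact[OF l n t(1) x] by (simp add: coset_eq_iff[OF subspace_TRel] t(2))
  qed
  then show "?f (b \<odot>\<^bsub>TT n\<^esub> x) = b \<odot>\<^bsub>?D'\<^esub> ?f x"
   using x t by (simp add: direct_sum_def tl_tensor_smult tlact_TS cong: restrict_cong)
 qed
 ultimately have "?f \<in> mod_iso (SA n) (ST n) ?D \<inter> mod_iso (TA n) (TT n) ?D'"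
  by (simp add: mod_iso_def Dcar)
 then show ?thesis unfolding bimod_isomorphic_def by blast
qed

end

declare One_nat_def [simp]

section \<open>Schur--Weyl duality\<close>

theorem theorem3p11:
  fixes v \<epsilon> \<delta> :: "'k::field" and n :: nat
  assumes "v \<noteq> 0" and "n \<ge> 1" and "qfact v n \<noteq> 0"
    and "\<epsilon> = 1 \<or> \<epsilon> = -1" and "\<delta> = \<epsilon> * (v + inverse v)"
  shows
    "(\<forall>l\<in>two_row_partitions n.
        is_basis (walks_to l) (mu v)
          (insert 0 (maximal_vectors v n (int (fst l) - int (snd l)))))
    \<and>
     (internal_direct_sum (schur v n) (schur_tensor v n) (walks n)
        (\<lambda>p. cyclic_submodule (schur v n) (schur_tensor v n) (mu v p)) \<and>
      (\<forall>p\<in>walks n. simple_module (schur v n)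
        ((schur_tensor v n)
           \<lparr>carrier := cyclic_submodule (schur v n) (schur_tensor v n) (mu v p)\<rparr>)) \<and>
      (\<forall>l\<in>two_row_partitions n. simple_module (schur v n) (weyl_of v l)) \<and>
      mod_isomorphic (schur v n) (schur_tensor v n)
        (direct_sum (SIGMA l:two_row_partitions n. {..<num_walks l}) (\<lambda>(l, j). weyl_of v l)))
    \<and>
     ((\<forall>p\<in>walks n. \<forall>k. weight_vector n k (mu v p) \<longrightarrow>
        is_basis {a. int a \<le> k} (\<lambda>a. (op_F v n ^^ a) (mu v p))
          (cyclic_submodule (schur v n) (schur_tensor v n) (mu v p)) \<and>
        pairwise_orthogonal n {a. int a \<le> k} (\<lambda>a. (op_F v n ^^ a) (mu v p))) \<and>
      is_basis (SIGMA p:walks n. {a. int a \<le> weight n (mu v p)})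
        (\<lambda>(p, a). (op_F v n ^^ a) (mu v p)) (carrier (tensor_power n)) \<and>
      pairwise_orthogonal n (SIGMA p:walks n. {a. int a \<le> weight n (mu v p)})
        (\<lambda>(p, a). (op_F v n ^^ a) (mu v p)))
    \<and>
     ((\<forall>l\<in>two_row_partitions n.
        simple_module (TL n \<delta>) (tl_cell v \<epsilon> n l) \<and> tvec.dim (Cspace v l) = num_walks l) \<and>
      (\<forall>l\<in>two_row_partitions n. \<forall>l'\<in>two_row_partitions n. l \<noteq> l' \<longrightarrow>
        \<not> mod_isomorphic (TL n \<delta>) (tl_cell v \<epsilon> n l) (tl_cell v \<epsilon> n l')))
    \<and>
     tl_rep v \<epsilon> n ` carrier (TL n \<delta>) = carrier (end_algebra (schur v n) (schur_tensor v n))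
    \<and>
     (tl_rep v \<epsilon> n \<in> alg_iso (TL n \<delta>) (end_algebra (schur v n) (schur_tensor v n)) \<and>
      split_semisimple TYPE('w) (TL n \<delta>) \<and>
      faithful_module (TL n \<delta>) (tl_tensor v \<epsilon> n) \<and>
      (\<forall>N :: ('k tl_elt, 'w) module. simple_module (TL n \<delta>) N \<longrightarrow>
        (\<exists>l\<in>two_row_partitions n. mod_isomorphic (TL n \<delta>) N (tl_cell v \<epsilon> n l))))
    \<and>
     (bimodule (schur v n) (TL n \<delta>) (schur_tensor v n) (tl_tensor v \<epsilon> n) \<and>
      schur_rep v n ` carrier (schur v n) =
        centralizer (end_algebra base_field (tensor_power n))
          (tl_rep v \<epsilon> n ` carrier (TL n \<delta>)) \<and>
      tl_rep v \<epsilon> n ` carrier (TL n \<delta>) =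
        centralizer (end_algebra base_field (tensor_power n))
          (schur_rep v n ` carrier (schur v n)))
    \<and>
     bimod_isomorphic (schur v n) (TL n \<delta>) (schur_tensor v n) (tl_tensor v \<epsilon> n)
       (direct_sum (two_row_partitions n)
          (\<lambda>l. tensor_left (schur v n) (TL n \<delta>) (weyl_of v l) (tl_cell v \<epsilon> n l)))
       (direct_sum (two_row_partitions n)
          (\<lambda>l. tensor_right (schur v n) (TL n \<delta>) (weyl_of v l) (tl_cell v \<epsilon> n l)))"
proof -
 interpret tl v n \<epsilon> \<delta>
  by unfold_locales (use assms in auto)
 have wt: "{a. int a \<le> k} = {..wtp p}" if "p \<in> walks n" "weight_vector n k (mu v p)" for p k
 proof -
  have "k = int (wtp p)" using weight_eq[of n k "mu v p"] weight_walks[OF that(1)] that(2) by (simp add: weight_vector_iff)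
  then show ?thesis by auto
 qed
 show ?thesis
 proof (intro conjI ballI allI impI)
  fix p assume "p \<in> walks n"
  then show "simple_module (schur v n)
    ((schur_tensor v n)\<lparr>carrier := cyclic_submodule (schur v n) (schur_tensor v n) (mu v p)\<rparr>)"
   using string_simple by (simp add: cyclic_string)
 next
  fix l assume "l \<in> two_row_partitions n"
  then obtain p where "p \<in> walks n" "last p = l" by (rule walk_to_exists)
  then show "simple_module (schur v n) (weyl_of v l)"
   using weyl_simple[of p n] by (simp add: weyl_of_eq wtp_kl)
 next
  fix p k assume p: "p \<in> walks n" and k: "weight_vector n k (mu v p)"
  show "is_basis {a. int a \<le> k} (\<lambda>a. (op_F v n ^^ a) (mu v p))
    (cyclic_submodule (schur v n) (schur_tensor v n) (mu v p))"
   using bas_string_basis[OF order_refl p] by (simp add: wt[OF p k] cyclic_string[OF order_refl p] string_def bas_def[abs_def])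
  show "pairwise_orthogonal n {a. int a \<le> k} (\<lambda>a. (op_F v n ^^ a) (mu v p))"
   using bas_orth[OF p p order_refl] by (simp add: pairwise_orthogonal_def bas_def)
 next
  show "is_basis (SIGMA p:walks n. {a. int a \<le> weight n (mu v p)})
    (\<lambda>(p, a). (op_F v n ^^ a) (mu v p)) (carrier (tensor_power n))"
   using bas_basis[OF order_refl] unfolding idx_frozen[OF order_refl] bas_def .
  show "pairwise_orthogonal n (SIGMA p:walks n. {a. int a \<le> weight n (mu v p)})
    (\<lambda>(p, a). (op_F v n ^^ a) (mu v p))"
   using bas_orthogonal[OF order_refl] unfolding idx_frozen[OF order_refl] bas_def .
 next
  have "internal_direct_sum (schur v n) (schur_tensor v n) (walks n) (string n)"
   by (rule tensor_direct_sum[OF order_refl])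
  then show "internal_direct_sum (schur v n) (schur_tensor v n) (walks n)
    (\<lambda>p. cyclic_submodule (schur v n) (schur_tensor v n) (mu v p))"
   unfolding internal_direct_sum_def by (simp add: cyclic_string cong: PiE_cong)
 next
  show "tl_rep v \<epsilon> n ` carrier (TL n \<delta>) = carrier (end_algebra (schur v n) (schur_tensor v n))"
   using tl_image[OF order_refl] by (simp add: end_algebra_def)
 qed (rule mu_basis[OF _ order_refl] tensor_weyl_iso[OF order_refl] tl_cell_simple[OF _ order_refl] dim_Cspace[OF _ order_refl]
   tl_cells_distinct[OF _ _ order_refl] tl_rep_iso[OF order_refl] TL_split_semisimple[OF order_refl] tl_tensor_faithful[OF order_refl]
   TL_simple_classification[OF order_refl] schur_tl_bimodule schur_rep_image[OF order_refl] tl_rep_image[OF order_refl]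
   tensor_bimodule_iso[OF order_refl]; assumption)+
qed

end
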